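(* Let $(X,P,\theta)$ and $(Y,S,\rho)$ be two essentially free semigroup actions, with $P\subseteq G$ and $S\subseteq H$ the associated countable groups. Then: (i) $(X,P,\theta)$ and $(Y,S,\rho)$ are continuously one-sided orbit equivalent if and only if the topological semi-groupoids $P\ltimes X$ and $S\ltimes Y$ are (topologically) isomorphic. (ii) If $(X,P,\theta)$ and $(Y,S,\rho)$ are continuously orbit equivalent, then the étale groupoids $\mathcal{G}(X,P,\theta)$ and $\mathcal{G}(Y,S,\rho)$ are (topologically) isomorphic. (iii) If $X$ and $Y$ are totally disconnected, then the following are equivalent: (a) $(X,P,\theta)$ and $(Y,S,\rho)$ are continuously orbit equivalent; (b) $\mathcal{G}(X,P,\theta)$ and $\mathcal{G}(Y,S,\rho)$ are (topologically) isomorphic; (c) there is a $*$-isomorphism $\Phi$ from $C_r^*(\mathcal{G}(X,P,\theta))$ onto $C_r^*(\mathcal{G}(Y,S,\rho))$ such that $\Phi(C(X))=C(Y)$. (iv) Assume in addition that $(X,P,\theta)$ and $(Y,S,\rho)$ are semigroup actions by homeomorphisms (every $\theta_m$ and every $\rho_s$ is a homeomorphism). If $(X,P,\theta)$ and $(Y,S,\rho)$ are continuously orbit equivalent, then the associated group actions $(X,G,\tilde{\theta})$ and $(Y,H,\tilde{\rho})$ are continuously orbit equivalent in Li's sense. Moreover, if $X$ and $Y$ are totally disconnected, or if $(G,P)$ and $(H,S)$ are two lattice-ordered groups, then the converse of this implication holds.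
   Context: **Semigroup actions.** A semigroup action $(X,P,\theta)$ consists of: a second-countable compact Hausdorff space $X$ without isolated points; a subsemigroup $P$ of a countable discrete group $G$ such that $P$ contains the identity $e$ of $G$ and $G=P^{-1}P=PP^{-1}$; and a map $n\in P\mapsto\theta_n$, where each $\theta_n:X\to X$ is a surjective local homeomorphism, with $\theta_n\theta_m=\theta_{mn}$ for all $m,n\in P$ and $\theta_e=\mathrm{id}_X$ (a right action). Likewise for $(Y,S,\rho)$, with $S$ contained in a countable discrete group $H$, $H=S^{-1}S=SS^{-1}$. $P$ and $S$ carry the discrete topology. **Essentially free.** $(X,P,\theta)$ is essentially free if for all distinct $m,n\in P$ the set $\{x\in X:\theta_m(x)=\theta_n(x)\}$ has empty interior in $X$. **Continuous one-sided orbit equivalence.** $(X,P,\theta)$ and $(Y,S,\rho)$ are continuously one-sided orbit equivalent if there exist a homeomorphism $\varphi:X\to Y$ and continuous maps $a:P\times X\to S$, $b:S\times Y\to P$ such that $\varphi(\theta_m(x))=\rho_{a(m,x)}(\varphi(x))$ for all $m\in P,x\in X$, and $\varphi^{-1}(\rho_s(y))=\theta_{b(s,y)}(\varphi^{-1}(y))$ for all $s\in S,y\in Y$. **Continuous orbit equivalence.** Put $X_{(m,n)}=\{(x,y)\in X\times X:\theta_m(x)=\theta_n(y)\}$ and $X_{P,\theta}=\{(m,n,x,y)\in P\times P\times X\times X:(x,y)\in X_{(m,n)}\}$ with the subspace topology of $P\times P\times X\times X$; define $Y_{(s,t)}$ and $Y_{S,\rho}$ similarly from $\rho$. The actions are continuously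 orbit equivalent if there exist a homeomorphism $\varphi:X\to Y$ and continuous maps $a_1,b_1:X_{P,\theta}\to S$ and $a_2,b_2:Y_{S,\rho}\to P$ such that $\rho_{a_1(m,n,x,y)}(\varphi(x))=\rho_{b_1(m,n,x,y)}(\varphi(y))$ for all $m,n\in P$, $(x,y)\in X_{(m,n)}$, and $\theta_{a_2(s,t,u,v)}(\varphi^{-1}(u))=\theta_{b_2(s,t,u,v)}(\varphi^{-1}(v))$ for all $s,t\in S$, $(u,v)\in Y_{(s,t)}$. **Semi-groupoid.** $P\ltimes X=P\times X$ with the product topology and the partially defined multiplication $(m,x)(n,y)=(nm,y)$, defined exactly when $x=\theta_n(y)$. A topological isomorphism of semi-groupoids is a homeomorphism $\Lambda$ such that two elements are composable if and only if their images are, and $\Lambda$ is multiplicative on composable pairs. **Transformation groupoid.** $\mathcal{G}(X,P,\theta)=\{(x,g,y)\in X\times G\times X:\exists m,n\in P,\ g=mn^{-1},\ \theta_m(x)=\theta_n(y)\}$, with $(x,g,y)(y,h,v)=(x,gh,v)$, $(x,g,y)^{-1}=(y,g^{-1},x)$, and the topology with basic open sets $\Sigma(U,m,n,V)=\{(x,mn^{-1},y):\theta_m(x)=\theta_n(y),x\in U,y\in V\}$, where $m,n\in P$, $U,V\subseteq X$ are open, $\theta_m|_U$ and $\theta_n|_V$ are homeomorphisms onto their images, and $\theta_m(U)=\theta_n(V)$. This is a second-countable locally compact Hausdorff étale groupoid; its unit space $\{(x,e,x)\}$ is identified with $X$, so $C(X)$ is a subalgebra of the reduced groupoid $C^*$-algebra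 $C_r^*(\mathcal{G}(X,P,\theta))$. A topological isomorphism of étale groupoids is a groupoid isomorphism that is a homeomorphism. **Associated group action.** If every $\theta_m$ is a homeomorphism, then $\tilde\theta_g:=\theta_n^{-1}\theta_m$ for $g=mn^{-1}$, $m,n\in P$, is well defined and gives a right action of $G$ on $X$ by homeomorphisms ($\tilde\theta_{gh}=\tilde\theta_h\tilde\theta_g$); similarly $\tilde\rho$ for $H$ on $Y$. Group actions $(X,G,\tilde\theta)$ and $(Y,H,\tilde\rho)$ are continuously orbit equivalent in Li's sense if there exist a homeomorphism $\varphi:X\to Y$ and continuous maps $a:G\times X\to H$, $b:H\times Y\to G$ ($G,H$ discrete) with $\varphi(\tilde\theta_g(x))=\tilde\rho_{a(g,x)}(\varphi(x))$ and $\varphi^{-1}(\tilde\rho_h(y))=\tilde\theta_{b(h,y)}(\varphi^{-1}(y))$ for all $g\in G,x\in X,h\in H,y\in Y$. **Lattice-ordered group.** For a countable group $H$ and subsemigroup $S$ with $S\cap S^{-1}=\{e\}$, define the left-invariant order $x\le y\Leftrightarrow x^{-1}y\in S$. The pair $(H,S)$ is a lattice-ordered group if every pair $x,y\in H$ has a least upper bound $x\vee y$ and a greatest lower bound $x\wedge y$. *)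

theory Defs
  imports "HOL-Analysis.Analysis" "HOL-Algebra.Group"
begin

section \<open>Semigroup actions\<close>

definition local_homeomorphism :: "'a topology \<Rightarrow> 'b topology \<Rightarrow> ('a \<Rightarrow> 'b) \<Rightarrow> bool" where
  "local_homeomorphism X Y f \<longleftrightarrow>
     f \<in> topspace X \<rightarrow> topspace Y \<and>
     (\<forall>x\<in>topspace X. \<exists>U. openin X U \<and> x \<in> U \<and> openin Y (f ` U) \<and>
        embedding_map (subtopology X U) Y f)"

definition totally_disconnected_space :: "'a topology \<Rightarrow> bool" where
  "totally_disconnected_space X \<longleftrightarrow> (\<forall>C. connectedin X C \<longrightarrow> (\<exists>a. C \<subseteq> {a}))"

text \<open>The values of \<open>\<theta>\<close> outside \<open>P\<close>, and of \<open>\<theta> m\<close> outside \<open>X\<close>, are irrelevant.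
  Note the order reversal in \<open>action_mult\<close>: this is a right action.\<close>

locale semigroup_action = group G for G :: "'g monoid" (structure) +
  fixes X :: "'x topology" and P :: "'g set" and \<theta> :: "'g \<Rightarrow> 'x \<Rightarrow> 'x"
  assumes second_countable_X: "second_countable X"
    and compact_X: "compact_space X"
    and Hausdorff_X: "Hausdorff_space X"
    and no_isolated_points: "\<And>x. x \<in> topspace X \<Longrightarrow> \<not> openin X {x}"
    and countable_G: "countable (carrier G)"
    and submonoid_P: "submonoid P G"
    and left_quotients: "carrier G = {inv m \<otimes> n |m n. m \<in> P \<and> n \<in> P}"
    and right_quotients: "carrier G = {m \<otimes> inv n |m n. m \<in> P \<and> n \<in> P}"
    and local_homeo: "\<And>m. m \<in> P \<Longrightarrow> local_homeomorphism X X (\<theta> m)"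
    and surj: "\<And>m. m \<in> P \<Longrightarrow> \<theta> m ` topspace X = topspace X"
    and action_mult: "\<And>m n x. m \<in> P \<Longrightarrow> n \<in> P \<Longrightarrow> x \<in> topspace X \<Longrightarrow> \<theta> n (\<theta> m x) = \<theta> (m \<otimes> n) x"
    and action_one: "\<And>x. x \<in> topspace X \<Longrightarrow> \<theta> \<one> x = x"

definition essentially_free :: "'x topology \<Rightarrow> 'g set \<Rightarrow> ('g \<Rightarrow> 'x \<Rightarrow> 'x) \<Rightarrow> bool" where
  "essentially_free X P \<theta> \<longleftrightarrow>
     (\<forall>m\<in>P. \<forall>n\<in>P. m \<noteq> n \<longrightarrow> X interior_of {x \<in> topspace X. \<theta> m x = \<theta> n x} = {})"

definition action_by_homeomorphisms :: "'x topology \<Rightarrow> 'g set \<Rightarrow> ('g \<Rightarrow> 'x \<Rightarrow> 'x) \<Rightarrow> bool" where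
  "action_by_homeomorphisms X P \<theta> \<longleftrightarrow> (\<forall>m\<in>P. homeomorphic_map X X (\<theta> m))"


section \<open>Orbit equivalences\<close>

text \<open>In all three notions \<open>\<psi>\<close> is the inverse of the homeomorphism \<open>\<phi>\<close>.\<close>

definition one_sided_coe ::
  "'x topology \<Rightarrow> 'g set \<Rightarrow> ('g \<Rightarrow> 'x \<Rightarrow> 'x) \<Rightarrow> 'y topology \<Rightarrow> 'h set \<Rightarrow> ('h \<Rightarrow> 'y \<Rightarrow> 'y) \<Rightarrow> bool" where
  "one_sided_coe X P \<theta> Y S \<rho> \<longleftrightarrow>
     (\<exists>\<phi> \<psi> a b.
        homeomorphic_maps X Y \<phi> \<psi> \<and>
        continuous_map (prod_topology (discrete_topology P) X) (discrete_topology S) a \<and>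
        continuous_map (prod_topology (discrete_topology S) Y) (discrete_topology P) b \<and>
        (\<forall>m\<in>P. \<forall>x\<in>topspace X. \<phi> (\<theta> m x) = \<rho> (a (m, x)) (\<phi> x)) \<and>
        (\<forall>s\<in>S. \<forall>y\<in>topspace Y. \<psi> (\<rho> s y) = \<theta> (b (s, y)) (\<psi> y)))"

text \<open>The space of all \<open>(m, n, x, y)\<close> with \<open>m, n \<in> P\<close>, \<open>x, y \<in> X\<close> and
  \<open>\<theta>\<^sub>m x = \<theta>\<^sub>n y\<close>.\<close>

definition pair_space ::
  "'x topology \<Rightarrow> 'g set \<Rightarrow> ('g \<Rightarrow> 'x \<Rightarrow> 'x) \<Rightarrow> ('g \<times> 'g \<times> 'x \<times> 'x) topology" where
  "pair_space X P \<theta> =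
     subtopology
       (prod_topology (discrete_topology P)
         (prod_topology (discrete_topology P) (prod_topology X X)))
       {(m, n, x, y). \<theta> m x = \<theta> n y}"

definition cont_orbit_equiv ::
  "'x topology \<Rightarrow> 'g set \<Rightarrow> ('g \<Rightarrow> 'x \<Rightarrow> 'x) \<Rightarrow> 'y topology \<Rightarrow> 'h set \<Rightarrow> ('h \<Rightarrow> 'y \<Rightarrow> 'y) \<Rightarrow> bool" where
  "cont_orbit_equiv X P \<theta> Y S \<rho> \<longleftrightarrow>
     (\<exists>\<phi> \<psi> a\<^sub>1 b\<^sub>1 a\<^sub>2 b\<^sub>2.
        homeomorphic_maps X Y \<phi> \<psi> \<and>
        continuous_map (pair_space X P \<theta>) (discrete_topology S) a\<^sub>1 \<and>
        continuous_map (pair_space X P \<theta>) (discrete_topology S) b\<^sub>1 \<and>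
        continuous_map (pair_space Y S \<rho>) (discrete_topology P) a\<^sub>2 \<and>
        continuous_map (pair_space Y S \<rho>) (discrete_topology P) b\<^sub>2 \<and>
        (\<forall>m\<in>P. \<forall>n\<in>P. \<forall>x\<in>topspace X. \<forall>y\<in>topspace X. \<theta> m x = \<theta> n y \<longrightarrow>
           \<rho> (a\<^sub>1 (m, n, x, y)) (\<phi> x) = \<rho> (b\<^sub>1 (m, n, x, y)) (\<phi> y)) \<and>
        (\<forall>s\<in>S. \<forall>t\<in>S. \<forall>u\<in>topspace Y. \<forall>v\<in>topspace Y. \<rho> s u = \<rho> t v \<longrightarrow>
           \<theta> (a\<^sub>2 (s, t, u, v)) (\<psi> u) = \<theta> (b\<^sub>2 (s, t, u, v)) (\<psi> v)))"

text \<open>Continuous orbit equivalence of group actions in the sense of Li; here \<open>\<alpha>\<close> and \<open>\<beta>\<close> are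
  indexed by the whole groups \<open>G\<close> and \<open>H\<close>.\<close>

definition Li_coe ::
  "'x topology \<Rightarrow> 'g monoid \<Rightarrow> ('g \<Rightarrow> 'x \<Rightarrow> 'x) \<Rightarrow> 'y topology \<Rightarrow> 'h monoid \<Rightarrow> ('h \<Rightarrow> 'y \<Rightarrow> 'y) \<Rightarrow> bool" where
  "Li_coe X G \<alpha> Y H \<beta> \<longleftrightarrow>
     (\<exists>\<phi> \<psi> a b.
        homeomorphic_maps X Y \<phi> \<psi> \<and>
        continuous_map (prod_topology (discrete_topology (carrier G)) X)
          (discrete_topology (carrier H)) a \<and>
        continuous_map (prod_topology (discrete_topology (carrier H)) Y)
          (discrete_topology (carrier G)) b \<and>
        (\<forall>g\<in>carrier G. \<forall>x\<in>topspace X. \<phi> (\<alpha> g x) = \<beta> (a (g, x)) (\<phi> x)) \<and>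
        (\<forall>h\<in>carrier H. \<forall>y\<in>topspace Y. \<psi> (\<beta> h y) = \<alpha> (b (h, y)) (\<psi> y)))"

text \<open>The associated group action \<open>g \<mapsto> \<theta>\<^sub>n\<^sup>-\<^sup>1 \<theta>\<^sub>m\<close> for \<open>g = m n\<^sup>-\<^sup>1\<close>. It is independent
  of the choice of \<open>m\<close> and \<open>n\<close>: see \<open>associated_action_eq\<close> below.\<close>

definition associated_action ::
  "'g monoid \<Rightarrow> 'x topology \<Rightarrow> 'g set \<Rightarrow> ('g \<Rightarrow> 'x \<Rightarrow> 'x) \<Rightarrow> 'g \<Rightarrow> 'x \<Rightarrow> 'x" where
  "associated_action G X P \<theta> g x =
     (THE y. \<exists>m\<in>P. \<exists>n\<in>P. g = m \<otimes>\<^bsub>G\<^esub> inv\<^bsub>G\<^esub> n \<and> y = inv_into (topspace X) (\<theta> n) (\<theta> m x))"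

definition lattice_ordered_group :: "'h monoid \<Rightarrow> 'h set \<Rightarrow> bool" where
  "lattice_ordered_group H S \<longleftrightarrow>
     group H \<and> countable (carrier H) \<and> submonoid S H \<and>
     S \<inter> (\<lambda>s. inv\<^bsub>H\<^esub> s) ` S = {\<one>\<^bsub>H\<^esub>} \<and>
     lattice \<lparr>carrier = carrier H, eq = (=), le = (\<lambda>x y. inv\<^bsub>H\<^esub> x \<otimes>\<^bsub>H\<^esub> y \<in> S)\<rparr>"


section \<open>Topological semi-groupoids and groupoids\<close>

text \<open>The elements of the structure are the points of \<open>sg_top\<close>; \<open>sg_mult \<alpha> \<beta>\<close> is
  meaningful only when \<open>sg_comp \<alpha> \<beta>\<close> holds.\<close>

record 'a top_semigroupoid =
  sg_top :: "'a topology"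
  sg_comp :: "'a \<Rightarrow> 'a \<Rightarrow> bool"
  sg_mult :: "'a \<Rightarrow> 'a \<Rightarrow> 'a"

record 'a top_groupoid = "'a top_semigroupoid" +
  gpd_inv :: "'a \<Rightarrow> 'a"

definition semigroupoid_iso ::
  "('a, 'm) top_semigroupoid_scheme \<Rightarrow> ('b, 'n) top_semigroupoid_scheme \<Rightarrow> ('a \<Rightarrow> 'b) \<Rightarrow> bool" where
  "semigroupoid_iso \<A> \<B> \<Lambda> \<longleftrightarrow>
     homeomorphic_map (sg_top \<A>) (sg_top \<B>) \<Lambda> \<and>
     (\<forall>\<alpha>\<in>topspace (sg_top \<A>). \<forall>\<beta>\<in>topspace (sg_top \<A>).
        (sg_comp \<A> \<alpha> \<beta> \<longleftrightarrow> sg_comp \<B> (\<Lambda> \<alpha>) (\<Lambda> \<beta>)) \<and>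
        (sg_comp \<A> \<alpha> \<beta> \<longrightarrow> \<Lambda> (sg_mult \<A> \<alpha> \<beta>) = sg_mult \<B> (\<Lambda> \<alpha>) (\<Lambda> \<beta>)))"

definition groupoid_iso ::
  "('a, 'm) top_groupoid_scheme \<Rightarrow> ('b, 'n) top_groupoid_scheme \<Rightarrow> ('a \<Rightarrow> 'b) \<Rightarrow> bool" where
  "groupoid_iso \<A> \<B> \<Lambda> \<longleftrightarrow>
     semigroupoid_iso \<A> \<B> \<Lambda> \<and>
     (\<forall>\<alpha>\<in>topspace (sg_top \<A>). \<Lambda> (gpd_inv \<A> \<alpha>) = gpd_inv \<B> (\<Lambda> \<alpha>))"

definition semigroupoids_isomorphic ::
  "('a, 'm) top_semigroupoid_scheme \<Rightarrow> ('b, 'n) top_semigroupoid_scheme \<Rightarrow> bool" where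
  "semigroupoids_isomorphic \<A> \<B> \<longleftrightarrow> (\<exists>\<Lambda>. semigroupoid_iso \<A> \<B> \<Lambda>)"

definition groupoids_isomorphic ::
  "('a, 'm) top_groupoid_scheme \<Rightarrow> ('b, 'n) top_groupoid_scheme \<Rightarrow> bool" where
  "groupoids_isomorphic \<A> \<B> \<longleftrightarrow> (\<exists>\<Lambda>. groupoid_iso \<A> \<B> \<Lambda>)"

definition action_semigroupoid ::
  "'g monoid \<Rightarrow> 'x topology \<Rightarrow> 'g set \<Rightarrow> ('g \<Rightarrow> 'x \<Rightarrow> 'x) \<Rightarrow> ('g \<times> 'x) top_semigroupoid" where
  "action_semigroupoid G X P \<theta> =
     \<lparr>sg_top = prod_topology (discrete_topology P) X,
      sg_comp = (\<lambda>(m, x) (n, y). x = \<theta> n y),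
      sg_mult = (\<lambda>(m, x) (n, y). (n \<otimes>\<^bsub>G\<^esub> m, y))\<rparr>"

definition basic_bisection ::
  "'g monoid \<Rightarrow> ('g \<Rightarrow> 'x \<Rightarrow> 'x) \<Rightarrow> 'x set \<Rightarrow> 'g \<Rightarrow> 'g \<Rightarrow> 'x set \<Rightarrow> ('x \<times> 'g \<times> 'x) set" where
  "basic_bisection G \<theta> U m n V =
     {(x, m \<otimes>\<^bsub>G\<^esub> inv\<^bsub>G\<^esub> n, y) |x y. \<theta> m x = \<theta> n y \<and> x \<in> U \<and> y \<in> V}"

definition basic_bisections ::
  "'g monoid \<Rightarrow> 'x topology \<Rightarrow> 'g set \<Rightarrow> ('g \<Rightarrow> 'x \<Rightarrow> 'x) \<Rightarrow> ('x \<times> 'g \<times> 'x) set set" where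
  "basic_bisections G X P \<theta> =
     {basic_bisection G \<theta> U m n V |U m n V.
        m \<in> P \<and> n \<in> P \<and> openin X U \<and> openin X V \<and>
        embedding_map (subtopology X U) X (\<theta> m) \<and>
        embedding_map (subtopology X V) X (\<theta> n) \<and>
        \<theta> m ` U = \<theta> n ` V}"

text \<open>The underlying set of the groupoid is the union of the basic open sets; that this is the
  expected set of triples is \<open>topspace_transformation_groupoid\<close> below.\<close>

definition transformation_groupoid ::
  "'g monoid \<Rightarrow> 'x topology \<Rightarrow> 'g set \<Rightarrow> ('g \<Rightarrow> 'x \<Rightarrow> 'x) \<Rightarrow> ('x \<times> 'g \<times> 'x) top_groupoid" where
  "transformation_groupoid G X P \<theta> =
     \<lparr>sg_top = topology_generated_by (basic_bisections G X P \<theta>),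
      sg_comp = (\<lambda>(x, g, y) (y', h, v). y = y'),
      sg_mult = (\<lambda>(x, g, y) (y', h, v). (x, g \<otimes>\<^bsub>G\<^esub> h, v)),
      gpd_inv = (\<lambda>(x, g, y). (y, inv\<^bsub>G\<^esub> g, x))\<rparr>"


section \<open>Operators on \<open>\<ell>\<^sup>2(A)\<close>\<close>

text \<open>Vectors of \<open>\<ell>\<^sup>2(A)\<close> are functions vanishing outside \<open>A\<close>; operators are
  extensional functions on that set of vectors, so that equality of operators is HOL equality.\<close>

definition ell2 :: "'a set \<Rightarrow> ('a \<Rightarrow> complex) set" where
  "ell2 A = {\<xi>. (\<forall>\<gamma>. \<gamma> \<notin> A \<longrightarrow> \<xi> \<gamma> = 0) \<and> (\<lambda>\<gamma>. (cmod (\<xi> \<gamma>))\<^sup>2) summable_on A}"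

definition ell2_inner :: "'a set \<Rightarrow> ('a \<Rightarrow> complex) \<Rightarrow> ('a \<Rightarrow> complex) \<Rightarrow> complex" where
  "ell2_inner A \<xi> \<eta> = (\<Sum>\<^sub>\<infinity>\<gamma>\<in>A. \<xi> \<gamma> * cnj (\<eta> \<gamma>))"

definition ell2_norm :: "'a set \<Rightarrow> ('a \<Rightarrow> complex) \<Rightarrow> real" where
  "ell2_norm A \<xi> = sqrt (\<Sum>\<^sub>\<infinity>\<gamma>\<in>A. (cmod (\<xi> \<gamma>))\<^sup>2)"

type_synonym 'a ell2_operator = "('a \<Rightarrow> complex) \<Rightarrow> ('a \<Rightarrow> complex)"

definition bounded_operators :: "'a set \<Rightarrow> 'a ell2_operator set" where
  "bounded_operators A =
     {T \<in> ell2 A \<rightarrow>\<^sub>E ell2 A.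
        (\<forall>\<xi>\<in>ell2 A. \<forall>\<eta>\<in>ell2 A. \<forall>c d.
           T (\<lambda>\<gamma>. c * \<xi> \<gamma> + d * \<eta> \<gamma>) = (\<lambda>\<gamma>. c * T \<xi> \<gamma> + d * T \<eta> \<gamma>)) \<and>
        (\<exists>K. \<forall>\<xi>\<in>ell2 A. ell2_norm A (T \<xi>) \<le> K * ell2_norm A \<xi>)}"

definition op_add :: "'a set \<Rightarrow> 'a ell2_operator \<Rightarrow> 'a ell2_operator \<Rightarrow> 'a ell2_operator" where
  "op_add A S T = (\<lambda>\<xi>\<in>ell2 A. \<lambda>\<gamma>. S \<xi> \<gamma> + T \<xi> \<gamma>)"

definition op_scale :: "'a set \<Rightarrow> complex \<Rightarrow> 'a ell2_operator \<Rightarrow> 'a ell2_operator" where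
  "op_scale A c T = (\<lambda>\<xi>\<in>ell2 A. \<lambda>\<gamma>. c * T \<xi> \<gamma>)"

definition op_mult :: "'a set \<Rightarrow> 'a ell2_operator \<Rightarrow> 'a ell2_operator \<Rightarrow> 'a ell2_operator" where
  "op_mult A S T = (\<lambda>\<xi>\<in>ell2 A. S (T \<xi>))"

definition op_adjoint :: "'a set \<Rightarrow> 'a ell2_operator \<Rightarrow> 'a ell2_operator" where
  "op_adjoint A T =
     (THE S. S \<in> bounded_operators A \<and>
        (\<forall>\<xi>\<in>ell2 A. \<forall>\<eta>\<in>ell2 A. ell2_inner A (T \<xi>) \<eta> = ell2_inner A \<xi> (S \<eta>)))"

definition op_norm :: "'a set \<Rightarrow> 'a ell2_operator \<Rightarrow> real" where
  "op_norm A T = (SUP \<xi>\<in>{\<xi> \<in> ell2 A. ell2_norm A \<xi> \<le> 1}. ell2_norm A (T \<xi>))"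

definition op_dist :: "'a set \<Rightarrow> 'a ell2_operator \<Rightarrow> 'a ell2_operator \<Rightarrow> real" where
  "op_dist A S T = op_norm A (op_add A S (op_scale A (- 1) T))"


section \<open>The reduced groupoid \<open>C\<^sup>*\<close>-algebra\<close>

text \<open>\<open>C\<^sub>c\<close> of a topological groupoid, as functions vanishing off the groupoid.\<close>

definition Cc :: "('a, 'm) top_groupoid_scheme \<Rightarrow> ('a \<Rightarrow> complex) set" where
  "Cc \<A> =
     {f. continuous_map (sg_top \<A>) euclidean f \<and>
         compactin (sg_top \<A>) (sg_top \<A> closure_of {\<gamma> \<in> topspace (sg_top \<A>). f \<gamma> \<noteq> 0}) \<and>
         (\<forall>\<gamma>. \<gamma> \<notin> topspace (sg_top \<A>) \<longrightarrow> f \<gamma> = 0)}"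

text \<open>Left convolution by \<open>f\<close> on \<open>\<ell>\<^sup>2\<close> of the whole groupoid. It is the direct sum over
  all units \<open>u\<close> of the regular representations \<open>\<lambda>\<^sub>u\<close> on \<open>\<ell>\<^sup>2\<close> of the source fibre of
  \<open>u\<close>, so its operator norm is the reduced norm, the supremum of all \<open>\<parallel>\<lambda>\<^sub>u(f)\<parallel>\<close>.\<close>

definition regular_rep :: "('a, 'm) top_groupoid_scheme \<Rightarrow> ('a \<Rightarrow> complex) \<Rightarrow> 'a ell2_operator" where
  "regular_rep \<A> f =
     (\<lambda>\<xi>\<in>ell2 (topspace (sg_top \<A>)). \<lambda>\<gamma>.
        \<Sum>\<^sub>\<infinity>(\<alpha>, \<beta>)\<in>{(\<alpha>, \<beta>). \<alpha> \<in> topspace (sg_top \<A>) \<and> \<beta> \<in> topspace (sg_top \<A>) \<and>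
            sg_comp \<A> \<alpha> \<beta> \<and> sg_mult \<A> \<alpha> \<beta> = \<gamma>}. f \<alpha> * \<xi> \<beta>)"

text \<open>The completion of \<open>C\<^sub>c\<close> in the reduced norm, realised as the norm closure of its image
  under the regular representation.\<close>

definition reduced_algebra :: "('a, 'm) top_groupoid_scheme \<Rightarrow> 'a ell2_operator set" where
  "reduced_algebra \<A> =
     {T \<in> bounded_operators (topspace (sg_top \<A>)).
        \<forall>\<epsilon>>0. \<exists>f\<in>Cc \<A>. op_dist (topspace (sg_top \<A>)) T (regular_rep \<A> f) < \<epsilon>}"

text \<open>The \<open>*\<close>-isomorphisms from a \<open>*\<close>-algebra \<open>M\<close> of operators on \<open>\<ell>\<^sup>2(A)\<close> onto a
  \<open>*\<close>-algebra \<open>N\<close> of operators on \<open>\<ell>\<^sup>2(B)\<close>.\<close>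

definition star_isomorphism ::
  "'a set \<Rightarrow> 'a ell2_operator set \<Rightarrow> 'b set \<Rightarrow> 'b ell2_operator set \<Rightarrow>
   ('a ell2_operator \<Rightarrow> 'b ell2_operator) \<Rightarrow> bool" where
  "star_isomorphism A M B N \<Phi> \<longleftrightarrow>
     bij_betw \<Phi> M N \<and>
     (\<forall>S\<in>M. \<forall>T\<in>M. \<Phi> (op_add A S T) = op_add B (\<Phi> S) (\<Phi> T)) \<and>
     (\<forall>c. \<forall>T\<in>M. \<Phi> (op_scale A c T) = op_scale B c (\<Phi> T)) \<and>
     (\<forall>S\<in>M. \<forall>T\<in>M. \<Phi> (op_mult A S T) = op_mult B (\<Phi> S) (\<Phi> T)) \<and>
     (\<forall>T\<in>M. \<Phi> (op_adjoint A T) = op_adjoint B (\<Phi> T))"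

definition reduced_algebra_iso ::
  "('a, 'm) top_groupoid_scheme \<Rightarrow> ('b, 'n) top_groupoid_scheme \<Rightarrow>
   ('a ell2_operator \<Rightarrow> 'b ell2_operator) \<Rightarrow> bool" where
  "reduced_algebra_iso \<A> \<B> \<Phi> \<longleftrightarrow>
     star_isomorphism (topspace (sg_top \<A>)) (reduced_algebra \<A>)
       (topspace (sg_top \<B>)) (reduced_algebra \<B>) \<Phi>"

text \<open>\<open>C(X)\<close> inside the reduced algebra of the transformation groupoid, via the identification
  of \<open>x\<close> with the unit \<open>(x, e, x)\<close>.\<close>

definition diagonal_function ::
  "'g monoid \<Rightarrow> 'x topology \<Rightarrow> ('x \<Rightarrow> complex) \<Rightarrow> 'x \<times> 'g \<times> 'x \<Rightarrow> complex" where
  "diagonal_function G X F =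
     (\<lambda>(x, g, y). if x \<in> topspace X \<and> g = \<one>\<^bsub>G\<^esub> \<and> y = x then F x else 0)"

definition diagonal_subalgebra ::
  "'g monoid \<Rightarrow> 'x topology \<Rightarrow> 'g set \<Rightarrow> ('g \<Rightarrow> 'x \<Rightarrow> 'x) \<Rightarrow> ('x \<times> 'g \<times> 'x) ell2_operator set" where
  "diagonal_subalgebra G X P \<theta> =
     {regular_rep (transformation_groupoid G X P \<theta>) (diagonal_function G X F) |F.
        continuous_map X euclidean F}"


section \<open>Well-definedness\<close>

context semigroup_action
begin

interpretation P: submonoid P G
  by (rule submonoid_P)

lemma act_closed: "m \<in> P \<Longrightarrow> x \<in> topspace X \<Longrightarrow> \<theta> m x \<in> topspace X"
  using surj by blast

lemma right_quotient_eq_cancel: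
  assumes "m \<in> P" "n \<in> P" "m' \<in> P" "n' \<in> P" and eq: "m \<otimes> inv n = m' \<otimes> inv n'"
  obtains p q where "p \<in> P" "q \<in> P" "m \<otimes> p = m' \<otimes> q" "n \<otimes> p = n' \<otimes> q"
proof -
  note [simp] = assms(1-4)
  have "inv m \<otimes> m' \<in> carrier G" by simp
  then obtain p q where pq: "p \<in> P" "q \<in> P" "inv m \<otimes> m' = p \<otimes> inv q"
    using right_quotients by blast
  note [simp] = pq(1,2)
  have m': "m' = m \<otimes> (p \<otimes> inv q)"
    by (metis pq(3) P.mem_carrier assms(1,3) inv_closed m_closed inv_solve_left)
  have 1: "m \<otimes> p = m' \<otimes> q"
    by (simp add: m' m_assoc)
  have "m \<otimes> inv n = m \<otimes> (p \<otimes> (inv q \<otimes> inv n'))"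
    using eq by (simp add: m' m_assoc)
  then have "inv n = p \<otimes> (inv q \<otimes> inv n')"
    by simp
  then have "inv n \<otimes> n' = p \<otimes> inv q"
    by (simp add: m_assoc)
  then have n': "n' = n \<otimes> (p \<otimes> inv q)"
    by (metis P.mem_carrier assms(2,4) pq(1,2) inv_closed m_closed inv_solve_left)
  have 2: "n \<otimes> p = n' \<otimes> q"
    by (simp add: n' m_assoc)
  show thesis
    using that 1 2 pq by blast
qed

lemma associated_action_eq:
  assumes "action_by_homeomorphisms X P \<theta>" and mn: "m \<in> P" "n \<in> P" and x: "x \<in> topspace X"
  shows "associated_action G X P \<theta> (m \<otimes> inv n) x = inv_into (topspace X) (\<theta> n) (\<theta> m x)"
proof -
  have inj: "inj_on (\<theta> k) (topspace X)" if "k \<in> P" for k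
    using assms(1) that by (simp add: action_by_homeomorphisms_def homeomorphic_eq_everything_map)
  have "inv_into (topspace X) (\<theta> n') (\<theta> m' x) = inv_into (topspace X) (\<theta> n) (\<theta> m x)"
    if mn': "m' \<in> P" "n' \<in> P" and eq: "m \<otimes> inv n = m' \<otimes> inv n'" for m' n'
  proof -
    obtain p q where pq: "p \<in> P" "q \<in> P" "m \<otimes> p = m' \<otimes> q" "n \<otimes> p = n' \<otimes> q"
      using right_quotient_eq_cancel[OF mn mn' eq] .
    define y where "y = inv_into (topspace X) (\<theta> n) (\<theta> m x)"
    have y: "y \<in> topspace X" "\<theta> n y = \<theta> m x"
      using surj mn x unfolding y_def
      by (metis act_closed inv_into_into, metis act_closed f_inv_into_f)
    have "\<theta> q (\<theta> n' y) = \<theta> p (\<theta> n y)"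
      by (metis action_mult mn(2) mn'(2) pq(1,2,4) y(1))
    also have "\<dots> = \<theta> q (\<theta> m' x)"
      by (metis action_mult mn(1) mn'(1) pq(1-3) x y(2))
    finally have "\<theta> n' y = \<theta> m' x"
      using inj[OF pq(2)] mn' x y(1) by (meson act_closed inj_onD)
    then have "inv_into (topspace X) (\<theta> n') (\<theta> m' x) = y"
      by (metis inj inv_into_f_f mn'(2) y(1))
    then show ?thesis
      by (simp add: y_def)
  qed
  then show ?thesis
    unfolding associated_action_def using mn by (intro the_equality) blast+
qed

lemma topspace_transformation_groupoid:
  "topspace (sg_top (transformation_groupoid G X P \<theta>)) =
     {(x, g, y). x \<in> topspace X \<and> g \<in> carrier G \<and> y \<in> topspace X \<and>
        (\<exists>m\<in>P. \<exists>n\<in>P. g = m \<otimes> inv n \<and> \<theta> m x = \<theta> n y)}" (is "?L = ?R")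
proof -
  have L: "?L = \<Union> (basic_bisections G X P \<theta>)"
    by (simp add: transformation_groupoid_def topology_generated_by_topspace)
  have "\<Union> (basic_bisections G X P \<theta>) \<subseteq> ?R"
    by (auto simp: basic_bisections_def basic_bisection_def dest: openin_subset)
  moreover have "?R \<subseteq> \<Union> (basic_bisections G X P \<theta>)"
  proof clarify
    fix x y m n
    assume *: "x \<in> topspace X" "y \<in> topspace X" "m \<in> P" "n \<in> P" "\<theta> m x = \<theta> n y"
    obtain U where U: "openin X U" "x \<in> U" "openin X (\<theta> m ` U)" "embedding_map (subtopology X U) X (\<theta> m)"
      using local_homeo[OF *(3)] *(1) unfolding local_homeomorphism_def by blast
    obtain V where V: "openin X V" "y \<in> V" "openin X (\<theta> n ` V)" "embedding_map (subtopology X V) X (\<theta> n)"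
      using local_homeo[OF *(4)] *(2) unfolding local_homeomorphism_def by blast
    define W where "W = \<theta> m ` U \<inter> \<theta> n ` V"
    have W: "openin X W" using U V unfolding W_def by (meson openin_Int)
    have emb: "openin X {u \<in> U'. \<theta> k u \<in> W} \<and>
        embedding_map (subtopology X {u \<in> U'. \<theta> k u \<in> W}) X (\<theta> k)"
      if U': "openin X U'" "embedding_map (subtopology X U') X (\<theta> k)" for U' k
    proof
      have top: "topspace (subtopology X U') = U'"
        using U'(1) by (meson openin_subset topspace_subtopology_subset)
      have "continuous_map (subtopology X U') X (\<theta> k)"
        using homeomorphic_imp_continuous_map[OF U'(2)[unfolded embedding_map_def]]
        by (simp add: continuous_map_in_subtopology)
      then have "openin (subtopology X U') {u \<in> U'. \<theta> k u \<in> W}"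
        using W openin_continuous_map_preimage top by fastforce
      then show "openin X {u \<in> U'. \<theta> k u \<in> W}"
        using U'(1) openin_trans_full by blast
      have hom: "homeomorphic_map (subtopology X U') (subtopology X (\<theta> k ` U')) (\<theta> k)"
        using U'(2) by (simp only: embedding_map_def top)
      have "topspace (subtopology X (\<theta> k ` U')) = \<theta> k ` U'"
        using homeomorphic_imp_surjective_map[OF hom] by (simp only: top)
      then have "homeomorphic_map (subtopology (subtopology X U') {u \<in> U'. \<theta> k u \<in> W})
          (subtopology (subtopology X (\<theta> k ` U')) (\<theta> k ` {u \<in> U'. \<theta> k u \<in> W})) (\<theta> k)"
        by (intro homeomorphic_map_subtopologies[OF hom]) (simp only: top, blast)
      moreover have "U' \<inter> {u \<in> U'. \<theta> k u \<in> W} = {u \<in> U'. \<theta> k u \<in> W}"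
        "\<theta> k ` U' \<inter> \<theta> k ` {u \<in> U'. \<theta> k u \<in> W} = \<theta> k ` {u \<in> U'. \<theta> k u \<in> W}"
        by blast+
      moreover have "topspace (subtopology X {u \<in> U'. \<theta> k u \<in> W}) = {u \<in> U'. \<theta> k u \<in> W}"
        using U'(1) openin_subset by fastforce
      ultimately show "embedding_map (subtopology X {u \<in> U'. \<theta> k u \<in> W}) X (\<theta> k)"
        by (simp only: embedding_map_def subtopology_subtopology)
    qed
    have img: "f ` {u \<in> B. f u \<in> W} = W" if "W \<subseteq> f ` B" for f :: "'x \<Rightarrow> 'x" and B
      using that by blast
    have "\<theta> m ` {u \<in> U. \<theta> m u \<in> W} = \<theta> n ` {u \<in> V. \<theta> n u \<in> W}"
      unfolding img[of "\<theta> m" U, unfolded W_def, OF Int_lower1, folded W_def]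
        img[of "\<theta> n" V, unfolded W_def, OF Int_lower2, folded W_def] by (rule refl)
    then have "basic_bisection G \<theta> {u \<in> U. \<theta> m u \<in> W} m n {u \<in> V. \<theta> n u \<in> W} \<in> basic_bisections G X P \<theta>"
      using emb[OF U(1,4)] emb[OF V(1,4)] *(3,4) unfolding basic_bisections_def by blast
    moreover have "\<theta> m x \<in> W" "\<theta> n y \<in> W"
      unfolding W_def using *(5) imageI[OF U(2), of "\<theta> m"] imageI[OF V(2), of "\<theta> n"] by simp_all
    then have "(x, m \<otimes> inv n, y) \<in> basic_bisection G \<theta> {u \<in> U. \<theta> m u \<in> W} m n {u \<in> V. \<theta> n u \<in> W}"
      using *(5) U(2) V(2) unfolding basic_bisection_def by blast
    ultimately show "(x, m \<otimes> inv n, y) \<in> \<Union> (basic_bisections G X P \<theta>)"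
      by blast
  qed
  ultimately show ?thesis
    unfolding L by (rule subset_antisym)
qed

end

end

theory Submission
  imports Defs
begin

text \<open>
  Parts (ii) and (iii) pass through germs: a homeomorphism \<open>\<phi>\<close> preserves orbit germs if
  \<open>\<theta> m x = \<theta> n y\<close> implies that \<open>\<rho> s (\<phi> x') = \<rho> t (\<phi> y')\<close> for fixed \<open>s\<close>, \<open>t\<close> and all
  \<open>(x', y')\<close> near \<open>(x, y)\<close> with \<open>\<theta> m x' = \<theta> n y'\<close>. By essential freeness the germ determines
  \<open>s t^-1\<close>, which makes \<open>(x, m n^-1, y) \<mapsto> (\<phi> x, s t^-1, \<phi> y)\<close> a well-defined groupoid
  isomorphism; conversely an isomorphism restricts to \<open>\<phi>\<close> on the unit space and preserves germs because
  it is continuous. For totally disconnected spaces the local choices of \<open>s\<close> and \<open>t\<close> are glued along a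
  finite clopen partition.

  A diagonal-preserving isomorphism \<open>\<Phi>\<close> of reduced algebras yields \<open>\<phi>\<close> by Stone duality on clopen
  sets. For a compact open bisection \<open>B\<close> implementing a partial homeomorphism \<open>\<tau>\<close> of \<open>X\<close>, the operator
  \<open>T = \<Phi>(1_B)\<close> is convolution by a continuous function, and the relations
  \<open>1_B 1_K = 1_{\<tau>^-1 K} 1_B\<close> force the support of that function into the pairs
  \<open>(\<phi> x, \<phi> (\<tau> x))\<close>. The support is open and meets every range fibre over \<open>\<phi>\<close> of the domain of \<open>\<tau>\<close>,
  so \<open>\<phi>\<close> preserves the germs of \<open>\<tau>\<close>.
\<close>

section \<open>Compact totally disconnected spaces and local homeomorphisms\<close>

text \<open>A single equation \<open>\<theta> m x = \<theta> n y\<close> does not fix the quotient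
  \<open>m n^-1\<close>: at points with isotropy several quotients fit, and essential freeness only
  controls nonempty open sets. Labels are therefore always compared on neighbourhoods, by one
  recurring argument: \<open>G = P P^-1\<close> yields common right multiples, two fractions are
  expanded to a common denominator, and a surplus factor \<open>q\<close> is cancelled by local
  injectivity of \<open>\<theta> q\<close>. The cocycles of an orbit equivalence are not canonical,
  only the quotient of their two values is. Germs forget the choice; choosing again continuously is
  what needs clopen partitions. On the operator side, commutation with projections reveals only the
  range and the source of a point of the support, never its group label. The label comes from
  topology: the coefficient function is a uniform limit of continuous functions, so its support is
  open, and a small neighbourhood in the groupoid carries one label. No range fibre over the domain
  is missed, because the product of \<open>1_B\<close> with the operator of the reversed bisection
  is a projection. In part (iv) the second point is a function of the first, so pairs of labels and
  quotients translate directly.\<close>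

lemma continuous_map_discreteI:
  assumes "\<And>z. z \<in> topspace Z \<Longrightarrow> f z \<in> C"
    and "\<And>z. z \<in> topspace Z \<Longrightarrow> \<exists>N. openin Z N \<and> z \<in> N \<and> (\<forall>z'\<in>N. f z' = f z)"
  shows "continuous_map Z (discrete_topology C) f"
proof -
  have "openin Z {z \<in> topspace Z. f z \<in> U}" for U
  proof (subst openin_subopen, intro ballI)
    fix z assume z: "z \<in> {z \<in> topspace Z. f z \<in> U}"
    then obtain N where "openin Z N" "z \<in> N" "\<forall>z'\<in>N. f z' = f z"
      using assms(2) by blast
    with z show "\<exists>T. openin Z T \<and> z \<in> T \<and> T \<subseteq> {z \<in> topspace Z. f z \<in> U}"
      using openin_subset by (intro exI[of _ N]) fastforce
  qed
  then show ?thesis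
    using assms(1) by (simp add: continuous_map_def)
qed

lemma continuous_map_discreteD:
  assumes "continuous_map Z (discrete_topology C) f" "z \<in> topspace Z"
  obtains N where "openin Z N" "z \<in> N" "\<And>z'. z' \<in> N \<Longrightarrow> f z' = f z"
proof -
  have "f z \<in> C"
    using assms by (auto simp: continuous_map_def)
  then have "openin Z {z' \<in> topspace Z. f z' \<in> {f z}}"
    by (intro openin_continuous_map_preimage[OF assms(1)]) auto
  then show thesis
    by (rule that) (use assms(2) in auto)
qed

lemma local_homeomorphism_imp_continuous_map:
  assumes "local_homeomorphism X Y f"
  shows "continuous_map X Y f"
proof -
  have "openin X {x \<in> topspace X. f x \<in> W}" if W: "openin Y W" for W
  proof (subst openin_subopen, intro ballI)
    fix x assume x: "x \<in> {x \<in> topspace X. f x \<in> W}"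
    then obtain U where U: "openin X U" "x \<in> U" "embedding_map (subtopology X U) Y f"
      using assms unfolding local_homeomorphism_def by blast
    have "continuous_map (subtopology X U) Y f"
      using homeomorphic_imp_continuous_map[OF U(3)[unfolded embedding_map_def]]
      by (simp add: continuous_map_in_subtopology)
    then have "openin (subtopology X U) {x \<in> topspace (subtopology X U). f x \<in> W}"
      using W by (rule openin_continuous_map_preimage)
    then have "openin X {x \<in> topspace (subtopology X U). f x \<in> W}"
      using U(1) openin_trans_full by blast
    then show "\<exists>T. openin X T \<and> x \<in> T \<and> T \<subseteq> {x \<in> topspace X. f x \<in> W}"
      using x U(2) by (intro exI[of _ "{x \<in> topspace (subtopology X U). f x \<in> W}"]) auto
  qed
  then show ?thesis
    using assms by (auto simp: continuous_map_def local_homeomorphism_def)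
qed

lemma local_homeomorphism_imp_open_map:
  assumes "local_homeomorphism X Y f"
  shows "open_map X Y f"
  unfolding open_map_def
proof (intro allI impI)
  fix W assume W: "openin X W"
  show "openin Y (f ` W)"
  proof (subst openin_subopen, intro ballI)
    fix y assume "y \<in> f ` W"
    then obtain x where x: "x \<in> W" "y = f x" by blast
    then have "x \<in> topspace X"
      using W openin_subset by blast
    then obtain U where U: "openin X U" "x \<in> U" "openin Y (f ` U)" "embedding_map (subtopology X U) Y f"
      using assms unfolding local_homeomorphism_def by blast
    have top: "topspace (subtopology X U) = U"
      using U(1) by (meson openin_subset topspace_subtopology_subset)
    have "openin (subtopology X U) (U \<inter> W)"
      using W by (metis openin_subtopology_Int2)
    then have "openin (subtopology Y (f ` U)) (f ` (U \<inter> W))"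
      using homeomorphic_imp_open_map[OF U(4)[unfolded embedding_map_def top]]
      unfolding open_map_def by blast
    then have "openin Y (f ` (U \<inter> W))"
      using U(3) openin_trans_full by blast
    then show "\<exists>T. openin Y T \<and> y \<in> T \<and> T \<subseteq> f ` W"
      using x U(2) by (intro exI[of _ "f ` (U \<inter> W)"]) auto
  qed
qed

lemma local_homeomorphism_imp_locally_injective:
  assumes "local_homeomorphism X Y f" "x \<in> topspace X"
  obtains U where "openin X U" "x \<in> U" "inj_on f U"
proof -
  obtain U where U: "openin X U" "x \<in> U" "embedding_map (subtopology X U) Y f"
    using assms unfolding local_homeomorphism_def by blast
  have "inj_on f U"
    using homeomorphic_imp_injective_map[OF U(3)[unfolded embedding_map_def]] U(1)
    by (metis openin_subset topspace_subtopology_subset)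
  with U that show thesis by blast
qed

text \<open>In a compact Hausdorff space quasi-components coincide with components, so total
  disconnectedness makes the quasi-component of \<open>x\<close> the singleton \<open>{x}\<close>. A
  quasi-component is separated from any disjoint compact set by a clopen set, here from the
  complement of \<open>U\<close>.\<close>

lemma clopen_neighbourhood:
  assumes "compact_space X" "Hausdorff_space X" "totally_disconnected_space X"
    and U: "openin X U" "x \<in> U"
  obtains K where "openin X K" "closedin X K" "x \<in> K" "K \<subseteq> U"
proof -
  have x: "x \<in> topspace X"
    using U openin_subset by blast
  have C: "quasi_component_of_set X x \<in> quasi_components_of X"
    using x by (simp add: quasi_component_in_quasi_components_of)
  then have "connectedin X (quasi_component_of_set X x)"
    using assms quasi_eq_connected_components_of connectedin_connected_components_of by metis
  then have sing: "quasi_component_of_set X x = {x}"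
    using assms(3) x unfolding totally_disconnected_space_def
    by (metis empty_iff mem_Collect_eq quasi_component_of_refl singletonD subset_singletonD)
  have "compactin X (topspace X - U)"
    using assms(1) U(1) by (intro closedin_compact_space closedin_diff) auto
  then have "separated_between X {x} (topspace X - U)"
    using separated_between_quasi_component_compact[OF C] U(2) by (simp add: sing disjnt_def)
  then obtain K where K: "closedin X K" "openin X K" "{x} \<subseteq> K" "topspace X - U \<subseteq> topspace X - K"
    unfolding separated_between by blast
  then have "K \<subseteq> U"
    using openin_subset by blast
  with K that show thesis by blast
qed

lemma clopen_separation:
  assumes "compact_space X" "Hausdorff_space X" "totally_disconnected_space X"
    and "x \<in> topspace X" "y \<in> topspace X" "x \<noteq> y"
  obtains K where "openin X K" "closedin X K" "x \<in> K" "y \<notin> K"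
proof -
  obtain U V where "openin X U" "openin X V" "x \<in> U" "y \<in> V" "disjnt U V"
    using assms unfolding Hausdorff_space_def by metis
  then show thesis
    using clopen_neighbourhood[OF assms(1-3), of U x] that by (metis disjnt_iff subsetD)
qed

text \<open>Only one half of Stone duality is stated; a homeomorphism arises by applying it to a Boolean
  isomorphism and to its inverse.\<close>

lemma clopen_homomorphism_dual:
  assumes X: "compact_space X" "Hausdorff_space X" "totally_disconnected_space X"
    and clopen: "\<And>K. openin X K \<Longrightarrow> closedin X K \<Longrightarrow> openin Y (\<kappa> K)"
    and Int: "\<And>K L. openin X K \<Longrightarrow> closedin X K \<Longrightarrow> openin X L \<Longrightarrow> closedin X L \<Longrightarrow>
      \<kappa> (K \<inter> L) = \<kappa> K \<inter> \<kappa> L"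
    and compl: "\<And>K. openin X K \<Longrightarrow> closedin X K \<Longrightarrow> \<kappa> (topspace X - K) = topspace Y - \<kappa> K"
  obtains \<psi> where "continuous_map Y X \<psi>"
    and "\<And>K y. openin X K \<Longrightarrow> closedin X K \<Longrightarrow> y \<in> topspace Y \<Longrightarrow> \<psi> y \<in> K \<longleftrightarrow> y \<in> \<kappa> K"
proof -
  \<comment> \<open>\<open>\<kappa> {}\<close> is the complement of
    \<open>\<kappa> (topspace X)\<close> and, by the intersection rule, also a subset of it.\<close>
  have empty: "\<kappa> {} = {}"
    using Int[of "{}" "topspace X"] compl[of "topspace X"] by auto
  have ex: "\<exists>x\<in>topspace X. \<forall>K. openin X K \<longrightarrow> closedin X K \<longrightarrow> (x \<in> K \<longleftrightarrow> y \<in> \<kappa> K)"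
    if y: "y \<in> topspace Y" for y
  proof -
    \<comment> \<open>The ultrafilter of clopen sets attached to \<open>y\<close>. Compactness gives
      it a common point, and because it contains \<open>K\<close> or the complement of
      \<open>K\<close> for each clopen \<open>K\<close>, that point decides membership exactly as
      \<open>\<kappa>\<close> does.\<close>
    define \<K> where "\<K> = {K. openin X K \<and> closedin X K \<and> y \<in> \<kappa> K}"
    have fin: "\<Inter>\<F> \<in> \<K>" if "finite \<F>" "\<F> \<noteq> {}" "\<F> \<subseteq> \<K>" for \<F>
      using that
    proof (induction rule: finite_ne_induct)
      case (insert K \<F>)
      then have "K \<in> \<K>" "\<Inter>\<F> \<in> \<K>" by auto
      then show ?case
        using Int[of K "\<Inter>\<F>"] unfolding \<K>_def by (simp add: openin_Int closedin_Int)
    qed auto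
    have top: "topspace X \<in> \<K>"
      using y compl[of "{}"] empty unfolding \<K>_def by simp
    have "\<Inter>\<K> \<noteq> {}"
    proof -
      have "\<Inter>\<F> \<noteq> {}" if "finite \<F>" "\<F> \<subseteq> \<K>" for \<F>
        using fin[OF that(1) _ that(2)] empty unfolding \<K>_def by (cases "\<F> = {}") auto
      moreover have "closedin X K" if "K \<in> \<K>" for K
        using that unfolding \<K>_def by blast
      ultimately show ?thesis
        by (intro X(1)[unfolded compact_space_fip, rule_format]) simp
    qed
    then obtain x where x: "x \<in> \<Inter>\<K>" by blast
    have "x \<in> topspace X" using x top by blast
    moreover have "x \<in> K \<longleftrightarrow> y \<in> \<kappa> K" if K: "openin X K" "closedin X K" for K
    proof
      show "y \<in> \<kappa> K \<Longrightarrow> x \<in> K"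
        using x K unfolding \<K>_def by blast
      assume "x \<in> K"
      show "y \<in> \<kappa> K"
      proof (rule ccontr)
        assume "y \<notin> \<kappa> K"
        then have "topspace X - K \<in> \<K>"
          using K y compl unfolding \<K>_def by (auto simp: openin_diff closedin_diff)
        then show False using x \<open>x \<in> K\<close> by blast
      qed
    qed
    ultimately show ?thesis by blast
  qed
  then obtain \<psi> where \<psi>: "\<And>y. y \<in> topspace Y \<Longrightarrow> \<psi> y \<in> topspace X"
    "\<And>K y. openin X K \<Longrightarrow> closedin X K \<Longrightarrow> y \<in> topspace Y \<Longrightarrow> \<psi> y \<in> K \<longleftrightarrow> y \<in> \<kappa> K"
    by metis
  have "openin Y {y \<in> topspace Y. \<psi> y \<in> U}" if U: "openin X U" for U
  proof (subst openin_subopen, intro ballI)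
    fix y assume y: "y \<in> {y \<in> topspace Y. \<psi> y \<in> U}"
    then obtain K where K: "openin X K" "closedin X K" "\<psi> y \<in> K" "K \<subseteq> U"
      using clopen_neighbourhood[OF X U] by blast
    have "openin Y (\<kappa> K)" using clopen K by blast
    moreover have "\<kappa> K \<subseteq> {y \<in> topspace Y. \<psi> y \<in> U}"
      using \<psi>(2)[OF K(1,2)] K(4) openin_subset[OF \<open>openin Y (\<kappa> K)\<close>] by blast
    ultimately show "\<exists>T. openin Y T \<and> y \<in> T \<and> T \<subseteq> {y \<in> topspace Y. \<psi> y \<in> U}"
      using \<psi>(2)[OF K(1,2)] K(3) y by blast
  qed
  then have "continuous_map Y X \<psi>"
    using \<psi>(1) by (auto simp: continuous_map_def)
  then show thesis using \<psi>(2) that by blast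
qed

section \<open>The topology of the transformation groupoid\<close>

context semigroup_action
begin

abbreviation gpd :: "('x \<times> 'g \<times> 'x) top_groupoid" where
  "gpd \<equiv> transformation_groupoid G X P \<theta>"

abbreviation \<Gamma> :: "('x \<times> 'g \<times> 'x) set" where
  "\<Gamma> \<equiv> topspace (sg_top gpd)"

lemma P_carrier [simp]: "m \<in> P \<Longrightarrow> m \<in> carrier G"
  using submonoid.mem_carrier[OF submonoid_P] .

lemma P_mult [simp]: "m \<in> P \<Longrightarrow> n \<in> P \<Longrightarrow> m \<otimes> n \<in> P"
  using submonoid.m_closed[OF submonoid_P] .

lemma P_one [simp]: "\<one> \<in> P"
  using submonoid.one_closed[OF submonoid_P] .

text \<open>The Ore condition: clear denominators in \<open>m^-1 n = p q^-1\<close>. It replaces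
  division inside \<open>P\<close> whenever two fractions have to be compared or multiplied.\<close>

lemma common_multiple:
  assumes "m \<in> P" "n \<in> P"
  obtains p q where "p \<in> P" "q \<in> P" "m \<otimes> p = n \<otimes> q"
proof -
  have "inv m \<otimes> n \<in> carrier G" using assms by simp
  then obtain p q where pq: "p \<in> P" "q \<in> P" "inv m \<otimes> n = p \<otimes> inv q"
    using right_quotients by blast
  then have "n = m \<otimes> (p \<otimes> inv q)"
    using assms by (metis P_carrier inv_closed inv_solve_left m_closed)
  then have "m \<otimes> p = n \<otimes> q"
    using assms pq by (simp add: m_assoc)
  with that pq show thesis by blast
qed

lemma mult_inv_cancel_right:
  assumes "m \<in> carrier G" "n \<in> carrier G" "p \<in> carrier G"
  shows "(m \<otimes> p) \<otimes> inv (n \<otimes> p) = m \<otimes> inv n"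
proof -
  have "p \<otimes> (inv p \<otimes> inv n) = inv n"
    using assms by (metis inv_closed l_one m_assoc r_inv)
  then show ?thesis
    using assms by (simp add: inv_mult_group m_assoc)
qed

lemma continuous_act: "m \<in> P \<Longrightarrow> continuous_map X X (\<theta> m)"
  by (simp add: local_homeo local_homeomorphism_imp_continuous_map)

lemma open_act: "m \<in> P \<Longrightarrow> openin X U \<Longrightarrow> openin X (\<theta> m ` U)"
  using local_homeo local_homeomorphism_imp_open_map unfolding open_map_def by blast

lemma open_act_preimage: "m \<in> P \<Longrightarrow> openin X U \<Longrightarrow> openin X {x \<in> topspace X. \<theta> m x \<in> U}"
  using continuous_act openin_continuous_map_preimage by blast

lemma embedding_act:
  assumes "m \<in> P" "openin X U" "inj_on (\<theta> m) U"
  shows "embedding_map (subtopology X U) X (\<theta> m)"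
proof (rule injective_open_imp_embedding_map)
  show "continuous_map (subtopology X U) X (\<theta> m)"
    using assms(1) continuous_act continuous_map_from_subtopology by blast
  show "open_map (subtopology X U) X (\<theta> m)"
    unfolding open_map_def using assms(1,2) open_act openin_trans_full by blast
  show "inj_on (\<theta> m) (topspace (subtopology X U))"
    using assms(3) by (auto intro: inj_on_subset)
qed

lemma act_lift:
  assumes "m \<in> P" "n \<in> P" "x \<in> topspace X" "\<theta> m x = \<theta> n y" "openin X B" "y \<in> B"
  obtains A where "openin X A" "x \<in> A" "\<And>x'. x' \<in> A \<Longrightarrow> \<exists>y'\<in>B. \<theta> m x' = \<theta> n y'"
proof
  show "openin X {x' \<in> topspace X. \<theta> m x' \<in> \<theta> n ` B}"
    using assms by (intro open_act_preimage open_act)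
qed (use assms in auto)

text \<open>Two fractions for one group element become equal after expansion by some
  \<open>p\<close> and \<open>q\<close>. Hence \<open>\<theta> m x' = \<theta> n y'\<close> gives
  \<open>\<theta> q (\<theta> m' x') = \<theta> q (\<theta> n' y')\<close>, and \<open>q\<close>
  cancels as long as both points stay in a set \<open>W\<close> on which \<open>\<theta> q\<close>
  is injective. Neighbourhoods in the groupoid thus do not depend on the fraction used.\<close>

lemma same_germ:
  assumes mn: "m \<in> P" "n \<in> P" "m' \<in> P" "n' \<in> P" and eq: "m \<otimes> inv n = m' \<otimes> inv n'"
    and xy: "x \<in> topspace X" "y \<in> topspace X" "\<theta> m' x = \<theta> n' y"
  obtains A B where "openin X A" "openin X B" "x \<in> A" "y \<in> B"
    "\<And>x' y'. x' \<in> A \<Longrightarrow> y' \<in> B \<Longrightarrow> \<theta> m x' = \<theta> n y' \<Longrightarrow> \<theta> m' x' = \<theta> n' y'"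
proof -
  obtain p q where pq: "p \<in> P" "q \<in> P" "m \<otimes> p = m' \<otimes> q" "n \<otimes> p = n' \<otimes> q"
    using right_quotient_eq_cancel[OF mn eq] .
  obtain W where W: "openin X W" "\<theta> m' x \<in> W" "inj_on (\<theta> q) W"
    using local_homeomorphism_imp_locally_injective[OF local_homeo[OF pq(2)]] act_closed mn xy by metis
  show thesis
  proof
    show "openin X {x \<in> topspace X. \<theta> m' x \<in> W}" "openin X {x \<in> topspace X. \<theta> n' x \<in> W}"
      using mn W by (simp_all add: open_act_preimage)
    show "x \<in> {x \<in> topspace X. \<theta> m' x \<in> W}" "y \<in> {x \<in> topspace X. \<theta> n' x \<in> W}"
      using xy W by auto
    fix x' y'
    assume *: "x' \<in> {x \<in> topspace X. \<theta> m' x \<in> W}" "y' \<in> {x \<in> topspace X. \<theta> n' x \<in> W}" "\<theta> m x' = \<theta> n y'"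
    have "\<theta> q (\<theta> m' x') = \<theta> p (\<theta> m x')"
      using *(1) mn pq by (simp add: action_mult)
    also have "\<dots> = \<theta> p (\<theta> n y')"
      using * by simp
    also have "\<dots> = \<theta> q (\<theta> n' y')"
      using *(2) mn pq by (simp add: action_mult)
    finally show "\<theta> m' x' = \<theta> n' y'"
      using W(3) * by (simp add: inj_on_eq_iff)
  qed
qed

lemma essentially_freeD:
  assumes "essentially_free X P \<theta>" "m \<in> P" "n \<in> P" "openin X U" "U \<noteq> {}"
    and "\<And>u. u \<in> U \<Longrightarrow> \<theta> m u = \<theta> n u"
  shows "m = n"
proof (rule ccontr)
  assume "m \<noteq> n"
  then have "X interior_of {x \<in> topspace X. \<theta> m x = \<theta> n x} = {}"
    using assms unfolding essentially_free_def by blast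
  moreover have "U \<subseteq> X interior_of {x \<in> topspace X. \<theta> m x = \<theta> n x}"
    using assms openin_subset[OF assms(4)] by (intro interior_of_maximal) auto
  ultimately show False using assms(5) by blast
qed

text \<open>After expansion to a common denominator \<open>n p = n' q\<close>, both
  \<open>\<theta> (m p) u\<close> and \<open>\<theta> (m' q) u\<close> are computed through the
  partner \<open>v\<close>, so they agree on all of \<open>U\<close>, and essential freeness gives
  \<open>m p = m' q\<close>. The partner may vary with \<open>u\<close>; only its existence
  matters.\<close>

lemma germ_determines_quotient:
  assumes "essentially_free X P \<theta>" "m \<in> P" "n \<in> P" "m' \<in> P" "n' \<in> P"
    and "openin X U" "U \<noteq> {}"
    and *: "\<And>u. u \<in> U \<Longrightarrow> \<exists>v\<in>topspace X. \<theta> m u = \<theta> n v \<and> \<theta> m' u = \<theta> n' v"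
  shows "m \<otimes> inv n = m' \<otimes> inv n'"
proof -
  obtain p q where pq: "p \<in> P" "q \<in> P" "n \<otimes> p = n' \<otimes> q"
    using common_multiple assms by metis
  have "m \<otimes> p = m' \<otimes> q"
  proof (rule essentially_freeD[OF assms(1) _ _ assms(6,7)])
    fix u assume u: "u \<in> U"
    then obtain v where v: "v \<in> topspace X" "\<theta> m u = \<theta> n v" "\<theta> m' u = \<theta> n' v"
      using * by blast
    have uX: "u \<in> topspace X" using u assms(6) openin_subset by blast
    have "\<theta> (m \<otimes> p) u = \<theta> p (\<theta> n v)"
      using uX v assms pq by (simp flip: action_mult)
    also have "\<dots> = \<theta> q (\<theta> n' v)"
      using v assms pq by (simp add: action_mult)
    also have "\<dots> = \<theta> (m' \<otimes> q) u"
      using uX v assms pq by (simp flip: action_mult)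
    finally show "\<theta> (m \<otimes> p) u = \<theta> (m' \<otimes> q) u" .
  qed (use assms pq in auto)
  then show ?thesis
    using mult_inv_cancel_right[of m n p] mult_inv_cancel_right[of m' n' q] assms pq by simp
qed

lemma in_\<Gamma>_iff:
  "(x, g, y) \<in> \<Gamma> \<longleftrightarrow> x \<in> topspace X \<and> y \<in> topspace X \<and>
     (\<exists>m\<in>P. \<exists>n\<in>P. g = m \<otimes> inv n \<and> \<theta> m x = \<theta> n y)"
  by (auto simp: topspace_transformation_groupoid)

lemma in_\<Gamma>I:
  "m \<in> P \<Longrightarrow> n \<in> P \<Longrightarrow> x \<in> topspace X \<Longrightarrow> y \<in> topspace X \<Longrightarrow> \<theta> m x = \<theta> n y \<Longrightarrow>
   (x, m \<otimes> inv n, y) \<in> \<Gamma>"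
  unfolding in_\<Gamma>_iff by blast

lemma in_\<Gamma>E:
  assumes "(x, g, y) \<in> \<Gamma>"
  obtains m n where "m \<in> P" "n \<in> P" "g = m \<otimes> inv n" "\<theta> m x = \<theta> n y"
    "x \<in> topspace X" "y \<in> topspace X"
  using assms unfolding in_\<Gamma>_iff by blast

lemma in_\<Gamma>_carrier: "(x, g, y) \<in> \<Gamma> \<Longrightarrow> g \<in> carrier G"
  by (auto elim!: in_\<Gamma>E)

lemma unit_in_\<Gamma>_iff [simp]: "(x, \<one>, x) \<in> \<Gamma> \<longleftrightarrow> x \<in> topspace X"
  using in_\<Gamma>I[of \<one> \<one> x x] by (auto elim: in_\<Gamma>E)

lemma inverse_in_\<Gamma>:
  assumes "(x, g, y) \<in> \<Gamma>"
  shows "(y, inv g, x) \<in> \<Gamma>"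
proof -
  obtain m n where *: "m \<in> P" "n \<in> P" "g = m \<otimes> inv n" "\<theta> m x = \<theta> n y"
    "x \<in> topspace X" "y \<in> topspace X"
    using assms by (rule in_\<Gamma>E)
  then have "inv g = n \<otimes> inv m"
    by (simp add: inv_mult_group)
  with * show ?thesis
    using in_\<Gamma>I[of n m y x] by simp
qed

text \<open>Multiplication of right fractions: expand both factors so that the inner denominator and
  numerator become the same element \<open>n p = m' q\<close>, which then cancels.\<close>

lemma product_quotient:
  assumes "m \<in> carrier G" "n \<in> carrier G" "m' \<in> carrier G" "n' \<in> carrier G"
    "p \<in> carrier G" "q \<in> carrier G" "n \<otimes> p = m' \<otimes> q"
  shows "(m \<otimes> p) \<otimes> inv (n' \<otimes> q) = (m \<otimes> inv n) \<otimes> (m' \<otimes> inv n')"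
proof -
  have "(m \<otimes> inv n) \<otimes> (m' \<otimes> inv n') = ((m \<otimes> p) \<otimes> inv (n \<otimes> p)) \<otimes> ((n \<otimes> p) \<otimes> inv (n' \<otimes> q))"
    using assms(1-6) mult_inv_cancel_right[of m n p] mult_inv_cancel_right[of m' n' q]
    by (simp add: assms(7))
  also have "\<dots> = (m \<otimes> p) \<otimes> (inv (n \<otimes> p) \<otimes> ((n \<otimes> p) \<otimes> inv (n' \<otimes> q)))"
    using assms(1-6) by (intro m_assoc) auto
  also have "inv (n \<otimes> p) \<otimes> ((n \<otimes> p) \<otimes> inv (n' \<otimes> q)) = inv (n' \<otimes> q)"
    using assms(1-6) by (subst m_assoc[symmetric]) auto
  finally show ?thesis by simp
qed

lemma mult_in_\<Gamma>:
  assumes "(x, g, y) \<in> \<Gamma>" "(y, h, z) \<in> \<Gamma>"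
  shows "(x, g \<otimes> h, z) \<in> \<Gamma>"
proof -
  obtain m n where 1: "m \<in> P" "n \<in> P" "g = m \<otimes> inv n" "\<theta> m x = \<theta> n y"
    "x \<in> topspace X" "y \<in> topspace X"
    using assms(1) by (rule in_\<Gamma>E)
  obtain m' n' where 2: "m' \<in> P" "n' \<in> P" "h = m' \<otimes> inv n'" "\<theta> m' y = \<theta> n' z"
    "y \<in> topspace X" "z \<in> topspace X"
    using assms(2) by (rule in_\<Gamma>E)
  obtain p q where pq: "p \<in> P" "q \<in> P" "n \<otimes> p = m' \<otimes> q"
    using common_multiple 1 2 by metis
  have "\<theta> (m \<otimes> p) x = \<theta> p (\<theta> n y)"
    using 1 pq by (simp flip: action_mult)
  also have "\<dots> = \<theta> q (\<theta> m' y)"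
    using 1 2(1,2) pq by (simp add: action_mult)
  also have "\<dots> = \<theta> q (\<theta> n' z)"
    using 2 by simp
  also have "\<dots> = \<theta> (n' \<otimes> q) z"
    using 2 pq by (simp add: action_mult)
  finally have "(x, (m \<otimes> p) \<otimes> inv (n' \<otimes> q), z) \<in> \<Gamma>"
    using 1 2 pq by (intro in_\<Gamma>I) auto
  then show ?thesis
    using product_quotient[of m n m' n' p q] 1 2 pq by simp
qed

text \<open>Together with \<open>openin_gpdI\<close> this describes the topology by neighbourhoods,
  so that the injectivity and image conditions on basic bisections need not be carried around. The
  fraction \<open>m\<close>, \<open>n\<close> is prescribed by the caller, not by the open
  set.\<close>

lemma openin_gpdD:
  assumes "openin (sg_top gpd) W" and mn: "m \<in> P" "n \<in> P"
    and xy: "x \<in> topspace X" "y \<in> topspace X" "\<theta> m x = \<theta> n y" and W: "(x, m \<otimes> inv n, y) \<in> W"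
  obtains A B where "openin X A" "openin X B" "x \<in> A" "y \<in> B"
    "\<And>x' y'. x' \<in> A \<Longrightarrow> y' \<in> B \<Longrightarrow> \<theta> m x' = \<theta> n y' \<Longrightarrow> (x', m \<otimes> inv n, y') \<in> W"
proof -
  have "generate_topology_on (basic_bisections G X P \<theta>) W"
    using assms(1) by (simp add: transformation_groupoid_def openin_topology_generated_by_iff)
  then have "\<exists>A B. openin X A \<and> openin X B \<and> x \<in> A \<and> y \<in> B \<and>
      (\<forall>x'\<in>A. \<forall>y'\<in>B. \<theta> m x' = \<theta> n y' \<longrightarrow> (x', m \<otimes> inv n, y') \<in> W)"
    using W
  proof (induction rule: generate_topology_on.induct)
    case (Int a b)
    obtain A B where "openin X A" "openin X B" "x \<in> A" "y \<in> B"
      "\<forall>x'\<in>A. \<forall>y'\<in>B. \<theta> m x' = \<theta> n y' \<longrightarrow> (x', m \<otimes> inv n, y') \<in> a"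
      using Int by blast
    moreover obtain A' B' where "openin X A'" "openin X B'" "x \<in> A'" "y \<in> B'"
      "\<forall>x'\<in>A'. \<forall>y'\<in>B'. \<theta> m x' = \<theta> n y' \<longrightarrow> (x', m \<otimes> inv n, y') \<in> b"
      using Int by blast
    ultimately show ?case
      by (intro exI[of _ "A \<inter> A'"] exI[of _ "B \<inter> B'"]) (simp add: openin_Int)
  next
    case (UN K)
    then obtain k where "k \<in> K" "(x, m \<otimes> inv n, y) \<in> k" by blast
    with UN.IH[of k] show ?case by (meson UnionI)
  next
    \<comment> \<open>The basic set comes with its own fraction \<open>m'\<close>,
      \<open>n'\<close>; \<open>same_germ\<close> translates it to the prescribed one.\<close>
    case (Basis s)
    then obtain U m' n' V where s: "s = basic_bisection G \<theta> U m' n' V" "m' \<in> P" "n' \<in> P"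
        "openin X U" "openin X V"
      unfolding basic_bisections_def by blast
    have eq: "m \<otimes> inv n = m' \<otimes> inv n'" "x \<in> U" "y \<in> V" "\<theta> m' x = \<theta> n' y"
      using Basis(2) unfolding s basic_bisection_def by auto
    obtain A B where "openin X A" "openin X B" "x \<in> A" "y \<in> B"
      and AB: "\<And>x' y'. x' \<in> A \<Longrightarrow> y' \<in> B \<Longrightarrow> \<theta> m x' = \<theta> n y' \<Longrightarrow> \<theta> m' x' = \<theta> n' y'"
      using same_germ[OF mn s(2,3) eq(1) xy(1,2) eq(4)] by blast
    then show ?case
      using s eq by (intro exI[of _ "A \<inter> U"] exI[of _ "B \<inter> V"])
        (auto simp: openin_Int basic_bisection_def)
  qed auto
  then show thesis using that by blast
qed

lemma basic_bisection_neighbourhood: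
  assumes mn: "m \<in> P" "n \<in> P" and "openin X A" "openin X B" "x \<in> A" "y \<in> B" "\<theta> m x = \<theta> n y"
  obtains U V where "U \<subseteq> A" "V \<subseteq> B" "x \<in> U" "y \<in> V"
    "basic_bisection G \<theta> U m n V \<in> basic_bisections G X P \<theta>"
proof -
  have xy: "x \<in> topspace X" "y \<in> topspace X"
    using assms openin_subset by blast+
  obtain U0 V0 where U0: "openin X U0" "x \<in> U0" "inj_on (\<theta> m) U0"
    and V0: "openin X V0" "y \<in> V0" "inj_on (\<theta> n) V0"
    using local_homeomorphism_imp_locally_injective[OF local_homeo] mn xy by metis
  \<comment> \<open>Basic bisections require \<open>\<theta> m\<close> U = \<theta> n
    \<open>V\<close>. Cutting both sides down to the preimages of the common part \<open>C\<close>
    of the images makes each image equal to \<open>C\<close>.\<close>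
  define C where "C = \<theta> m ` (U0 \<inter> A) \<inter> \<theta> n ` (V0 \<inter> B)"
  have C: "openin X C"
    using U0 V0 assms unfolding C_def by (intro openin_Int open_act)
  define U where "U = (U0 \<inter> A) \<inter> {x \<in> topspace X. \<theta> m x \<in> C}"
  define V where "V = (V0 \<inter> B) \<inter> {x \<in> topspace X. \<theta> n x \<in> C}"
  have op: "openin X U" "openin X V"
    using U0 V0 C assms unfolding U_def V_def by (auto intro!: openin_Int open_act_preimage)
  have inj: "inj_on (\<theta> m) U" "inj_on (\<theta> n) V"
    using U0(3) V0(3) unfolding U_def V_def by (auto intro: inj_on_subset)
  have "U0 \<subseteq> topspace X" "V0 \<subseteq> topspace X"
    using U0 V0 openin_subset by blast+
  then have "U = {u \<in> U0 \<inter> A. \<theta> m u \<in> C}" "V = {v \<in> V0 \<inter> B. \<theta> n v \<in> C}"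
    unfolding U_def V_def by blast+
  moreover have "f ` {u \<in> D. f u \<in> C} = C" if "C \<subseteq> f ` D" for f :: "'x \<Rightarrow> 'x" and D
    using that by blast
  moreover have "C \<subseteq> \<theta> m ` (U0 \<inter> A)" "C \<subseteq> \<theta> n ` (V0 \<inter> B)"
    unfolding C_def by (rule Int_lower1, rule Int_lower2)
  ultimately have "\<theta> m ` U = C" "\<theta> n ` V = C"
    by metis+
  then have bb: "basic_bisection G \<theta> U m n V \<in> basic_bisections G X P \<theta>"
    unfolding basic_bisections_def
    by (intro CollectI exI[of _ U] exI[of _ m] exI[of _ n] exI[of _ V] conjI refl op mn
        embedding_act inj) simp
  have "\<theta> m x \<in> \<theta> m ` (U0 \<inter> A)" "\<theta> n y \<in> \<theta> n ` (V0 \<inter> B)"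
    by (intro imageI IntI U0 V0 assms)+
  then have "\<theta> m x \<in> C"
    unfolding C_def by (simp add: \<open>\<theta> m x = \<theta> n y\<close>)
  then have "x \<in> U" "y \<in> V"
    unfolding U_def V_def using U0 V0 assms xy by auto
  with bb show thesis
    using that[of U V] unfolding U_def V_def by blast
qed

text \<open>Here one suitable fraction per point is enough, whereas \<open>openin_gpdD\<close>
  delivers every fraction; the two therefore compose without matching representatives.\<close>

lemma openin_gpdI:
  assumes "\<And>x g y. (x, g, y) \<in> W \<Longrightarrow> \<exists>m\<in>P. \<exists>n\<in>P. \<exists>A B. g = m \<otimes> inv n \<and> \<theta> m x = \<theta> n y \<and>
    openin X A \<and> openin X B \<and> x \<in> A \<and> y \<in> B \<and>
    (\<forall>x'\<in>A. \<forall>y'\<in>B. \<theta> m x' = \<theta> n y' \<longrightarrow> (x', g, y') \<in> W)"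
  shows "openin (sg_top gpd) W"
proof (subst openin_subopen, intro ballI)
  fix \<gamma> assume \<gamma>: "\<gamma> \<in> W"
  obtain x g y where xgy: "\<gamma> = (x, g, y)" by (metis prod.exhaust)
  then obtain m n A B where *: "m \<in> P" "n \<in> P" "g = m \<otimes> inv n" "\<theta> m x = \<theta> n y"
    "openin X A" "openin X B" "x \<in> A" "y \<in> B"
    "\<forall>x'\<in>A. \<forall>y'\<in>B. \<theta> m x' = \<theta> n y' \<longrightarrow> (x', g, y') \<in> W"
    using assms[of x g y] \<gamma> by blast
  obtain U V where UV: "U \<subseteq> A" "V \<subseteq> B" "x \<in> U" "y \<in> V"
    "basic_bisection G \<theta> U m n V \<in> basic_bisections G X P \<theta>"
    using basic_bisection_neighbourhood[OF *(1,2,5-8,4)] by blast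
  have "openin (sg_top gpd) (basic_bisection G \<theta> U m n V)"
    using UV(5) by (simp add: transformation_groupoid_def topology_generated_by_Basis)
  moreover have "basic_bisection G \<theta> U m n V \<subseteq> W"
    using UV * unfolding basic_bisection_def by blast
  moreover have "\<gamma> \<in> basic_bisection G \<theta> U m n V"
    using UV * xgy unfolding basic_bisection_def by blast
  ultimately show "\<exists>T. openin (sg_top gpd) T \<and> \<gamma> \<in> T \<and> T \<subseteq> W" by blast
qed

text \<open>The source is compact for fixed \<open>m\<close> and \<open>n\<close>, so this map
  produces compact subsets of the groupoid; on the diagonal it is the inclusion of the unit
  space.\<close>

lemma continuous_map_into_gpd:
  assumes "m \<in> P" "n \<in> P"
  shows "continuous_map (subtopology (prod_topology X X) {(x, y). \<theta> m x = \<theta> n y}) (sg_top gpd)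
    (\<lambda>(x, y). (x, m \<otimes> inv n, y))" (is "continuous_map ?Z _ ?f")
  unfolding continuous_map_def
proof (intro conjI allI impI)
  show "?f \<in> topspace ?Z \<rightarrow> \<Gamma>"
    using assms by (auto intro: in_\<Gamma>I)
  fix W assume W: "openin (sg_top gpd) W"
  show "openin ?Z {z \<in> topspace ?Z. ?f z \<in> W}"
  proof (subst openin_subopen, intro ballI)
    fix z assume z: "z \<in> {z \<in> topspace ?Z. ?f z \<in> W}"
    obtain x y where xy: "z = (x, y)" by (metis prod.exhaust)
    then have "x \<in> topspace X" "y \<in> topspace X" "\<theta> m x = \<theta> n y" "(x, m \<otimes> inv n, y) \<in> W"
      using z by auto
    then obtain A B where AB: "openin X A" "openin X B" "x \<in> A" "y \<in> B"
      "\<And>x' y'. x' \<in> A \<Longrightarrow> y' \<in> B \<Longrightarrow> \<theta> m x' = \<theta> n y' \<Longrightarrow> (x', m \<otimes> inv n, y') \<in> W"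
      using openin_gpdD[OF W assms] by metis
    have sub: "A \<subseteq> topspace X" "B \<subseteq> topspace X"
      using AB openin_subset by blast+
    show "\<exists>T. openin ?Z T \<and> z \<in> T \<and> T \<subseteq> {z \<in> topspace ?Z. ?f z \<in> W}"
    proof (intro exI conjI)
      show "openin ?Z ({(x, y). \<theta> m x = \<theta> n y} \<inter> (A \<times> B))"
        by (intro openin_subtopology_Int2) (simp add: openin_prod_Times_iff AB)
    qed (use AB z xy sub in auto)
  qed
qed

end

section \<open>Orbit equivalences and germs\<close>

text \<open>One direction of a continuous orbit equivalence, isolated so that each argument is made
  once and then applied a second time with the two actions exchanged.\<close>

definition orbit_cocycles ::
  "'x topology \<Rightarrow> 'g set \<Rightarrow> ('g \<Rightarrow> 'x \<Rightarrow> 'x) \<Rightarrow> 'y topology \<Rightarrow> 'h set \<Rightarrow> ('h \<Rightarrow> 'y \<Rightarrow> 'y) \<Rightarrow> ('x \<Rightarrow> 'y) \<Rightarrow> bool" where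
  "orbit_cocycles X P \<theta> Y S \<rho> \<phi> \<longleftrightarrow>
     (\<exists>a b. continuous_map (pair_space X P \<theta>) (discrete_topology S) a \<and>
        continuous_map (pair_space X P \<theta>) (discrete_topology S) b \<and>
        (\<forall>m\<in>P. \<forall>n\<in>P. \<forall>x\<in>topspace X. \<forall>y\<in>topspace X. \<theta> m x = \<theta> n y \<longrightarrow>
           \<rho> (a (m, n, x, y)) (\<phi> x) = \<rho> (b (m, n, x, y)) (\<phi> y)))"

lemma cont_orbit_equiv_iff:
  "cont_orbit_equiv X P \<theta> Y S \<rho> \<longleftrightarrow>
     (\<exists>\<phi> \<psi>. homeomorphic_maps X Y \<phi> \<psi> \<and> orbit_cocycles X P \<theta> Y S \<rho> \<phi> \<and> orbit_cocycles Y S \<rho> X P \<theta> \<psi>)"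
  unfolding cont_orbit_equiv_def orbit_cocycles_def by (intro iffI; elim exE conjE; intro exI conjI) assumption+

definition Li_cocycle ::
  "'x topology \<Rightarrow> 'g monoid \<Rightarrow> ('g \<Rightarrow> 'x \<Rightarrow> 'x) \<Rightarrow> 'y topology \<Rightarrow> 'h monoid \<Rightarrow> ('h \<Rightarrow> 'y \<Rightarrow> 'y) \<Rightarrow> ('x \<Rightarrow> 'y) \<Rightarrow> bool" where
  "Li_cocycle X G \<alpha> Y H \<beta> \<phi> \<longleftrightarrow>
     (\<exists>a. continuous_map (prod_topology (discrete_topology (carrier G)) X) (discrete_topology (carrier H)) a \<and>
        (\<forall>g\<in>carrier G. \<forall>x\<in>topspace X. \<phi> (\<alpha> g x) = \<beta> (a (g, x)) (\<phi> x)))"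

lemma Li_coe_iff:
  "Li_coe X G \<alpha> Y H \<beta> \<longleftrightarrow>
     (\<exists>\<phi> \<psi>. homeomorphic_maps X Y \<phi> \<psi> \<and> Li_cocycle X G \<alpha> Y H \<beta> \<phi> \<and> Li_cocycle Y H \<beta> X G \<alpha> \<psi>)"
  unfolding Li_coe_def Li_cocycle_def by (intro iffI; elim exE conjE; intro exI conjI) assumption+

text \<open>The germ version of continuous orbit equivalence: the two orbit labels only have to exist
  locally, without a global continuous choice.\<close>

definition preserves_orbit_germs ::
  "'x topology \<Rightarrow> 'g set \<Rightarrow> ('g \<Rightarrow> 'x \<Rightarrow> 'x) \<Rightarrow> 'h set \<Rightarrow> ('h \<Rightarrow> 'y \<Rightarrow> 'y) \<Rightarrow> ('x \<Rightarrow> 'y) \<Rightarrow> bool" where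
  "preserves_orbit_germs X P \<theta> S \<rho> \<phi> \<longleftrightarrow>
     (\<forall>m\<in>P. \<forall>n\<in>P. \<forall>x\<in>topspace X. \<forall>y\<in>topspace X. \<theta> m x = \<theta> n y \<longrightarrow>
       (\<exists>s\<in>S. \<exists>t\<in>S. \<exists>A B. openin X A \<and> openin X B \<and> x \<in> A \<and> y \<in> B \<and>
         (\<forall>x'\<in>A. \<forall>y'\<in>B. \<theta> m x' = \<theta> n y' \<longrightarrow> \<rho> s (\<phi> x') = \<rho> t (\<phi> y'))))"

lemma preserves_orbit_germsE:
  assumes "preserves_orbit_germs X P \<theta> S \<rho> \<phi>" "m \<in> P" "n \<in> P"
    "x \<in> topspace X" "y \<in> topspace X" "\<theta> m x = \<theta> n y"
  obtains s t A B where "s \<in> S" "t \<in> S" "openin X A" "openin X B" "x \<in> A" "y \<in> B"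
    "\<And>x' y'. x' \<in> A \<Longrightarrow> y' \<in> B \<Longrightarrow> \<theta> m x' = \<theta> n y' \<Longrightarrow> \<rho> s (\<phi> x') = \<rho> t (\<phi> y')"
  using assms(1)[unfolded preserves_orbit_germs_def, rule_format, OF assms(2-6)] by blast

lemma openin_prod_topologyE:
  assumes "openin (prod_topology X Y) W" "(x, y) \<in> W"
  obtains U V where "openin X U" "openin Y V" "x \<in> U" "y \<in> V" "U \<times> V \<subseteq> W"
  using assms(1)[unfolded openin_prod_topology_alt, rule_format, OF assms(2)] by blast

lemma topspace_pair_space:
  "topspace (pair_space X P \<theta>) =
     {(m, n, x, y). m \<in> P \<and> n \<in> P \<and> x \<in> topspace X \<and> y \<in> topspace X \<and> \<theta> m x = \<theta> n y}"
  by (auto simp: pair_space_def)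

lemma openin_pair_spaceD:
  assumes "openin (pair_space X P \<theta>) N" "(m, n, x, y) \<in> N"
  obtains A B where "openin X A" "openin X B" "x \<in> A" "y \<in> B"
    "\<And>x' y'. x' \<in> A \<Longrightarrow> y' \<in> B \<Longrightarrow> \<theta> m x' = \<theta> n y' \<Longrightarrow> (m, n, x', y') \<in> N"
proof -
  obtain T where T: "openin (prod_topology (discrete_topology P)
         (prod_topology (discrete_topology P) (prod_topology X X))) T"
    "N = T \<inter> {(m, n, x, y). \<theta> m x = \<theta> n y}"
    using assms(1) unfolding pair_space_def openin_subtopology by blast
  then have "(m, n, x, y) \<in> T" using assms(2) by blast
  then obtain U V where UV: "openin (prod_topology (discrete_topology P) (prod_topology X X)) V"
    "m \<in> U" "(n, x, y) \<in> V" "U \<times> V \<subseteq> T"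
    using openin_prod_topologyE[OF T(1)] by metis
  then obtain U' V' where UV': "openin (prod_topology X X) V'" "n \<in> U'" "(x, y) \<in> V'" "U' \<times> V' \<subseteq> V"
    using openin_prod_topologyE[OF UV(1,3)] by metis
  then obtain A B where "openin X A" "openin X B" "x \<in> A" "y \<in> B" "A \<times> B \<subseteq> V'"
    using openin_prod_topologyE[OF UV'(1,3)] by metis
  moreover have "(m, n, x', y') \<in> T" if "(x', y') \<in> V'" for x' y'
    using that UV(2,4) UV'(2,4) by blast
  ultimately show thesis
    using T(2) by (intro that[of A B]) auto
qed

lemma openin_pair_space_box:
  assumes "m \<in> P" "n \<in> P" "openin X A" "openin X B"
  shows "openin (pair_space X P \<theta>)
    {(m', n', x, y). m' = m \<and> n' = n \<and> x \<in> A \<and> y \<in> B \<and> \<theta> m x = \<theta> n y}"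
proof -
  have "{(m', n', x, y). m' = m \<and> n' = n \<and> x \<in> A \<and> y \<in> B \<and> \<theta> m x = \<theta> n y} =
      ({m} \<times> {n} \<times> A \<times> B) \<inter> {(m, n, x, y). \<theta> m x = \<theta> n y}"
    by auto
  then show ?thesis
    unfolding pair_space_def using assms
    by (simp add: openin_subtopology_Int openin_prod_Times_iff)
qed

text \<open>Compactness leaves finitely many clopen sets, each with one admissible constant. A
  global choice is then built by overriding, one set at a time.\<close>

lemma clopen_selection:
  assumes "compact_space Z"
    and ex: "\<And>z. z \<in> topspace Z \<Longrightarrow>
      \<exists>c\<in>C. \<exists>K. openin Z K \<and> closedin Z K \<and> z \<in> K \<and> (\<forall>z'\<in>K. Q z' c)"
  obtains f where "continuous_map Z (discrete_topology C) f" "\<And>z. z \<in> topspace Z \<Longrightarrow> Q z (f z)"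
proof -
  define \<K> where "\<K> = {K. openin Z K \<and> closedin Z K \<and> (\<exists>c\<in>C. \<forall>z\<in>K. Q z c)}"
  have "topspace Z \<subseteq> \<Union>\<K>"
    using ex unfolding \<K>_def by blast
  moreover have "\<And>K. K \<in> \<K> \<Longrightarrow> openin Z K"
    unfolding \<K>_def by blast
  ultimately obtain \<F> where \<F>: "finite \<F>" "\<F> \<subseteq> \<K>" "topspace Z \<subseteq> \<Union>\<F>"
    using assms(1) unfolding compact_space_alt by meson
  have "\<exists>f. \<forall>z\<in>\<Union>\<F>. f z \<in> C \<and> Q z (f z) \<and> (\<exists>N. openin Z N \<and> z \<in> N \<and> (\<forall>z'\<in>N. f z' = f z))"
    using \<F>(1,2)
  proof (induction rule: finite_induct)
    case (insert K \<F>)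
    then obtain f where f: "\<forall>z\<in>\<Union>\<F>. f z \<in> C \<and> Q z (f z) \<and> (\<exists>N. openin Z N \<and> z \<in> N \<and> (\<forall>z'\<in>N. f z' = f z))"
      by auto
    obtain c where c: "openin Z K" "closedin Z K" "c \<in> C" "\<forall>z\<in>K. Q z c"
      using insert.prems unfolding \<K>_def by auto
    \<comment> \<open>Off \<open>K\<close> the old function survives and remains locally constant
      because \<open>K\<close> is closed; on \<open>K\<close> the new constant is locally constant
      because \<open>K\<close> is open.\<close>
    define f' where "f' = (\<lambda>z. if z \<in> K then c else f z)"
    have "f' z \<in> C \<and> Q z (f' z) \<and> (\<exists>N. openin Z N \<and> z \<in> N \<and> (\<forall>z'\<in>N. f' z' = f' z))"
      if z: "z \<in> \<Union>(insert K \<F>)" for z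
    proof (cases "z \<in> K")
      case True
      then show ?thesis using c unfolding f'_def by (auto intro!: exI[of _ K])
    next
      case False
      then have "z \<in> \<Union>\<F>" using z by auto
      then obtain N where "f z \<in> C" "Q z (f z)" and N: "openin Z N" "z \<in> N" "\<forall>z'\<in>N. f z' = f z"
        using f by blast
      moreover have "f' z' = f' z" if "z' \<in> N - K" for z'
        using that N(3) False unfolding f'_def by auto
      moreover have "f' z = f z" using False by (simp add: f'_def)
      ultimately show ?thesis
        using False c(2) openin_diff[OF N(1) c(2)] by (metis DiffI)
    qed
    then show ?case by blast
  qed auto
  then obtain f where f: "\<And>z. z \<in> topspace Z \<Longrightarrow> f z \<in> C \<and> Q z (f z) \<and>
      (\<exists>N. openin Z N \<and> z \<in> N \<and> (\<forall>z'\<in>N. f z' = f z))"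
    using \<F>(3) by blast
  show thesis
    by (rule that[of f]) (use f in \<open>auto intro!: continuous_map_discreteI\<close>)
qed

context semigroup_action
begin

text \<open>The slice of \<open>pair_space\<close> at fixed labels. The whole pair space need not be
  compact when \<open>P\<close> is infinite, but each slice is, and discreteness of \<open>P\<close>
  makes the slices independent of each other.\<close>

definition eq_space :: "'g \<Rightarrow> 'g \<Rightarrow> ('x \<times> 'x) topology" where
  "eq_space m n = subtopology (prod_topology X X) {(x, y). \<theta> m x = \<theta> n y}"

lemma topspace_eq_space:
  "topspace (eq_space m n) = {(x, y). x \<in> topspace X \<and> y \<in> topspace X \<and> \<theta> m x = \<theta> n y}"
  by (auto simp: eq_space_def)

text \<open>It is closed in the compact square, as the equaliser of two continuous maps into a
  Hausdorff space.\<close>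

lemma compact_eq_space:
  assumes "m \<in> P" "n \<in> P"
  shows "compact_space (eq_space m n)"
proof -
  have "continuous_map (prod_topology X X) X (\<lambda>z. \<theta> m (fst z))"
    "continuous_map (prod_topology X X) X (\<lambda>z. \<theta> n (snd z))"
    using assms by (auto intro: continuous_map_compose[OF continuous_map_fst continuous_act, unfolded comp_def]
        continuous_map_compose[OF continuous_map_snd continuous_act, unfolded comp_def])
  then have "closedin (prod_topology X X) {z \<in> topspace (prod_topology X X). \<theta> m (fst z) = \<theta> n (snd z)}"
    by (rule closedin_continuous_maps_eq[OF Hausdorff_X])
  moreover have "{z \<in> topspace (prod_topology X X). \<theta> m (fst z) = \<theta> n (snd z)} = topspace (eq_space m n)"
    by (auto simp: topspace_eq_space)
  moreover have "compact_space (prod_topology X X)"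
    using compact_X by (simp add: compact_space_prod_topology)
  ultimately have "compactin (prod_topology X X) (topspace (eq_space m n))"
    using closedin_compact_space by metis
  then show ?thesis
    unfolding compact_space_def eq_space_def compactin_subtopology by auto
qed

lemma openin_eq_spaceD:
  assumes "openin (eq_space m n) N" "(x, y) \<in> N"
  obtains A B where "openin X A" "openin X B" "x \<in> A" "y \<in> B"
    "\<And>x' y'. x' \<in> A \<Longrightarrow> y' \<in> B \<Longrightarrow> \<theta> m x' = \<theta> n y' \<Longrightarrow> (x', y') \<in> N"
proof -
  obtain T where T: "openin (prod_topology X X) T" "N = T \<inter> {(x, y). \<theta> m x = \<theta> n y}"
    using assms(1) unfolding eq_space_def openin_subtopology by blast
  then have "(x, y) \<in> T" using assms(2) by blast
  then obtain A B where "openin X A" "openin X B" "x \<in> A" "y \<in> B" "A \<times> B \<subseteq> T"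
    using openin_prod_topologyE[OF T(1)] by metis
  with T(2) show thesis
    by (intro that[of A B]) auto
qed

text \<open>Continuous maps into a discrete space are locally constant, so the two cocycle values at
  a point serve as fixed \<open>s\<close> and \<open>t\<close> nearby.\<close>

lemma orbit_cocycles_imp_preserves_orbit_germs:
  assumes "orbit_cocycles X P \<theta> Y S \<rho> \<phi>"
  shows "preserves_orbit_germs X P \<theta> S \<rho> \<phi>"
  unfolding preserves_orbit_germs_def
proof (intro ballI impI)
  fix m n x y assume *: "m \<in> P" "n \<in> P" "x \<in> topspace X" "y \<in> topspace X" "\<theta> m x = \<theta> n y"
  obtain a b where ab: "continuous_map (pair_space X P \<theta>) (discrete_topology S) a"
    "continuous_map (pair_space X P \<theta>) (discrete_topology S) b"
    "\<forall>m\<in>P. \<forall>n\<in>P. \<forall>x\<in>topspace X. \<forall>y\<in>topspace X. \<theta> m x = \<theta> n y \<longrightarrow>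
       \<rho> (a (m, n, x, y)) (\<phi> x) = \<rho> (b (m, n, x, y)) (\<phi> y)"
    using assms unfolding orbit_cocycles_def by (elim exE conjE)
  have z: "(m, n, x, y) \<in> topspace (pair_space X P \<theta>)"
    using * by (simp add: topspace_pair_space)
  obtain N where N: "openin (pair_space X P \<theta>) N" "(m, n, x, y) \<in> N" "\<And>z. z \<in> N \<Longrightarrow> a z = a (m, n, x, y)"
    using continuous_map_discreteD[OF ab(1) z] by blast
  obtain N' where N': "openin (pair_space X P \<theta>) N'" "(m, n, x, y) \<in> N'" "\<And>z. z \<in> N' \<Longrightarrow> b z = b (m, n, x, y)"
    using continuous_map_discreteD[OF ab(2) z] by blast
  obtain A B where AB: "openin X A" "openin X B" "x \<in> A" "y \<in> B"
    "\<And>x' y'. x' \<in> A \<Longrightarrow> y' \<in> B \<Longrightarrow> \<theta> m x' = \<theta> n y' \<Longrightarrow> (m, n, x', y') \<in> N \<inter> N'"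
    using openin_pair_spaceD[OF openin_Int[OF N(1) N'(1)]] N(2) N'(2) by (metis IntI)
  have "a (m, n, x, y) \<in> S" "b (m, n, x, y) \<in> S"
    using z ab(1,2) by (auto simp: continuous_map_def)
  moreover have "\<rho> (a (m, n, x, y)) (\<phi> x') = \<rho> (b (m, n, x, y)) (\<phi> y')"
    if "x' \<in> A" "y' \<in> B" "\<theta> m x' = \<theta> n y'" for x' y'
    using ab(3)[rule_format, OF *(1,2) _ _ that(3)] AB(5)[OF that] N(3) N'(3) that AB(1,2) openin_subset
    by (metis IntE subsetD)
  ultimately show "\<exists>s\<in>S. \<exists>t\<in>S. \<exists>A B. openin X A \<and> openin X B \<and> x \<in> A \<and> y \<in> B \<and>
         (\<forall>x'\<in>A. \<forall>y'\<in>B. \<theta> m x' = \<theta> n y' \<longrightarrow> \<rho> s (\<phi> x') = \<rho> t (\<phi> y'))"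
    using AB(1-4) by blast
qed

lemma preserves_orbit_germs_imp_orbit_cocycles:
  assumes td: "totally_disconnected_space X" and germs: "preserves_orbit_germs X P \<theta> S \<rho> \<phi>"
  shows "orbit_cocycles X P \<theta> Y S \<rho> \<phi>"
proof -
  have "\<exists>f. continuous_map (eq_space m n) (discrete_topology (S \<times> S)) f \<and>
      (\<forall>x y. (x, y) \<in> topspace (eq_space m n) \<longrightarrow> \<rho> (fst (f (x, y))) (\<phi> x) = \<rho> (snd (f (x, y))) (\<phi> y))"
    if mn: "m \<in> P" "n \<in> P" for m n
  proof -
    \<comment> \<open>The two labels are selected together, as one map into
      \<open>S \<times> S\<close>: chosen separately they need not belong to the same local
      solution.\<close>
    define Q where "Q = (\<lambda>z c. \<rho> (fst c) (\<phi> (fst z)) = \<rho> (snd c) (\<phi> (snd z)))"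
    have "\<exists>c\<in>S \<times> S. \<exists>K. openin (eq_space m n) K \<and> closedin (eq_space m n) K \<and> z \<in> K \<and> (\<forall>z'\<in>K. Q z' c)"
      if z: "z \<in> topspace (eq_space m n)" for z
    proof -
      obtain x y where xy: "z = (x, y)" "x \<in> topspace X" "y \<in> topspace X" "\<theta> m x = \<theta> n y"
        using z by (auto simp: topspace_eq_space)
      obtain s t A B where st: "s \<in> S" "t \<in> S" and AB: "openin X A" "openin X B" "x \<in> A" "y \<in> B"
        "\<And>x' y'. x' \<in> A \<Longrightarrow> y' \<in> B \<Longrightarrow> \<theta> m x' = \<theta> n y' \<Longrightarrow> \<rho> s (\<phi> x') = \<rho> t (\<phi> y')"
        using preserves_orbit_germsE[OF germs mn xy(2-4)] by metis
      obtain K where K: "openin X K" "closedin X K" "x \<in> K" "K \<subseteq> A"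
        using clopen_neighbourhood[OF compact_X Hausdorff_X td AB(1,3)] .
      obtain L where L: "openin X L" "closedin X L" "y \<in> L" "L \<subseteq> B"
        using clopen_neighbourhood[OF compact_X Hausdorff_X td AB(2,4)] .
      define N where "N = {(x, y). \<theta> m x = \<theta> n y} \<inter> (K \<times> L)"
      have "openin (eq_space m n) N" "closedin (eq_space m n) N"
        unfolding N_def eq_space_def using K L
        by (auto intro!: openin_subtopology_Int2 closedin_subtopology_Int_closed
            simp: openin_prod_Times_iff closedin_prod_Times_iff)
      moreover have "z \<in> N" using xy K L unfolding N_def by auto
      moreover have "\<forall>z'\<in>N. Q z' (s, t)"
        using AB(5) subsetD[OF K(4)] subsetD[OF L(4)] unfolding N_def Q_def by auto
      ultimately show ?thesis using st by blast
    qed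
    from clopen_selection[OF compact_eq_space[OF mn] this] obtain f
      where "continuous_map (eq_space m n) (discrete_topology (S \<times> S)) f"
        "\<And>z. z \<in> topspace (eq_space m n) \<Longrightarrow> Q z (f z)"
      by blast
    then show ?thesis
      unfolding Q_def by (metis fst_conv snd_conv)
  qed
  then obtain f where cont: "\<And>m n. m \<in> P \<Longrightarrow> n \<in> P \<Longrightarrow> continuous_map (eq_space m n) (discrete_topology (S \<times> S)) (f m n)"
    and f: "\<And>m n x y. m \<in> P \<Longrightarrow> n \<in> P \<Longrightarrow> (x, y) \<in> topspace (eq_space m n) \<Longrightarrow>
      \<rho> (fst (f m n (x, y))) (\<phi> x) = \<rho> (snd (f m n (x, y))) (\<phi> y)"
    by metis
  \<comment> \<open>The selections on the individual slices are put side by side. A neighbourhood in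
    the pair space may keep \<open>m\<close> and \<open>n\<close> fixed, so continuity is that of a
    single slice.\<close>
  define F where "F = (\<lambda>(m, n, z). f m n z)"
  have F: "continuous_map (pair_space X P \<theta>) (discrete_topology (S \<times> S)) F"
  proof (rule continuous_map_discreteI)
    fix z assume z: "z \<in> topspace (pair_space X P \<theta>)"
    then obtain m n x y where xy: "z = (m, n, x, y)" "m \<in> P" "n \<in> P" "x \<in> topspace X" "y \<in> topspace X" "\<theta> m x = \<theta> n y"
      by (auto simp: topspace_pair_space)
    then have xy': "(x, y) \<in> topspace (eq_space m n)"
      by (simp add: topspace_eq_space)
    show "F z \<in> S \<times> S"
      using cont[OF xy(2,3)] xy xy' unfolding F_def by (auto simp: continuous_map_def)
    obtain N where N: "openin (eq_space m n) N" "(x, y) \<in> N" "\<And>z. z \<in> N \<Longrightarrow> f m n z = f m n (x, y)"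
      using continuous_map_discreteD[OF cont[OF xy(2,3)] xy'] by blast
    obtain A B where AB: "openin X A" "openin X B" "x \<in> A" "y \<in> B"
      "\<And>x' y'. x' \<in> A \<Longrightarrow> y' \<in> B \<Longrightarrow> \<theta> m x' = \<theta> n y' \<Longrightarrow> (x', y') \<in> N"
      using openin_eq_spaceD[OF N(1,2)] by blast
    define c where "c = f m n (x, y)"
    have Fc: "F (m, n, x', y') = c" if "x' \<in> A" "y' \<in> B" "\<theta> m x' = \<theta> n y'" for x' y'
      using N(3)[OF AB(5)[OF that]] by (simp add: F_def c_def)
    have Fz: "F z = c" by (simp add: F_def c_def xy)
    show "\<exists>N. openin (pair_space X P \<theta>) N \<and> z \<in> N \<and> (\<forall>z'\<in>N. F z' = F z)"
      by (intro exI conjI, rule openin_pair_space_box[OF xy(2,3) AB(1,2)])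
        (use xy AB(3,4) Fc Fz in auto)
  qed
  have "continuous_map (pair_space X P \<theta>) (discrete_topology S) (fst \<circ> F)"
    "continuous_map (pair_space X P \<theta>) (discrete_topology S) (snd \<circ> F)"
    using F by (auto intro!: continuous_map_compose[OF F] simp: continuous_map_from_discrete_topology)
  moreover have "\<rho> ((fst \<circ> F) (m, n, x, y)) (\<phi> x) = \<rho> ((snd \<circ> F) (m, n, x, y)) (\<phi> y)"
    if "m \<in> P" "n \<in> P" "x \<in> topspace X" "y \<in> topspace X" "\<theta> m x = \<theta> n y" for m n x y
    using f[of m n x y] that by (simp add: F_def topspace_eq_space)
  ultimately show ?thesis
    unfolding orbit_cocycles_def by blast
qed

text \<open>This removes the inverse of \<open>\<theta> n\<close> from sight: for homeomorphisms,
  the pairs related by \<open>m\<close> and \<open>n\<close> form the graph of the group element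
  \<open>m n^-1\<close>.\<close>

lemma associated_action_eq_iff:
  assumes "action_by_homeomorphisms X P \<theta>" "m \<in> P" "n \<in> P" "x \<in> topspace X" "y \<in> topspace X"
  shows "associated_action G X P \<theta> (m \<otimes> inv n) x = y \<longleftrightarrow> \<theta> m x = \<theta> n y"
proof -
  have "inj_on (\<theta> n) (topspace X)"
    using assms by (simp add: action_by_homeomorphisms_def homeomorphic_eq_everything_map)
  then show ?thesis
    using assms act_closed surj[of n] by (metis associated_action_eq f_inv_into_f inv_into_f_f)
qed

lemma associated_action_closed:
  assumes "action_by_homeomorphisms X P \<theta>" "g \<in> carrier G" "x \<in> topspace X"
  shows "associated_action G X P \<theta> g x \<in> topspace X"
proof -
  obtain m n where "m \<in> P" "n \<in> P" "g = m \<otimes> inv n"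
    using assms(2) right_quotients by blast
  then show ?thesis
    using assms act_closed surj[of n] by (metis associated_action_eq inv_into_into)
qed

lemma continuous_associated_action:
  assumes "action_by_homeomorphisms X P \<theta>" "g \<in> carrier G"
  shows "continuous_map X X (associated_action G X P \<theta> g)"
proof -
  obtain m n where mn: "m \<in> P" "n \<in> P" "g = m \<otimes> inv n"
    using assms(2) right_quotients by blast
  obtain f where f: "homeomorphic_maps X X (\<theta> n) f"
    using assms(1) mn(2) unfolding action_by_homeomorphisms_def homeomorphic_map_maps by blast
  have "continuous_map X X (f \<circ> \<theta> m)"
    using f mn(1) continuous_act continuous_map_compose unfolding homeomorphic_maps_def by blast
  moreover have "(f \<circ> \<theta> m) x = associated_action G X P \<theta> g x" if "x \<in> topspace X" for x
  proof -
    have "\<theta> n (f (\<theta> m x)) = \<theta> m x" "f (\<theta> m x) \<in> topspace X"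
      using f that act_closed[OF mn(1)] unfolding homeomorphic_maps_def continuous_map_def by auto
    then show ?thesis
      using associated_action_eq_iff[OF assms(1) mn(1,2) that] mn(3) by fastforce
  qed
  ultimately show ?thesis
    by (rule continuous_map_eq)
qed

end

section \<open>Orbit cocycles and Li's cocycles for actions by homeomorphisms\<close>

locale semigroup_action_pair =
  X: semigroup_action G X P \<theta> + Y: semigroup_action H Y S \<rho>
  for G :: "'g monoid" and X :: "'x topology" and P :: "'g set" and \<theta> :: "'g \<Rightarrow> 'x \<Rightarrow> 'x"
    and H :: "'h monoid" and Y :: "'y topology" and S :: "'h set" and \<rho> :: "'h \<Rightarrow> 'y \<Rightarrow> 'y"
begin

lemma orbit_cocycles_imp_Li_cocycle:
  assumes hX: "action_by_homeomorphisms X P \<theta>" and hY: "action_by_homeomorphisms Y S \<rho>"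
    and \<phi>: "continuous_map X Y \<phi>" and oc: "orbit_cocycles X P \<theta> Y S \<rho> \<phi>"
  shows "Li_cocycle X G (associated_action G X P \<theta>) Y H (associated_action H Y S \<rho>) \<phi>"
proof -
  obtain a b where ab: "continuous_map (pair_space X P \<theta>) (discrete_topology S) a"
    "continuous_map (pair_space X P \<theta>) (discrete_topology S) b"
    "\<forall>m\<in>P. \<forall>n\<in>P. \<forall>x\<in>topspace X. \<forall>y\<in>topspace X. \<theta> m x = \<theta> n y \<longrightarrow>
       \<rho> (a (m, n, x, y)) (\<phi> x) = \<rho> (b (m, n, x, y)) (\<phi> y)"
    using oc unfolding orbit_cocycles_def by (elim exE conjE)
  define \<alpha> where "\<alpha> = associated_action G X P \<theta>"
  have "\<forall>g\<in>carrier G. \<exists>m n. m \<in> P \<and> n \<in> P \<and> g = m \<otimes>\<^bsub>G\<^esub> inv\<^bsub>G\<^esub> n"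
    using X.right_quotients by blast
  then obtain num den where nd: "\<And>g. g \<in> carrier G \<Longrightarrow> num g \<in> P \<and> den g \<in> P \<and> g = num g \<otimes>\<^bsub>G\<^esub> inv\<^bsub>G\<^esub> den g"
    by metis
  \<comment> \<open>For a chosen fraction of \<open>g\<close> the partner of \<open>x\<close> is
    \<open>\<alpha> g x\<close>, so \<open>z (g, x)\<close> lies in the pair space and the cocycles
    can be evaluated there. The quotient of the two values is Li's cocycle; the choice of fraction
    is harmless because \<open>G\<close> is discrete.\<close>
  define z where "z = (\<lambda>(g, x). (num g, den g, x, \<alpha> g x))"
  define c where "c = (\<lambda>gx. a (z gx) \<otimes>\<^bsub>H\<^esub> inv\<^bsub>H\<^esub> b (z gx))"
  have zin: "z (g, x) \<in> topspace (pair_space X P \<theta>)" if "g \<in> carrier G" "x \<in> topspace X" for g x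
  proof -
    have "\<theta> (num g) x = \<theta> (den g) (\<alpha> g x)"
      using X.associated_action_eq_iff[OF hX, of "num g" "den g" x "\<alpha> g x"] nd[of g] that
        X.associated_action_closed[OF hX that] unfolding \<alpha>_def by auto
    then show ?thesis
      using X.associated_action_closed[OF hX that] that nd[of g]
      by (simp add: z_def topspace_pair_space \<alpha>_def)
  qed
  have abS: "a (z (g, x)) \<in> S" "b (z (g, x)) \<in> S" if "g \<in> carrier G" "x \<in> topspace X" for g x
    using zin[OF that] ab(1,2) by (auto simp: continuous_map_def)
  have "\<phi> (\<alpha> g x) = associated_action H Y S \<rho> (c (g, x)) (\<phi> x)"
    if "g \<in> carrier G" "x \<in> topspace X" for g x
  proof -
    have z: "num g \<in> P" "den g \<in> P" "\<alpha> g x \<in> topspace X" "\<theta> (num g) x = \<theta> (den g) (\<alpha> g x)"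
      using zin[OF that] by (auto simp: z_def topspace_pair_space)
    then have "\<rho> (a (z (g, x))) (\<phi> x) = \<rho> (b (z (g, x))) (\<phi> (\<alpha> g x))"
      using ab(3) that by (simp add: z_def)
    moreover have "\<phi> x \<in> topspace Y" "\<phi> (\<alpha> g x) \<in> topspace Y"
      using \<phi> that z by (auto simp: continuous_map_def)
    ultimately show ?thesis
      using Y.associated_action_eq_iff[OF hY] abS[OF that] unfolding c_def by metis
  qed
  moreover have "continuous_map (prod_topology (discrete_topology (carrier G)) X)
      (discrete_topology (carrier H)) c"
  proof (rule continuous_map_discreteI)
    fix gx assume gx: "gx \<in> topspace (prod_topology (discrete_topology (carrier G)) X)"
    then obtain g x where gx': "gx = (g, x)" and g: "g \<in> carrier G" and x: "x \<in> topspace X" by auto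
    show "c gx \<in> carrier H"
      using abS[OF g x] by (simp add: c_def gx')
    have z: "z (g, x) \<in> topspace (pair_space X P \<theta>)" using zin g x .
    obtain N where N: "openin (pair_space X P \<theta>) N" "z (g, x) \<in> N" "\<And>z'. z' \<in> N \<Longrightarrow> a z' = a (z (g, x))"
      using continuous_map_discreteD[OF ab(1) z] by blast
    obtain N' where N': "openin (pair_space X P \<theta>) N'" "z (g, x) \<in> N'" "\<And>z'. z' \<in> N' \<Longrightarrow> b z' = b (z (g, x))"
      using continuous_map_discreteD[OF ab(2) z] by blast
    have "(num g, den g, x, \<alpha> g x) \<in> N \<inter> N'"
      using N(2) N'(2) by (simp add: z_def)
    then obtain A B where AB: "openin X A" "openin X B" "x \<in> A" "\<alpha> g x \<in> B"
      "\<And>x' y'. x' \<in> A \<Longrightarrow> y' \<in> B \<Longrightarrow> \<theta> (num g) x' = \<theta> (den g) y' \<Longrightarrow> (num g, den g, x', y') \<in> N \<inter> N'"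
      using openin_pair_spaceD[OF openin_Int[OF N(1) N'(1)]] by metis
    \<comment> \<open>The second coordinate \<open>\<alpha> g x'\<close> moves with
      \<open>x'\<close>; its continuity keeps \<open>z (g, x')\<close> inside the set where both
      cocycles are constant.\<close>
    define D where "D = A \<inter> {x' \<in> topspace X. \<alpha> g x' \<in> B}"
    have "openin X D"
      unfolding D_def \<alpha>_def using AB g
      by (intro openin_Int openin_continuous_map_preimage[OF X.continuous_associated_action[OF hX]])
    moreover define c\<^sub>0 where "c\<^sub>0 = c (g, x)"
    moreover have "c (g, x') = c\<^sub>0" if "x' \<in> D" for x'
    proof -
      have "x' \<in> topspace X" using that by (simp add: D_def)
      then have "z (g, x') \<in> N \<inter> N'"
        using zin[OF g, of x'] AB(5)[of x' "\<alpha> g x'"] that by (auto simp: z_def D_def topspace_pair_space)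
      then show ?thesis
        using N(3) N'(3) by (simp add: c_def c\<^sub>0_def)
    qed
    moreover have "x \<in> D" using AB x by (simp add: D_def)
    ultimately show "\<exists>N. openin (prod_topology (discrete_topology (carrier G)) X) N \<and> gx \<in> N \<and>
        (\<forall>z'\<in>N. c z' = c gx)"
      using g by (intro exI[of _ "{g} \<times> D"]) (auto simp: openin_prod_Times_iff gx' simp flip: c\<^sub>0_def)
  qed
  ultimately show ?thesis
    unfolding Li_cocycle_def \<alpha>_def by blast
qed

text \<open>The quotient \<open>h = s t^-1\<close> is split by an arbitrary choice of \<open>s\<close> and \<open>t\<close>, which is
  continuous in \<open>h\<close> because \<open>H\<close> is discrete.\<close>

lemma Li_cocycle_imp_orbit_cocycles:
  assumes hX: "action_by_homeomorphisms X P \<theta>" and hY: "action_by_homeomorphisms Y S \<rho>"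
    and \<phi>: "continuous_map X Y \<phi>"
    and Li: "Li_cocycle X G (associated_action G X P \<theta>) Y H (associated_action H Y S \<rho>) \<phi>"
  shows "orbit_cocycles X P \<theta> Y S \<rho> \<phi>"
proof -
  obtain c where c: "continuous_map (prod_topology (discrete_topology (carrier G)) X) (discrete_topology (carrier H)) c"
    "\<And>g x. g \<in> carrier G \<Longrightarrow> x \<in> topspace X \<Longrightarrow>
      \<phi> (associated_action G X P \<theta> g x) = associated_action H Y S \<rho> (c (g, x)) (\<phi> x)"
    using Li unfolding Li_cocycle_def by blast
  have "\<forall>h\<in>carrier H. \<exists>s t. s \<in> S \<and> t \<in> S \<and> h = s \<otimes>\<^bsub>H\<^esub> inv\<^bsub>H\<^esub> t"
    using Y.right_quotients by blast
  then obtain num den where nd: "\<And>h. h \<in> carrier H \<Longrightarrow> num h \<in> S \<and> den h \<in> S \<and> h = num h \<otimes>\<^bsub>H\<^esub> inv\<^bsub>H\<^esub> den h"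
    by metis
  define k where "k = (\<lambda>(m, n, x :: 'x, y :: 'x). (m \<otimes>\<^bsub>G\<^esub> inv\<^bsub>G\<^esub> n, x))"
  have k: "continuous_map (pair_space X P \<theta>) (prod_topology (discrete_topology (carrier G)) X) k"
  proof -
    have 1: "continuous_map (pair_space X P \<theta>) X (\<lambda>(m, n, x, y). x)"
      unfolding continuous_map_def
    proof (intro conjI allI impI)
      fix U assume U: "openin X U"
      show "openin (pair_space X P \<theta>) {z \<in> topspace (pair_space X P \<theta>). (case z of (m, n, x, y) \<Rightarrow> x) \<in> U}"
      proof (subst openin_subopen, intro ballI)
        fix z assume z: "z \<in> {z \<in> topspace (pair_space X P \<theta>). (case z of (m, n, x, y) \<Rightarrow> x) \<in> U}"
        then obtain m n x y where xy: "z = (m, n, x, y)" "m \<in> P" "n \<in> P" "y \<in> topspace X" "x \<in> U" "\<theta> m x = \<theta> n y"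
          by (auto simp: topspace_pair_space)
        show "\<exists>T. openin (pair_space X P \<theta>) T \<and> z \<in> T \<and>
            T \<subseteq> {z \<in> topspace (pair_space X P \<theta>). (case z of (m, n, x, y) \<Rightarrow> x) \<in> U}"
          by (intro exI conjI, rule openin_pair_space_box[OF xy(2,3) U openin_topspace])
            (use openin_subset[OF U] xy in \<open>auto simp: topspace_pair_space\<close>)
      qed
    qed (auto simp: topspace_pair_space)
    have 2: "continuous_map (pair_space X P \<theta>) (discrete_topology (carrier G)) (\<lambda>(m, n, x, y). m \<otimes>\<^bsub>G\<^esub> inv\<^bsub>G\<^esub> n)"
    proof (rule continuous_map_discreteI)
      fix z assume z: "z \<in> topspace (pair_space X P \<theta>)"
      then obtain m n x y where xy: "z = (m, n, x, y)" "m \<in> P" "n \<in> P" "x \<in> topspace X" "y \<in> topspace X" "\<theta> m x = \<theta> n y"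
        by (auto simp: topspace_pair_space)
      show "(case z of (m, n, x, y) \<Rightarrow> m \<otimes>\<^bsub>G\<^esub> inv\<^bsub>G\<^esub> n) \<in> carrier G"
        using xy by simp
      show "\<exists>N. openin (pair_space X P \<theta>) N \<and> z \<in> N \<and>
          (\<forall>z'\<in>N. (case z' of (m, n, x, y) \<Rightarrow> m \<otimes>\<^bsub>G\<^esub> inv\<^bsub>G\<^esub> n) = (case z of (m, n, x, y) \<Rightarrow> m \<otimes>\<^bsub>G\<^esub> inv\<^bsub>G\<^esub> n))"
        by (intro exI conjI, rule openin_pair_space_box[OF xy(2,3) openin_topspace openin_topspace])
          (use xy in auto)
    qed
    have "continuous_map (pair_space X P \<theta>) (prod_topology (discrete_topology (carrier G)) X)
        (\<lambda>z. ((\<lambda>(m, n, x, y). m \<otimes>\<^bsub>G\<^esub> inv\<^bsub>G\<^esub> n) z, (\<lambda>(m, n, x, y). x) z))"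
      using 1 2 by (rule continuous_map_pairedI[rotated])
    then show ?thesis
      by (rule continuous_map_eq) (auto simp: k_def)
  qed
  have ck: "continuous_map (pair_space X P \<theta>) (discrete_topology (carrier H)) (c \<circ> k)"
    using k c(1) by (rule continuous_map_compose)
  have "continuous_map (pair_space X P \<theta>) (discrete_topology S) (num \<circ> (c \<circ> k))"
    "continuous_map (pair_space X P \<theta>) (discrete_topology S) (den \<circ> (c \<circ> k))"
    using nd by (auto intro!: continuous_map_compose[OF ck] simp: continuous_map_from_discrete_topology)
  moreover have "\<rho> ((num \<circ> (c \<circ> k)) (m, n, x, y)) (\<phi> x) = \<rho> ((den \<circ> (c \<circ> k)) (m, n, x, y)) (\<phi> y)"
    if *: "m \<in> P" "n \<in> P" "x \<in> topspace X" "y \<in> topspace X" "\<theta> m x = \<theta> n y" for m n x y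
  proof -
    define h where "h = c (m \<otimes>\<^bsub>G\<^esub> inv\<^bsub>G\<^esub> n, x)"
    have "h \<in> carrier H"
      using * c(1) unfolding h_def by (auto simp: continuous_map_def)
    then have h: "num h \<in> S" "den h \<in> S" "h = num h \<otimes>\<^bsub>H\<^esub> inv\<^bsub>H\<^esub> den h"
      using nd by auto
    have "associated_action G X P \<theta> (m \<otimes>\<^bsub>G\<^esub> inv\<^bsub>G\<^esub> n) x = y"
      using X.associated_action_eq_iff[OF hX] * by blast
    then have "\<phi> y = associated_action H Y S \<rho> h (\<phi> x)"
      using c(2)[of "m \<otimes>\<^bsub>G\<^esub> inv\<^bsub>G\<^esub> n" x] * by (simp add: h_def)
    moreover have "\<phi> x \<in> topspace Y" "\<phi> y \<in> topspace Y"
      using \<phi> * by (auto simp: continuous_map_def)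
    ultimately have "\<rho> (num h) (\<phi> x) = \<rho> (den h) (\<phi> y)"
      using Y.associated_action_eq_iff[OF hY] h by metis
    then show ?thesis by (simp add: k_def h_def)
  qed
  ultimately show ?thesis
    unfolding orbit_cocycles_def by blast
qed

end

text \<open>Both notions use the same pair of inverse homeomorphisms, so only the cocycles are
  converted, separately for each of the two actions.\<close>

lemma cont_orbit_equiv_iff_Li_coe:
  assumes "semigroup_action G X P \<theta>" "semigroup_action H Y S \<rho>"
    and hX: "action_by_homeomorphisms X P \<theta>" and hY: "action_by_homeomorphisms Y S \<rho>"
  shows "cont_orbit_equiv X P \<theta> Y S \<rho> \<longleftrightarrow>
    Li_coe X G (associated_action G X P \<theta>) Y H (associated_action H Y S \<rho>)"
proof -
  interpret XY: semigroup_action_pair G X P \<theta> H Y S \<rho>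
    using assms by (simp add: semigroup_action_pair_def)
  interpret YX: semigroup_action_pair H Y S \<rho> G X P \<theta>
    using assms by (simp add: semigroup_action_pair_def)
  show ?thesis
    unfolding cont_orbit_equiv_iff Li_coe_iff homeomorphic_maps_def
    using XY.orbit_cocycles_imp_Li_cocycle[OF hX hY] XY.Li_cocycle_imp_orbit_cocycles[OF hX hY]
      YX.orbit_cocycles_imp_Li_cocycle[OF hY hX] YX.Li_cocycle_imp_orbit_cocycles[OF hY hX]
    by meson
qed

section \<open>One-sided orbit equivalence and semi-groupoid isomorphisms\<close>

context semigroup_action
begin

lemma label_locally_constant:
  assumes "continuous_map (prod_topology (discrete_topology P) X) (discrete_topology C) a"
    and "m \<in> P" "x \<in> topspace X"
  obtains U where "openin X U" "x \<in> U" "\<And>x'. x' \<in> U \<Longrightarrow> a (m, x') = a (m, x)"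
proof -
  have "continuous_map X (prod_topology (discrete_topology P) X) (\<lambda>x. (m, x))"
    using assms(2) by (intro continuous_map_pairedI) auto
  then have "continuous_map X (discrete_topology C) (a \<circ> (\<lambda>x. (m, x)))"
    using assms(1) continuous_map_compose by blast
  from continuous_map_discreteD[OF this assms(3)] show thesis
    using that unfolding comp_def by metis
qed

end

context semigroup_action_pair
begin

text \<open>The isomorphism is \<open>(m, x) \<mapsto> (a (m, x), \<phi> x)\<close>. Bijectivity and
  multiplicativity are identities between semigroup elements; each is obtained by shrinking to an
  open set where the labels involved are constant, showing that both elements act alike there, and
  invoking essential freeness.\<close>

lemma one_sided_coe_imp_semigroupoids_isomorphic:
  assumes freeX: "essentially_free X P \<theta>" and freeY: "essentially_free Y S \<rho>"
    and "one_sided_coe X P \<theta> Y S \<rho>"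
  shows "semigroupoids_isomorphic (action_semigroupoid G X P \<theta>) (action_semigroupoid H Y S \<rho>)"
proof -
  let ?PX = "prod_topology (discrete_topology P) X" and ?SY = "prod_topology (discrete_topology S) Y"
  obtain \<phi> \<psi> a b where hm: "homeomorphic_maps X Y \<phi> \<psi>"
    and a: "continuous_map ?PX (discrete_topology S) a" and b: "continuous_map ?SY (discrete_topology P) b"
    and a_eq: "\<And>m x. m \<in> P \<Longrightarrow> x \<in> topspace X \<Longrightarrow> \<phi> (\<theta> m x) = \<rho> (a (m, x)) (\<phi> x)"
    and b_eq: "\<And>s y. s \<in> S \<Longrightarrow> y \<in> topspace Y \<Longrightarrow> \<psi> (\<rho> s y) = \<theta> (b (s, y)) (\<psi> y)"
    using assms(3) unfolding one_sided_coe_def by blast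
  have aS: "a (m, x) \<in> S" if "m \<in> P" "x \<in> topspace X" for m x
    using a that by (auto simp: continuous_map_def)
  have bP: "b (s, y) \<in> P" if "s \<in> S" "y \<in> topspace Y" for s y
    using b that by (auto simp: continuous_map_def)
  have \<phi>: "continuous_map X Y \<phi>" and \<psi>: "continuous_map Y X \<psi>"
    and \<psi>\<phi>: "\<And>x. x \<in> topspace X \<Longrightarrow> \<psi> (\<phi> x) = x" and \<phi>\<psi>: "\<And>y. y \<in> topspace Y \<Longrightarrow> \<phi> (\<psi> y) = y"
    using hm unfolding homeomorphic_maps_def by auto
  have \<phi>Y: "\<phi> x \<in> topspace Y" if "x \<in> topspace X" for x
    using \<phi> that by (auto simp: continuous_map_def)
  have \<psi>X: "\<psi> y \<in> topspace X" if "y \<in> topspace Y" for y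
    using \<psi> that by (auto simp: continuous_map_def)
  \<comment> \<open>Applying \<phi> and then \<psi> to \<open>\<theta> m x'\<close> replaces the
    label \<open>m\<close> by \<open>b\<close> of \<open>a\<close>, with constant labels near
    \<open>x\<close>.\<close>
  have ba: "b (a (m, x), \<phi> x) = m" if mx: "m \<in> P" "x \<in> topspace X" for m x
  proof -
    obtain U where U: "openin X U" "x \<in> U" "\<And>x'. x' \<in> U \<Longrightarrow> a (m, x') = a (m, x)"
      using X.label_locally_constant[OF a mx] by blast
    obtain V where V: "openin Y V" "\<phi> x \<in> V" "\<And>y'. y' \<in> V \<Longrightarrow> b (a (m, x), y') = b (a (m, x), \<phi> x)"
      using Y.label_locally_constant[OF b aS[OF mx] \<phi>Y[OF mx(2)]] by blast
    have "openin X (U \<inter> {x' \<in> topspace X. \<phi> x' \<in> V})"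
      using U V \<phi> by (intro openin_Int openin_continuous_map_preimage)
    moreover have "\<theta> (b (a (m, x), \<phi> x)) x' = \<theta> m x'" if "x' \<in> U \<inter> {x' \<in> topspace X. \<phi> x' \<in> V}" for x'
    proof -
      have x': "x' \<in> topspace X" "\<phi> x' \<in> V" "x' \<in> U" using that by auto
      have "\<theta> m x' = \<psi> (\<phi> (\<theta> m x'))"
        using x' mx X.act_closed \<psi>\<phi> by simp
      also have "\<dots> = \<theta> (b (a (m, x), \<phi> x)) x'"
        using x' mx U(3) V(3) a_eq b_eq aS \<phi>Y \<psi>\<phi> by simp
      finally show ?thesis by simp
    qed
    ultimately show ?thesis
      using X.essentially_freeD[OF freeX bP[OF aS[OF mx] \<phi>Y[OF mx(2)]] mx(1)] U V mx by blast
  qed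
  have ab: "a (b (s, y), \<psi> y) = s" if sy: "s \<in> S" "y \<in> topspace Y" for s y
  proof -
    obtain U where U: "openin Y U" "y \<in> U" "\<And>y'. y' \<in> U \<Longrightarrow> b (s, y') = b (s, y)"
      using Y.label_locally_constant[OF b sy] by blast
    obtain V where V: "openin X V" "\<psi> y \<in> V" "\<And>x'. x' \<in> V \<Longrightarrow> a (b (s, y), x') = a (b (s, y), \<psi> y)"
      using X.label_locally_constant[OF a bP[OF sy] \<psi>X[OF sy(2)]] by blast
    have "openin Y (U \<inter> {y' \<in> topspace Y. \<psi> y' \<in> V})"
      using U V \<psi> by (intro openin_Int openin_continuous_map_preimage)
    moreover have "\<rho> (a (b (s, y), \<psi> y)) y' = \<rho> s y'" if "y' \<in> U \<inter> {y' \<in> topspace Y. \<psi> y' \<in> V}" for y'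
    proof -
      have y': "y' \<in> topspace Y" "\<psi> y' \<in> V" "y' \<in> U" using that by auto
      have "\<rho> s y' = \<phi> (\<psi> (\<rho> s y'))"
        using y' sy Y.act_closed \<phi>\<psi> by simp
      also have "\<dots> = \<rho> (a (b (s, y), \<psi> y)) y'"
        using y' sy U(3) V(3) a_eq b_eq bP \<psi>X \<phi>\<psi> by simp
      finally show ?thesis by simp
    qed
    ultimately show ?thesis
      using Y.essentially_freeD[OF freeY aS[OF bP[OF sy] \<psi>X[OF sy(2)]] sy(1)] U V sy by blast
  qed
  \<comment> \<open>The label of the map applied first stands on the left, as it must for a right
    action. The three sets \<open>U\<close>, \<open>V\<close>, \<open>W\<close> freeze the three
    labels.\<close>
  have cocycle: "a (n \<otimes>\<^bsub>G\<^esub> m, y) = a (n, y) \<otimes>\<^bsub>H\<^esub> a (m, \<theta> n y)"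
    if mn: "m \<in> P" "n \<in> P" and y: "y \<in> topspace X" for m n y
  proof -
    have nm: "n \<otimes>\<^bsub>G\<^esub> m \<in> P" and ny: "\<theta> n y \<in> topspace X"
      using mn y by (simp_all add: X.act_closed)
    obtain U where U: "openin X U" "y \<in> U" "\<And>x'. x' \<in> U \<Longrightarrow> a (n \<otimes>\<^bsub>G\<^esub> m, x') = a (n \<otimes>\<^bsub>G\<^esub> m, y)"
      using X.label_locally_constant[OF a nm y] by blast
    obtain V where V: "openin X V" "y \<in> V" "\<And>x'. x' \<in> V \<Longrightarrow> a (n, x') = a (n, y)"
      using X.label_locally_constant[OF a mn(2) y] by blast
    obtain W where W: "openin X W" "\<theta> n y \<in> W" "\<And>x'. x' \<in> W \<Longrightarrow> a (m, x') = a (m, \<theta> n y)"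
      using X.label_locally_constant[OF a mn(1) ny] by blast
    define D where "D = U \<inter> V \<inter> {x \<in> topspace X. \<theta> n x \<in> W}"
    have D: "openin X D" "y \<in> D"
      unfolding D_def using U V W mn y by (auto intro!: openin_Int X.open_act_preimage)
    then have D': "openin Y (\<phi> ` D)" "\<phi> ` D \<noteq> {}"
      using homeomorphic_imp_open_map[OF homeomorphic_maps_imp_map[OF hm]] by (auto simp: open_map_def)
    show ?thesis
    proof (rule Y.essentially_freeD[OF freeY _ _ D'])
      fix u assume "u \<in> \<phi> ` D"
      then obtain x where x: "x \<in> U" "x \<in> V" "x \<in> topspace X" "\<theta> n x \<in> W" "u = \<phi> x"
        unfolding D_def by blast
      have "\<rho> (a (n \<otimes>\<^bsub>G\<^esub> m, y)) u = \<phi> (\<theta> (n \<otimes>\<^bsub>G\<^esub> m) x)"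
        using x a_eq[OF nm] U(3) by simp
      also have "\<dots> = \<phi> (\<theta> m (\<theta> n x))"
        using x mn by (simp add: X.action_mult)
      also have "\<dots> = \<rho> (a (m, \<theta> n y)) (\<rho> (a (n, y)) u)"
        using x mn a_eq W(3) V(3) by (simp add: X.act_closed)
      also have "\<dots> = \<rho> (a (n, y) \<otimes>\<^bsub>H\<^esub> a (m, \<theta> n y)) u"
        using x mn y ny aS \<phi>Y by (simp add: Y.action_mult)
      finally show "\<rho> (a (n \<otimes>\<^bsub>G\<^esub> m, y)) u = \<rho> (a (n, y) \<otimes>\<^bsub>H\<^esub> a (m, \<theta> n y)) u" .
    qed (use mn y ny nm aS in auto)
  qed
  define \<Lambda> where "\<Lambda> = (\<lambda>z. (a z, \<phi> (snd z)))"
  define \<Lambda>' where "\<Lambda>' = (\<lambda>z. (b z, \<psi> (snd z)))"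
  have "continuous_map ?PX ?SY \<Lambda>" "continuous_map ?SY ?PX \<Lambda>'"
    unfolding \<Lambda>_def \<Lambda>'_def
    using a b continuous_map_compose[OF continuous_map_snd \<phi>] continuous_map_compose[OF continuous_map_snd \<psi>]
    by (auto intro!: continuous_map_pairedI simp: comp_def)
  then have "homeomorphic_maps ?PX ?SY \<Lambda> \<Lambda>'"
    using ba ab \<phi>\<psi> \<psi>\<phi> unfolding homeomorphic_maps_def \<Lambda>_def \<Lambda>'_def by auto
  then have "homeomorphic_map ?PX ?SY \<Lambda>"
    by (rule homeomorphic_maps_imp_map)
  \<comment> \<open>Equivariance gives one implication and injectivity of \<phi> the other, so
    composability is both preserved and reflected.\<close>
  moreover have "x = \<theta> n y \<longleftrightarrow> \<phi> x = \<rho> (a (n, y)) (\<phi> y)"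
    if "n \<in> P" "x \<in> topspace X" "y \<in> topspace X" for n x y
    using that a_eq[of n y] \<psi>\<phi> X.act_closed by metis
  ultimately show ?thesis
    unfolding semigroupoids_isomorphic_def semigroupoid_iso_def action_semigroupoid_def
    using cocycle by (intro exI[of _ \<Lambda>]) (auto simp: \<Lambda>_def)
qed

text \<open>The homeomorphism is the restriction of \<Lambda> to the units \<open>(e, x)\<close>,
  and the labels are the first components of \<Lambda> and its inverse. Everything is read off from
  which pairs are composable.\<close>

lemma semigroupoids_isomorphic_imp_one_sided_coe:
  assumes "semigroupoids_isomorphic (action_semigroupoid G X P \<theta>) (action_semigroupoid H Y S \<rho>)"
  shows "one_sided_coe X P \<theta> Y S \<rho>"
proof -
  let ?PX = "prod_topology (discrete_topology P) X" and ?SY = "prod_topology (discrete_topology S) Y"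
  obtain \<Lambda> where hom: "homeomorphic_map ?PX ?SY \<Lambda>"
    and comp_mult: "\<forall>\<alpha>\<in>topspace ?PX. \<forall>\<beta>\<in>topspace ?PX.
       ((case \<alpha> of (m, x) \<Rightarrow> \<lambda>(n, y). x = \<theta> n y) \<beta> \<longleftrightarrow>
          (case \<Lambda> \<alpha> of (m, x) \<Rightarrow> \<lambda>(n, y). x = \<rho> n y) (\<Lambda> \<beta>)) \<and>
       ((case \<alpha> of (m, x) \<Rightarrow> \<lambda>(n, y). x = \<theta> n y) \<beta> \<longrightarrow>
          \<Lambda> ((case \<alpha> of (m, x) \<Rightarrow> \<lambda>(n, y). (n \<otimes>\<^bsub>G\<^esub> m, y)) \<beta>) =
          (case \<Lambda> \<alpha> of (m, x) \<Rightarrow> \<lambda>(n, y). (n \<otimes>\<^bsub>H\<^esub> m, y)) (\<Lambda> \<beta>))"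
    using assms unfolding semigroupoids_isomorphic_def semigroupoid_iso_def action_semigroupoid_def by auto
  obtain \<Lambda>' where maps: "homeomorphic_maps ?PX ?SY \<Lambda> \<Lambda>'"
    using hom unfolding homeomorphic_map_maps by blast
  have cont: "continuous_map ?PX ?SY \<Lambda>" "continuous_map ?SY ?PX \<Lambda>'"
    and inv: "\<And>z. z \<in> topspace ?PX \<Longrightarrow> \<Lambda>' (\<Lambda> z) = z" "\<And>z. z \<in> topspace ?SY \<Longrightarrow> \<Lambda> (\<Lambda>' z) = z"
    using maps unfolding homeomorphic_maps_def by auto
  have \<Lambda>_in: "fst (\<Lambda> (m, x)) \<in> S \<and> snd (\<Lambda> (m, x)) \<in> topspace Y" if "m \<in> P" "x \<in> topspace X" for m x
    using cont(1) that unfolding continuous_map_def by (auto simp: mem_Times_iff Pi_iff)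
  have \<Lambda>'_in: "fst (\<Lambda>' (s, y)) \<in> P \<and> snd (\<Lambda>' (s, y)) \<in> topspace X" if "s \<in> S" "y \<in> topspace Y" for s y
    using cont(2) that unfolding continuous_map_def by (auto simp: mem_Times_iff Pi_iff)
  have comp: "x = \<theta> n y \<longleftrightarrow> snd (\<Lambda> (m, x)) = \<rho> (fst (\<Lambda> (n, y))) (snd (\<Lambda> (n, y)))"
    and mult: "x = \<theta> n y \<Longrightarrow>
      \<Lambda> (n \<otimes>\<^bsub>G\<^esub> m, y) = (fst (\<Lambda> (n, y)) \<otimes>\<^bsub>H\<^esub> fst (\<Lambda> (m, x)), snd (\<Lambda> (n, y)))"
    if "m \<in> P" "n \<in> P" "x \<in> topspace X" "y \<in> topspace X" for m n x y
    using comp_mult[rule_format, of "(m, x)" "(n, y)"] that by (auto simp: case_prod_unfold)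
  define \<phi> where "\<phi> = (\<lambda>x. snd (\<Lambda> (\<one>\<^bsub>G\<^esub>, x)))"
  define \<psi> where "\<psi> = (\<lambda>y. snd (\<Lambda>' (\<one>\<^bsub>H\<^esub>, y)))"
  \<comment> \<open>A unit is idempotent, and the identity is the only idempotent of a
    group.\<close>
  have unit: "\<Lambda> (\<one>\<^bsub>G\<^esub>, x) = (\<one>\<^bsub>H\<^esub>, \<phi> x)" if x: "x \<in> topspace X" for x
  proof -
    have "\<Lambda> (\<one>\<^bsub>G\<^esub> \<otimes>\<^bsub>G\<^esub> \<one>\<^bsub>G\<^esub>, x) =
        (fst (\<Lambda> (\<one>\<^bsub>G\<^esub>, x)) \<otimes>\<^bsub>H\<^esub> fst (\<Lambda> (\<one>\<^bsub>G\<^esub>, x)), snd (\<Lambda> (\<one>\<^bsub>G\<^esub>, x)))"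
      using x by (intro mult) (simp_all add: X.action_one)
    then have "fst (\<Lambda> (\<one>\<^bsub>G\<^esub>, x)) = fst (\<Lambda> (\<one>\<^bsub>G\<^esub>, x)) \<otimes>\<^bsub>H\<^esub> fst (\<Lambda> (\<one>\<^bsub>G\<^esub>, x))"
      by (metis X.l_one X.one_closed fst_conv)
    then have "fst (\<Lambda> (\<one>\<^bsub>G\<^esub>, x)) = \<one>\<^bsub>H\<^esub>"
      using \<Lambda>_in[of "\<one>\<^bsub>G\<^esub>" x] x by (metis Y.P_carrier X.P_one Y.l_cancel_one')
    then show ?thesis by (simp add: \<phi>_def prod_eq_iff)
  qed
  \<comment> \<open>\<open>(m, x)\<close> is composable with the unit at \<open>x\<close>, which
    pins down the second component of its image. The next fact uses in the same way that the unit at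
    \<open>\<theta> m x\<close> is composable with \<open>(m, x)\<close>.\<close>
  have snd_\<Lambda>: "snd (\<Lambda> (m, x)) = \<phi> x" if "m \<in> P" "x \<in> topspace X" for m x
    using comp[of m "\<one>\<^bsub>G\<^esub>" x x] that \<Lambda>_in[of "\<one>\<^bsub>G\<^esub>" x] unit[of x]
    by (simp add: X.action_one Y.action_one)
  have \<phi>_act: "\<phi> (\<theta> m x) = \<rho> (fst (\<Lambda> (m, x))) (\<phi> x)" if "m \<in> P" "x \<in> topspace X" for m x
    using comp[of "\<one>\<^bsub>G\<^esub>" m "\<theta> m x" x] that snd_\<Lambda>[OF that] by (simp add: X.act_closed \<phi>_def)
  have \<phi>Y: "\<phi> x \<in> topspace Y" if "x \<in> topspace X" for x
    using \<Lambda>_in[of "\<one>\<^bsub>G\<^esub>" x] that by (simp add: \<phi>_def)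
  have snd_\<Lambda>': "\<phi> (snd (\<Lambda>' (s, y))) = y" if "s \<in> S" "y \<in> topspace Y" for s y
    using snd_\<Lambda>[of "fst (\<Lambda>' (s, y))" "snd (\<Lambda>' (s, y))"] inv(2)[of "(s, y)"] \<Lambda>'_in[OF that] that by simp
  have \<psi>X: "\<psi> y \<in> topspace X" if "y \<in> topspace Y" for y
    using \<Lambda>'_in[of "\<one>\<^bsub>H\<^esub>" y] that by (simp add: \<psi>_def)
  have \<phi>\<psi>: "\<phi> (\<psi> y) = y" if "y \<in> topspace Y" for y
    using snd_\<Lambda>'[of "\<one>\<^bsub>H\<^esub>" y] that by (simp add: \<psi>_def)
  have \<psi>\<phi>: "\<psi> (\<phi> x) = x" if "x \<in> topspace X" for x
    using inv(1)[of "(\<one>\<^bsub>G\<^esub>, x)"] unit[OF that] that by (simp add: \<psi>_def)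
  have snd_\<Lambda>'_eq: "snd (\<Lambda>' (s, y)) = \<psi> y" if "s \<in> S" "y \<in> topspace Y" for s y
    using snd_\<Lambda>'[OF that] \<psi>\<phi> \<Lambda>'_in[OF that] by metis
  have \<psi>_act: "\<psi> (\<rho> s y) = \<theta> (fst (\<Lambda>' (s, y))) (\<psi> y)" if sy: "s \<in> S" "y \<in> topspace Y" for s y
  proof -
    have "\<Lambda> (fst (\<Lambda>' (s, y)), \<psi> y) = (s, y)"
      using inv(2)[of "(s, y)"] snd_\<Lambda>'_eq[OF sy] sy by (metis SigmaI prod.collapse topspace_discrete_topology topspace_prod_topology)
    then have "\<phi> (\<theta> (fst (\<Lambda>' (s, y))) (\<psi> y)) = \<rho> s y"
      using \<phi>_act[of "fst (\<Lambda>' (s, y))" "\<psi> y"] \<Lambda>'_in[OF sy] \<psi>X \<phi>\<psi> sy by simp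
    then show ?thesis
      using \<psi>\<phi> \<Lambda>'_in[OF sy] \<psi>X sy X.act_closed by metis
  qed
  have "continuous_map X Y \<phi>"
  proof -
    have "continuous_map X ?PX (\<lambda>x. (\<one>\<^bsub>G\<^esub>, x))"
      by (intro continuous_map_pairedI) auto
    from continuous_map_compose[OF continuous_map_compose[OF this cont(1)] continuous_map_snd]
    show ?thesis by (simp add: \<phi>_def comp_def)
  qed
  moreover have "continuous_map Y X \<psi>"
  proof -
    have "continuous_map Y ?SY (\<lambda>y. (\<one>\<^bsub>H\<^esub>, y))"
      by (intro continuous_map_pairedI) auto
    from continuous_map_compose[OF continuous_map_compose[OF this cont(2)] continuous_map_snd]
    show ?thesis by (simp add: \<psi>_def comp_def)
  qed
  ultimately have "homeomorphic_maps X Y \<phi> \<psi>"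
    using \<phi>\<psi> \<psi>\<phi> by (auto simp: homeomorphic_maps_def)
  moreover have "continuous_map ?PX (discrete_topology S) (fst \<circ> \<Lambda>)"
    "continuous_map ?SY (discrete_topology P) (fst \<circ> \<Lambda>')"
    by (rule continuous_map_compose[OF cont(1) continuous_map_fst], rule continuous_map_compose[OF cont(2) continuous_map_fst])
  ultimately show ?thesis
    unfolding one_sided_coe_def using \<phi>_act \<psi>_act
    by (intro exI[of _ \<phi>] exI[of _ \<psi>] exI[of _ "fst \<circ> \<Lambda>"] exI[of _ "fst \<circ> \<Lambda>'"]) simp
qed

end

section \<open>Groupoid isomorphisms and germs\<close>

text \<open>One direction of the correspondence: freeness of the target makes labels unique. The
  inverse map is the same locale with the two actions exchanged.\<close>

locale germ_map = semigroup_action_pair G X P \<theta> H Y S \<rho>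
  for G :: "'g monoid" and X :: "'x topology" and P :: "'g set" and \<theta> :: "'g \<Rightarrow> 'x \<Rightarrow> 'x"
    and H :: "'h monoid" and Y :: "'y topology" and S :: "'h set" and \<rho> :: "'h \<Rightarrow> 'y \<Rightarrow> 'y" +
  fixes \<phi> :: "'x \<Rightarrow> 'y" and \<psi> :: "'y \<Rightarrow> 'x"
  assumes homeo: "homeomorphic_maps X Y \<phi> \<psi>"
    and germs: "preserves_orbit_germs X P \<theta> S \<rho> \<phi>"
    and freeY: "essentially_free Y S \<rho>"
begin

text \<open>A relation before it is a function: it records that some fraction of \<open>g\<close>
  near \<open>(x, y)\<close> is carried into some fraction of \<open>h\<close>. Existence,
  uniqueness, products and inverses can then be treated without fixing representatives.\<close>

definition germ_label :: "'x \<Rightarrow> 'g \<Rightarrow> 'x \<Rightarrow> 'h \<Rightarrow> bool" where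
  "germ_label x g y h \<longleftrightarrow> x \<in> topspace X \<and> y \<in> topspace X \<and>
     (\<exists>m\<in>P. \<exists>n\<in>P. \<exists>s\<in>S. \<exists>t\<in>S. \<exists>A B. g = m \<otimes>\<^bsub>G\<^esub> inv\<^bsub>G\<^esub> n \<and> h = s \<otimes>\<^bsub>H\<^esub> inv\<^bsub>H\<^esub> t \<and> \<theta> m x = \<theta> n y \<and>
       openin X A \<and> openin X B \<and> x \<in> A \<and> y \<in> B \<and>
       (\<forall>x'\<in>A. \<forall>y'\<in>B. \<theta> m x' = \<theta> n y' \<longrightarrow> \<rho> s (\<phi> x') = \<rho> t (\<phi> y')))"

lemma germ_labelI:
  assumes "x \<in> topspace X" "y \<in> topspace X" "m \<in> P" "n \<in> P" "s \<in> S" "t \<in> S"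
    "g = m \<otimes>\<^bsub>G\<^esub> inv\<^bsub>G\<^esub> n" "h = s \<otimes>\<^bsub>H\<^esub> inv\<^bsub>H\<^esub> t" "\<theta> m x = \<theta> n y"
    "openin X A" "openin X B" "x \<in> A" "y \<in> B"
    "\<And>x' y'. x' \<in> A \<Longrightarrow> y' \<in> B \<Longrightarrow> \<theta> m x' = \<theta> n y' \<Longrightarrow> \<rho> s (\<phi> x') = \<rho> t (\<phi> y')"
  shows "germ_label x g y h"
  unfolding germ_label_def
  by (intro conjI assms(1,2), rule bexI[OF _ assms(3)], rule bexI[OF _ assms(4)], rule bexI[OF _ assms(5)],
      rule bexI[OF _ assms(6)], intro exI[of _ A] exI[of _ B] conjI ballI impI assms)

lemma germ_labelE:
  assumes "germ_label x g y h"
  obtains m n s t A B where "x \<in> topspace X" "y \<in> topspace X" "m \<in> P" "n \<in> P" "s \<in> S" "t \<in> S"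
    "g = m \<otimes>\<^bsub>G\<^esub> inv\<^bsub>G\<^esub> n" "h = s \<otimes>\<^bsub>H\<^esub> inv\<^bsub>H\<^esub> t" "\<theta> m x = \<theta> n y"
    "openin X A" "openin X B" "x \<in> A" "y \<in> B"
    "\<forall>x'\<in>A. \<forall>y'\<in>B. \<theta> m x' = \<theta> n y' \<longrightarrow> \<rho> s (\<phi> x') = \<rho> t (\<phi> y')"
  using assms unfolding germ_label_def by (elim conjE bexE exE) (rule that)

lemma continuous_\<phi>: "continuous_map X Y \<phi>"
  using homeo unfolding homeomorphic_maps_def by blast

lemma \<phi>_closed: "x \<in> topspace X \<Longrightarrow> \<phi> x \<in> topspace Y"
  using continuous_\<phi> by (auto simp: continuous_map_def)

lemma \<psi>_\<phi>: "x \<in> topspace X \<Longrightarrow> \<psi> (\<phi> x) = x"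
  using homeo unfolding homeomorphic_maps_def by blast

lemma open_\<phi>: "openin X U \<Longrightarrow> openin Y (\<phi> ` U)"
  using homeomorphic_imp_open_map[OF homeomorphic_maps_imp_map[OF homeo]] by (auto simp: open_map_def)

lemma germ_label_exists:
  assumes "(x, g, y) \<in> X.\<Gamma>"
  obtains h where "germ_label x g y h"
proof -
  obtain m n where *: "m \<in> P" "n \<in> P" "g = m \<otimes>\<^bsub>G\<^esub> inv\<^bsub>G\<^esub> n" "\<theta> m x = \<theta> n y"
    "x \<in> topspace X" "y \<in> topspace X"
    using assms by (rule X.in_\<Gamma>E)
  obtain s t A B where "s \<in> S" "t \<in> S" "openin X A" "openin X B" "x \<in> A" "y \<in> B"
    "\<And>x' y'. x' \<in> A \<Longrightarrow> y' \<in> B \<Longrightarrow> \<theta> m x' = \<theta> n y' \<Longrightarrow> \<rho> s (\<phi> x') = \<rho> t (\<phi> y')"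
    using preserves_orbit_germsE[OF germs *(1,2,5,6,4)] by metis
  with * show thesis
    by (intro that[of "s \<otimes>\<^bsub>H\<^esub> inv\<^bsub>H\<^esub> t"] germ_labelI[of x y m n s t _ _ A B]) auto
qed

lemma germ_label_in_\<Gamma>:
  assumes "germ_label x g y h"
  shows "(x, g, y) \<in> X.\<Gamma>" "(\<phi> x, h, \<phi> y) \<in> Y.\<Gamma>"
proof -
  obtain m n s t A B where *: "x \<in> topspace X" "y \<in> topspace X" "m \<in> P" "n \<in> P" "s \<in> S" "t \<in> S"
    "g = m \<otimes>\<^bsub>G\<^esub> inv\<^bsub>G\<^esub> n" "h = s \<otimes>\<^bsub>H\<^esub> inv\<^bsub>H\<^esub> t" "\<theta> m x = \<theta> n y"
    "openin X A" "openin X B" "x \<in> A" "y \<in> B"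
    "\<forall>x'\<in>A. \<forall>y'\<in>B. \<theta> m x' = \<theta> n y' \<longrightarrow> \<rho> s (\<phi> x') = \<rho> t (\<phi> y')"
    using assms by (rule germ_labelE)
  show "(x, g, y) \<in> X.\<Gamma>"
    using * X.in_\<Gamma>I by metis
  have "\<rho> s (\<phi> x) = \<rho> t (\<phi> y)"
    using * by blast
  then show "(\<phi> x, h, \<phi> y) \<in> Y.\<Gamma>"
    using * Y.in_\<Gamma>I \<phi>_closed by metis
qed

text \<open>\<open>same_germ\<close> makes the pairs related by the first fraction of
  \<open>g\<close> also related by the second, so near \<open>(x, y)\<close> both pairs of target
  labels hold for the same points. With \<open>act_lift\<close> supplying a partner
  \<open>y'\<close> for each \<open>x'\<close>, the point \<open>\<phi> y'\<close> serves as the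
  common partner in \<open>germ_determines_quotient\<close>.\<close>

lemma germ_label_unique:
  assumes "germ_label x g y h" "germ_label x g y h'"
  shows "h = h'"
proof -
  obtain m n s t A B where 1: "x \<in> topspace X" "y \<in> topspace X" "m \<in> P" "n \<in> P" "s \<in> S" "t \<in> S"
    "g = m \<otimes>\<^bsub>G\<^esub> inv\<^bsub>G\<^esub> n" "h = s \<otimes>\<^bsub>H\<^esub> inv\<^bsub>H\<^esub> t" "\<theta> m x = \<theta> n y"
    "openin X A" "openin X B" "x \<in> A" "y \<in> B"
    "\<forall>x'\<in>A. \<forall>y'\<in>B. \<theta> m x' = \<theta> n y' \<longrightarrow> \<rho> s (\<phi> x') = \<rho> t (\<phi> y')"
    using assms(1) by (rule germ_labelE)
  obtain m' n' s' t' A' B' where 2: "x \<in> topspace X" "y \<in> topspace X" "m' \<in> P" "n' \<in> P" "s' \<in> S" "t' \<in> S"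
    "g = m' \<otimes>\<^bsub>G\<^esub> inv\<^bsub>G\<^esub> n'" "h' = s' \<otimes>\<^bsub>H\<^esub> inv\<^bsub>H\<^esub> t'" "\<theta> m' x = \<theta> n' y"
    "openin X A'" "openin X B'" "x \<in> A'" "y \<in> B'"
    "\<forall>x'\<in>A'. \<forall>y'\<in>B'. \<theta> m' x' = \<theta> n' y' \<longrightarrow> \<rho> s' (\<phi> x') = \<rho> t' (\<phi> y')"
    using assms(2) by (rule germ_labelE)
  have "m \<otimes>\<^bsub>G\<^esub> inv\<^bsub>G\<^esub> n = m' \<otimes>\<^bsub>G\<^esub> inv\<^bsub>G\<^esub> n'" using 1(7) 2(7) by simp
  then obtain A0 B0 where 0: "openin X A0" "openin X B0" "x \<in> A0" "y \<in> B0"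
    "\<And>x' y'. x' \<in> A0 \<Longrightarrow> y' \<in> B0 \<Longrightarrow> \<theta> m x' = \<theta> n y' \<Longrightarrow> \<theta> m' x' = \<theta> n' y'"
    using X.same_germ[OF 1(3,4) 2(3,4) _ 1(1,2) 2(9)] by metis
  have "openin X (B \<inter> B' \<inter> B0)" "y \<in> B \<inter> B' \<inter> B0"
    using 0 1 2 by auto
  then obtain A1 where A1: "openin X A1" "x \<in> A1" "\<And>x'. x' \<in> A1 \<Longrightarrow> \<exists>y'\<in>B \<inter> B' \<inter> B0. \<theta> m x' = \<theta> n y'"
    using X.act_lift[OF 1(3,4,1,9)] by metis
  define U where "U = A \<inter> A' \<inter> A0 \<inter> A1"
  have "openin Y (\<phi> ` U)" "\<phi> ` U \<noteq> {}"
    unfolding U_def using 0 1 2 A1 by (auto intro!: open_\<phi> openin_Int)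
  moreover have "\<exists>v\<in>topspace Y. \<rho> s u = \<rho> t v \<and> \<rho> s' u = \<rho> t' v" if u: "u \<in> \<phi> ` U" for u
  proof -
    obtain x' where x': "x' \<in> A" "x' \<in> A'" "x' \<in> A0" "x' \<in> A1" "u = \<phi> x'"
      using u unfolding U_def by blast
    then obtain y' where y': "y' \<in> B" "y' \<in> B'" "y' \<in> B0" "\<theta> m x' = \<theta> n y'"
      using A1(3) by blast
    have "\<phi> y' \<in> topspace Y"
      using y'(1) 1(11) openin_subset \<phi>_closed by blast
    moreover have "\<rho> s u = \<rho> t (\<phi> y')"
      unfolding x'(5) using 1(14) x'(1) y'(1,4) by blast
    moreover have "\<rho> s' u = \<rho> t' (\<phi> y')"
      unfolding x'(5) using 2(14) x'(2) y'(2) 0(5)[OF x'(3) y'(3,4)] by blast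
    ultimately show ?thesis by blast
  qed
  ultimately show ?thesis
    using Y.germ_determines_quotient[OF freeY 1(5,6) 2(5,6)] 1(8) 2(8) by simp
qed

text \<open>The product relation mentions only the outer points \<open>x'\<close> and
  \<open>z'\<close>, so a middle point has to be recovered. It is found by lifting \<open>x'\<close>
  to some \<open>y'\<close> near \<open>y\<close>; the relation then gives
  \<open>\<theta> q (\<theta> m' y') = \<theta> q (\<theta> n' z')\<close>, and \<open>q\<close>
  cancels because both arguments were forced into \<open>W\<close>. The two given germs can now be
  applied one after the other.\<close>

lemma germ_label_mult:
  assumes "germ_label x g y h" "germ_label y k z l"
  shows "germ_label x (g \<otimes>\<^bsub>G\<^esub> k) z (h \<otimes>\<^bsub>H\<^esub> l)"
proof -
  obtain m n s t A B where 1: "x \<in> topspace X" "y \<in> topspace X" "m \<in> P" "n \<in> P" "s \<in> S" "t \<in> S"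
    "g = m \<otimes>\<^bsub>G\<^esub> inv\<^bsub>G\<^esub> n" "h = s \<otimes>\<^bsub>H\<^esub> inv\<^bsub>H\<^esub> t" "\<theta> m x = \<theta> n y"
    "openin X A" "openin X B" "x \<in> A" "y \<in> B"
    "\<forall>x'\<in>A. \<forall>y'\<in>B. \<theta> m x' = \<theta> n y' \<longrightarrow> \<rho> s (\<phi> x') = \<rho> t (\<phi> y')"
    using assms(1) by (rule germ_labelE)
  obtain m' n' s' t' A' B' where 2: "y \<in> topspace X" "z \<in> topspace X" "m' \<in> P" "n' \<in> P" "s' \<in> S" "t' \<in> S"
    "k = m' \<otimes>\<^bsub>G\<^esub> inv\<^bsub>G\<^esub> n'" "l = s' \<otimes>\<^bsub>H\<^esub> inv\<^bsub>H\<^esub> t'" "\<theta> m' y = \<theta> n' z"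
    "openin X A'" "openin X B'" "y \<in> A'" "z \<in> B'"
    "\<forall>x'\<in>A'. \<forall>y'\<in>B'. \<theta> m' x' = \<theta> n' y' \<longrightarrow> \<rho> s' (\<phi> x') = \<rho> t' (\<phi> y')"
    using assms(2) by (rule germ_labelE)
  obtain p q where pq: "p \<in> P" "q \<in> P" "n \<otimes>\<^bsub>G\<^esub> p = m' \<otimes>\<^bsub>G\<^esub> q"
    using X.common_multiple 1(4) 2(3) by metis
  obtain p' q' where pq': "p' \<in> S" "q' \<in> S" "t \<otimes>\<^bsub>H\<^esub> p' = s' \<otimes>\<^bsub>H\<^esub> q'"
    using Y.common_multiple 1(6) 2(5) by metis
  obtain W where W: "openin X W" "\<theta> m' y \<in> W" "inj_on (\<theta> q) W"
    using local_homeomorphism_imp_locally_injective[OF X.local_homeo[OF pq(2)], of "\<theta> m' y"]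
      X.act_closed[OF 2(3,1)] by blast
  have nbhd: "openin X (B \<inter> A' \<inter> {y' \<in> topspace X. \<theta> m' y' \<in> W})"
    "y \<in> B \<inter> A' \<inter> {y' \<in> topspace X. \<theta> m' y' \<in> W}"
    using 1 2 W X.open_act_preimage[OF 2(3) W(1)] by auto
  obtain A1 where A1: "openin X A1" "x \<in> A1"
    "\<And>x'. x' \<in> A1 \<Longrightarrow> \<exists>y'\<in>B \<inter> A' \<inter> {y' \<in> topspace X. \<theta> m' y' \<in> W}. \<theta> m x' = \<theta> n y'"
    using X.act_lift[OF 1(3,4,1,9) nbhd] by blast
  define B1 where "B1 = B' \<inter> {z' \<in> topspace X. \<theta> n' z' \<in> W}"
  have B1: "openin X B1" "z \<in> B1"
    unfolding B1_def using 2 W X.open_act_preimage[OF 2(4) W(1)] by auto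
  have split: "\<theta> (m \<otimes>\<^bsub>G\<^esub> p) x' = \<theta> q (\<theta> m' y')"
    if "x' \<in> topspace X" "y' \<in> topspace X" "\<theta> m x' = \<theta> n y'" for x' y'
  proof -
    have "\<theta> (m \<otimes>\<^bsub>G\<^esub> p) x' = \<theta> p (\<theta> m x')"
      using that(1) 1(3) pq(1) by (simp add: X.action_mult)
    also have "\<dots> = \<theta> p (\<theta> n y')"
      by (simp add: that(3))
    also have "\<dots> = \<theta> q (\<theta> m' y')"
      using that(2) 1(4) 2(3) pq by (simp add: X.action_mult)
    finally show ?thesis .
  qed
  have split': "\<rho> (s \<otimes>\<^bsub>H\<^esub> p') u = \<rho> (t' \<otimes>\<^bsub>H\<^esub> q') w"
    if "u \<in> topspace Y" "v \<in> topspace Y" "w \<in> topspace Y" "\<rho> s u = \<rho> t v" "\<rho> s' v = \<rho> t' w" for u v w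
  proof -
    have "\<rho> (s \<otimes>\<^bsub>H\<^esub> p') u = \<rho> p' (\<rho> s u)"
      using that(1) 1(5) pq'(1) by (simp add: Y.action_mult)
    also have "\<dots> = \<rho> p' (\<rho> t v)"
      by (simp add: that(4))
    also have "\<dots> = \<rho> q' (\<rho> s' v)"
      using that(2) 1(6) 2(5) pq' by (simp add: Y.action_mult)
    also have "\<dots> = \<rho> q' (\<rho> t' w)"
      by (simp add: that(5))
    also have "\<dots> = \<rho> (t' \<otimes>\<^bsub>H\<^esub> q') w"
      using that(3) 2(6) pq'(2) by (simp add: Y.action_mult)
    finally show ?thesis .
  qed
  have n'q: "\<theta> (n' \<otimes>\<^bsub>G\<^esub> q) z' = \<theta> q (\<theta> n' z')" if "z' \<in> topspace X" for z'
    using that 2(4) pq(2) by (simp add: X.action_mult)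
  show ?thesis
  proof (rule germ_labelI[of x z "m \<otimes>\<^bsub>G\<^esub> p" "n' \<otimes>\<^bsub>G\<^esub> q" "s \<otimes>\<^bsub>H\<^esub> p'" "t' \<otimes>\<^bsub>H\<^esub> q'" _ _ "A \<inter> A1" B1])
    show "g \<otimes>\<^bsub>G\<^esub> k = m \<otimes>\<^bsub>G\<^esub> p \<otimes>\<^bsub>G\<^esub> inv\<^bsub>G\<^esub> (n' \<otimes>\<^bsub>G\<^esub> q)"
      using X.product_quotient[of m n m' n' p q] 1 2 pq by simp
    show "h \<otimes>\<^bsub>H\<^esub> l = s \<otimes>\<^bsub>H\<^esub> p' \<otimes>\<^bsub>H\<^esub> inv\<^bsub>H\<^esub> (t' \<otimes>\<^bsub>H\<^esub> q')"
      using Y.product_quotient[of s t s' t' p' q'] 1 2 pq' by simp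
    show "\<theta> (m \<otimes>\<^bsub>G\<^esub> p) x = \<theta> (n' \<otimes>\<^bsub>G\<^esub> q) z"
      using split[OF 1(1,2,9)] n'q[OF 2(2)] 2(9) by simp
    fix x' z' assume x': "x' \<in> A \<inter> A1" and z': "z' \<in> B1" and eq: "\<theta> (m \<otimes>\<^bsub>G\<^esub> p) x' = \<theta> (n' \<otimes>\<^bsub>G\<^esub> q) z'"
    obtain y' where y': "y' \<in> B" "y' \<in> A'" "y' \<in> topspace X" "\<theta> m' y' \<in> W" "\<theta> m x' = \<theta> n y'"
      using A1(3)[of x'] x' by blast
    have xX: "x' \<in> topspace X" using x' 1(10) openin_subset by blast
    have zX: "z' \<in> topspace X" "\<theta> n' z' \<in> W" "z' \<in> B'" using z' by (auto simp: B1_def)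
    have "\<theta> q (\<theta> m' y') = \<theta> q (\<theta> n' z')"
      using split[OF xX y'(3,5)] n'q[OF zX(1)] eq by simp
    then have "\<theta> m' y' = \<theta> n' z'"
      using W(3) y'(4) zX(2) by (simp add: inj_on_eq_iff)
    then have "\<rho> s' (\<phi> y') = \<rho> t' (\<phi> z')" using 2(14) y' zX by blast
    moreover have "\<rho> s (\<phi> x') = \<rho> t (\<phi> y')" using 1(14) x' y' by blast
    ultimately show "\<rho> (s \<otimes>\<^bsub>H\<^esub> p') (\<phi> x') = \<rho> (t' \<otimes>\<^bsub>H\<^esub> q') (\<phi> z')"
      using split'[of "\<phi> x'" "\<phi> y'" "\<phi> z'"] \<phi>_closed xX y'(3) zX(1) by blast
  qed (use 1 2 pq pq' A1 B1 in auto)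
qed

lemma germ_label_inverse:
  assumes "germ_label x g y h"
  shows "germ_label y (inv\<^bsub>G\<^esub> g) x (inv\<^bsub>H\<^esub> h)"
proof -
  obtain m n s t A B where 1: "x \<in> topspace X" "y \<in> topspace X" "m \<in> P" "n \<in> P" "s \<in> S" "t \<in> S"
    "g = m \<otimes>\<^bsub>G\<^esub> inv\<^bsub>G\<^esub> n" "h = s \<otimes>\<^bsub>H\<^esub> inv\<^bsub>H\<^esub> t" "\<theta> m x = \<theta> n y"
    "openin X A" "openin X B" "x \<in> A" "y \<in> B"
    "\<forall>x'\<in>A. \<forall>y'\<in>B. \<theta> m x' = \<theta> n y' \<longrightarrow> \<rho> s (\<phi> x') = \<rho> t (\<phi> y')"
    using assms(1) by (rule germ_labelE)
  have "inv\<^bsub>G\<^esub> g = n \<otimes>\<^bsub>G\<^esub> inv\<^bsub>G\<^esub> m" "inv\<^bsub>H\<^esub> h = t \<otimes>\<^bsub>H\<^esub> inv\<^bsub>H\<^esub> s"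
    using 1 by (simp_all add: X.inv_mult_group Y.inv_mult_group)
  moreover have "\<theta> n x' = \<theta> m y' \<Longrightarrow> \<rho> t (\<phi> x') = \<rho> s (\<phi> y')" if "x' \<in> B" "y' \<in> A" for x' y'
    using that 1(14) by metis
  ultimately show ?thesis
    using 1 by (intro germ_labelI[of y x n m t s _ _ B A]) auto
qed

definition \<Lambda> :: "'x \<times> 'g \<times> 'x \<Rightarrow> 'y \<times> 'h \<times> 'y" where
  "\<Lambda> = (\<lambda>(x, g, y). (\<phi> x, THE h. germ_label x g y h, \<phi> y))"

lemma \<Lambda>_eq: "germ_label x g y h \<Longrightarrow> \<Lambda> (x, g, y) = (\<phi> x, h, \<phi> y)"
  unfolding \<Lambda>_def using germ_label_unique by auto

text \<open>The witnesses of a germ label at \<open>(x, g, y)\<close> are also witnesses at all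
  nearby points with the same fraction. The label \<open>h\<close> is thus locally constant, and
  only the end points move, continuously through \<phi>.\<close>

lemma continuous_\<Lambda>: "continuous_map (sg_top X.gpd) (sg_top Y.gpd) \<Lambda>"
  unfolding continuous_map_def
proof (intro conjI allI impI)
  show "\<Lambda> \<in> X.\<Gamma> \<rightarrow> Y.\<Gamma>"
  proof
    fix \<gamma> assume \<gamma>: "\<gamma> \<in> X.\<Gamma>"
    obtain x g y where xgy: "\<gamma> = (x, g, y)" by (metis prod.exhaust)
    then obtain h where "germ_label x g y h"
      using germ_label_exists \<gamma> by blast
    then show "\<Lambda> \<gamma> \<in> Y.\<Gamma>"
      using \<Lambda>_eq germ_label_in_\<Gamma>(2) xgy by simp
  qed
  fix W assume W: "openin (sg_top Y.gpd) W"
  show "openin (sg_top X.gpd) {\<gamma> \<in> X.\<Gamma>. \<Lambda> \<gamma> \<in> W}"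
  proof (rule X.openin_gpdI)
    fix x g y assume *: "(x, g, y) \<in> {\<gamma> \<in> X.\<Gamma>. \<Lambda> \<gamma> \<in> W}"
    then obtain h where h: "germ_label x g y h"
      using germ_label_exists by blast
    then obtain m n s t A B where 1: "x \<in> topspace X" "y \<in> topspace X" "m \<in> P" "n \<in> P" "s \<in> S" "t \<in> S"
      "g = m \<otimes>\<^bsub>G\<^esub> inv\<^bsub>G\<^esub> n" "h = s \<otimes>\<^bsub>H\<^esub> inv\<^bsub>H\<^esub> t" "\<theta> m x = \<theta> n y"
      "openin X A" "openin X B" "x \<in> A" "y \<in> B"
      "\<forall>x'\<in>A. \<forall>y'\<in>B. \<theta> m x' = \<theta> n y' \<longrightarrow> \<rho> s (\<phi> x') = \<rho> t (\<phi> y')"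
      by (rule germ_labelE)
    have "(\<phi> x, s \<otimes>\<^bsub>H\<^esub> inv\<^bsub>H\<^esub> t, \<phi> y) \<in> W"
      using * \<Lambda>_eq[OF h] 1(8) by simp
    moreover have "\<rho> s (\<phi> x) = \<rho> t (\<phi> y)" using 1 by blast
    ultimately obtain A' B' where A'B': "openin Y A'" "openin Y B'" "\<phi> x \<in> A'" "\<phi> y \<in> B'"
      "\<And>u v. u \<in> A' \<Longrightarrow> v \<in> B' \<Longrightarrow> \<rho> s u = \<rho> t v \<Longrightarrow> (u, s \<otimes>\<^bsub>H\<^esub> inv\<^bsub>H\<^esub> t, v) \<in> W"
      using Y.openin_gpdD[OF W 1(5,6) \<phi>_closed[OF 1(1)] \<phi>_closed[OF 1(2)]] by metis
    define A1 where "A1 = A \<inter> {x' \<in> topspace X. \<phi> x' \<in> A'}"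
    define B1 where "B1 = B \<inter> {x' \<in> topspace X. \<phi> x' \<in> B'}"
    have op: "openin X A1" "openin X B1"
      unfolding A1_def B1_def using 1 A'B' continuous_\<phi> by (auto intro!: openin_Int openin_continuous_map_preimage)
    have mem: "x \<in> A1" "y \<in> B1"
      unfolding A1_def B1_def using 1 A'B' by auto
    have "(x', g, y') \<in> {\<gamma> \<in> X.\<Gamma>. \<Lambda> \<gamma> \<in> W}" if "x' \<in> A1" "y' \<in> B1" "\<theta> m x' = \<theta> n y'" for x' y'
    proof -
      have x'y': "x' \<in> A" "y' \<in> B" "x' \<in> topspace X" "y' \<in> topspace X" "\<phi> x' \<in> A'" "\<phi> y' \<in> B'"
        using that unfolding A1_def B1_def by auto
      then have l: "germ_label x' g y' h"
        using 1 that(3) by (intro germ_labelI[of x' y' m n s t _ _ A B]) auto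
      have "(\<phi> x', h, \<phi> y') \<in> W"
        using A'B'(5) x'y' 1(8,14) that(3) by metis
      then show ?thesis
        using germ_label_in_\<Gamma>(1)[OF l] \<Lambda>_eq[OF l] by simp
    qed
    then show "\<exists>m\<in>P. \<exists>n\<in>P. \<exists>A B. g = m \<otimes>\<^bsub>G\<^esub> inv\<^bsub>G\<^esub> n \<and> \<theta> m x = \<theta> n y \<and>
      openin X A \<and> openin X B \<and> x \<in> A \<and> y \<in> B \<and>
      (\<forall>x'\<in>A. \<forall>y'\<in>B. \<theta> m x' = \<theta> n y' \<longrightarrow> (x', g, y') \<in> {\<gamma> \<in> X.\<Gamma>. \<Lambda> \<gamma> \<in> W})"
      by (intro bexI[OF _ 1(3)] bexI[OF _ 1(4)] exI[of _ A1] exI[of _ B1] conjI ballI impI 1(7,9) op mem)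
  qed
qed

text \<open>Germ preservation by \<psi> turns the fraction of \<open>h\<close> back into some
  fraction \<open>m'\<close>, \<open>n'\<close>. The points near \<open>(x, y)\<close> satisfy both
  the original relation and the returned one, so freeness of the first action identifies the two
  quotients.\<close>

lemma germ_label_reverse:
  assumes "germ_map H Y S \<rho> G X P \<theta> \<psi> \<phi>" and h: "germ_label x g y h"
  shows "germ_map.germ_label H Y S \<rho> G P \<theta> \<psi> (\<phi> x) h (\<phi> y) g"
proof -
  interpret R: germ_map H Y S \<rho> G X P \<theta> \<psi> \<phi> by fact
  obtain m n s t A B where 1: "x \<in> topspace X" "y \<in> topspace X" "m \<in> P" "n \<in> P" "s \<in> S" "t \<in> S"
    "g = m \<otimes>\<^bsub>G\<^esub> inv\<^bsub>G\<^esub> n" "h = s \<otimes>\<^bsub>H\<^esub> inv\<^bsub>H\<^esub> t" "\<theta> m x = \<theta> n y"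
    "openin X A" "openin X B" "x \<in> A" "y \<in> B"
    "\<forall>x'\<in>A. \<forall>y'\<in>B. \<theta> m x' = \<theta> n y' \<longrightarrow> \<rho> s (\<phi> x') = \<rho> t (\<phi> y')"
    using h by (rule germ_labelE)
  have eq: "\<rho> s (\<phi> x) = \<rho> t (\<phi> y)" using 1 by blast
  obtain m' n' A' B' where 2: "m' \<in> P" "n' \<in> P" "openin Y A'" "openin Y B'" "\<phi> x \<in> A'" "\<phi> y \<in> B'"
    "\<And>u v. u \<in> A' \<Longrightarrow> v \<in> B' \<Longrightarrow> \<rho> s u = \<rho> t v \<Longrightarrow> \<theta> m' (\<psi> u) = \<theta> n' (\<psi> v)"
    using preserves_orbit_germsE[OF R.germs 1(5,6) \<phi>_closed[OF 1(1)] \<phi>_closed[OF 1(2)] eq] by metis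
  define A1 where "A1 = A \<inter> {x' \<in> topspace X. \<phi> x' \<in> A'}"
  define B1 where "B1 = B \<inter> {x' \<in> topspace X. \<phi> x' \<in> B'}"
  have op: "openin X A1" "openin X B1"
    unfolding A1_def B1_def using 1 2 continuous_\<phi> by (auto intro!: openin_Int openin_continuous_map_preimage)
  have mem: "x \<in> A1" "y \<in> B1"
    unfolding A1_def B1_def using 1 2 by auto
  obtain A2 where A2: "openin X A2" "x \<in> A2" "\<And>x'. x' \<in> A2 \<Longrightarrow> \<exists>y'\<in>B1. \<theta> m x' = \<theta> n y'"
    using X.act_lift[OF 1(3,4,1,9) op(2) mem(2)] by metis
  have "m \<otimes>\<^bsub>G\<^esub> inv\<^bsub>G\<^esub> n = m' \<otimes>\<^bsub>G\<^esub> inv\<^bsub>G\<^esub> n'"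
  proof (rule X.germ_determines_quotient[OF R.freeY 1(3,4) 2(1,2)])
    show "openin X (A1 \<inter> A2)" "A1 \<inter> A2 \<noteq> {}" using op mem A2 by auto
    fix x' assume x': "x' \<in> A1 \<inter> A2"
    then obtain y' where y': "y' \<in> B1" "\<theta> m x' = \<theta> n y'" using A2 by blast
    then have *: "x' \<in> A" "y' \<in> B" "x' \<in> topspace X" "y' \<in> topspace X" "\<phi> x' \<in> A'" "\<phi> y' \<in> B'"
      using x' unfolding A1_def B1_def by auto
    then have "\<rho> s (\<phi> x') = \<rho> t (\<phi> y')"
      using y'(2) 1(14) by blast
    then have "\<theta> m' x' = \<theta> n' y'"
      using 2(7)[of "\<phi> x'" "\<phi> y'"] * \<psi>_\<phi> by simp
    with *(4) y'(2) show "\<exists>v\<in>topspace X. \<theta> m x' = \<theta> n v \<and> \<theta> m' x' = \<theta> n' v"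
      by blast
  qed
  then show ?thesis
    using 1 2 eq \<phi>_closed by (intro R.germ_labelI[of _ _ s t m' n' _ _ A' B']) auto
qed

lemma groupoid_iso_\<Lambda>:
  assumes "germ_map H Y S \<rho> G X P \<theta> \<psi> \<phi>"
  shows "groupoid_iso X.gpd Y.gpd \<Lambda>"
proof -
  interpret R: germ_map H Y S \<rho> G X P \<theta> \<psi> \<phi> by fact
  have 1: "R.\<Lambda> (\<Lambda> \<gamma>) = \<gamma>" if "\<gamma> \<in> X.\<Gamma>" for \<gamma>
  proof -
    obtain x g y h where *: "\<gamma> = (x, g, y)" "germ_label x g y h"
      using germ_label_exists \<open>\<gamma> \<in> X.\<Gamma>\<close> by (metis prod.exhaust)
    then have "x \<in> topspace X" "y \<in> topspace X" unfolding germ_label_def by auto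
    then show ?thesis
      using * \<Lambda>_eq R.\<Lambda>_eq[OF germ_label_reverse[OF assms *(2)]] \<psi>_\<phi> by simp
  qed
  have 2: "\<Lambda> (R.\<Lambda> \<gamma>) = \<gamma>" if "\<gamma> \<in> Y.\<Gamma>" for \<gamma>
  proof -
    obtain u h v g where *: "\<gamma> = (u, h, v)" "R.germ_label u h v g"
      using R.germ_label_exists \<open>\<gamma> \<in> Y.\<Gamma>\<close> by (metis prod.exhaust)
    then have "u \<in> topspace Y" "v \<in> topspace Y" unfolding R.germ_label_def by auto
    moreover have "germ_label (\<psi> u) g (\<psi> v) h"
      using R.germ_label_reverse[OF germ_map_axioms *(2)] .
    ultimately show ?thesis
      using * \<Lambda>_eq R.\<Lambda>_eq[OF *(2)] R.\<psi>_\<phi> by simp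
  qed
  have "homeomorphic_maps (sg_top X.gpd) (sg_top Y.gpd) \<Lambda> R.\<Lambda>"
    unfolding homeomorphic_maps_def using 1 2 continuous_\<Lambda> R.continuous_\<Lambda> by blast
  then have hom: "homeomorphic_map (sg_top X.gpd) (sg_top Y.gpd) \<Lambda>"
    by (rule homeomorphic_maps_imp_map)
  have inj: "\<phi> x = \<phi> y \<longleftrightarrow> x = y" if "x \<in> topspace X" "y \<in> topspace X" for x y
    using that \<psi>_\<phi> by metis
  show ?thesis
    unfolding groupoid_iso_def semigroupoid_iso_def
  proof (intro conjI ballI hom)
    fix \<alpha> \<beta> assume \<alpha>: "\<alpha> \<in> X.\<Gamma>" and \<beta>: "\<beta> \<in> X.\<Gamma>"
    obtain x g y h where a: "\<alpha> = (x, g, y)" "germ_label x g y h"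
      using germ_label_exists \<alpha> by (metis prod.exhaust)
    obtain x' g' y' h' where b: "\<beta> = (x', g', y')" "germ_label x' g' y' h'"
      using germ_label_exists \<beta> by (metis prod.exhaust)
    have "y \<in> topspace X" "x' \<in> topspace X" using a b unfolding germ_label_def by auto
    then show "sg_comp X.gpd \<alpha> \<beta> \<longleftrightarrow> sg_comp Y.gpd (\<Lambda> \<alpha>) (\<Lambda> \<beta>)"
      using a b \<Lambda>_eq inj by (simp add: transformation_groupoid_def)
    show "sg_comp X.gpd \<alpha> \<beta> \<longrightarrow> \<Lambda> (sg_mult X.gpd \<alpha> \<beta>) = sg_mult Y.gpd (\<Lambda> \<alpha>) (\<Lambda> \<beta>)"
      using a b \<Lambda>_eq germ_label_mult[of x g y h g' y' h'] by (auto simp: transformation_groupoid_def)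
  next
    fix \<alpha> assume \<alpha>: "\<alpha> \<in> X.\<Gamma>"
    obtain x g y h where a: "\<alpha> = (x, g, y)" "germ_label x g y h"
      using germ_label_exists \<alpha> by (metis prod.exhaust)
    then show "\<Lambda> (gpd_inv X.gpd \<alpha>) = gpd_inv Y.gpd (\<Lambda> \<alpha>)"
      using \<Lambda>_eq germ_label_inverse by (simp add: transformation_groupoid_def)
  qed
qed

end

lemma preserves_orbit_germs_imp_groupoids_isomorphic:
  assumes "semigroup_action G X P \<theta>" "essentially_free X P \<theta>"
    and "semigroup_action H Y S \<rho>" "essentially_free Y S \<rho>"
    and "homeomorphic_maps X Y \<phi> \<psi>"
    and "preserves_orbit_germs X P \<theta> S \<rho> \<phi>" "preserves_orbit_germs Y S \<rho> P \<theta> \<psi>"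
  shows "groupoids_isomorphic (transformation_groupoid G X P \<theta>) (transformation_groupoid H Y S \<rho>)"
proof -
  have "germ_map G X P \<theta> H Y S \<rho> \<phi> \<psi>" "germ_map H Y S \<rho> G X P \<theta> \<psi> \<phi>"
    using assms homeomorphic_maps_sym[of X Y \<phi> \<psi>]
    by (simp_all add: germ_map_def germ_map_axioms_def semigroup_action_pair_def)
  then show ?thesis
    unfolding groupoids_isomorphic_def using germ_map.groupoid_iso_\<Lambda> by blast
qed

section \<open>From groupoid isomorphisms back to germs\<close>

lemma groupoid_iso_inverse:
  assumes iso: "groupoid_iso \<A> \<B> \<Lambda>" and maps: "homeomorphic_maps (sg_top \<A>) (sg_top \<B>) \<Lambda> \<Lambda>'"
    and mult: "\<And>\<alpha> \<beta>. \<alpha> \<in> topspace (sg_top \<A>) \<Longrightarrow> \<beta> \<in> topspace (sg_top \<A>) \<Longrightarrow> sg_comp \<A> \<alpha> \<beta> \<Longrightarrow>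
      sg_mult \<A> \<alpha> \<beta> \<in> topspace (sg_top \<A>)"
    and inv: "\<And>\<alpha>. \<alpha> \<in> topspace (sg_top \<A>) \<Longrightarrow> gpd_inv \<A> \<alpha> \<in> topspace (sg_top \<A>)"
  shows "groupoid_iso \<B> \<A> \<Lambda>'"
proof -
  have in\<A>: "\<Lambda>' \<beta> \<in> topspace (sg_top \<A>)" and right: "\<Lambda> (\<Lambda>' \<beta>) = \<beta>" if "\<beta> \<in> topspace (sg_top \<B>)" for \<beta>
    using maps that unfolding homeomorphic_maps_def continuous_map_def by auto
  have left: "\<Lambda>' (\<Lambda> \<alpha>) = \<alpha>" if "\<alpha> \<in> topspace (sg_top \<A>)" for \<alpha>
    using maps that unfolding homeomorphic_maps_def by auto
  have hom: "homeomorphic_map (sg_top \<B>) (sg_top \<A>) \<Lambda>'"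
    using maps homeomorphic_maps_sym homeomorphic_maps_imp_map by blast
  show ?thesis
    unfolding groupoid_iso_def semigroupoid_iso_def
  proof (intro conjI ballI hom)
    fix \<alpha> \<beta> assume "\<alpha> \<in> topspace (sg_top \<B>)" "\<beta> \<in> topspace (sg_top \<B>)"
    then have *: "\<Lambda>' \<alpha> \<in> topspace (sg_top \<A>)" "\<Lambda>' \<beta> \<in> topspace (sg_top \<A>)"
      "\<Lambda> (\<Lambda>' \<alpha>) = \<alpha>" "\<Lambda> (\<Lambda>' \<beta>) = \<beta>"
      using in\<A> right by auto
    then show comp: "sg_comp \<B> \<alpha> \<beta> \<longleftrightarrow> sg_comp \<A> (\<Lambda>' \<alpha>) (\<Lambda>' \<beta>)"
      using iso unfolding groupoid_iso_def semigroupoid_iso_def by metis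
    show "sg_comp \<B> \<alpha> \<beta> \<longrightarrow> \<Lambda>' (sg_mult \<B> \<alpha> \<beta>) = sg_mult \<A> (\<Lambda>' \<alpha>) (\<Lambda>' \<beta>)"
      using iso * comp left mult[OF *(1,2)] unfolding groupoid_iso_def semigroupoid_iso_def by metis
  next
    fix \<alpha> assume "\<alpha> \<in> topspace (sg_top \<B>)"
    then show "\<Lambda>' (gpd_inv \<B> \<alpha>) = gpd_inv \<A> (\<Lambda>' \<alpha>)"
      using iso in\<A> right left inv unfolding groupoid_iso_def semigroupoid_iso_def by metis
  qed
qed

context semigroup_action
begin

lemma sg_mult_closed:
  assumes "\<alpha> \<in> \<Gamma>" "\<beta> \<in> \<Gamma>" "sg_comp gpd \<alpha> \<beta>"
  shows "sg_mult gpd \<alpha> \<beta> \<in> \<Gamma>"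
  using assms mult_in_\<Gamma>
  by (cases \<alpha>; cases \<beta>) (auto simp: transformation_groupoid_def)

lemma gpd_inv_closed:
  assumes "\<alpha> \<in> \<Gamma>"
  shows "gpd_inv gpd \<alpha> \<in> \<Gamma>"
  using assms inverse_in_\<Gamma> by (cases \<alpha>) (auto simp: transformation_groupoid_def)

lemma sg_comp_gpd [simp]: "sg_comp gpd (x, g, y) (y', h, z) \<longleftrightarrow> y = y'"
  by (simp add: transformation_groupoid_def)

lemma sg_mult_gpd [simp]: "sg_mult gpd (x, g, y) (y', h, z) = (x, g \<otimes> h, z)"
  by (simp add: transformation_groupoid_def)

lemma continuous_unit: "continuous_map X (sg_top gpd) (\<lambda>x. (x, \<one>, x))"
proof -
  have "continuous_map X (eq_space \<one> \<one>) (\<lambda>x. (x, x))"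
    unfolding eq_space_def continuous_map_in_subtopology
    by (auto intro!: continuous_map_pairedI)
  from continuous_map_compose[OF this continuous_map_into_gpd[of \<one> \<one>, folded eq_space_def]]
  show ?thesis by (simp add: comp_def)
qed

lemma continuous_range: "continuous_map (sg_top gpd) X fst"
  unfolding continuous_map_def
proof (intro conjI allI impI)
  show "fst \<in> \<Gamma> \<rightarrow> topspace X"
    by (auto elim!: in_\<Gamma>E)
  fix U assume U: "openin X U"
  show "openin (sg_top gpd) {\<gamma> \<in> \<Gamma>. fst \<gamma> \<in> U}"
  proof (rule openin_gpdI)
    fix x g y assume *: "(x, g, y) \<in> {\<gamma> \<in> \<Gamma>. fst \<gamma> \<in> U}"
    then obtain m n where mn: "m \<in> P" "n \<in> P" "g = m \<otimes> inv n" "\<theta> m x = \<theta> n y" "y \<in> topspace X"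
      by (auto elim: in_\<Gamma>E)
    have "(x', g, y') \<in> {\<gamma> \<in> \<Gamma>. fst \<gamma> \<in> U}" if "x' \<in> U" "y' \<in> topspace X" "\<theta> m x' = \<theta> n y'" for x' y'
      using that mn openin_subset[OF U] by (auto intro: in_\<Gamma>I)
    then show "\<exists>m\<in>P. \<exists>n\<in>P. \<exists>A B. g = m \<otimes> inv n \<and> \<theta> m x = \<theta> n y \<and>
      openin X A \<and> openin X B \<and> x \<in> A \<and> y \<in> B \<and>
      (\<forall>x'\<in>A. \<forall>y'\<in>B. \<theta> m x' = \<theta> n y' \<longrightarrow> (x', g, y') \<in> {\<gamma> \<in> \<Gamma>. fst \<gamma> \<in> U})"
      using * U by (intro bexI[OF _ mn(1)] bexI[OF _ mn(2)] exI[of _ U] exI[of _ "topspace X"] conjI ballI impI mn) auto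
  qed
qed

lemma openin_label:
  assumes "m \<in> P" "n \<in> P"
  shows "openin (sg_top gpd) {(x, g, y). x \<in> topspace X \<and> y \<in> topspace X \<and> g = m \<otimes> inv n \<and> \<theta> m x = \<theta> n y}"
    (is "openin _ ?W")
proof (rule openin_gpdI)
  fix x g y assume *: "(x, g, y) \<in> ?W"
  then show "\<exists>m\<in>P. \<exists>n\<in>P. \<exists>A B. g = m \<otimes> inv n \<and> \<theta> m x = \<theta> n y \<and>
      openin X A \<and> openin X B \<and> x \<in> A \<and> y \<in> B \<and>
      (\<forall>x'\<in>A. \<forall>y'\<in>B. \<theta> m x' = \<theta> n y' \<longrightarrow> (x', g, y') \<in> ?W)"
    by (intro bexI[OF _ assms(1)] bexI[OF _ assms(2)] exI[of _ "topspace X"]) auto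
qed

end

context semigroup_action_pair
begin

text \<open>Units are idempotent, hence mapped to units, which defines \<phi>. Composability with
  units on either side shows that \<Lambda> acts on ranges and sources through \<phi>, so the only
  freedom left is the label.\<close>

lemma groupoid_iso_unit_map:
  assumes iso: "groupoid_iso X.gpd Y.gpd \<Lambda>"
  obtains \<phi> where "continuous_map X Y \<phi>"
    "\<And>x. x \<in> topspace X \<Longrightarrow> \<Lambda> (x, \<one>\<^bsub>G\<^esub>, x) = (\<phi> x, \<one>\<^bsub>H\<^esub>, \<phi> x)"
    "\<And>x g y. (x, g, y) \<in> X.\<Gamma> \<Longrightarrow> \<exists>h. \<Lambda> (x, g, y) = (\<phi> x, h, \<phi> y)"
    "preserves_orbit_germs X P \<theta> S \<rho> \<phi>"
proof -
  have hom: "homeomorphic_map (sg_top X.gpd) (sg_top Y.gpd) \<Lambda>"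
    and comp: "\<And>\<alpha> \<beta>. \<alpha> \<in> X.\<Gamma> \<Longrightarrow> \<beta> \<in> X.\<Gamma> \<Longrightarrow> sg_comp X.gpd \<alpha> \<beta> \<Longrightarrow> sg_comp Y.gpd (\<Lambda> \<alpha>) (\<Lambda> \<beta>)"
    and mult: "\<And>\<alpha> \<beta>. \<alpha> \<in> X.\<Gamma> \<Longrightarrow> \<beta> \<in> X.\<Gamma> \<Longrightarrow> sg_comp X.gpd \<alpha> \<beta> \<Longrightarrow>
      \<Lambda> (sg_mult X.gpd \<alpha> \<beta>) = sg_mult Y.gpd (\<Lambda> \<alpha>) (\<Lambda> \<beta>)"
    using iso unfolding groupoid_iso_def semigroupoid_iso_def by blast+
  have cont: "continuous_map (sg_top X.gpd) (sg_top Y.gpd) \<Lambda>"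
    using hom by (rule homeomorphic_imp_continuous_map)
  then have \<Lambda>_in: "\<Lambda> \<gamma> \<in> Y.\<Gamma>" if "\<gamma> \<in> X.\<Gamma>" for \<gamma>
    using that by (auto simp: continuous_map_def)
  define \<phi> where "\<phi> = (\<lambda>x. fst (\<Lambda> (x, \<one>\<^bsub>G\<^esub>, x)))"
  have unit: "\<Lambda> (x, \<one>\<^bsub>G\<^esub>, x) = (\<phi> x, \<one>\<^bsub>H\<^esub>, \<phi> x)" if x: "x \<in> topspace X" for x
  proof -
    obtain u h v where uhv: "\<Lambda> (x, \<one>\<^bsub>G\<^esub>, x) = (u, h, v)" by (metis prod.exhaust)
    have "v = u" "(u, h, v) = (u, h \<otimes>\<^bsub>H\<^esub> h, v)"
      using comp[of "(x, \<one>\<^bsub>G\<^esub>, x)" "(x, \<one>\<^bsub>G\<^esub>, x)"] mult[of "(x, \<one>\<^bsub>G\<^esub>, x)" "(x, \<one>\<^bsub>G\<^esub>, x)"] x uhv by auto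
    moreover have "h \<in> carrier H"
      using \<Lambda>_in[of "(x, \<one>\<^bsub>G\<^esub>, x)"] x uhv Y.in_\<Gamma>_carrier by auto
    ultimately show ?thesis
      using uhv Y.l_cancel_one' by (auto simp: \<phi>_def)
  qed
  have range_source: "\<exists>h. \<Lambda> (x, g, y) = (\<phi> x, h, \<phi> y)" if \<gamma>: "(x, g, y) \<in> X.\<Gamma>" for x g y
  proof -
    obtain u h v where uhv: "\<Lambda> (x, g, y) = (u, h, v)" by (metis prod.exhaust)
    have xy: "x \<in> topspace X" "y \<in> topspace X" using \<gamma> by (auto elim: X.in_\<Gamma>E)
    have "\<phi> x = u"
      using comp[of "(x, \<one>\<^bsub>G\<^esub>, x)" "(x, g, y)"] \<gamma> xy unit uhv by simp
    moreover have "v = \<phi> y"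
      using comp[of "(x, g, y)" "(y, \<one>\<^bsub>G\<^esub>, y)"] \<gamma> xy unit uhv by simp
    ultimately show ?thesis using uhv by simp
  qed
  have "continuous_map X Y (fst \<circ> (\<Lambda> \<circ> (\<lambda>x. (x, \<one>\<^bsub>G\<^esub>, x))))"
    by (intro continuous_map_compose[OF _ Y.continuous_range] continuous_map_compose[OF X.continuous_unit cont])
  then have cont\<phi>: "continuous_map X Y \<phi>"
    by (simp add: \<phi>_def comp_def)
  have "preserves_orbit_germs X P \<theta> S \<rho> \<phi>"
    unfolding preserves_orbit_germs_def
  proof (intro ballI impI)
    fix m n x y assume *: "m \<in> P" "n \<in> P" "x \<in> topspace X" "y \<in> topspace X" "\<theta> m x = \<theta> n y"
    define g where "g = m \<otimes>\<^bsub>G\<^esub> inv\<^bsub>G\<^esub> n"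
    have \<gamma>: "(x, g, y) \<in> X.\<Gamma>" unfolding g_def using * by (simp add: X.in_\<Gamma>I)
    then obtain h where h: "\<Lambda> (x, g, y) = (\<phi> x, h, \<phi> y)" using range_source by blast
    then have "(\<phi> x, h, \<phi> y) \<in> Y.\<Gamma>" using \<Lambda>_in[OF \<gamma>] by simp
    then obtain s t where st: "s \<in> S" "t \<in> S" "h = s \<otimes>\<^bsub>H\<^esub> inv\<^bsub>H\<^esub> t" "\<rho> s (\<phi> x) = \<rho> t (\<phi> y)"
      "\<phi> x \<in> topspace Y" "\<phi> y \<in> topspace Y"
      by (rule Y.in_\<Gamma>E)
    \<comment> \<open>The open set of elements represented by the fixed fraction \<open>s\<close>,
      \<open>t\<close>. Its preimage under \<Lambda> is open, and a neighbourhood inside it keeps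
      \<open>s\<close> and \<open>t\<close> constant.\<close>
    define W where "W = {(u, h, v). u \<in> topspace Y \<and> v \<in> topspace Y \<and> h = s \<otimes>\<^bsub>H\<^esub> inv\<^bsub>H\<^esub> t \<and> \<rho> s u = \<rho> t v}"
    have op: "openin (sg_top X.gpd) {\<gamma> \<in> X.\<Gamma>. \<Lambda> \<gamma> \<in> W}"
      unfolding W_def by (intro openin_continuous_map_preimage[OF cont] Y.openin_label st)
    have mem: "(x, m \<otimes>\<^bsub>G\<^esub> inv\<^bsub>G\<^esub> n, y) \<in> {\<gamma> \<in> X.\<Gamma>. \<Lambda> \<gamma> \<in> W}"
      using \<gamma> h st unfolding W_def by (simp flip: g_def)
    obtain A B where AB: "openin X A" "openin X B" "x \<in> A" "y \<in> B"
      "\<And>x' y'. x' \<in> A \<Longrightarrow> y' \<in> B \<Longrightarrow> \<theta> m x' = \<theta> n y' \<Longrightarrow> (x', m \<otimes>\<^bsub>G\<^esub> inv\<^bsub>G\<^esub> n, y') \<in> {\<gamma> \<in> X.\<Gamma>. \<Lambda> \<gamma> \<in> W}"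
      using X.openin_gpdD[OF op * mem] by blast
    have "\<rho> s (\<phi> x') = \<rho> t (\<phi> y')" if "x' \<in> A" "y' \<in> B" "\<theta> m x' = \<theta> n y'" for x' y'
      using AB(5)[OF that] range_source[of x' "m \<otimes>\<^bsub>G\<^esub> inv\<^bsub>G\<^esub> n" y'] unfolding W_def by auto
    then show "\<exists>s\<in>S. \<exists>t\<in>S. \<exists>A B. openin X A \<and> openin X B \<and> x \<in> A \<and> y \<in> B \<and>
         (\<forall>x'\<in>A. \<forall>y'\<in>B. \<theta> m x' = \<theta> n y' \<longrightarrow> \<rho> s (\<phi> x') = \<rho> t (\<phi> y'))"
      using AB(1-4) st(1,2) by blast
  qed
  with unit range_source cont\<phi> that show thesis by blast
qed

end

lemma groupoids_isomorphic_obtain: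
  assumes "semigroup_action G X P \<theta>" "semigroup_action H Y S \<rho>"
    and "groupoids_isomorphic (transformation_groupoid G X P \<theta>) (transformation_groupoid H Y S \<rho>)"
  obtains \<Lambda> \<Lambda>' \<phi> \<psi> where
    "groupoid_iso (transformation_groupoid G X P \<theta>) (transformation_groupoid H Y S \<rho>) \<Lambda>"
    "groupoid_iso (transformation_groupoid H Y S \<rho>) (transformation_groupoid G X P \<theta>) \<Lambda>'"
    "homeomorphic_maps (sg_top (transformation_groupoid G X P \<theta>))
       (sg_top (transformation_groupoid H Y S \<rho>)) \<Lambda> \<Lambda>'"
    "homeomorphic_maps X Y \<phi> \<psi>"
    "\<And>x. x \<in> topspace X \<Longrightarrow> \<Lambda> (x, \<one>\<^bsub>G\<^esub>, x) = (\<phi> x, \<one>\<^bsub>H\<^esub>, \<phi> x)"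
    "\<And>y. y \<in> topspace Y \<Longrightarrow> \<Lambda>' (y, \<one>\<^bsub>H\<^esub>, y) = (\<psi> y, \<one>\<^bsub>G\<^esub>, \<psi> y)"
    "preserves_orbit_germs X P \<theta> S \<rho> \<phi>" "preserves_orbit_germs Y S \<rho> P \<theta> \<psi>"
proof -
  interpret XY: semigroup_action_pair G X P \<theta> H Y S \<rho>
    using assms by (simp add: semigroup_action_pair_def)
  interpret YX: semigroup_action_pair H Y S \<rho> G X P \<theta>
    using assms by (simp add: semigroup_action_pair_def)
  obtain \<Lambda> where \<Lambda>: "groupoid_iso XY.X.gpd XY.Y.gpd \<Lambda>"
    using assms(3) unfolding groupoids_isomorphic_def by blast
  then obtain \<Lambda>' where maps: "homeomorphic_maps (sg_top XY.X.gpd) (sg_top XY.Y.gpd) \<Lambda> \<Lambda>'"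
    unfolding groupoid_iso_def semigroupoid_iso_def homeomorphic_map_maps by blast
  have \<Lambda>': "groupoid_iso XY.Y.gpd XY.X.gpd \<Lambda>'"
    by (rule groupoid_iso_inverse[OF \<Lambda> maps XY.X.sg_mult_closed XY.X.gpd_inv_closed])
  obtain \<phi> where \<phi>: "continuous_map X Y \<phi>"
    "\<And>x. x \<in> topspace X \<Longrightarrow> \<Lambda> (x, \<one>\<^bsub>G\<^esub>, x) = (\<phi> x, \<one>\<^bsub>H\<^esub>, \<phi> x)" "preserves_orbit_germs X P \<theta> S \<rho> \<phi>"
    using XY.groupoid_iso_unit_map[OF \<Lambda>] by metis
  obtain \<psi> where \<psi>: "continuous_map Y X \<psi>"
    "\<And>y. y \<in> topspace Y \<Longrightarrow> \<Lambda>' (y, \<one>\<^bsub>H\<^esub>, y) = (\<psi> y, \<one>\<^bsub>G\<^esub>, \<psi> y)" "preserves_orbit_germs Y S \<rho> P \<theta> \<psi>"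
    using YX.groupoid_iso_unit_map[OF \<Lambda>'] by metis
  have "\<phi> x \<in> topspace Y" if "x \<in> topspace X" for x
    using \<phi>(1) that by (auto simp: continuous_map_def)
  moreover have "\<psi> y \<in> topspace X" if "y \<in> topspace Y" for y
    using \<psi>(1) that by (auto simp: continuous_map_def)
  moreover have "\<Lambda>' (\<Lambda> \<gamma>) = \<gamma>" if "\<gamma> \<in> XY.X.\<Gamma>" for \<gamma>
    using maps that unfolding homeomorphic_maps_def by blast
  moreover have "\<Lambda> (\<Lambda>' \<gamma>) = \<gamma>" if "\<gamma> \<in> XY.Y.\<Gamma>" for \<gamma>
    using maps that unfolding homeomorphic_maps_def by blast
  ultimately have "\<psi> (\<phi> x) = x" if "x \<in> topspace X" for x
    using that \<phi>(2)[OF that] \<psi>(2)[of "\<phi> x"] by (metis XY.X.unit_in_\<Gamma>_iff fst_conv)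
  moreover have "\<phi> (\<psi> y) = y" if "y \<in> topspace Y" for y
    using that \<psi>(2)[OF that] \<phi>(2)[of "\<psi> y"] \<open>\<And>y. y \<in> topspace Y \<Longrightarrow> \<psi> y \<in> topspace X\<close>
      \<open>\<And>\<gamma>. \<gamma> \<in> XY.Y.\<Gamma> \<Longrightarrow> \<Lambda> (\<Lambda>' \<gamma>) = \<gamma>\<close>[of "(y, \<one>\<^bsub>H\<^esub>, y)"] by simp
  ultimately have "homeomorphic_maps X Y \<phi> \<psi>"
    unfolding homeomorphic_maps_def using \<phi>(1) \<psi>(1) by blast
  with \<Lambda> \<Lambda>' maps \<phi> \<psi> that show thesis by blast
qed

section \<open>Bounded operators on \<open>\<ell>\<^sup>2(A)\<close>\<close>

lemma ell2_zero: "\<xi> \<in> ell2 A \<Longrightarrow> \<gamma> \<notin> A \<Longrightarrow> \<xi> \<gamma> = 0"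
  by (simp add: ell2_def)

lemma ell2_summable: "\<xi> \<in> ell2 A \<Longrightarrow> (\<lambda>\<gamma>. (cmod (\<xi> \<gamma>))\<^sup>2) summable_on A"
  by (simp add: ell2_def)

lemma ell2_norm_nonneg [simp]: "0 \<le> ell2_norm A \<xi>"
  by (simp add: ell2_norm_def infsum_nonneg)

lemma ell2_norm_sq: "(ell2_norm A \<xi>)\<^sup>2 = (\<Sum>\<^sub>\<infinity>\<gamma>\<in>A. (cmod (\<xi> \<gamma>))\<^sup>2)"
  by (simp add: ell2_norm_def infsum_nonneg)

lemma ell2_sum_le:
  assumes "\<xi> \<in> ell2 A" "finite F" "F \<subseteq> A"
  shows "(\<Sum>\<gamma>\<in>F. (cmod (\<xi> \<gamma>))\<^sup>2) \<le> (ell2_norm A \<xi>)\<^sup>2"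
  unfolding ell2_norm_sq using assms by (intro finite_sum_le_infsum) (auto simp: ell2_summable)

lemma ell2_coord_le:
  assumes "\<xi> \<in> ell2 A"
  shows "cmod (\<xi> \<gamma>) \<le> ell2_norm A \<xi>"
proof (cases "\<gamma> \<in> A")
  case True
  then have "(cmod (\<xi> \<gamma>))\<^sup>2 \<le> (ell2_norm A \<xi>)\<^sup>2"
    using ell2_sum_le[OF assms, of "{\<gamma>}"] by simp
  then show ?thesis by (rule power2_le_imp_le) simp
qed (simp add: ell2_zero[OF assms])

text \<open>It reduces membership and norm to finite sums of squares, the form in which the later
  estimates are carried out.\<close>

lemma ell2I:
  assumes "\<And>\<gamma>. \<gamma> \<notin> A \<Longrightarrow> \<xi> \<gamma> = 0"
    and "\<And>F. finite F \<Longrightarrow> F \<subseteq> A \<Longrightarrow> (\<Sum>\<gamma>\<in>F. (cmod (\<xi> \<gamma>))\<^sup>2) \<le> C\<^sup>2" and "0 \<le> C"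
  shows "\<xi> \<in> ell2 A" "ell2_norm A \<xi> \<le> C"
proof -
  have summ: "(\<lambda>\<gamma>. (cmod (\<xi> \<gamma>))\<^sup>2) summable_on A"
    by (rule nonneg_bdd_above_summable_on) (use assms(2) in \<open>auto intro!: bdd_aboveI[of _ "C\<^sup>2"]\<close>)
  then show "\<xi> \<in> ell2 A"
    using assms(1) by (simp add: ell2_def)
  have "(ell2_norm A \<xi>)\<^sup>2 \<le> C\<^sup>2"
    unfolding ell2_norm_sq by (rule infsum_le_finite_sums[OF summ]) (use assms(2) in blast)
  then show "ell2_norm A \<xi> \<le> C"
    using assms(3) by (rule power2_le_imp_le)
qed

text \<open>The factor 2 is deliberately crude: it comes from
  \<open>(a + b)^2 \<le> 2 (a^2 + b^2)\<close> under the sum, in place of the Minkowski inequality.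
  Boundedness and limits are insensitive to it.\<close>

lemma ell2_lincomb:
  assumes "\<xi> \<in> ell2 A" "\<eta> \<in> ell2 A"
  shows "(\<lambda>\<gamma>. c * \<xi> \<gamma> + d * \<eta> \<gamma>) \<in> ell2 A"
    and "ell2_norm A (\<lambda>\<gamma>. c * \<xi> \<gamma> + d * \<eta> \<gamma>) \<le> 2 * (cmod c * ell2_norm A \<xi> + cmod d * ell2_norm A \<eta>)"
proof -
  let ?C = "2 * (cmod c * ell2_norm A \<xi> + cmod d * ell2_norm A \<eta>)"
  have *: "(\<Sum>\<gamma>\<in>F. (cmod (c * \<xi> \<gamma> + d * \<eta> \<gamma>))\<^sup>2) \<le> ?C\<^sup>2" if F: "finite F" "F \<subseteq> A" for F
  proof -
    have "(cmod (c * \<xi> \<gamma> + d * \<eta> \<gamma>))\<^sup>2 \<le> 2 * ((cmod c)\<^sup>2 * (cmod (\<xi> \<gamma>))\<^sup>2 + (cmod d)\<^sup>2 * (cmod (\<eta> \<gamma>))\<^sup>2)" for \<gamma>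
    proof -
      have "cmod (c * \<xi> \<gamma> + d * \<eta> \<gamma>) \<le> cmod c * cmod (\<xi> \<gamma>) + cmod d * cmod (\<eta> \<gamma>)"
        by (metis norm_mult norm_triangle_ineq)
      then have "(cmod (c * \<xi> \<gamma> + d * \<eta> \<gamma>))\<^sup>2 \<le> (cmod c * cmod (\<xi> \<gamma>) + cmod d * cmod (\<eta> \<gamma>))\<^sup>2"
        by (simp add: power_mono)
      also have "\<dots> \<le> 2 * ((cmod c * cmod (\<xi> \<gamma>))\<^sup>2 + (cmod d * cmod (\<eta> \<gamma>))\<^sup>2)"
        using sum_squares_bound[of "cmod c * cmod (\<xi> \<gamma>)" "cmod d * cmod (\<eta> \<gamma>)"] by (simp add: power2_sum)
      finally show ?thesis by (simp add: power_mult_distrib)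
    qed
    then have "(\<Sum>\<gamma>\<in>F. (cmod (c * \<xi> \<gamma> + d * \<eta> \<gamma>))\<^sup>2) \<le>
        (\<Sum>\<gamma>\<in>F. 2 * ((cmod c)\<^sup>2 * (cmod (\<xi> \<gamma>))\<^sup>2 + (cmod d)\<^sup>2 * (cmod (\<eta> \<gamma>))\<^sup>2))"
      by (rule sum_mono)
    also have "\<dots> = 2 * ((cmod c)\<^sup>2 * (\<Sum>\<gamma>\<in>F. (cmod (\<xi> \<gamma>))\<^sup>2) + (cmod d)\<^sup>2 * (\<Sum>\<gamma>\<in>F. (cmod (\<eta> \<gamma>))\<^sup>2))"
      by (simp add: sum_distrib_left sum.distrib)
    also have "\<dots> \<le> 2 * ((cmod c)\<^sup>2 * (ell2_norm A \<xi>)\<^sup>2 + (cmod d)\<^sup>2 * (ell2_norm A \<eta>)\<^sup>2)"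
      using ell2_sum_le[OF assms(1) F] ell2_sum_le[OF assms(2) F] by (intro mult_left_mono add_mono) auto
    also have "\<dots> \<le> ?C\<^sup>2"
      by (simp add: power2_eq_square algebra_simps)
    finally show ?thesis .
  qed
  have "0 \<le> ?C" by simp
  from ell2I[OF _ * this] show "(\<lambda>\<gamma>. c * \<xi> \<gamma> + d * \<eta> \<gamma>) \<in> ell2 A"
    "ell2_norm A (\<lambda>\<gamma>. c * \<xi> \<gamma> + d * \<eta> \<gamma>) \<le> ?C"
    using ell2_zero[OF assms(1)] ell2_zero[OF assms(2)] by auto
qed

lemma ell2_0 [simp]: "(\<lambda>\<gamma>. 0) \<in> ell2 A"
  by (simp add: ell2_def)

definition basis_vector :: "'a \<Rightarrow> 'a \<Rightarrow> complex" where
  "basis_vector \<beta> = (\<lambda>\<gamma>. if \<gamma> = \<beta> then 1 else 0)"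

lemma basis_vector_ell2:
  assumes "\<beta> \<in> A"
  shows "basis_vector \<beta> \<in> ell2 A" "ell2_norm A (basis_vector \<beta>) \<le> 1"
proof -
  have *: "(\<Sum>\<gamma>\<in>F. (cmod (basis_vector \<beta> \<gamma>))\<^sup>2) \<le> 1\<^sup>2" if F: "finite F" for F
  proof -
    have "(cmod (basis_vector \<beta> \<gamma>))\<^sup>2 = (if \<gamma> = \<beta> then 1 else 0)" for \<gamma>
      by (simp add: basis_vector_def)
    then show ?thesis using F by simp
  qed
  show "basis_vector \<beta> \<in> ell2 A"
    by (rule ell2I(1)[OF _ *]) (use assms in \<open>auto simp: basis_vector_def\<close>)
  show "ell2_norm A (basis_vector \<beta>) \<le> 1"
    by (rule ell2I(2)[OF _ *]) (use assms in \<open>auto simp: basis_vector_def\<close>)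
qed

lemma ell2_restrict:
  assumes "\<xi> \<in> ell2 A"
  shows "(\<lambda>\<gamma>. if \<gamma> \<in> F then \<xi> \<gamma> else 0) \<in> ell2 A"
    and "ell2_norm A (\<lambda>\<gamma>. if \<gamma> \<in> F then \<xi> \<gamma> else 0) \<le> ell2_norm A \<xi>"
proof -
  have *: "(\<Sum>\<gamma>\<in>F'. (cmod (if \<gamma> \<in> F then \<xi> \<gamma> else 0))\<^sup>2) \<le> (ell2_norm A \<xi>)\<^sup>2" if "finite F'" "F' \<subseteq> A" for F'
    by (rule order_trans[OF sum_mono ell2_sum_le[OF assms that]]) auto
  show "(\<lambda>\<gamma>. if \<gamma> \<in> F then \<xi> \<gamma> else 0) \<in> ell2 A"
    by (rule ell2I(1)[OF _ *]) (auto simp: ell2_zero[OF assms])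
  show "ell2_norm A (\<lambda>\<gamma>. if \<gamma> \<in> F then \<xi> \<gamma> else 0) \<le> ell2_norm A \<xi>"
    by (rule ell2I(2)[OF _ *]) (auto simp: ell2_zero[OF assms])
qed

lemma ell2_finite_approximation:
  assumes "\<xi> \<in> ell2 A" "0 < \<epsilon>"
  obtains F where "finite F" "F \<subseteq> A" "ell2_norm A (\<lambda>\<gamma>. if \<gamma> \<in> F then 0 else \<xi> \<gamma>) \<le> \<epsilon>"
proof -
  have pos: "0 < \<epsilon>\<^sup>2" using assms(2) by simp
  obtain F where F: "finite F" "F \<subseteq> A"
    "dist (\<Sum>\<gamma>\<in>F. (cmod (\<xi> \<gamma>))\<^sup>2) (\<Sum>\<^sub>\<infinity>\<gamma>\<in>A. (cmod (\<xi> \<gamma>))\<^sup>2) \<le> \<epsilon>\<^sup>2"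
    using infsum_finite_approximation[OF ell2_summable[OF assms(1)] pos] by blast
  have *: "(\<Sum>\<gamma>\<in>F'. (cmod (if \<gamma> \<in> F then 0 else \<xi> \<gamma>))\<^sup>2) \<le> \<epsilon>\<^sup>2" if F': "finite F'" "F' \<subseteq> A" for F'
  proof -
    have "(\<Sum>\<gamma>\<in>F'. (cmod (if \<gamma> \<in> F then 0 else \<xi> \<gamma>))\<^sup>2) = (\<Sum>\<gamma>\<in>F' - F. (cmod (\<xi> \<gamma>))\<^sup>2)"
      using F' by (intro sum.mono_neutral_cong_right) auto
    also have "\<dots> = (\<Sum>\<gamma>\<in>F' \<union> F. (cmod (\<xi> \<gamma>))\<^sup>2) - (\<Sum>\<gamma>\<in>F. (cmod (\<xi> \<gamma>))\<^sup>2)"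
    proof -
      have "(\<Sum>\<gamma>\<in>(F' - F) \<union> F. (cmod (\<xi> \<gamma>))\<^sup>2) = (\<Sum>\<gamma>\<in>F' - F. (cmod (\<xi> \<gamma>))\<^sup>2) + (\<Sum>\<gamma>\<in>F. (cmod (\<xi> \<gamma>))\<^sup>2)"
        using F(1) F' by (intro sum.union_disjoint) auto
      then show ?thesis by simp
    qed
    also have "\<dots> \<le> (ell2_norm A \<xi>)\<^sup>2 - (\<Sum>\<gamma>\<in>F. (cmod (\<xi> \<gamma>))\<^sup>2)"
      using ell2_sum_le[OF assms(1), of "F' \<union> F"] F F' by simp
    also have "\<dots> \<le> \<epsilon>\<^sup>2"
      using F(3) unfolding ell2_norm_sq dist_real_def by linarith
    finally show ?thesis .
  qed
  have "ell2_norm A (\<lambda>\<gamma>. if \<gamma> \<in> F then 0 else \<xi> \<gamma>) \<le> \<epsilon>"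
    by (rule ell2I(2)[OF _ *]) (use assms ell2_zero in auto)
  with F that show thesis by blast
qed

lemma bounded_operators_linear:
  assumes "T \<in> bounded_operators A" "\<xi> \<in> ell2 A" "\<eta> \<in> ell2 A"
  shows "T (\<lambda>\<gamma>. c * \<xi> \<gamma> + d * \<eta> \<gamma>) = (\<lambda>\<gamma>. c * T \<xi> \<gamma> + d * T \<eta> \<gamma>)"
  using assms unfolding bounded_operators_def by blast

lemma bounded_operators_closed: "T \<in> bounded_operators A \<Longrightarrow> \<xi> \<in> ell2 A \<Longrightarrow> T \<xi> \<in> ell2 A"
  unfolding bounded_operators_def by (auto simp: PiE_def Pi_iff)

lemma bounded_operators_bound:
  assumes "T \<in> bounded_operators A"
  obtains K where "0 \<le> K" "\<And>\<xi>. \<xi> \<in> ell2 A \<Longrightarrow> ell2_norm A (T \<xi>) \<le> K * ell2_norm A \<xi>"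
proof -
  obtain K where K: "\<forall>\<xi>\<in>ell2 A. ell2_norm A (T \<xi>) \<le> K * ell2_norm A \<xi>"
    using assms unfolding bounded_operators_def by blast
  have "ell2_norm A (T \<xi>) \<le> \<bar>K\<bar> * ell2_norm A \<xi>" if "\<xi> \<in> ell2 A" for \<xi>
    using K that by (meson abs_ge_self ell2_norm_nonneg mult_right_mono order_trans)
  then show thesis using that[of "\<bar>K\<bar>"] by simp
qed

lemma bounded_operators_finite_sum:
  assumes T: "T \<in> bounded_operators A" and "\<xi> \<in> ell2 A" and F: "finite F" "F \<subseteq> A"
  shows "T (\<lambda>\<gamma>. if \<gamma> \<in> F then \<xi> \<gamma> else 0) = (\<lambda>\<gamma>. \<Sum>\<beta>\<in>F. \<xi> \<beta> * T (basis_vector \<beta>) \<gamma>)"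
  using F
proof (induction rule: finite_induct)
  case empty
  show ?case
    using bounded_operators_linear[OF T ell2_0 ell2_0, of 0 0] by simp
next
  case (insert \<beta> F)
  have "(\<lambda>\<gamma>. if \<gamma> \<in> insert \<beta> F then \<xi> \<gamma> else 0) =
      (\<lambda>\<gamma>. \<xi> \<beta> * basis_vector \<beta> \<gamma> + 1 * (if \<gamma> \<in> F then \<xi> \<gamma> else 0))"
    using insert.hyps by (auto simp: basis_vector_def fun_eq_iff)
  then have "T (\<lambda>\<gamma>. if \<gamma> \<in> insert \<beta> F then \<xi> \<gamma> else 0) =
      (\<lambda>\<gamma>. \<xi> \<beta> * T (basis_vector \<beta>) \<gamma> + 1 * T (\<lambda>\<gamma>. if \<gamma> \<in> F then \<xi> \<gamma> else 0) \<gamma>)"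
    using bounded_operators_linear[OF T basis_vector_ell2(1)[of \<beta> A] ell2_restrict(1)[OF assms(2), of F],
        of "\<xi> \<beta>" 1] insert.prems by simp
  then show ?case
    using insert by simp
qed

text \<open>A bounded operator is governed by its matrix columns: truncating the vector to a finite
  set changes both the vector and its image little in norm.\<close>

lemma bounded_operators_approximation:
  assumes T: "T \<in> bounded_operators A" and \<xi>: "\<xi> \<in> ell2 A" and "0 < \<epsilon>"
  obtains F where "finite F" "F \<subseteq> A"
    "\<And>\<gamma>. cmod (T \<xi> \<gamma> - (\<Sum>\<beta>\<in>F. \<xi> \<beta> * T (basis_vector \<beta>) \<gamma>)) \<le> \<epsilon>"
    "ell2_norm A (\<lambda>\<gamma>. \<xi> \<gamma> - (if \<gamma> \<in> F then \<xi> \<gamma> else 0)) \<le> \<epsilon>"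
    "ell2_norm A (\<lambda>\<gamma>. T \<xi> \<gamma> - (\<Sum>\<beta>\<in>F. \<xi> \<beta> * T (basis_vector \<beta>) \<gamma>)) \<le> \<epsilon>"
proof -
  obtain K where K: "0 \<le> K" "\<And>\<xi>. \<xi> \<in> ell2 A \<Longrightarrow> ell2_norm A (T \<xi>) \<le> K * ell2_norm A \<xi>"
    using bounded_operators_bound[OF T] by blast
  \<comment> \<open>Dividing by \<open>K + 1\<close> instead of \<open>K\<close> is safe for
    \<open>K = 0\<close>, and since \<open>K + 1 \<ge> 1\<close> the error of the vector itself is
    also at most \<epsilon>.\<close>
  have "0 < \<epsilon> / (K + 1)" using assms(3) K(1) by simp
  then obtain F where F: "finite F" "F \<subseteq> A"
    and rest: "ell2_norm A (\<lambda>\<gamma>. if \<gamma> \<in> F then 0 else \<xi> \<gamma>) \<le> \<epsilon> / (K + 1)"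
    using ell2_finite_approximation[OF \<xi>] by blast
  let ?\<xi>F = "\<lambda>\<gamma>. if \<gamma> \<in> F then \<xi> \<gamma> else 0"
  have eq: "(\<lambda>\<gamma>. 1 * \<xi> \<gamma> + (- 1) * ?\<xi>F \<gamma>) = (\<lambda>\<gamma>. if \<gamma> \<in> F then 0 else \<xi> \<gamma>)"
    by auto
  have rest_ell2: "(\<lambda>\<gamma>. if \<gamma> \<in> F then 0 else \<xi> \<gamma>) \<in> ell2 A"
    using ell2_lincomb(1)[OF \<xi> ell2_restrict(1)[OF \<xi>, of F], of 1 "- 1"] by (simp only: eq)
  have T_rest: "T (\<lambda>\<gamma>. if \<gamma> \<in> F then 0 else \<xi> \<gamma>) = (\<lambda>\<gamma>. T \<xi> \<gamma> - (\<Sum>\<beta>\<in>F. \<xi> \<beta> * T (basis_vector \<beta>) \<gamma>))"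
    using bounded_operators_linear[OF T \<xi> ell2_restrict(1)[OF \<xi>, of F], of 1 "- 1"]
    unfolding eq bounded_operators_finite_sum[OF T \<xi> F] by simp
  have le: "(K + 1) * (\<epsilon> / (K + 1)) = \<epsilon>" using K(1) by simp
  have "K * ell2_norm A (\<lambda>\<gamma>. if \<gamma> \<in> F then 0 else \<xi> \<gamma>) \<le> (K + 1) * (\<epsilon> / (K + 1))"
    using rest K(1) by (intro mult_mono) auto
  then have small: "ell2_norm A (\<lambda>\<gamma>. T \<xi> \<gamma> - (\<Sum>\<beta>\<in>F. \<xi> \<beta> * T (basis_vector \<beta>) \<gamma>)) \<le> \<epsilon>"
    using K(2)[OF rest_ell2] unfolding T_rest le by linarith
  moreover have "cmod (T \<xi> \<gamma> - (\<Sum>\<beta>\<in>F. \<xi> \<beta> * T (basis_vector \<beta>) \<gamma>)) \<le> \<epsilon>" for \<gamma>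
    using ell2_coord_le[OF bounded_operators_closed[OF T rest_ell2], of \<gamma>] small unfolding T_rest by linarith
  moreover have "ell2_norm A (\<lambda>\<gamma>. \<xi> \<gamma> - ?\<xi>F \<gamma>) \<le> \<epsilon>"
  proof -
    have "\<epsilon> / (K + 1) \<le> \<epsilon>" using K(1) assms(3) by (simp add: divide_le_eq)
    then show ?thesis using rest eq by (simp add: algebra_simps)
  qed
  ultimately show thesis using that F by blast
qed

text \<open>A vanishing matrix row annihilates the coordinate on every vector. Read backwards, a
  nonzero coordinate exhibits a nonzero matrix entry.\<close>

lemma bounded_operators_coord_zero:
  assumes T: "T \<in> bounded_operators A" and \<xi>: "\<xi> \<in> ell2 A"
    and zero: "\<And>\<beta>. \<beta> \<in> A \<Longrightarrow> T (basis_vector \<beta>) \<gamma> = 0"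
  shows "T \<xi> \<gamma> = 0"
proof -
  have "cmod (T \<xi> \<gamma>) \<le> 0 + \<epsilon>" if \<epsilon>: "0 < \<epsilon>" for \<epsilon>
  proof -
    obtain F where F: "F \<subseteq> A" "cmod (T \<xi> \<gamma> - (\<Sum>\<beta>\<in>F. \<xi> \<beta> * T (basis_vector \<beta>) \<gamma>)) \<le> \<epsilon>"
      using bounded_operators_approximation[OF T \<xi> \<epsilon>] by metis
    have "(\<Sum>\<beta>\<in>F. \<xi> \<beta> * T (basis_vector \<beta>) \<gamma>) = 0"
      using F(1) zero by (intro sum.neutral) auto
    with F(2) show ?thesis by simp
  qed
  then have "cmod (T \<xi> \<gamma>) \<le> 0" by (rule field_le_epsilon)
  then show ?thesis by simp
qed

lemma op_diff_bounded:
  assumes S: "S \<in> bounded_operators A" and T: "T \<in> bounded_operators A"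
  shows "op_add A S (op_scale A (- 1) T) \<in> bounded_operators A" (is "?D \<in> _")
proof -
  have D: "?D \<xi> = (\<lambda>\<gamma>. 1 * S \<xi> \<gamma> + (- 1) * T \<xi> \<gamma>)" if "\<xi> \<in> ell2 A" for \<xi>
    using that by (simp add: op_add_def op_scale_def)
  obtain K where K: "0 \<le> K" "\<And>\<xi>. \<xi> \<in> ell2 A \<Longrightarrow> ell2_norm A (S \<xi>) \<le> K * ell2_norm A \<xi>"
    using bounded_operators_bound[OF S] by blast
  obtain L where L: "0 \<le> L" "\<And>\<xi>. \<xi> \<in> ell2 A \<Longrightarrow> ell2_norm A (T \<xi>) \<le> L * ell2_norm A \<xi>"
    using bounded_operators_bound[OF T] by blast
  have "?D \<in> ell2 A \<rightarrow>\<^sub>E ell2 A"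
  proof (intro PiE_I)
    show "?D \<xi> \<in> ell2 A" if "\<xi> \<in> ell2 A" for \<xi>
      unfolding D[OF that] by (intro ell2_lincomb bounded_operators_closed[OF S that] bounded_operators_closed[OF T that])
  qed (simp add: op_add_def)
  moreover have "?D (\<lambda>\<gamma>. c * \<xi> \<gamma> + d * \<eta> \<gamma>) = (\<lambda>\<gamma>. c * ?D \<xi> \<gamma> + d * ?D \<eta> \<gamma>)"
    if "\<xi> \<in> ell2 A" "\<eta> \<in> ell2 A" for \<xi> \<eta> c d
    unfolding D[OF that(1)] D[OF that(2)] D[OF ell2_lincomb(1)[OF that]]
      bounded_operators_linear[OF S that] bounded_operators_linear[OF T that]
    by (simp add: algebra_simps fun_eq_iff)
  moreover have "ell2_norm A (?D \<xi>) \<le> (2 * (K + L)) * ell2_norm A \<xi>" if "\<xi> \<in> ell2 A" for \<xi>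
  proof -
    have "ell2_norm A (?D \<xi>) \<le> 2 * (cmod 1 * ell2_norm A (S \<xi>) + cmod (- 1) * ell2_norm A (T \<xi>))"
      unfolding D[OF that] by (intro ell2_lincomb bounded_operators_closed[OF S that] bounded_operators_closed[OF T that])
    also have "\<dots> \<le> 2 * (K * ell2_norm A \<xi> + L * ell2_norm A \<xi>)"
      using K(2)[OF that] L(2)[OF that] by simp
    finally show ?thesis by (simp add: algebra_simps)
  qed
  ultimately show ?thesis
    unfolding bounded_operators_def by blast
qed

lemma op_norm_bound:
  assumes T: "T \<in> bounded_operators A" and \<xi>: "\<xi> \<in> ell2 A" "ell2_norm A \<xi> \<le> 1"
  shows "ell2_norm A (T \<xi>) \<le> op_norm A T"
proof -
  obtain K where K: "0 \<le> K" "\<And>\<xi>. \<xi> \<in> ell2 A \<Longrightarrow> ell2_norm A (T \<xi>) \<le> K * ell2_norm A \<xi>"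
    using bounded_operators_bound[OF T] by blast
  have "ell2_norm A (T \<eta>) \<le> K" if "\<eta> \<in> ell2 A" "ell2_norm A \<eta> \<le> 1" for \<eta>
    using K(2)[OF that(1)] mult_left_mono[OF that(2) K(1)] by simp
  then have "bdd_above ((\<lambda>\<xi>. ell2_norm A (T \<xi>)) ` {\<xi> \<in> ell2 A. ell2_norm A \<xi> \<le> 1})"
    by (auto intro!: bdd_aboveI[of _ K])
  then show ?thesis
    unfolding op_norm_def using \<xi> by (intro cSUP_upper) auto
qed

lemma op_dist_coord:
  assumes S: "S \<in> bounded_operators A" and T: "T \<in> bounded_operators A"
    and \<xi>: "\<xi> \<in> ell2 A" "ell2_norm A \<xi> \<le> 1"
  shows "cmod (S \<xi> \<gamma> - T \<xi> \<gamma>) \<le> op_dist A S T"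
proof -
  note D = op_diff_bounded[OF S T]
  have "cmod (op_add A S (op_scale A (- 1) T) \<xi> \<gamma>) \<le> op_norm A (op_add A S (op_scale A (- 1) T))"
    using ell2_coord_le[OF bounded_operators_closed[OF D \<xi>(1)]] op_norm_bound[OF D \<xi>] order_trans by blast
  then show ?thesis
    using \<xi> by (simp add: op_dist_def op_add_def op_scale_def)
qed

lemma op_dist_self:
  assumes "T \<in> bounded_operators A"
  shows "op_dist A T T = 0"
proof -
  have "op_add A T (op_scale A (- 1) T) \<xi> = (\<lambda>\<gamma>. 0)" if "\<xi> \<in> ell2 A" for \<xi>
    using that by (simp add: op_add_def op_scale_def)
  moreover have "ell2_norm A (\<lambda>\<gamma>. 0) = 0"
    by (simp add: ell2_norm_def)
  moreover have "{\<xi> \<in> ell2 A. ell2_norm A \<xi> \<le> 1} \<noteq> {}"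
    using calculation(2) ell2_0 by (metis (mono_tags, lifting) empty_iff mem_Collect_eq zero_le_one)
  ultimately show ?thesis
    unfolding op_dist_def op_norm_def by (subst SUP_cong[OF refl, of _ _ "\<lambda>_. 0"]) auto
qed

lemma ell2_inner_summable:
  assumes "\<xi> \<in> ell2 A" "\<eta> \<in> ell2 A"
  shows "(\<lambda>\<gamma>. norm (\<xi> \<gamma> * cnj (\<eta> \<gamma>))) summable_on A"
proof (rule summable_on_comparison_test[OF summable_on_add[OF ell2_summable[OF assms(1)] ell2_summable[OF assms(2)]]])
  fix \<gamma>
  show "norm (\<xi> \<gamma> * cnj (\<eta> \<gamma>)) \<le> (cmod (\<xi> \<gamma>))\<^sup>2 + (cmod (\<eta> \<gamma>))\<^sup>2"
    using sum_squares_bound[of "cmod (\<xi> \<gamma>)" "cmod (\<eta> \<gamma>)"] mult_nonneg_nonneg[OF norm_ge_zero norm_ge_zero, of "\<xi> \<gamma>" "\<eta> \<gamma>"]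
    unfolding norm_mult complex_mod_cnj mult.assoc by linarith
qed simp

lemma ell2_Cauchy_Schwarz:
  assumes "\<xi> \<in> ell2 A" "\<eta> \<in> ell2 A"
  shows "cmod (ell2_inner A \<xi> \<eta>) \<le> ell2_norm A \<xi> * ell2_norm A \<eta>"
proof -
  have "cmod (ell2_inner A \<xi> \<eta>) \<le> (\<Sum>\<^sub>\<infinity>\<gamma>\<in>A. norm (\<xi> \<gamma> * cnj (\<eta> \<gamma>)))"
    unfolding ell2_inner_def using ell2_inner_summable[OF assms] by (rule norm_infsum_bound)
  also have "\<dots> \<le> ell2_norm A \<xi> * ell2_norm A \<eta>"
  proof (rule infsum_le_finite_sums[OF ell2_inner_summable[OF assms]])
    fix F assume F: "finite F" "F \<subseteq> A"
    have "(\<Sum>\<gamma>\<in>F. norm (\<xi> \<gamma> * cnj (\<eta> \<gamma>))) = (\<Sum>\<gamma>\<in>F. \<bar>cmod (\<xi> \<gamma>)\<bar> * \<bar>cmod (\<eta> \<gamma>)\<bar>)"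
      by (simp add: norm_mult)
    also have "\<dots> \<le> L2_set (\<lambda>\<gamma>. cmod (\<xi> \<gamma>)) F * L2_set (\<lambda>\<gamma>. cmod (\<eta> \<gamma>)) F"
      by (rule L2_set_mult_ineq)
    also have "\<dots> \<le> ell2_norm A \<xi> * ell2_norm A \<eta>"
    proof (rule mult_mono)
      show "L2_set (\<lambda>\<gamma>. cmod (\<xi> \<gamma>)) F \<le> ell2_norm A \<xi>" "L2_set (\<lambda>\<gamma>. cmod (\<eta> \<gamma>)) F \<le> ell2_norm A \<eta>"
        using ell2_sum_le[OF assms(1) F] ell2_sum_le[OF assms(2) F]
        by (simp_all add: L2_set_def real_le_lsqrt sum_nonneg)
    qed (simp_all add: L2_set_nonneg)
    finally show "(\<Sum>\<gamma>\<in>F. norm (\<xi> \<gamma> * cnj (\<eta> \<gamma>))) \<le> ell2_norm A \<xi> * ell2_norm A \<eta>" .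
  qed
  finally show ?thesis .
qed

lemma ell2_inner_lincomb_left:
  assumes "\<xi> \<in> ell2 A" "\<xi>' \<in> ell2 A" "\<eta> \<in> ell2 A"
  shows "ell2_inner A (\<lambda>\<gamma>. c * \<xi> \<gamma> + d * \<xi>' \<gamma>) \<eta> = c * ell2_inner A \<xi> \<eta> + d * ell2_inner A \<xi>' \<eta>"
proof -
  have s: "(\<lambda>\<gamma>. \<xi> \<gamma> * cnj (\<eta> \<gamma>)) summable_on A" "(\<lambda>\<gamma>. \<xi>' \<gamma> * cnj (\<eta> \<gamma>)) summable_on A"
    by (rule abs_summable_summable[OF ell2_inner_summable] assms)+
  have "ell2_inner A (\<lambda>\<gamma>. c * \<xi> \<gamma> + d * \<xi>' \<gamma>) \<eta> =
      (\<Sum>\<^sub>\<infinity>\<gamma>\<in>A. c * (\<xi> \<gamma> * cnj (\<eta> \<gamma>)) + d * (\<xi>' \<gamma> * cnj (\<eta> \<gamma>)))"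
    unfolding ell2_inner_def by (rule infsum_cong) (simp add: algebra_simps)
  also have "\<dots> = (\<Sum>\<^sub>\<infinity>\<gamma>\<in>A. c * (\<xi> \<gamma> * cnj (\<eta> \<gamma>))) + (\<Sum>\<^sub>\<infinity>\<gamma>\<in>A. d * (\<xi>' \<gamma> * cnj (\<eta> \<gamma>)))"
    using s by (intro infsum_add summable_on_cmult_right)
  also have "\<dots> = c * ell2_inner A \<xi> \<eta> + d * ell2_inner A \<xi>' \<eta>"
    using s by (simp add: ell2_inner_def infsum_cmult_right)
  finally show ?thesis .
qed

lemma ell2_inner_cnj: "ell2_inner A \<eta> \<xi> = cnj (ell2_inner A \<xi> \<eta>)"
  unfolding ell2_inner_def infsum_cnj[symmetric] by (simp add: mult.commute)

lemma ell2_inner_basis_vector: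
  assumes "\<beta> \<in> A"
  shows "ell2_inner A \<xi> (basis_vector \<beta>) = \<xi> \<beta>"
proof -
  have "ell2_inner A \<xi> (basis_vector \<beta>) = (\<Sum>\<^sub>\<infinity>\<gamma>\<in>{\<beta>}. \<xi> \<gamma> * cnj (basis_vector \<beta> \<gamma>))"
    unfolding ell2_inner_def by (rule infsum_cong_neutral) (use assms in \<open>auto simp: basis_vector_def\<close>)
  then show ?thesis by (simp add: basis_vector_def)
qed

lemma ell2_inner_finite_sum:
  assumes "finite F" "\<And>\<beta>. \<beta> \<in> F \<Longrightarrow> v \<beta> \<in> ell2 A" "\<eta> \<in> ell2 A"
  shows "(\<lambda>\<gamma>. \<Sum>\<beta>\<in>F. c \<beta> * v \<beta> \<gamma>) \<in> ell2 A \<and>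
    ell2_inner A (\<lambda>\<gamma>. \<Sum>\<beta>\<in>F. c \<beta> * v \<beta> \<gamma>) \<eta> = (\<Sum>\<beta>\<in>F. c \<beta> * ell2_inner A (v \<beta>) \<eta>)"
  using assms(1,2)
proof (induction rule: finite_induct)
  case empty
  then show ?case by (simp add: ell2_inner_def)
next
  case (insert \<beta> F)
  have v: "v \<beta> \<in> ell2 A" using insert.prems by simp
  have IH: "(\<lambda>\<gamma>. \<Sum>\<beta>\<in>F. c \<beta> * v \<beta> \<gamma>) \<in> ell2 A"
    "ell2_inner A (\<lambda>\<gamma>. \<Sum>\<beta>\<in>F. c \<beta> * v \<beta> \<gamma>) \<eta> = (\<Sum>\<beta>\<in>F. c \<beta> * ell2_inner A (v \<beta>) \<eta>)"
    using insert by auto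
  have eq: "(\<lambda>\<gamma>. \<Sum>\<beta>\<in>insert \<beta> F. c \<beta> * v \<beta> \<gamma>) = (\<lambda>\<gamma>. c \<beta> * v \<beta> \<gamma> + 1 * (\<Sum>\<beta>\<in>F. c \<beta> * v \<beta> \<gamma>))"
    using insert.hyps by (simp add: fun_eq_iff)
  show ?case
    unfolding eq using ell2_lincomb(1)[OF v IH(1), of "c \<beta>" 1]
      ell2_inner_lincomb_left[OF v IH(1) assms(3), of "c \<beta>" 1] IH(2) insert.hyps
    by simp
qed

text \<open>\<open>op_adjoint\<close> is a definite description, so adjoints can be transported only
  after existence and uniqueness are known. The construction is by matrix entries, with boundedness
  and the adjoint identity obtained from finitely supported vectors.\<close>

lemma adjoint_exists:
  assumes T: "T \<in> bounded_operators A"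
  shows "\<exists>!S. S \<in> bounded_operators A \<and>
    (\<forall>\<xi>\<in>ell2 A. \<forall>\<eta>\<in>ell2 A. ell2_inner A (T \<xi>) \<eta> = ell2_inner A \<xi> (S \<eta>))"
proof (rule ex_ex1I)
  obtain K where K: "0 \<le> K" "\<And>\<xi>. \<xi> \<in> ell2 A \<Longrightarrow> ell2_norm A (T \<xi>) \<le> K * ell2_norm A \<xi>"
    using bounded_operators_bound[OF T] by blast
  \<comment> \<open>The only possible value: pairing with the basis vector at \<beta> forces the
    coordinate of \<open>S \<eta>\<close> at \<beta> to be the inner product of \<eta> with the
    column of \<open>T\<close> at \<beta>.\<close>
  define S where "S = (\<lambda>\<eta>\<in>ell2 A. \<lambda>\<beta>. if \<beta> \<in> A then ell2_inner A \<eta> (T (basis_vector \<beta>)) else 0)"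
  have Tb: "T (basis_vector \<beta>) \<in> ell2 A" if "\<beta> \<in> A" for \<beta>
    using bounded_operators_closed[OF T basis_vector_ell2(1)[OF that]] .
  have fin: "ell2_inner A (T (\<lambda>\<gamma>. if \<gamma> \<in> F then \<xi> \<gamma> else 0)) \<eta> = (\<Sum>\<beta>\<in>F. \<xi> \<beta> * cnj (S \<eta> \<beta>))"
    if "\<xi> \<in> ell2 A" "\<eta> \<in> ell2 A" "finite F" "F \<subseteq> A" for \<xi> \<eta> F
  proof -
    have "ell2_inner A (T (\<lambda>\<gamma>. if \<gamma> \<in> F then \<xi> \<gamma> else 0)) \<eta> = (\<Sum>\<beta>\<in>F. \<xi> \<beta> * ell2_inner A (T (basis_vector \<beta>)) \<eta>)"
      unfolding bounded_operators_finite_sum[OF T that(1,3,4)]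
      using ell2_inner_finite_sum[OF that(3) _ that(2), of "\<lambda>\<beta>. T (basis_vector \<beta>)"] Tb that(4) by blast
    also have "\<dots> = (\<Sum>\<beta>\<in>F. \<xi> \<beta> * cnj (S \<eta> \<beta>))"
    proof (rule sum.cong[OF refl])
      fix \<beta> assume "\<beta> \<in> F"
      then have "S \<eta> \<beta> = ell2_inner A \<eta> (T (basis_vector \<beta>))"
        using that by (auto simp: S_def)
      then show "\<xi> \<beta> * ell2_inner A (T (basis_vector \<beta>)) \<eta> = \<xi> \<beta> * cnj (S \<eta> \<beta>)"
        by (metis ell2_inner_cnj)
    qed
    finally show ?thesis .
  qed
  have S_bound: "S \<eta> \<in> ell2 A \<and> ell2_norm A (S \<eta>) \<le> K * ell2_norm A \<eta>" if \<eta>: "\<eta> \<in> ell2 A" for \<eta>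
  proof -
    have *: "(\<Sum>\<gamma>\<in>F. (cmod (S \<eta> \<gamma>))\<^sup>2) \<le> (K * ell2_norm A \<eta>)\<^sup>2" if F: "finite F" "F \<subseteq> A" for F
    proof -
      \<comment> \<open>Testing against the truncation of \<open>S \<eta>\<close> itself gives
        \<open>N^2 \<le> K N\<close> times the norm of \<eta>, where \<open>N\<close> is the norm of
        the truncation; dividing by \<open>N\<close> bounds \<open>S\<close>.\<close>
      define \<zeta> where "\<zeta> = (\<lambda>\<gamma>. if \<gamma> \<in> F then S \<eta> \<gamma> else 0)"
      define N where "N = sqrt (\<Sum>\<gamma>\<in>F. (cmod (S \<eta> \<gamma>))\<^sup>2)"
      have N2: "N\<^sup>2 = (\<Sum>\<gamma>\<in>F. (cmod (S \<eta> \<gamma>))\<^sup>2)" and N0: "0 \<le> N"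
        unfolding N_def by (simp_all add: sum_nonneg)
      have \<zeta>_sum: "(\<Sum>\<gamma>\<in>F'. (cmod (\<zeta> \<gamma>))\<^sup>2) \<le> N\<^sup>2" if "finite F'" "F' \<subseteq> A" for F'
      proof -
        have "(\<Sum>\<gamma>\<in>F'. (cmod (\<zeta> \<gamma>))\<^sup>2) = (\<Sum>\<gamma>\<in>F' \<inter> F. (cmod (S \<eta> \<gamma>))\<^sup>2)"
          using that by (intro sum.mono_neutral_cong_right) (auto simp: \<zeta>_def)
        also have "\<dots> \<le> N\<^sup>2"
          unfolding N2 using F by (intro sum_mono2) auto
        finally show ?thesis .
      qed
      have "\<zeta> \<gamma> = 0" if "\<gamma> \<notin> A" for \<gamma>
        using F that by (auto simp: \<zeta>_def)
      then have \<zeta>: "\<zeta> \<in> ell2 A" "ell2_norm A \<zeta> \<le> N"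
        using ell2I[of A \<zeta> N] \<zeta>_sum N0 by blast+
      have "ell2_inner A (T (\<lambda>\<gamma>. if \<gamma> \<in> F then \<zeta> \<gamma> else 0)) \<eta> = (\<Sum>\<beta>\<in>F. \<zeta> \<beta> * cnj (S \<eta> \<beta>))"
        using fin[OF \<zeta>(1) \<eta> F] .
      also have "\<dots> = (\<Sum>\<beta>\<in>F. of_real ((cmod (S \<eta> \<beta>))\<^sup>2))"
        by (intro sum.cong refl) (simp only: \<zeta>_def complex_norm_square, simp)
      also have "\<dots> = of_real (N\<^sup>2)"
        by (simp add: N2)
      finally have "N\<^sup>2 = cmod (ell2_inner A (T (\<lambda>\<gamma>. if \<gamma> \<in> F then \<zeta> \<gamma> else 0)) \<eta>)"
        by (simp only: norm_of_real) simp
      also have "(\<lambda>\<gamma>. if \<gamma> \<in> F then \<zeta> \<gamma> else 0) = \<zeta>"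
        by (auto simp: \<zeta>_def)
      finally have "N\<^sup>2 \<le> ell2_norm A (T \<zeta>) * ell2_norm A \<eta>"
        using ell2_Cauchy_Schwarz[OF bounded_operators_closed[OF T \<zeta>(1)] \<eta>] by simp
      also have "\<dots> \<le> (K * N) * ell2_norm A \<eta>"
        using K(2)[OF \<zeta>(1)] mult_left_mono[OF \<zeta>(2) K(1)] by (intro mult_right_mono) auto
      finally have "N * N \<le> (K * ell2_norm A \<eta>) * N"
        by (simp add: power2_eq_square algebra_simps)
      then have "N \<le> K * ell2_norm A \<eta>"
        using N0 K(1) by (cases "N = 0") auto
      then show ?thesis
        using N0 power_mono[of N "K * ell2_norm A \<eta>" 2] N2 by simp
    qed
    have "0 \<le> K * ell2_norm A \<eta>" using K(1) by simp
    from ell2I[OF _ * this] show ?thesis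
      using \<eta> by (auto simp: S_def)
  qed
  have "S \<in> ell2 A \<rightarrow>\<^sub>E ell2 A"
    using S_bound by (auto simp: S_def PiE_def)
  moreover have "S (\<lambda>\<gamma>. c * \<xi> \<gamma> + d * \<eta> \<gamma>) = (\<lambda>\<gamma>. c * S \<xi> \<gamma> + d * S \<eta> \<gamma>)"
    if "\<xi> \<in> ell2 A" "\<eta> \<in> ell2 A" for \<xi> \<eta> c d
    using ell2_inner_lincomb_left[OF that Tb] ell2_lincomb(1)[OF that] that by (auto simp: S_def fun_eq_iff)
  ultimately have "S \<in> bounded_operators A"
    unfolding bounded_operators_def using S_bound by blast
  moreover have "ell2_inner A (T \<xi>) \<eta> = ell2_inner A \<xi> (S \<eta>)" if \<xi>: "\<xi> \<in> ell2 A" and \<eta>: "\<eta> \<in> ell2 A" for \<xi> \<eta>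
  proof -
    \<comment> \<open>The truncation error is multiplied by the norms of \<eta> and of
      \<open>S \<eta>\<close>; the summand 1 only keeps the divisor positive.\<close>
    define M where "M = ell2_norm A \<eta> + ell2_norm A (S \<eta>) + 1"
    have M: "M > 0" "ell2_norm A \<eta> + ell2_norm A (S \<eta>) \<le> M"
      unfolding M_def by (simp_all add: add_nonneg_pos)
    have "cmod (ell2_inner A (T \<xi>) \<eta> - ell2_inner A \<xi> (S \<eta>)) \<le> 0 + \<epsilon>" if "0 < \<epsilon>" for \<epsilon>
    proof -
      have pos: "0 < \<epsilon> / M" using that M by simp
      obtain F where F: "finite F" "F \<subseteq> A"
        "ell2_norm A (\<lambda>\<gamma>. \<xi> \<gamma> - (if \<gamma> \<in> F then \<xi> \<gamma> else 0)) \<le> \<epsilon> / M"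
        "ell2_norm A (\<lambda>\<gamma>. T \<xi> \<gamma> - (\<Sum>\<beta>\<in>F. \<xi> \<beta> * T (basis_vector \<beta>) \<gamma>)) \<le> \<epsilon> / M"
        by (rule bounded_operators_approximation[OF T \<xi> pos])
      let ?\<xi>F = "\<lambda>\<gamma>. if \<gamma> \<in> F then \<xi> \<gamma> else 0"
      have \<xi>F: "?\<xi>F \<in> ell2 A" using ell2_restrict(1)[OF \<xi>] .
      have T\<xi>: "T \<xi> \<in> ell2 A" "T ?\<xi>F \<in> ell2 A" using bounded_operators_closed[OF T] \<xi> \<xi>F by auto
      have S\<eta>: "S \<eta> \<in> ell2 A" using S_bound \<eta> by blast
      have "ell2_inner A ?\<xi>F (S \<eta>) = (\<Sum>\<^sub>\<infinity>\<gamma>\<in>F. \<xi> \<gamma> * cnj (S \<eta> \<gamma>))"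
        unfolding ell2_inner_def by (rule infsum_cong_neutral) (use F in auto)
      then have eqF: "ell2_inner A (T ?\<xi>F) \<eta> = ell2_inner A ?\<xi>F (S \<eta>)"
        using fin[OF \<xi> \<eta> F(1,2)] F(1) by simp
      have 1: "ell2_inner A (T \<xi>) \<eta> - ell2_inner A (T ?\<xi>F) \<eta> = ell2_inner A (\<lambda>\<gamma>. 1 * T \<xi> \<gamma> + (- 1) * T ?\<xi>F \<gamma>) \<eta>"
        using ell2_inner_lincomb_left[OF T\<xi> \<eta>, of 1 "- 1"] by simp
      have 2: "ell2_inner A \<xi> (S \<eta>) - ell2_inner A ?\<xi>F (S \<eta>) = ell2_inner A (\<lambda>\<gamma>. 1 * \<xi> \<gamma> + (- 1) * ?\<xi>F \<gamma>) (S \<eta>)"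
        using ell2_inner_lincomb_left[OF \<xi> \<xi>F S\<eta>, of 1 "- 1"] by simp
      have "cmod (ell2_inner A (T \<xi>) \<eta> - ell2_inner A (T ?\<xi>F) \<eta>) \<le> \<epsilon> / M * ell2_norm A \<eta>"
        unfolding 1
        by (rule order_trans[OF ell2_Cauchy_Schwarz[OF ell2_lincomb(1)[OF T\<xi>] \<eta>]], rule mult_right_mono)
          (use F(4) bounded_operators_finite_sum[OF T \<xi> F(1,2)] in auto)
      moreover have "cmod (ell2_inner A \<xi> (S \<eta>) - ell2_inner A ?\<xi>F (S \<eta>)) \<le> \<epsilon> / M * ell2_norm A (S \<eta>)"
        unfolding 2
        by (rule order_trans[OF ell2_Cauchy_Schwarz[OF ell2_lincomb(1)[OF \<xi> \<xi>F] S\<eta>]], rule mult_right_mono)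
          (use F(3) in auto)
      moreover have "ell2_inner A (T \<xi>) \<eta> - ell2_inner A \<xi> (S \<eta>) =
          (ell2_inner A (T \<xi>) \<eta> - ell2_inner A (T ?\<xi>F) \<eta>) - (ell2_inner A \<xi> (S \<eta>) - ell2_inner A ?\<xi>F (S \<eta>))"
        using eqF by simp
      ultimately have "cmod (ell2_inner A (T \<xi>) \<eta> - ell2_inner A \<xi> (S \<eta>)) \<le>
          \<epsilon> / M * ell2_norm A \<eta> + \<epsilon> / M * ell2_norm A (S \<eta>)"
        by (simp only:) (rule order_trans[OF norm_triangle_ineq4 add_mono])
      also have "\<dots> = \<epsilon> / M * (ell2_norm A \<eta> + ell2_norm A (S \<eta>))"
        by (simp add: algebra_simps)
      also have "\<dots> \<le> \<epsilon> / M * M"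
        using M that by (intro mult_left_mono) auto
      finally show ?thesis using M(1) by simp
    qed
    then have "cmod (ell2_inner A (T \<xi>) \<eta> - ell2_inner A \<xi> (S \<eta>)) \<le> 0" by (rule field_le_epsilon)
    then show ?thesis by simp
  qed
  ultimately show "\<exists>S. S \<in> bounded_operators A \<and>
    (\<forall>\<xi>\<in>ell2 A. \<forall>\<eta>\<in>ell2 A. ell2_inner A (T \<xi>) \<eta> = ell2_inner A \<xi> (S \<eta>))" by blast
next
  fix S S'
  assume S: "S \<in> bounded_operators A \<and>
    (\<forall>\<xi>\<in>ell2 A. \<forall>\<eta>\<in>ell2 A. ell2_inner A (T \<xi>) \<eta> = ell2_inner A \<xi> (S \<eta>))"
    and S': "S' \<in> bounded_operators A \<and>
    (\<forall>\<xi>\<in>ell2 A. \<forall>\<eta>\<in>ell2 A. ell2_inner A (T \<xi>) \<eta> = ell2_inner A \<xi> (S' \<eta>))"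
  have "S \<eta> \<gamma> = S' \<eta> \<gamma>" if \<eta>: "\<eta> \<in> ell2 A" for \<eta> \<gamma>
  proof (cases "\<gamma> \<in> A")
    case True
    then have "ell2_inner A (basis_vector \<gamma>) (S \<eta>) = ell2_inner A (basis_vector \<gamma>) (S' \<eta>)"
      using S S' \<eta> basis_vector_ell2(1) by metis
    then show ?thesis
      using ell2_inner_cnj ell2_inner_basis_vector[OF True] by (metis complex_cnj_cancel_iff)
  next
    case False
    then show ?thesis
      using S S' \<eta> bounded_operators_closed ell2_zero by metis
  qed
  moreover have "S \<in> extensional (ell2 A)" "S' \<in> extensional (ell2 A)"
    using S S' by (auto simp: bounded_operators_def PiE_def)
  ultimately show "S = S'"
    by (intro extensionalityI[of S "ell2 A" S']) auto
qed

section \<open>Transport of the reduced algebra\<close>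

text \<open>Composition with \<open>f\<close>, cut off outside \<open>A\<close> because vectors of
  \<open>ell2 A\<close> vanish there. For a bijection it is the unitary from \<open>ell2 B\<close>
  onto \<open>ell2 A\<close> that permutes the basis.\<close>

definition pull :: "'a set \<Rightarrow> ('a \<Rightarrow> 'b) \<Rightarrow> ('b \<Rightarrow> complex) \<Rightarrow> 'a \<Rightarrow> complex" where
  "pull A f \<xi> = (\<lambda>a. if a \<in> A then \<xi> (f a) else 0)"

locale index_bijection =
  fixes A :: "'a set" and B :: "'b set" and f :: "'a \<Rightarrow> 'b" and g :: "'b \<Rightarrow> 'a"
  assumes f_closed: "a \<in> A \<Longrightarrow> f a \<in> B" and g_closed: "b \<in> B \<Longrightarrow> g b \<in> A"
    and g_f: "a \<in> A \<Longrightarrow> g (f a) = a" and f_g: "b \<in> B \<Longrightarrow> f (g b) = b"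
begin

lemma swap: "index_bijection B A g f"
  by unfold_locales (simp_all add: f_closed g_closed g_f f_g)

lemma bij: "bij_betw f A B"
  by (rule bij_betw_byWitness[of _ g]) (auto simp: f_closed g_closed g_f f_g)

lemma pull_ell2: "\<eta> \<in> ell2 B \<Longrightarrow> pull A f \<eta> \<in> ell2 A"
  using summable_on_reindex_bij_betw[OF bij, of "\<lambda>b. (cmod (\<eta> b))\<^sup>2"]
    summable_on_cong[of A "\<lambda>a. (cmod (pull A f \<eta> a))\<^sup>2" "\<lambda>a. (cmod (\<eta> (f a)))\<^sup>2"]
  by (simp add: ell2_def pull_def)

lemma norm_pull: "ell2_norm A (pull A f \<eta>) = ell2_norm B \<eta>"
  using infsum_reindex_bij_betw[OF bij, of "\<lambda>b. (cmod (\<eta> b))\<^sup>2"]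
    infsum_cong[of A "\<lambda>a. (cmod (pull A f \<eta> a))\<^sup>2" "\<lambda>a. (cmod (\<eta> (f a)))\<^sup>2"]
  by (simp add: ell2_norm_def pull_def)

lemma inner_pull: "ell2_inner A (pull A f \<xi>) (pull A f \<eta>) = ell2_inner B \<xi> \<eta>"
  using infsum_reindex_bij_betw[OF bij, of "\<lambda>b. \<xi> b * cnj (\<eta> b)"]
    infsum_cong[of A "\<lambda>a. pull A f \<xi> a * cnj (pull A f \<eta> a)" "\<lambda>a. \<xi> (f a) * cnj (\<eta> (f a))"]
  by (simp add: ell2_inner_def pull_def)

lemma pull_pull: "\<eta> \<in> ell2 B \<Longrightarrow> pull B g (pull A f \<eta>) = \<eta>"
  by (auto simp: pull_def fun_eq_iff g_closed f_g ell2_zero)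

lemma pull_lincomb: "pull A f (\<lambda>b. c * \<xi> b + d * \<eta> b) = (\<lambda>a. c * pull A f \<xi> a + d * pull A f \<eta> a)"
  by (auto simp: pull_def)

text \<open>Conjugation by that unitary, whose inverse is \<open>pull B g\<close>; extensional like
  all operators here.\<close>

definition conj :: "'a ell2_operator \<Rightarrow> 'b ell2_operator" where
  "conj T = (\<lambda>\<eta>\<in>ell2 B. pull B g (T (pull A f \<eta>)))"

lemma conj_bounded:
  assumes T: "T \<in> bounded_operators A"
  shows "conj T \<in> bounded_operators B"
proof -
  interpret inv: index_bijection B A g f by (rule swap)
  obtain K where K: "\<And>\<xi>. \<xi> \<in> ell2 A \<Longrightarrow> ell2_norm A (T \<xi>) \<le> K * ell2_norm A \<xi>"
    using bounded_operators_bound[OF T] by blast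
  have "conj T \<in> ell2 B \<rightarrow>\<^sub>E ell2 B"
    using bounded_operators_closed[OF T] by (auto simp: conj_def pull_ell2 inv.pull_ell2)
  moreover have "conj T (\<lambda>b. c * \<xi> b + d * \<eta> b) = (\<lambda>b. c * conj T \<xi> b + d * conj T \<eta> b)"
    if "\<xi> \<in> ell2 B" "\<eta> \<in> ell2 B" for \<xi> \<eta> c d
    using that bounded_operators_linear[OF T pull_ell2[OF that(1)] pull_ell2[OF that(2)]]
    by (simp add: conj_def ell2_lincomb pull_lincomb inv.pull_lincomb)
  moreover have "ell2_norm B (conj T \<eta>) \<le> K * ell2_norm B \<eta>" if "\<eta> \<in> ell2 B" for \<eta>
    using K[OF pull_ell2[OF that]] that by (simp add: conj_def norm_pull inv.norm_pull)
  ultimately show ?thesis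
    unfolding bounded_operators_def by blast
qed

lemma conj_inverse:
  assumes "T \<in> bounded_operators A"
  shows "index_bijection.conj B A g f (conj T) = T"
proof -
  interpret inv: index_bijection B A g f by (rule swap)
  have "T \<in> extensional (ell2 A)"
    using assms by (auto simp: bounded_operators_def PiE_def)
  moreover have "inv.conj (conj T) \<xi> = T \<xi>" if "\<xi> \<in> ell2 A" for \<xi>
    using that bounded_operators_closed[OF assms that]
    by (simp add: inv.conj_def conj_def inv.pull_ell2 inv.pull_pull)
  ultimately show ?thesis
    by (intro extensionalityI[of _ "ell2 A"]) (auto simp: inv.conj_def)
qed

lemma conj_add: "conj (op_add A S T) = op_add B (conj S) (conj T)"
  by (auto simp: conj_def op_add_def pull_ell2 fun_eq_iff restrict_def) (auto simp: pull_def)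

lemma conj_scale: "conj (op_scale A c T) = op_scale B c (conj T)"
  by (auto simp: conj_def op_scale_def pull_ell2 fun_eq_iff restrict_def) (auto simp: pull_def)

lemma conj_mult:
  assumes "T \<in> bounded_operators A"
  shows "conj (op_mult A S T) = op_mult B (conj S) (conj T)"
proof -
  interpret inv: index_bijection B A g f by (rule swap)
  show ?thesis
    using bounded_operators_closed[OF assms]
    by (auto simp: conj_def op_mult_def pull_ell2 inv.pull_ell2 inv.pull_pull fun_eq_iff restrict_def)
qed

lemma conj_adjoint:
  assumes T: "T \<in> bounded_operators A"
  shows "conj (op_adjoint A T) = op_adjoint B (conj T)"
proof -
  interpret inv: index_bijection B A g f by (rule swap)
  have adj: "op_adjoint A T \<in> bounded_operators A"
    "\<And>\<xi> \<eta>. \<xi> \<in> ell2 A \<Longrightarrow> \<eta> \<in> ell2 A \<Longrightarrow> ell2_inner A (T \<xi>) \<eta> = ell2_inner A \<xi> (op_adjoint A T \<eta>)"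
    using theI'[OF adjoint_exists[OF T], folded op_adjoint_def] by blast+
  have "ell2_inner B (conj T \<xi>) \<eta> = ell2_inner B \<xi> (conj (op_adjoint A T) \<eta>)"
    if "\<xi> \<in> ell2 B" "\<eta> \<in> ell2 B" for \<xi> \<eta>
  proof -
    have "ell2_inner B (conj T \<xi>) \<eta> = ell2_inner B (pull B g (T (pull A f \<xi>))) (pull B g (pull A f \<eta>))"
      using that by (simp add: conj_def pull_pull)
    also have "\<dots> = ell2_inner A (pull A f \<xi>) (op_adjoint A T (pull A f \<eta>))"
      using adj(2) that by (simp add: inv.inner_pull pull_ell2)
    also have "\<dots> = ell2_inner B (pull B g (pull A f \<xi>)) (conj (op_adjoint A T) \<eta>)"
      using that by (simp add: conj_def inv.inner_pull)
    finally show ?thesis using that by (simp add: pull_pull)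
  qed
  then show ?thesis
    unfolding op_adjoint_def[of B]
    by (intro the1_equality[OF adjoint_exists[OF conj_bounded[OF T]], symmetric] conjI conj_bounded adj) blast
qed

lemma op_norm_conj: "op_norm B (conj T) = op_norm A T"
proof -
  interpret inv: index_bijection B A g f by (rule swap)
  have "(\<lambda>\<eta>. ell2_norm B (conj T \<eta>)) ` {\<eta> \<in> ell2 B. ell2_norm B \<eta> \<le> 1} =
      (\<lambda>\<xi>. ell2_norm A (T \<xi>)) ` {\<xi> \<in> ell2 A. ell2_norm A \<xi> \<le> 1}" (is "?L = ?R")
  proof
    show "?L \<subseteq> ?R"
    proof
      fix r assume "r \<in> ?L"
      then obtain \<eta> where "\<eta> \<in> ell2 B" "ell2_norm B \<eta> \<le> 1" "r = ell2_norm B (conj T \<eta>)" by blast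
      then show "r \<in> ?R"
        by (intro image_eqI[of _ _ "pull A f \<eta>"]) (auto simp: conj_def inv.norm_pull norm_pull pull_ell2)
    qed
    show "?R \<subseteq> ?L"
    proof
      fix r assume "r \<in> ?R"
      then obtain \<xi> where "\<xi> \<in> ell2 A" "ell2_norm A \<xi> \<le> 1" "r = ell2_norm A (T \<xi>)" by blast
      then show "r \<in> ?L"
        by (intro image_eqI[of _ _ "pull B g \<xi>"])
          (auto simp: conj_def inv.norm_pull inv.pull_ell2 inv.pull_pull)
    qed
  qed
  then show ?thesis by (simp add: op_norm_def)
qed

lemma op_dist_conj: "op_dist B (conj S) (conj T) = op_dist A S T"
  by (simp add: op_dist_def op_norm_conj flip: conj_add conj_scale)

end

locale groupoid_transport =
  fixes \<A> :: "('a, 'm) top_groupoid_scheme" and \<B> :: "('b, 'n) top_groupoid_scheme"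
    and \<Lambda> :: "'a \<Rightarrow> 'b" and \<Lambda>' :: "'b \<Rightarrow> 'a"
  assumes iso: "groupoid_iso \<A> \<B> \<Lambda>" "groupoid_iso \<B> \<A> \<Lambda>'"
    and maps: "homeomorphic_maps (sg_top \<A>) (sg_top \<B>) \<Lambda> \<Lambda>'"
    and mult_closed: "\<alpha> \<in> topspace (sg_top \<A>) \<Longrightarrow> \<beta> \<in> topspace (sg_top \<A>) \<Longrightarrow> sg_comp \<A> \<alpha> \<beta> \<Longrightarrow>
      sg_mult \<A> \<alpha> \<beta> \<in> topspace (sg_top \<A>)"
    "\<alpha>' \<in> topspace (sg_top \<B>) \<Longrightarrow> \<beta>' \<in> topspace (sg_top \<B>) \<Longrightarrow> sg_comp \<B> \<alpha>' \<beta>' \<Longrightarrow>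
      sg_mult \<B> \<alpha>' \<beta>' \<in> topspace (sg_top \<B>)"
begin

lemma transport_swap: "groupoid_transport \<B> \<A> \<Lambda>' \<Lambda>"
  by unfold_locales (use iso maps mult_closed in \<open>auto simp: homeomorphic_maps_def\<close>)

sublocale index_bijection "topspace (sg_top \<A>)" "topspace (sg_top \<B>)" \<Lambda> \<Lambda>'
  by unfold_locales (use maps in \<open>auto simp: homeomorphic_maps_def continuous_map_def\<close>)

text \<open>The convolution sum runs over factorisations of \<gamma>, and an isomorphism of
  groupoids carries factorisations bijectively to factorisations.\<close>

lemma conj_regular_rep:
  "conj (regular_rep \<A> f) = regular_rep \<B> (pull (topspace (sg_top \<B>)) \<Lambda>' f)"
proof -
  let ?A = "topspace (sg_top \<A>)" and ?B = "topspace (sg_top \<B>)"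
  have "conj (regular_rep \<A> f) \<eta> \<gamma> = regular_rep \<B> (pull ?B \<Lambda>' f) \<eta> \<gamma>" if \<eta>: "\<eta> \<in> ell2 ?B" for \<eta> \<gamma>
  proof (cases "\<gamma> \<in> ?B")
    case True
    have hA: "\<And>\<alpha> \<beta>. \<alpha> \<in> ?A \<Longrightarrow> \<beta> \<in> ?A \<Longrightarrow> sg_comp \<A> \<alpha> \<beta> \<longleftrightarrow> sg_comp \<B> (\<Lambda> \<alpha>) (\<Lambda> \<beta>)"
      "\<And>\<alpha> \<beta>. \<alpha> \<in> ?A \<Longrightarrow> \<beta> \<in> ?A \<Longrightarrow> sg_comp \<A> \<alpha> \<beta> \<Longrightarrow> \<Lambda> (sg_mult \<A> \<alpha> \<beta>) = sg_mult \<B> (\<Lambda> \<alpha>) (\<Lambda> \<beta>)"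
      using iso(1) unfolding groupoid_iso_def semigroupoid_iso_def by blast+
    have hB: "\<And>\<alpha> \<beta>. \<alpha> \<in> ?B \<Longrightarrow> \<beta> \<in> ?B \<Longrightarrow> sg_comp \<B> \<alpha> \<beta> \<longleftrightarrow> sg_comp \<A> (\<Lambda>' \<alpha>) (\<Lambda>' \<beta>)"
      "\<And>\<alpha> \<beta>. \<alpha> \<in> ?B \<Longrightarrow> \<beta> \<in> ?B \<Longrightarrow> sg_comp \<B> \<alpha> \<beta> \<Longrightarrow> \<Lambda>' (sg_mult \<B> \<alpha> \<beta>) = sg_mult \<A> (\<Lambda>' \<alpha>) (\<Lambda>' \<beta>)"
      using iso(2) unfolding groupoid_iso_def semigroupoid_iso_def by blast+
    have "conj (regular_rep \<A> f) \<eta> \<gamma> =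
        (\<Sum>\<^sub>\<infinity>(\<alpha>, \<beta>)\<in>{(\<alpha>, \<beta>). \<alpha> \<in> ?A \<and> \<beta> \<in> ?A \<and> sg_comp \<A> \<alpha> \<beta> \<and> sg_mult \<A> \<alpha> \<beta> = \<Lambda>' \<gamma>}. f \<alpha> * pull ?A \<Lambda> \<eta> \<beta>)"
      using True \<eta> pull_ell2[OF \<eta>] by (simp add: conj_def regular_rep_def) (simp add: pull_def)
    also have "\<dots> = (\<Sum>\<^sub>\<infinity>(\<alpha>, \<beta>)\<in>{(\<alpha>, \<beta>). \<alpha> \<in> ?B \<and> \<beta> \<in> ?B \<and> sg_comp \<B> \<alpha> \<beta> \<and> sg_mult \<B> \<alpha> \<beta> = \<gamma>}.
        pull ?B \<Lambda>' f \<alpha> * \<eta> \<beta>)"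
      by (rule infsum_reindex_bij_witness[of _ "map_prod \<Lambda>' \<Lambda>'" "map_prod \<Lambda> \<Lambda>"])
        (use True in \<open>auto simp: f_closed g_closed f_g g_f hA(1)[symmetric] hB(1)[symmetric]
          simp flip: hA(2) hB(2), auto simp: pull_def f_closed g_f\<close>)
    also have "\<dots> = regular_rep \<B> (pull ?B \<Lambda>' f) \<eta> \<gamma>"
      using \<eta> by (simp add: regular_rep_def)
    finally show ?thesis .
  next
    case False
    then have empty: "{(\<alpha>, \<beta>). \<alpha> \<in> ?B \<and> \<beta> \<in> ?B \<and> sg_comp \<B> \<alpha> \<beta> \<and> sg_mult \<B> \<alpha> \<beta> = \<gamma>} = {}"
      using mult_closed(2) by blast
    have "regular_rep \<B> (pull ?B \<Lambda>' f) \<eta> \<gamma> = 0"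
      using \<eta> by (simp only: regular_rep_def restrict_apply' empty infsum_empty)
    then show ?thesis
      using False \<eta> by (simp add: conj_def pull_def)
  qed
  then show ?thesis
  proof (intro extensionalityI[of _ "ell2 ?B"] ext)
    show "conj (regular_rep \<A> f) \<in> extensional (ell2 ?B)" by (simp add: conj_def)
    show "regular_rep \<B> (pull ?B \<Lambda>' f) \<in> extensional (ell2 ?B)" by (simp add: regular_rep_def)
  qed
qed

lemma pull_Cc:
  assumes "f \<in> Cc \<A>"
  shows "pull (topspace (sg_top \<B>)) \<Lambda>' f \<in> Cc \<B>"
proof -
  let ?A = "topspace (sg_top \<A>)" and ?B = "topspace (sg_top \<B>)"
  have f: "continuous_map (sg_top \<A>) euclidean f"
    "compactin (sg_top \<A>) (sg_top \<A> closure_of {\<gamma> \<in> ?A. f \<gamma> \<noteq> 0})"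
    using assms unfolding Cc_def by auto
  have \<Lambda>: "homeomorphic_map (sg_top \<A>) (sg_top \<B>) \<Lambda>"
    using maps by (rule homeomorphic_maps_imp_map)
  have "continuous_map (sg_top \<B>) euclidean (f \<circ> \<Lambda>')"
    using maps f(1) continuous_map_compose unfolding homeomorphic_maps_def by blast
  then have 1: "continuous_map (sg_top \<B>) euclidean (pull ?B \<Lambda>' f)"
    by (rule continuous_map_eq) (simp add: pull_def)
  have "{\<gamma> \<in> ?B. pull ?B \<Lambda>' f \<gamma> \<noteq> 0} = \<Lambda> ` {\<gamma> \<in> ?A. f \<gamma> \<noteq> 0}"
  proof
    show "{\<gamma> \<in> ?B. pull ?B \<Lambda>' f \<gamma> \<noteq> 0} \<subseteq> \<Lambda> ` {\<gamma> \<in> ?A. f \<gamma> \<noteq> 0}"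
    proof
      fix \<gamma> assume "\<gamma> \<in> {\<gamma> \<in> ?B. pull ?B \<Lambda>' f \<gamma> \<noteq> 0}"
      then show "\<gamma> \<in> \<Lambda> ` {\<gamma> \<in> ?A. f \<gamma> \<noteq> 0}"
        by (intro image_eqI[of _ _ "\<Lambda>' \<gamma>"]) (auto simp: pull_def g_closed f_g)
    qed
  qed (auto simp: pull_def f_closed g_f)
  then have "sg_top \<B> closure_of {\<gamma> \<in> ?B. pull ?B \<Lambda>' f \<gamma> \<noteq> 0} = \<Lambda> ` (sg_top \<A> closure_of {\<gamma> \<in> ?A. f \<gamma> \<noteq> 0})"
    using homeomorphic_map_closure_of[OF \<Lambda>, of "{\<gamma> \<in> ?A. f \<gamma> \<noteq> 0}"] by auto
  then have 2: "compactin (sg_top \<B>) (sg_top \<B> closure_of {\<gamma> \<in> ?B. pull ?B \<Lambda>' f \<gamma> \<noteq> 0})"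
    using image_compactin[OF f(2) homeomorphic_imp_continuous_map[OF \<Lambda>]] by simp
  show ?thesis
    using 1 2 by (simp add: Cc_def) (simp add: pull_def)
qed

lemma conj_reduced_algebra:
  assumes "T \<in> reduced_algebra \<A>"
  shows "conj T \<in> reduced_algebra \<B>"
  unfolding reduced_algebra_def
proof (intro CollectI conjI allI impI)
  show "conj T \<in> bounded_operators (topspace (sg_top \<B>))"
    using assms conj_bounded unfolding reduced_algebra_def by blast
  fix \<epsilon> :: real assume "0 < \<epsilon>"
  then obtain f where f: "f \<in> Cc \<A>" "op_dist (topspace (sg_top \<A>)) T (regular_rep \<A> f) < \<epsilon>"
    using assms unfolding reduced_algebra_def by blast
  then show "\<exists>f\<in>Cc \<B>. op_dist (topspace (sg_top \<B>)) (conj T) (regular_rep \<B> f) < \<epsilon>"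
    using op_dist_conj[of T "regular_rep \<A> f"] pull_Cc conj_regular_rep by (metis (no_types, lifting))
qed

lemma reduced_algebra_iso_conj: "reduced_algebra_iso \<A> \<B> conj"
proof -
  interpret inv: groupoid_transport \<B> \<A> \<Lambda>' \<Lambda> by (rule transport_swap)
  have bounded: "reduced_algebra \<A> \<subseteq> bounded_operators (topspace (sg_top \<A>))"
    "reduced_algebra \<B> \<subseteq> bounded_operators (topspace (sg_top \<B>))"
    unfolding reduced_algebra_def by blast+
  have "bij_betw conj (reduced_algebra \<A>) (reduced_algebra \<B>)"
    using bounded conj_reduced_algebra inv.conj_reduced_algebra conj_inverse inv.conj_inverse
    by (intro bij_betw_byWitness[of _ inv.conj]) auto
  then show ?thesis
    unfolding reduced_algebra_iso_def star_isomorphism_def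
    using bounded(1) conj_add conj_scale conj_mult conj_adjoint by blast
qed

end

text \<open>The isomorphism is conjugation by the unitary that \<Lambda> induces. Since \<Lambda>
  sends the unit at \<open>x\<close> to the unit at \<open>\<phi> x\<close>, a diagonal function is
  carried to its composition with \<psi>, which accounts for the diagonal subalgebras.\<close>

lemma groupoids_isomorphic_imp_reduced_algebra_iso:
  fixes G :: "'g monoid" and X :: "'x topology" and H :: "'h monoid" and Y :: "'y topology"
  assumes X: "semigroup_action G X P \<theta>" and Y: "semigroup_action H Y S \<rho>"
    and "groupoids_isomorphic (transformation_groupoid G X P \<theta>) (transformation_groupoid H Y S \<rho>)"
  shows "\<exists>\<Phi>. reduced_algebra_iso (transformation_groupoid G X P \<theta>) (transformation_groupoid H Y S \<rho>) \<Phi> \<and>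
    \<Phi> ` diagonal_subalgebra G X P \<theta> = diagonal_subalgebra H Y S \<rho>"
proof -
  interpret X: semigroup_action G X P \<theta> by (rule X)
  interpret Y: semigroup_action H Y S \<rho> by (rule Y)
  obtain \<Lambda> \<Lambda>' \<phi> \<psi> where iso: "groupoid_iso X.gpd Y.gpd \<Lambda>" "groupoid_iso Y.gpd X.gpd \<Lambda>'"
    and maps: "homeomorphic_maps (sg_top X.gpd) (sg_top Y.gpd) \<Lambda> \<Lambda>'" and hm: "homeomorphic_maps X Y \<phi> \<psi>"
    and unit: "\<And>x. x \<in> topspace X \<Longrightarrow> \<Lambda> (x, \<one>\<^bsub>G\<^esub>, x) = (\<phi> x, \<one>\<^bsub>H\<^esub>, \<phi> x)"
      "\<And>y. y \<in> topspace Y \<Longrightarrow> \<Lambda>' (y, \<one>\<^bsub>H\<^esub>, y) = (\<psi> y, \<one>\<^bsub>G\<^esub>, \<psi> y)"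
    using groupoids_isomorphic_obtain[OF assms] by metis
  interpret t: groupoid_transport X.gpd Y.gpd \<Lambda> \<Lambda>'
    using iso maps X.sg_mult_closed Y.sg_mult_closed by unfold_locales
  interpret t': groupoid_transport Y.gpd X.gpd \<Lambda>' \<Lambda>
    by (rule t.transport_swap)
  have \<phi>: "continuous_map X Y \<phi>" and \<psi>: "continuous_map Y X \<psi>"
    and \<psi>_in: "\<And>y. y \<in> topspace Y \<Longrightarrow> \<psi> y \<in> topspace X" and \<phi>_in: "\<And>x. x \<in> topspace X \<Longrightarrow> \<phi> x \<in> topspace Y"
    using hm by (auto simp: homeomorphic_maps_def continuous_map_def)
  have pull_diag: "pull Y.\<Gamma> \<Lambda>' (diagonal_function G X F) = diagonal_function H Y (F \<circ> \<psi>)" for F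
  proof
    fix \<gamma> :: "'y \<times> 'h \<times> 'y"
    obtain u h v where \<gamma>: "\<gamma> = (u, h, v)" by (metis prod.exhaust)
    show "pull Y.\<Gamma> \<Lambda>' (diagonal_function G X F) \<gamma> = diagonal_function H Y (F \<circ> \<psi>) \<gamma>"
    proof (cases "u \<in> topspace Y \<and> h = \<one>\<^bsub>H\<^esub> \<and> v = u")
      case True
      then show ?thesis
        by (simp add: \<gamma> pull_def unit diagonal_function_def \<psi>_in)
    next
      case False
      have "diagonal_function G X F (\<Lambda>' \<gamma>) = 0" if \<gamma>': "\<gamma> \<in> Y.\<Gamma>"
      proof (rule ccontr)
        assume "diagonal_function G X F (\<Lambda>' \<gamma>) \<noteq> 0"
        then obtain x where x: "\<Lambda>' \<gamma> = (x, \<one>\<^bsub>G\<^esub>, x)" "x \<in> topspace X"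
          unfolding diagonal_function_def by (auto split: if_splits prod.splits)
        then have "\<gamma> = (\<phi> x, \<one>\<^bsub>H\<^esub>, \<phi> x)"
          using t.f_g[OF \<gamma>'] unit(1) by simp
        then show False using False \<gamma> \<phi>_in x(2) by auto
      qed
      then show ?thesis
        using False by (auto simp: \<gamma> pull_def diagonal_function_def)
    qed
  qed
  have "t.conj ` diagonal_subalgebra G X P \<theta> \<subseteq> diagonal_subalgebra H Y S \<rho>"
    unfolding diagonal_subalgebra_def
    using t.conj_regular_rep pull_diag continuous_map_compose[OF \<psi>] by auto blast
  moreover have "diagonal_subalgebra H Y S \<rho> \<subseteq> t.conj ` diagonal_subalgebra G X P \<theta>"
  proof
    fix T assume "T \<in> diagonal_subalgebra H Y S \<rho>"
    then obtain F where F: "continuous_map Y euclidean F" "T = regular_rep Y.gpd (diagonal_function H Y F)"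
      unfolding diagonal_subalgebra_def by blast
    \<comment> \<open>\<open>F \<circ> \<phi> \<circ> \<psi>\<close> agrees with \<open>F\<close>
      only on the space, which suffices because a diagonal function ignores all other
      values.\<close>
    have eq: "diagonal_function H Y F = diagonal_function H Y ((F \<circ> \<phi>) \<circ> \<psi>)"
      using hm by (auto simp: diagonal_function_def fun_eq_iff homeomorphic_maps_def)
    have "T = t.conj (regular_rep X.gpd (diagonal_function G X (F \<circ> \<phi>)))"
      using F(2) eq by (simp only: t.conj_regular_rep pull_diag)
    then show "T \<in> t.conj ` diagonal_subalgebra G X P \<theta>"
      unfolding diagonal_subalgebra_def using continuous_map_compose[OF \<phi> F(1)] by blast
  qed
  ultimately show ?thesis
    using t.reduced_algebra_iso_conj by blast
qed

section \<open>Convolution operators\<close>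

declare split_paired_All [simp del] split_paired_Ex [simp del]

context semigroup_action
begin

abbreviation rng :: "'x \<times> 'g \<times> 'x \<Rightarrow> 'x" where "rng \<equiv> fst"
abbreviation src :: "'x \<times> 'g \<times> 'x \<Rightarrow> 'x" where "src \<gamma> \<equiv> snd (snd \<gamma>)"

text \<open>The element \<open>\<alpha>^-1 \<gamma>\<close> in coordinates. It is the unique second
  factor of \<gamma> once the first factor \<alpha> is given, so the convolution sum over
  factorisations becomes a sum over the range fibre of \<gamma>.\<close>

definition ldiv :: "'x \<times> 'g \<times> 'x \<Rightarrow> 'x \<times> 'g \<times> 'x \<Rightarrow> 'x \<times> 'g \<times> 'x" where
  "ldiv \<alpha> \<gamma> = (src \<alpha>, inv (fst (snd \<alpha>)) \<otimes> fst (snd \<gamma>), src \<gamma>)"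

lemma ldiv_in_\<Gamma>:
  assumes "\<alpha> \<in> \<Gamma>" "\<gamma> \<in> \<Gamma>" "rng \<alpha> = rng \<gamma>"
  shows "ldiv \<alpha> \<gamma> \<in> \<Gamma>"
  using assms mult_in_\<Gamma>[OF inverse_in_\<Gamma>] by (cases \<alpha>; cases \<gamma>) (auto simp: ldiv_def)

lemma mult_ldiv:
  assumes "\<alpha> \<in> \<Gamma>" "\<gamma> \<in> \<Gamma>" "rng \<alpha> = rng \<gamma>"
  shows "sg_comp gpd \<alpha> (ldiv \<alpha> \<gamma>)" "sg_mult gpd \<alpha> (ldiv \<alpha> \<gamma>) = \<gamma>"
proof -
  obtain x g y z h where *: "\<alpha> = (x, g, y)" "\<gamma> = (x, h, z)"
    using assms(3) by (metis fst_conv prod.exhaust)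
  have "g \<in> carrier G" "h \<in> carrier G"
    using assms * in_\<Gamma>_carrier by auto
  then have "g \<otimes> (inv g \<otimes> h) = h"
    by (simp flip: m_assoc)
  then show "sg_comp gpd \<alpha> (ldiv \<alpha> \<gamma>)" "sg_mult gpd \<alpha> (ldiv \<alpha> \<gamma>) = \<gamma>"
    by (simp_all add: * ldiv_def)
qed

lemma ldiv_mult:
  assumes "\<alpha> \<in> \<Gamma>" "\<beta> \<in> \<Gamma>" "src \<alpha> = rng \<beta>"
  shows "ldiv \<alpha> (sg_mult gpd \<alpha> \<beta>) = \<beta>"
proof -
  obtain x g y z h where *: "\<alpha> = (x, g, y)" "\<beta> = (y, h, z)"
    using assms(3) by (metis fst_conv snd_conv prod.exhaust)
  have "g \<in> carrier G" "h \<in> carrier G"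
    using assms * in_\<Gamma>_carrier by auto
  then have "inv g \<otimes> (g \<otimes> h) = h"
    by (simp flip: m_assoc)
  then show ?thesis by (simp add: * ldiv_def)
qed

lemma regular_rep_apply:
  assumes \<xi>: "\<xi> \<in> ell2 \<Gamma>" and \<gamma>: "\<gamma> \<in> \<Gamma>"
  shows "regular_rep gpd f \<xi> \<gamma> = (\<Sum>\<^sub>\<infinity>\<alpha>\<in>{\<alpha> \<in> \<Gamma>. rng \<alpha> = rng \<gamma>}. f \<alpha> * \<xi> (ldiv \<alpha> \<gamma>))"
proof -
  have rng_mult: "rng (sg_mult gpd \<alpha> \<beta>) = rng \<alpha>" and comp: "sg_comp gpd \<alpha> \<beta> \<longleftrightarrow> src \<alpha> = rng \<beta>" for \<alpha> \<beta>
    by (cases \<alpha>; cases \<beta>; simp)+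
  have "regular_rep gpd f \<xi> \<gamma> =
      (\<Sum>\<^sub>\<infinity>(\<alpha>, \<beta>)\<in>{(\<alpha>, \<beta>). \<alpha> \<in> \<Gamma> \<and> \<beta> \<in> \<Gamma> \<and> sg_comp gpd \<alpha> \<beta> \<and> sg_mult gpd \<alpha> \<beta> = \<gamma>}. f \<alpha> * \<xi> \<beta>)"
    using \<xi> by (simp add: regular_rep_def)
  also have "\<dots> = (\<Sum>\<^sub>\<infinity>\<alpha>\<in>{\<alpha> \<in> \<Gamma>. rng \<alpha> = rng \<gamma>}. f \<alpha> * \<xi> (ldiv \<alpha> \<gamma>))"
    by (rule infsum_reindex_bij_witness[of _ "\<lambda>\<alpha>. (\<alpha>, ldiv \<alpha> \<gamma>)" fst])
      (use \<gamma> mult_ldiv ldiv_in_\<Gamma> ldiv_mult rng_mult comp in auto)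
  finally show ?thesis .
qed

lemma regular_rep_outside:
  assumes "\<xi> \<in> ell2 \<Gamma>" "\<gamma> \<notin> \<Gamma>"
  shows "regular_rep gpd f \<xi> \<gamma> = 0"
proof -
  have "{(\<alpha>, \<beta>). \<alpha> \<in> \<Gamma> \<and> \<beta> \<in> \<Gamma> \<and> sg_comp gpd \<alpha> \<beta> \<and> sg_mult gpd \<alpha> \<beta> = \<gamma>} = {}"
    using assms(2) sg_mult_closed by blast
  then show ?thesis
    using assms(1) by (simp only: regular_rep_def restrict_apply' infsum_empty)
qed

lemma regular_rep_extensional: "regular_rep gpd f \<in> extensional (ell2 \<Gamma>)"
  by (simp add: regular_rep_def)

lemma regular_rep_single:
  assumes "\<xi> \<in> ell2 \<Gamma>" "\<gamma> \<in> \<Gamma>" "\<alpha> \<in> \<Gamma>" "rng \<alpha> = rng \<gamma>"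
    and zero: "\<And>\<alpha>'. \<alpha>' \<in> \<Gamma> \<Longrightarrow> rng \<alpha>' = rng \<gamma> \<Longrightarrow> \<alpha>' \<noteq> \<alpha> \<Longrightarrow> f \<alpha>' * \<xi> (ldiv \<alpha>' \<gamma>) = 0"
  shows "regular_rep gpd f \<xi> \<gamma> = f \<alpha> * \<xi> (ldiv \<alpha> \<gamma>)"
proof -
  have "regular_rep gpd f \<xi> \<gamma> = (\<Sum>\<^sub>\<infinity>\<alpha>\<in>{\<alpha>}. f \<alpha> * \<xi> (ldiv \<alpha> \<gamma>))"
    unfolding regular_rep_apply[OF assms(1,2)]
    by (rule infsum_cong_neutral) (use assms(3,4) zero in auto)
  then show ?thesis by simp
qed

lemma regular_rep_null:
  assumes "\<xi> \<in> ell2 \<Gamma>" "\<gamma> \<in> \<Gamma>"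
    and zero: "\<And>\<alpha>. \<alpha> \<in> \<Gamma> \<Longrightarrow> rng \<alpha> = rng \<gamma> \<Longrightarrow> f \<alpha> * \<xi> (ldiv \<alpha> \<gamma>) = 0"
  shows "regular_rep gpd f \<xi> \<gamma> = 0"
  unfolding regular_rep_apply[OF assms(1,2)] by (rule infsum_0) (use zero in auto)

lemma Cc_continuous: "f \<in> Cc gpd \<Longrightarrow> continuous_map (sg_top gpd) euclidean f"
  and Cc_zero: "f \<in> Cc gpd \<Longrightarrow> \<gamma> \<notin> \<Gamma> \<Longrightarrow> f \<gamma> = 0"
  by (auto simp: Cc_def)

lemma CcI:
  assumes "continuous_map (sg_top gpd) euclidean f" "\<And>\<gamma>. \<gamma> \<notin> \<Gamma> \<Longrightarrow> f \<gamma> = 0"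
    and K: "compactin (sg_top gpd) K" "closedin (sg_top gpd) K" "\<And>\<gamma>. \<gamma> \<in> \<Gamma> \<Longrightarrow> f \<gamma> \<noteq> 0 \<Longrightarrow> \<gamma> \<in> K"
  shows "f \<in> Cc gpd"
proof -
  have "sg_top gpd closure_of {\<gamma> \<in> \<Gamma>. f \<gamma> \<noteq> 0} \<subseteq> K"
    using K(2,3) by (intro closure_of_minimal) auto
  then have "compactin (sg_top gpd) (sg_top gpd closure_of {\<gamma> \<in> \<Gamma>. f \<gamma> \<noteq> 0})"
    using closed_compactin K(1) closedin_closure_of by blast
  with assms(1,2) show ?thesis by (simp add: Cc_def)
qed

lemma CcE:
  assumes "f \<in> Cc gpd"
  obtains K where "compactin (sg_top gpd) K" "closedin (sg_top gpd) K"
    "\<And>\<gamma>. \<gamma> \<in> \<Gamma> \<Longrightarrow> f \<gamma> \<noteq> 0 \<Longrightarrow> \<gamma> \<in> K"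
proof
  show "compactin (sg_top gpd) (sg_top gpd closure_of {\<gamma> \<in> \<Gamma>. f \<gamma> \<noteq> 0})"
    using assms by (simp add: Cc_def)
  show "\<gamma> \<in> sg_top gpd closure_of {\<gamma> \<in> \<Gamma>. f \<gamma> \<noteq> 0}" if "\<gamma> \<in> \<Gamma>" "f \<gamma> \<noteq> 0" for \<gamma>
    using that closure_of_subset[of "{\<gamma> \<in> \<Gamma>. f \<gamma> \<noteq> 0}" "sg_top gpd"] by auto
qed simp

lemma Cc_bounded:
  assumes "f \<in> Cc gpd"
  obtains M where "0 \<le> M" "\<And>\<gamma>. cmod (f \<gamma>) \<le> M"
proof -
  obtain K where K: "compactin (sg_top gpd) K" "\<And>\<gamma>. \<gamma> \<in> \<Gamma> \<Longrightarrow> f \<gamma> \<noteq> 0 \<Longrightarrow> \<gamma> \<in> K"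
    using CcE[OF assms] by metis
  have "compactin euclidean (f ` K)"
    by (rule image_compactin[OF K(1) Cc_continuous[OF assms]])
  then have "bounded (f ` K)"
    by (simp add: compact_imp_bounded)
  then obtain M where M: "\<And>\<gamma>. \<gamma> \<in> K \<Longrightarrow> cmod (f \<gamma>) \<le> M"
    unfolding bounded_iff by blast
  have "cmod (f \<gamma>) \<le> \<bar>M\<bar>" for \<gamma>
  proof (cases "f \<gamma> = 0")
    case False
    then have "\<gamma> \<in> K" using K(2) Cc_zero[OF assms] by blast
    then show ?thesis using M by fastforce
  qed simp
  then show thesis using that[of "\<bar>M\<bar>"] by simp
qed

lemma basic_bisection_inj:
  assumes "B \<in> basic_bisections G X P \<theta>" "\<alpha> \<in> B" "\<alpha>' \<in> B"
  shows "rng \<alpha> = rng \<alpha>' \<Longrightarrow> \<alpha> = \<alpha>'" "src \<alpha> = src \<alpha>' \<Longrightarrow> \<alpha> = \<alpha>'"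
proof -
  obtain U m n V where B: "B = basic_bisection G \<theta> U m n V" "openin X U" "openin X V"
    "embedding_map (subtopology X U) X (\<theta> m)" "embedding_map (subtopology X V) X (\<theta> n)"
    using assms(1) unfolding basic_bisections_def by blast
  have "inj_on (\<theta> m) U" "inj_on (\<theta> n) V"
    using homeomorphic_imp_injective_map[OF B(4)[unfolded embedding_map_def]]
      homeomorphic_imp_injective_map[OF B(5)[unfolded embedding_map_def]] B(2,3)
    by (metis openin_subset topspace_subtopology_subset)+
  then show "rng \<alpha> = rng \<alpha>' \<Longrightarrow> \<alpha> = \<alpha>'" "src \<alpha> = src \<alpha>' \<Longrightarrow> \<alpha> = \<alpha>'"
    using assms(2,3) unfolding B(1) basic_bisection_def by (auto, metis inj_onD, metis inj_onD)
qed

lemma openin_basic_bisections: "B \<in> basic_bisections G X P \<theta> \<Longrightarrow> openin (sg_top gpd) B"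
  by (simp add: transformation_groupoid_def topology_generated_by_Basis)

text \<open>A compact support is covered by finitely many basic bisections, and each of them meets a
  range fibre or a source fibre in at most one point. The bound \<open>N\<close> is the number of
  bisections, uniform over all fibres.\<close>

lemma Cc_fibre_bound:
  assumes "f \<in> Cc gpd"
  obtains N where "\<And>x. finite {\<alpha> \<in> \<Gamma>. rng \<alpha> = x \<and> f \<alpha> \<noteq> 0}" "\<And>x. card {\<alpha> \<in> \<Gamma>. rng \<alpha> = x \<and> f \<alpha> \<noteq> 0} \<le> N"
    "\<And>x. finite {\<alpha> \<in> \<Gamma>. src \<alpha> = x \<and> f \<alpha> \<noteq> 0}" "\<And>x. card {\<alpha> \<in> \<Gamma>. src \<alpha> = x \<and> f \<alpha> \<noteq> 0} \<le> N"
proof -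
  obtain K where K: "compactin (sg_top gpd) K" "\<And>\<gamma>. \<gamma> \<in> \<Gamma> \<Longrightarrow> f \<gamma> \<noteq> 0 \<Longrightarrow> \<gamma> \<in> K"
    using CcE[OF assms] by metis
  have "\<Gamma> = \<Union> (basic_bisections G X P \<theta>)"
    by (simp add: transformation_groupoid_def topology_generated_by_topspace)
  then have "K \<subseteq> \<Union> (basic_bisections G X P \<theta>)"
    using compactin_subset_topspace[OF K(1)] by simp
  then obtain \<F> where \<F>: "finite \<F>" "\<F> \<subseteq> basic_bisections G X P \<theta>" "K \<subseteq> \<Union>\<F>"
    using K(1)[unfolded compactin_def, THEN conjunct2, rule_format, of "basic_bisections G X P \<theta>"]
      openin_basic_bisections by blast
  have fibre: "finite {\<alpha> \<in> \<Gamma>. p \<alpha> = x \<and> f \<alpha> \<noteq> 0} \<and> card {\<alpha> \<in> \<Gamma>. p \<alpha> = x \<and> f \<alpha> \<noteq> 0} \<le> card \<F>"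
    if inj: "\<And>B \<alpha> \<alpha>'. B \<in> \<F> \<Longrightarrow> \<alpha> \<in> B \<Longrightarrow> \<alpha>' \<in> B \<Longrightarrow> p \<alpha> = p \<alpha>' \<Longrightarrow> \<alpha> = \<alpha>'" for p :: "'x \<times> 'g \<times> 'x \<Rightarrow> 'x" and x
  proof -
    define E where "E = {\<alpha> \<in> \<Gamma>. p \<alpha> = x \<and> f \<alpha> \<noteq> 0}"
    have "\<forall>\<alpha>\<in>E. \<exists>B. B \<in> \<F> \<and> \<alpha> \<in> B" using K(2) \<F>(3) unfolding E_def by blast
    then obtain c where c: "\<forall>\<alpha>\<in>E. c \<alpha> \<in> \<F> \<and> \<alpha> \<in> c \<alpha>"
      by (rule bchoice[THEN exE])
    have "inj_on c E"
    proof (rule inj_onI)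
      fix \<alpha> \<alpha>' assume "\<alpha> \<in> E" "\<alpha>' \<in> E" "c \<alpha> = c \<alpha>'"
      then have "c \<alpha> \<in> \<F>" "\<alpha> \<in> c \<alpha>" "\<alpha>' \<in> c \<alpha>" "p \<alpha> = p \<alpha>'"
        using c unfolding E_def by auto
      then show "\<alpha> = \<alpha>'" by (rule inj)
    qed
    moreover have "c ` E \<subseteq> \<F>" using c by blast
    ultimately show ?thesis
      unfolding E_def[symmetric] using \<F>(1) card_inj_on_le inj_on_finite by metis
  qed
  have 1: "finite {\<alpha> \<in> \<Gamma>. rng \<alpha> = x \<and> f \<alpha> \<noteq> 0} \<and> card {\<alpha> \<in> \<Gamma>. rng \<alpha> = x \<and> f \<alpha> \<noteq> 0} \<le> card \<F>" for x
    by (rule fibre) (use \<F>(2) basic_bisection_inj(1) in blast)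
  have 2: "finite {\<alpha> \<in> \<Gamma>. src \<alpha> = x \<and> f \<alpha> \<noteq> 0} \<and> card {\<alpha> \<in> \<Gamma>. src \<alpha> = x \<and> f \<alpha> \<noteq> 0} \<le> card \<F>" for x
    by (rule fibre) (use \<F>(2) basic_bisection_inj(2) in blast)
  show thesis
    by (rule that[of "card \<F>"]) (use 1 2 in simp_all)
qed

lemma regular_rep_finite:
  assumes "\<xi> \<in> ell2 \<Gamma>" "\<gamma> \<in> \<Gamma>" "finite {\<alpha> \<in> \<Gamma>. rng \<alpha> = rng \<gamma> \<and> f \<alpha> \<noteq> 0}"
  shows "regular_rep gpd f \<xi> \<gamma> = (\<Sum>\<alpha>\<in>{\<alpha> \<in> \<Gamma>. rng \<alpha> = rng \<gamma> \<and> f \<alpha> \<noteq> 0}. f \<alpha> * \<xi> (ldiv \<alpha> \<gamma>))"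
proof -
  have "regular_rep gpd f \<xi> \<gamma> = (\<Sum>\<^sub>\<infinity>\<alpha>\<in>{\<alpha> \<in> \<Gamma>. rng \<alpha> = rng \<gamma> \<and> f \<alpha> \<noteq> 0}. f \<alpha> * \<xi> (ldiv \<alpha> \<gamma>))"
    unfolding regular_rep_apply[OF assms(1,2)] by (rule infsum_cong_neutral) auto
  then show ?thesis using assms(3) by simp
qed

text \<open>A Schur test: the support of \<open>f\<close> meets every range and every source fibre in at most \<open>N\<close>
  points, and \<open>|f| \<le> M\<close>, so convolution by \<open>f\<close> has norm at most \<open>N M\<close>.\<close>

lemma regular_rep_bounded:
  assumes f: "f \<in> Cc gpd"
  shows "regular_rep gpd f \<in> bounded_operators \<Gamma>"
proof -
  define E where "E = (\<lambda>x. {\<alpha> \<in> \<Gamma>. rng \<alpha> = x \<and> f \<alpha> \<noteq> 0})"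
  define E' where "E' = (\<lambda>x. {\<alpha> \<in> \<Gamma>. src \<alpha> = x \<and> f \<alpha> \<noteq> 0})"
  obtain N where "\<And>x. finite {\<alpha> \<in> \<Gamma>. rng \<alpha> = x \<and> f \<alpha> \<noteq> 0}" "\<And>x. card {\<alpha> \<in> \<Gamma>. rng \<alpha> = x \<and> f \<alpha> \<noteq> 0} \<le> N"
    "\<And>x. finite {\<alpha> \<in> \<Gamma>. src \<alpha> = x \<and> f \<alpha> \<noteq> 0}" "\<And>x. card {\<alpha> \<in> \<Gamma>. src \<alpha> = x \<and> f \<alpha> \<noteq> 0} \<le> N"
    by (rule Cc_fibre_bound[OF f]) (rule that; simp)
  then have N: "finite (E x)" "card (E x) \<le> N" "finite (E' x)" "card (E' x) \<le> N" for x
    unfolding E_def E'_def by simp_all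
  obtain M where M: "0 \<le> M" "\<And>\<gamma>. cmod (f \<gamma>) \<le> M"
    using Cc_bounded[OF f] by blast
  have formula: "regular_rep gpd f \<xi> \<gamma> = (\<Sum>\<alpha>\<in>E (rng \<gamma>). f \<alpha> * \<xi> (ldiv \<alpha> \<gamma>))"
    if "\<xi> \<in> ell2 \<Gamma>" "\<gamma> \<in> \<Gamma>" for \<xi> \<gamma>
    using regular_rep_finite[OF that] N(1)[of "rng \<gamma>"] unfolding E_def by blast
  have bound: "(\<Sum>\<gamma>\<in>F. (cmod (regular_rep gpd f \<xi> \<gamma>))\<^sup>2) \<le> (N * M * ell2_norm \<Gamma> \<xi>)\<^sup>2"
    if \<xi>: "\<xi> \<in> ell2 \<Gamma>" and F: "finite F" "F \<subseteq> \<Gamma>" for \<xi> F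
  proof -
    have "(cmod (regular_rep gpd f \<xi> \<gamma>))\<^sup>2 \<le> N * M\<^sup>2 * (\<Sum>\<alpha>\<in>E (rng \<gamma>). (cmod (\<xi> (ldiv \<alpha> \<gamma>)))\<^sup>2)"
      if \<gamma>: "\<gamma> \<in> F" for \<gamma>
    proof -
      have "cmod (regular_rep gpd f \<xi> \<gamma>) \<le> (\<Sum>\<alpha>\<in>E (rng \<gamma>). cmod (f \<alpha> * \<xi> (ldiv \<alpha> \<gamma>)))"
        unfolding formula[OF \<xi> subsetD[OF F(2) \<gamma>]] by (rule norm_sum)
      also have "\<dots> \<le> (\<Sum>\<alpha>\<in>E (rng \<gamma>). M * cmod (\<xi> (ldiv \<alpha> \<gamma>)))"
        unfolding norm_mult using M by (intro sum_mono mult_right_mono) auto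
      finally have "(cmod (regular_rep gpd f \<xi> \<gamma>))\<^sup>2 \<le> (\<Sum>\<alpha>\<in>E (rng \<gamma>). M * cmod (\<xi> (ldiv \<alpha> \<gamma>)))\<^sup>2"
        by (rule power_mono) simp
      \<comment> \<open>Cauchy-Schwarz over a range fibre costs its cardinality, the first factor
        \<open>N\<close>; the second one comes from the source fibres after the change of variables
        below.\<close>
      also have "\<dots> \<le> (\<Sum>\<alpha>\<in>E (rng \<gamma>). (M * cmod (\<xi> (ldiv \<alpha> \<gamma>)))\<^sup>2) * card (E (rng \<gamma>))"
        by (rule sum_squared_le_sum_of_squares)
      also have "\<dots> \<le> (\<Sum>\<alpha>\<in>E (rng \<gamma>). (M * cmod (\<xi> (ldiv \<alpha> \<gamma>)))\<^sup>2) * N"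
        using N(2) by (intro mult_left_mono) (auto simp: sum_nonneg)
      also have "\<dots> = N * M\<^sup>2 * (\<Sum>\<alpha>\<in>E (rng \<gamma>). (cmod (\<xi> (ldiv \<alpha> \<gamma>)))\<^sup>2)"
        by (simp add: power_mult_distrib sum_distrib_left sum_distrib_right algebra_simps)
      finally show ?thesis .
    qed
    then have "(\<Sum>\<gamma>\<in>F. (cmod (regular_rep gpd f \<xi> \<gamma>))\<^sup>2) \<le>
        N * M\<^sup>2 * (\<Sum>\<gamma>\<in>F. \<Sum>\<alpha>\<in>E (rng \<gamma>). (cmod (\<xi> (ldiv \<alpha> \<gamma>)))\<^sup>2)"
      unfolding sum_distrib_left[of _ _ F] by (rule sum_mono)
    also have "(\<Sum>\<gamma>\<in>F. \<Sum>\<alpha>\<in>E (rng \<gamma>). (cmod (\<xi> (ldiv \<alpha> \<gamma>)))\<^sup>2) \<le> N * (ell2_norm \<Gamma> \<xi>)\<^sup>2"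
    proof -
      define D where "D = (SIGMA \<gamma>:F. E (rng \<gamma>))"
      \<comment> \<open>Change of variables from \<open>(\<gamma>, \<alpha>)\<close> to
        \<open>(\<beta>, \<alpha>)\<close> with \<open>\<beta> = \<alpha>^-1 \<gamma>\<close>. For
        fixed \<beta> the admissible \<alpha> have source \<open>rng \<beta>\<close>, so the inner
        sum now runs over a source fibre.\<close>
      define p where "p = (\<lambda>(\<gamma>, \<alpha>). (ldiv \<alpha> \<gamma>, \<alpha>))"
      define F' where "F' = fst ` p ` D"
      have D: "finite D" unfolding D_def using F(1) N(1) by auto
      have mem: "\<gamma> \<in> \<Gamma> \<and> \<alpha> \<in> \<Gamma> \<and> rng \<alpha> = rng \<gamma> \<and> f \<alpha> \<noteq> 0" if "(\<gamma>, \<alpha>) \<in> D" for \<gamma> \<alpha>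
        using that F unfolding D_def E_def by auto
      have inj: "inj_on p D"
      proof (rule inj_onI, clarify)
        fix x g y \<alpha> x' g' y' \<alpha>'
        assume 1: "((x, g, y), \<alpha>) \<in> D" and 2: "((x', g', y'), \<alpha>') \<in> D" and eq: "p ((x, g, y), \<alpha>) = p ((x', g', y'), \<alpha>')"
        then have "\<alpha> = \<alpha>'" "ldiv \<alpha> (x, g, y) = ldiv \<alpha> (x', g', y')" unfolding p_def by auto
        then show "(x, g, y) = (x', g', y') \<and> \<alpha> = \<alpha>'"
          using mem[OF 1] mem[OF 2] mult_ldiv(2) by metis
      qed
      have F': "finite F'" "F' \<subseteq> \<Gamma>"
      proof -
        show "finite F'" unfolding F'_def using D by simp
        show "F' \<subseteq> \<Gamma>"
        proof
          fix \<beta> assume "\<beta> \<in> F'"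
          then obtain d where d: "d \<in> D" "\<beta> = fst (p d)" unfolding F'_def by blast
          obtain \<gamma> \<alpha> where d': "d = (\<gamma>, \<alpha>)" by (rule prod.exhaust)
          then have "\<beta> = ldiv \<alpha> \<gamma>" using d(2) by (simp add: p_def)
          then show "\<beta> \<in> \<Gamma>"
            using mem[of \<gamma> \<alpha>] d(1) d' ldiv_in_\<Gamma> by simp
        qed
      qed
      have "(\<Sum>\<gamma>\<in>F. \<Sum>\<alpha>\<in>E (rng \<gamma>). (cmod (\<xi> (ldiv \<alpha> \<gamma>)))\<^sup>2) = (\<Sum>(\<gamma>, \<alpha>)\<in>D. (cmod (\<xi> (ldiv \<alpha> \<gamma>)))\<^sup>2)"
        unfolding D_def using F(1) N(1) by (intro sum.Sigma) auto
      also have "\<dots> = (\<Sum>(\<beta>, \<alpha>)\<in>p ` D. (cmod (\<xi> \<beta>))\<^sup>2)"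
        by (subst sum.reindex[OF inj]) (auto simp: p_def intro!: sum.cong)
      also have "\<dots> \<le> (\<Sum>(\<beta>, \<alpha>)\<in>(SIGMA \<beta>:F'. E' (rng \<beta>)). (cmod (\<xi> \<beta>))\<^sup>2)"
      proof (rule sum_mono2)
        show "p ` D \<subseteq> (SIGMA \<beta>:F'. E' (rng \<beta>))"
          unfolding F'_def E'_def using mem by (force simp: p_def ldiv_def)
      qed (use F' N(3) in auto)
      also have "\<dots> = (\<Sum>\<beta>\<in>F'. \<Sum>\<alpha>\<in>E' (rng \<beta>). (cmod (\<xi> \<beta>))\<^sup>2)"
        using F'(1) N(3) by (intro sum.Sigma[symmetric]) auto
      also have "\<dots> \<le> (\<Sum>\<beta>\<in>F'. N * (cmod (\<xi> \<beta>))\<^sup>2)"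
        using N(4) by (intro sum_mono) (simp add: mult_right_mono)
      also have "\<dots> = N * (\<Sum>\<beta>\<in>F'. (cmod (\<xi> \<beta>))\<^sup>2)"
        by (simp add: sum_distrib_left)
      also have "\<dots> \<le> N * (ell2_norm \<Gamma> \<xi>)\<^sup>2"
        using ell2_sum_le[OF \<xi> F'] by (simp add: mult_left_mono)
      finally show ?thesis .
    qed
    then have "N * M\<^sup>2 * (\<Sum>\<gamma>\<in>F. \<Sum>\<alpha>\<in>E (rng \<gamma>). (cmod (\<xi> (ldiv \<alpha> \<gamma>)))\<^sup>2) \<le> N * M\<^sup>2 * (N * (ell2_norm \<Gamma> \<xi>)\<^sup>2)"
      by (intro mult_left_mono) auto
    finally show ?thesis
      by (simp add: power2_eq_square algebra_simps)
  qed
  have nn: "0 \<le> N * M * ell2_norm \<Gamma> \<xi>" for \<xi> using M(1) by simp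
  have into: "regular_rep gpd f \<xi> \<in> ell2 \<Gamma> \<and> ell2_norm \<Gamma> (regular_rep gpd f \<xi>) \<le> N * M * ell2_norm \<Gamma> \<xi>"
    if \<xi>: "\<xi> \<in> ell2 \<Gamma>" for \<xi>
    using ell2I[of \<Gamma> "regular_rep gpd f \<xi>" "N * M * ell2_norm \<Gamma> \<xi>"] regular_rep_outside[OF \<xi>] bound[OF \<xi>] nn
    by blast
  have "regular_rep gpd f \<in> ell2 \<Gamma> \<rightarrow>\<^sub>E ell2 \<Gamma>"
    using into regular_rep_extensional by (auto simp: PiE_def)
  moreover have "regular_rep gpd f (\<lambda>\<gamma>. c * \<xi> \<gamma> + d * \<eta> \<gamma>) = (\<lambda>\<gamma>. c * regular_rep gpd f \<xi> \<gamma> + d * regular_rep gpd f \<eta> \<gamma>)"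
    if "\<xi> \<in> ell2 \<Gamma>" "\<eta> \<in> ell2 \<Gamma>" for \<xi> \<eta> c d
  proof
    fix \<gamma>
    show "regular_rep gpd f (\<lambda>\<gamma>. c * \<xi> \<gamma> + d * \<eta> \<gamma>) \<gamma> = c * regular_rep gpd f \<xi> \<gamma> + d * regular_rep gpd f \<eta> \<gamma>"
    proof (cases "\<gamma> \<in> \<Gamma>")
      case True
      then show ?thesis
        using that ell2_lincomb(1)[OF that]
        by (simp add: formula sum.distrib sum_distrib_left algebra_simps)
    qed (use that ell2_lincomb(1)[OF that] in \<open>simp add: regular_rep_outside\<close>)
  qed
  ultimately show ?thesis
    unfolding bounded_operators_def using into by blast
qed

lemma regular_rep_in_reduced_algebra:
  assumes "f \<in> Cc gpd"
  shows "regular_rep gpd f \<in> reduced_algebra gpd"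
  unfolding reduced_algebra_def using regular_rep_bounded[OF assms] op_dist_self assms by force

end

section \<open>Matrix coefficients of operators in the reduced algebra\<close>

context semigroup_action
begin

text \<open>The element \<open>\<gamma> \<eta>^-1\<close>, at which a convolution kernel is
  evaluated to give the matrix entry in row \<gamma> and column \<eta>.\<close>

definition rdiv :: "'x \<times> 'g \<times> 'x \<Rightarrow> 'x \<times> 'g \<times> 'x \<Rightarrow> 'x \<times> 'g \<times> 'x" where
  "rdiv \<gamma> \<eta> = (rng \<gamma>, fst (snd \<gamma>) \<otimes> inv (fst (snd \<eta>)), rng \<eta>)"

lemma rdiv_in_\<Gamma>:
  assumes "\<gamma> \<in> \<Gamma>" "\<eta> \<in> \<Gamma>" "src \<gamma> = src \<eta>"
  shows "rdiv \<gamma> \<eta> \<in> \<Gamma>"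
  using assms mult_in_\<Gamma>[OF _ inverse_in_\<Gamma>] by (cases \<gamma>; cases \<eta>) (auto simp: rdiv_def)

lemma ldiv_eq_iff:
  assumes "\<gamma> \<in> \<Gamma>" "\<eta> \<in> \<Gamma>" "\<alpha> \<in> \<Gamma>" "rng \<alpha> = rng \<gamma>"
  shows "ldiv \<alpha> \<gamma> = \<eta> \<longleftrightarrow> src \<gamma> = src \<eta> \<and> \<alpha> = rdiv \<gamma> \<eta>"
proof -
  obtain x k y where \<alpha>: "\<alpha> = (x, k, y)" by (metis prod.exhaust)
  obtain g z where \<gamma>: "\<gamma> = (x, g, z)" using assms(4) \<alpha> by (metis fst_conv prod.exhaust)
  obtain w l z' where \<eta>: "\<eta> = (w, l, z')" by (metis prod.exhaust)
  have car: "k \<in> carrier G" "g \<in> carrier G" "l \<in> carrier G"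
    using assms \<alpha> \<gamma> \<eta> in_\<Gamma>_carrier by auto
  have "inv k \<otimes> g = l \<longleftrightarrow> k = g \<otimes> inv l"
    using car by (metis inv_closed inv_solve_left inv_solve_right)
  then show ?thesis
    by (auto simp: \<alpha> \<gamma> \<eta> ldiv_def rdiv_def)
qed

lemma regular_rep_basis_vector:
  assumes "\<gamma> \<in> \<Gamma>" "\<eta> \<in> \<Gamma>"
  shows "regular_rep gpd f (basis_vector \<eta>) \<gamma> = (if src \<gamma> = src \<eta> then f (rdiv \<gamma> \<eta>) else 0)"
proof (cases "src \<gamma> = src \<eta>")
  case True
  have \<alpha>: "rdiv \<gamma> \<eta> \<in> \<Gamma>" "rng (rdiv \<gamma> \<eta>) = rng \<gamma>"
    using rdiv_in_\<Gamma>[OF assms True] by (simp_all add: rdiv_def)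
  have "regular_rep gpd f (basis_vector \<eta>) \<gamma> = f (rdiv \<gamma> \<eta>) * basis_vector \<eta> (ldiv (rdiv \<gamma> \<eta>) \<gamma>)"
    by (rule regular_rep_single[OF basis_vector_ell2(1)[OF assms(2)] assms(1) \<alpha>])
      (use ldiv_eq_iff[OF assms] in \<open>auto simp: basis_vector_def\<close>)
  moreover have "ldiv (rdiv \<gamma> \<eta>) \<gamma> = \<eta>"
    using ldiv_eq_iff[OF assms \<alpha>] True by simp
  ultimately show ?thesis using True by (simp add: basis_vector_def)
next
  case False
  have "regular_rep gpd f (basis_vector \<eta>) \<gamma> = 0"
    by (rule regular_rep_null[OF basis_vector_ell2(1)[OF assms(2)] assms(1)])
      (use ldiv_eq_iff[OF assms] False in \<open>auto simp: basis_vector_def\<close>)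
  with False show ?thesis by simp
qed

lemma reduced_algebra_bounded: "T \<in> reduced_algebra gpd \<Longrightarrow> T \<in> bounded_operators \<Gamma>"
  by (simp add: reduced_algebra_def)

text \<open>Basis vectors lie in the unit ball, so closeness in operator norm is closeness of all
  matrix entries, uniformly.\<close>

lemma reduced_algebra_approx:
  assumes "T \<in> reduced_algebra gpd" "0 < \<epsilon>"
  obtains f where "f \<in> Cc gpd"
    "\<And>\<eta> \<gamma>. \<eta> \<in> \<Gamma> \<Longrightarrow> cmod (T (basis_vector \<eta>) \<gamma> - regular_rep gpd f (basis_vector \<eta>) \<gamma>) < \<epsilon>"
proof -
  obtain f where f: "f \<in> Cc gpd" "op_dist \<Gamma> T (regular_rep gpd f) < \<epsilon>"
    using assms unfolding reduced_algebra_def by blast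
  have "cmod (T (basis_vector \<eta>) \<gamma> - regular_rep gpd f (basis_vector \<eta>) \<gamma>) < \<epsilon>" if "\<eta> \<in> \<Gamma>" for \<eta> \<gamma>
    using op_dist_coord[OF reduced_algebra_bounded[OF assms(1)] regular_rep_bounded[OF f(1)] basis_vector_ell2[OF that]]
      f(2) le_less_trans by blast
  with f(1) show thesis by (rule that)
qed

text \<open>\<open>T\<close> in the reduced algebra is convolution by the function \<open>coeff T\<close>.\<close>

definition coeff :: "('x \<times> 'g \<times> 'x) ell2_operator \<Rightarrow> 'x \<times> 'g \<times> 'x \<Rightarrow> complex" where
  "coeff T \<gamma> = T (basis_vector (src \<gamma>, \<one>, src \<gamma>)) \<gamma>"

lemma src_in_X: "\<gamma> \<in> \<Gamma> \<Longrightarrow> src \<gamma> \<in> topspace X"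
  and rng_in_X: "\<gamma> \<in> \<Gamma> \<Longrightarrow> rng \<gamma> \<in> topspace X"
  by (cases \<gamma>; auto elim: in_\<Gamma>E)+

lemma coeff_regular_rep:
  assumes "\<gamma> \<in> \<Gamma>"
  shows "coeff (regular_rep gpd f) \<gamma> = f \<gamma>"
proof -
  have "rdiv \<gamma> (src \<gamma>, \<one>, src \<gamma>) = \<gamma>"
    using assms in_\<Gamma>_carrier by (cases \<gamma>) (auto simp: rdiv_def)
  then show ?thesis
    using assms src_in_X[OF assms] by (simp add: coeff_def regular_rep_basis_vector)
qed

text \<open>For a convolution operator the entries have this form by direct computation. Both the
  entry of \<open>T\<close> and the value of \<open>coeff T\<close> are within
  \<open>\<epsilon> / 2\<close> of those of a convolution, and \<epsilon> is arbitrary.\<close>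

lemma reduced_algebra_matrix:
  assumes T: "T \<in> reduced_algebra gpd" and "\<gamma> \<in> \<Gamma>" "\<eta> \<in> \<Gamma>"
  shows "T (basis_vector \<eta>) \<gamma> = (if src \<gamma> = src \<eta> then coeff T (rdiv \<gamma> \<eta>) else 0)" (is "?l = ?r")
proof -
  have "cmod (?l - ?r) \<le> 0 + \<epsilon>" if \<epsilon>: "0 < \<epsilon>" for \<epsilon>
  proof -
    have "0 < \<epsilon> / 2" using \<epsilon> by simp
    then obtain f where f: "f \<in> Cc gpd" and
      app: "\<And>\<eta> \<gamma>. \<eta> \<in> \<Gamma> \<Longrightarrow> cmod (T (basis_vector \<eta>) \<gamma> - regular_rep gpd f (basis_vector \<eta>) \<gamma>) < \<epsilon> / 2"
      using reduced_algebra_approx[OF T] by blast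
    show ?thesis
    proof (cases "src \<gamma> = src \<eta>")
      case True
      note \<alpha> = rdiv_in_\<Gamma>[OF assms(2,3) True]
      have "cmod (?l - f (rdiv \<gamma> \<eta>)) < \<epsilon> / 2"
        using app[OF assms(3), of \<gamma>] True by (simp add: regular_rep_basis_vector[OF assms(2,3)])
      moreover have "cmod (coeff T (rdiv \<gamma> \<eta>) - f (rdiv \<gamma> \<eta>)) < \<epsilon> / 2"
        using app[of "(src (rdiv \<gamma> \<eta>), \<one>, src (rdiv \<gamma> \<eta>))" "rdiv \<gamma> \<eta>"] coeff_regular_rep[OF \<alpha>, of f] src_in_X[OF \<alpha>]
        by (simp add: coeff_def)
      ultimately have "cmod (?l - coeff T (rdiv \<gamma> \<eta>)) < \<epsilon>"
        using norm_diff_triangle_less[of ?l "f (rdiv \<gamma> \<eta>)" "\<epsilon> / 2" "coeff T (rdiv \<gamma> \<eta>)" "\<epsilon> / 2"]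
        by (simp add: norm_minus_commute)
      then show ?thesis using True by simp
    next
      case False
      then have "cmod ?l < \<epsilon> / 2"
        using app[OF assms(3), of \<gamma>] by (simp add: regular_rep_basis_vector[OF assms(2,3)])
      then show ?thesis using False \<epsilon> by simp
    qed
  qed
  then have "cmod (?l - ?r) \<le> 0" by (rule field_le_epsilon)
  then show ?thesis by simp
qed

text \<open>\<open>coeff T\<close> is a uniform limit of continuous functions. Rather than its
  continuity, only openness of the support is extracted, from a single good approximant.\<close>

lemma openin_coeff_support:
  assumes T: "T \<in> reduced_algebra gpd"
  shows "openin (sg_top gpd) {\<gamma> \<in> \<Gamma>. coeff T \<gamma> \<noteq> 0}"
proof (subst openin_subopen, intro ballI)
  fix \<gamma>\<^sub>0 assume "\<gamma>\<^sub>0 \<in> {\<gamma> \<in> \<Gamma>. coeff T \<gamma> \<noteq> 0}"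
  then have \<gamma>\<^sub>0: "\<gamma>\<^sub>0 \<in> \<Gamma>" "coeff T \<gamma>\<^sub>0 \<noteq> 0" by auto
  \<comment> \<open>Half the value at \<open>\<gamma>\<^sub>0\<close>: an approximant within
    \<epsilon> exceeds \<epsilon> in modulus at that point, and wherever it exceeds \<epsilon> the
    coefficient cannot vanish.\<close>
  define \<epsilon> where "\<epsilon> = cmod (coeff T \<gamma>\<^sub>0) / 2"
  have \<epsilon>: "0 < \<epsilon>" "2 * \<epsilon> = cmod (coeff T \<gamma>\<^sub>0)" using \<gamma>\<^sub>0(2) by (simp_all add: \<epsilon>_def)
  obtain f where f: "f \<in> Cc gpd" and
    app: "\<And>\<eta> \<gamma>. \<eta> \<in> \<Gamma> \<Longrightarrow> cmod (T (basis_vector \<eta>) \<gamma> - regular_rep gpd f (basis_vector \<eta>) \<gamma>) < \<epsilon>"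
    using reduced_algebra_approx[OF T \<epsilon>(1)] by blast
  have near: "cmod (coeff T \<gamma> - f \<gamma>) < \<epsilon>" if "\<gamma> \<in> \<Gamma>" for \<gamma>
    using app[of "(src \<gamma>, \<one>, src \<gamma>)" \<gamma>] coeff_regular_rep[OF that, of f] src_in_X[OF that]
    by (simp add: coeff_def)
  define W where "W = {\<gamma> \<in> \<Gamma>. f \<gamma> \<in> {z. \<epsilon> < cmod z}}"
  have "open {z :: complex. \<epsilon> < cmod z}"
    by (intro open_Collect_less continuous_intros)
  then have "openin (sg_top gpd) W"
    unfolding W_def by (intro openin_continuous_map_preimage[OF Cc_continuous[OF f]]) simp
  moreover have "\<gamma>\<^sub>0 \<in> W"
    using near[OF \<gamma>\<^sub>0(1)] norm_triangle_ineq2[of "coeff T \<gamma>\<^sub>0" "f \<gamma>\<^sub>0"] norm_triangle_ineq2[of "coeff T \<gamma>\<^sub>0" "coeff T \<gamma>\<^sub>0 - f \<gamma>\<^sub>0"] \<epsilon> \<gamma>\<^sub>0(1)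
    unfolding W_def by simp
  moreover have "W \<subseteq> {\<gamma> \<in> \<Gamma>. coeff T \<gamma> \<noteq> 0}"
  proof
    fix \<gamma> assume "\<gamma> \<in> W"
    then have "\<gamma> \<in> \<Gamma>" "\<epsilon> < cmod (f \<gamma>)" unfolding W_def by auto
    with near[of \<gamma>] show "\<gamma> \<in> {\<gamma> \<in> \<Gamma>. coeff T \<gamma> \<noteq> 0}" by auto
  qed
  ultimately show "\<exists>W. openin (sg_top gpd) W \<and> \<gamma>\<^sub>0 \<in> W \<and> W \<subseteq> {\<gamma> \<in> \<Gamma>. coeff T \<gamma> \<noteq> 0}"
    by blast
qed

lemma regular_rep_diagonal:
  assumes \<xi>: "\<xi> \<in> ell2 \<Gamma>"
  shows "regular_rep gpd (diagonal_function G X F) \<xi> = (\<lambda>\<gamma>. F (rng \<gamma>) * \<xi> \<gamma>)"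
proof
  fix \<gamma> :: "'x \<times> 'g \<times> 'x"
  show "regular_rep gpd (diagonal_function G X F) \<xi> \<gamma> = F (rng \<gamma>) * \<xi> \<gamma>"
  proof (cases "\<gamma> \<in> \<Gamma>")
    case True
    let ?u = "(rng \<gamma>, \<one>, rng \<gamma>)"
    have u: "?u \<in> \<Gamma>" using rng_in_X[OF True] by simp
    have "regular_rep gpd (diagonal_function G X F) \<xi> \<gamma> = diagonal_function G X F ?u * \<xi> (ldiv ?u \<gamma>)"
      by (rule regular_rep_single[OF \<xi> True u]) (auto simp: diagonal_function_def split: prod.splits)
    moreover have "ldiv ?u \<gamma> = \<gamma>"
      using in_\<Gamma>_carrier True by (cases \<gamma>) (auto simp: ldiv_def)
    ultimately show ?thesis
      using rng_in_X[OF True] by (simp add: diagonal_function_def)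
  next
    case False
    then show ?thesis by (simp add: regular_rep_outside[OF \<xi>] ell2_zero[OF \<xi>])
  qed
qed

lemma openin_basic_bisection:
  assumes "m \<in> P" "n \<in> P" "openin X U" "openin X V"
  shows "openin (sg_top gpd) (basic_bisection G \<theta> U m n V)" (is "openin _ ?W")
proof (rule openin_gpdI)
  fix x g y assume "(x, g, y) \<in> basic_bisection G \<theta> U m n V"
  then have *: "g = m \<otimes> inv n" "\<theta> m x = \<theta> n y" "x \<in> U" "y \<in> V"
    unfolding basic_bisection_def by auto
  have "(x', g, y') \<in> basic_bisection G \<theta> U m n V" if "x' \<in> U" "y' \<in> V" "\<theta> m x' = \<theta> n y'" for x' y'
    using that *(1) unfolding basic_bisection_def by blast
  then show "\<exists>m\<in>P. \<exists>n\<in>P. \<exists>A B. g = m \<otimes> inv n \<and> \<theta> m x = \<theta> n y \<and>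
      openin X A \<and> openin X B \<and> x \<in> A \<and> y \<in> B \<and>
      (\<forall>x'\<in>A. \<forall>y'\<in>B. \<theta> m x' = \<theta> n y' \<longrightarrow> (x', g, y') \<in> ?W)"
    by (intro bexI[OF _ assms(1)] bexI[OF _ assms(2)] exI[of _ U] exI[of _ V] conjI ballI impI * assms) auto
qed

lemma basic_bisection_subset_\<Gamma>:
  assumes "m \<in> P" "n \<in> P" "U \<subseteq> topspace X" "V \<subseteq> topspace X"
  shows "basic_bisection G \<theta> U m n V \<subseteq> \<Gamma>"
  using assms in_\<Gamma>I unfolding basic_bisection_def by blast

text \<open>A point can fail to lie in the bisection through its label, the equation, its range or
  its source, and each failure persists nearby. Closedness is what makes functions cut off to a
  clopen bisection continuous.\<close>

lemma closedin_basic_bisection: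
  assumes mn: "m \<in> P" "n \<in> P" and U: "closedin X U" and V: "closedin X V"
  shows "closedin (sg_top gpd) (basic_bisection G \<theta> U m n V)"
  unfolding closedin_def
proof
  let ?B = "basic_bisection G \<theta> U m n V"
  show "?B \<subseteq> \<Gamma>"
    using basic_bisection_subset_\<Gamma>[OF mn] U V closedin_subset by blast
  show "openin (sg_top gpd) (\<Gamma> - ?B)"
  proof (rule openin_gpdI)
    fix x g y assume *: "(x, g, y) \<in> \<Gamma> - ?B"
    then have \<gamma>: "(x, g, y) \<in> \<Gamma>" by blast
    obtain m' n' where m'n': "m' \<in> P" "n' \<in> P" "g = m' \<otimes> inv n'" "\<theta> m' x = \<theta> n' y"
      "x \<in> topspace X" "y \<in> topspace X"
      using \<gamma> by (rule in_\<Gamma>E)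
    have goal: "\<exists>m\<in>P. \<exists>n\<in>P. \<exists>A B. g = m \<otimes> inv n \<and> \<theta> m x = \<theta> n y \<and>
      openin X A \<and> openin X B \<and> x \<in> A \<and> y \<in> B \<and>
      (\<forall>x'\<in>A. \<forall>y'\<in>B. \<theta> m x' = \<theta> n y' \<longrightarrow> (x', g, y') \<in> \<Gamma> - ?B)"
      if "p \<in> P" "q \<in> P" "g = p \<otimes> inv q" "\<theta> p x = \<theta> q y" "openin X A" "openin X B" "x \<in> A" "y \<in> B"
        and notin: "\<And>x' y'. x' \<in> A \<Longrightarrow> y' \<in> B \<Longrightarrow> \<theta> p x' = \<theta> q y' \<Longrightarrow> (x', g, y') \<notin> ?B" for p q A B
    proof -
      have "(x', g, y') \<in> \<Gamma> - ?B" if "x' \<in> A" "y' \<in> B" "\<theta> p x' = \<theta> q y'" for x' y'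
        using notin[OF that] in_\<Gamma>I[OF \<open>p \<in> P\<close> \<open>q \<in> P\<close> _ _ that(3)] that(1,2) \<open>g = p \<otimes> inv q\<close>
          openin_subset[OF \<open>openin X A\<close>] openin_subset[OF \<open>openin X B\<close>] by auto
      then show ?thesis
        using \<open>\<theta> p x = \<theta> q y\<close>
        by (intro bexI[OF _ \<open>p \<in> P\<close>] bexI[OF _ \<open>q \<in> P\<close>] exI[of _ A] exI[of _ B] conjI ballI impI that) auto
    qed
    consider "g \<noteq> m \<otimes> inv n" | "g = m \<otimes> inv n" "\<theta> m x \<noteq> \<theta> n y" | "g = m \<otimes> inv n" "\<theta> m x = \<theta> n y" "x \<notin> U"
      | "g = m \<otimes> inv n" "\<theta> m x = \<theta> n y" "y \<notin> V"
      using * unfolding basic_bisection_def by blast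
    then show "\<exists>m\<in>P. \<exists>n\<in>P. \<exists>A B. g = m \<otimes> inv n \<and> \<theta> m x = \<theta> n y \<and>
      openin X A \<and> openin X B \<and> x \<in> A \<and> y \<in> B \<and>
      (\<forall>x'\<in>A. \<forall>y'\<in>B. \<theta> m x' = \<theta> n y' \<longrightarrow> (x', g, y') \<in> \<Gamma> - ?B)"
    proof cases
      case 1
      then show ?thesis
        by (intro goal[OF m'n'(1-4) openin_topspace openin_topspace m'n'(5,6)]) (auto simp: basic_bisection_def)
    next
      \<comment> \<open>The label is right but this fraction does not witness it, so the
        neighbourhood is taken for another fraction \<open>m'\<close>, \<open>n'\<close> and shrunk
        until \<open>\<theta> m\<close> and \<open>\<theta> n\<close> take values in disjoint open
        sets.\<close>
      case 2
      have "\<theta> m x \<in> topspace X" "\<theta> n y \<in> topspace X"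
        using mn m'n' act_closed by auto
      then obtain O1 O2 where O12: "openin X O1" "openin X O2" "\<theta> m x \<in> O1" "\<theta> n y \<in> O2" "disjnt O1 O2"
        using Hausdorff_X 2(2) unfolding Hausdorff_space_def by blast
      show ?thesis
        by (rule goal[OF m'n'(1-4), of "{x' \<in> topspace X. \<theta> m x' \<in> O1}" "{y' \<in> topspace X. \<theta> n y' \<in> O2}"])
          (use O12 m'n' mn in \<open>auto simp: open_act_preimage basic_bisection_def disjnt_iff\<close>)
    next
      case 3
      show ?thesis
        by (rule goal[OF mn 3(1,2), of "topspace X - U" "topspace X"])
          (use U 3 m'n' in \<open>auto simp: basic_bisection_def openin_diff\<close>)
    next
      case 4
      show ?thesis
        by (rule goal[OF mn 4(1,2), of "topspace X" "topspace X - V"])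
          (use V 4 m'n' in \<open>auto simp: basic_bisection_def openin_diff\<close>)
    qed
  qed
qed

lemma compactin_basic_bisection:
  assumes mn: "m \<in> P" "n \<in> P" and U: "closedin X U" and V: "closedin X V"
  shows "compactin (sg_top gpd) (basic_bisection G \<theta> U m n V)"
proof -
  let ?K = "{(x, y). \<theta> m x = \<theta> n y} \<inter> (U \<times> V)"
  have sub: "U \<subseteq> topspace X" "V \<subseteq> topspace X"
    using U V closedin_subset by auto
  have "closedin (prod_topology X X) (U \<times> V)"
    using U V by (simp add: closedin_prod_Times_iff)
  then have "closedin (eq_space m n) ?K"
    unfolding eq_space_def by (rule closedin_subtopology_Int_closed)
  then have "compactin (eq_space m n) ?K"
    using compact_eq_space[OF mn] closedin_compact_space by blast
  then have "compactin (sg_top gpd) ((\<lambda>(x, y). (x, m \<otimes> inv n, y)) ` ?K)"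
    by (rule image_compactin) (use continuous_map_into_gpd[OF mn] in \<open>simp add: eq_space_def\<close>)
  moreover have "(\<lambda>(x, y). (x, m \<otimes> inv n, y)) ` ?K = basic_bisection G \<theta> U m n V"
    unfolding basic_bisection_def by auto
  ultimately show ?thesis by simp
qed

text \<open>Two cases are used: \<open>F = 1\<close> gives the characteristic function of a compact
  open bisection, and the bisection of all units gives the diagonal functions.\<close>

lemma Cc_basic_bisection:
  assumes mn: "m \<in> P" "n \<in> P" and U: "openin X U" "closedin X U" and V: "openin X V" "closedin X V"
    and F: "continuous_map X euclidean F"
  shows "(\<lambda>\<gamma>. if \<gamma> \<in> basic_bisection G \<theta> U m n V then F (rng \<gamma>) else 0) \<in> Cc gpd" (is "?f \<in> _")
proof (rule CcI)
  let ?B = "basic_bisection G \<theta> U m n V"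
  have B: "openin (sg_top gpd) ?B" "closedin (sg_top gpd) ?B" "compactin (sg_top gpd) ?B" "?B \<subseteq> \<Gamma>"
    using openin_basic_bisection[OF mn U(1) V(1)] closedin_basic_bisection[OF mn U(2) V(2)]
      compactin_basic_bisection[OF mn U(2) V(2)] by (simp_all add: closedin_subset)
  show "compactin (sg_top gpd) ?B" "closedin (sg_top gpd) ?B" by fact+
  show "?f \<gamma> = 0" if "\<gamma> \<notin> \<Gamma>" for \<gamma> using that B(4) by auto
  show "\<gamma> \<in> ?B" if "?f \<gamma> \<noteq> 0" for \<gamma> using that by presburger
  show "continuous_map (sg_top gpd) euclidean ?f"
    unfolding continuous_map_def
  proof (intro conjI allI impI)
    fix O' :: "complex set" assume O': "openin euclidean O'"
    have "continuous_map (sg_top gpd) euclidean (F \<circ> rng)"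
      using continuous_range F by (rule continuous_map_compose)
    then have "openin (sg_top gpd) {\<gamma> \<in> \<Gamma>. (F \<circ> rng) \<gamma> \<in> O'}"
      using O' by (rule openin_continuous_map_preimage)
    then have "openin (sg_top gpd) ({\<gamma> \<in> \<Gamma>. (F \<circ> rng) \<gamma> \<in> O'} \<inter> ?B \<union> (if 0 \<in> O' then \<Gamma> - ?B else {}))"
      using B(1,2) by auto
    moreover have "{\<gamma> \<in> \<Gamma>. ?f \<gamma> \<in> O'} = {\<gamma> \<in> \<Gamma>. (F \<circ> rng) \<gamma> \<in> O'} \<inter> ?B \<union> (if 0 \<in> O' then \<Gamma> - ?B else {})"
      by (auto split: if_splits)
    ultimately show "openin (sg_top gpd) {\<gamma> \<in> \<Gamma>. ?f \<gamma> \<in> O'}" by simp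
  qed auto
qed

lemma Cc_diagonal:
  assumes "continuous_map X euclidean F"
  shows "diagonal_function G X F \<in> Cc gpd"
proof -
  have "(\<lambda>\<gamma>. if \<gamma> \<in> basic_bisection G \<theta> (topspace X) \<one> \<one> (topspace X) then F (rng \<gamma>) else 0) =
      diagonal_function G X F"
    by (auto simp: diagonal_function_def basic_bisection_def action_one fun_eq_iff)
  then show ?thesis
    using Cc_basic_bisection[of \<one> \<one> "topspace X" "topspace X" F] assms by simp
qed

end

section \<open>Products and sums of compactly supported functions\<close>

context semigroup_action
begin

text \<open>Openness of multiplication. As for products of germ labels, the middle point is found by
  lifting \<open>x'\<close> to some \<open>y'\<close> near \<open>y\<close> and then cancelling
  \<open>q\<close> on the set \<open>N\<close>. It later yields continuity of translation by a
  bisection.\<close>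

lemma openin_product:
  assumes W1: "openin (sg_top gpd) W1" and W2: "openin (sg_top gpd) W2"
  shows "openin (sg_top gpd) {\<gamma>. \<exists>\<alpha>\<in>W1. \<exists>\<beta>\<in>W2. src \<alpha> = rng \<beta> \<and> \<gamma> = sg_mult gpd \<alpha> \<beta>}" (is "openin _ ?W")
proof (rule openin_gpdI)
  fix x g z assume "(x, g, z) \<in> ?W"
  then obtain \<alpha> \<beta> where \<alpha>\<beta>: "\<alpha> \<in> W1" "\<beta> \<in> W2" "src \<alpha> = rng \<beta>" "(x, g, z) = sg_mult gpd \<alpha> \<beta>"
    by blast
  obtain x' a y where \<alpha>: "\<alpha> = (x', a, y)" by (metis prod.exhaust)
  obtain y' b z' where \<beta>: "\<beta> = (y', b, z')" by (metis prod.exhaust)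
  have eqs: "x' = x" "y' = y" "z' = z" "g = a \<otimes> b"
    using \<alpha>\<beta>(3,4) by (auto simp: \<alpha> \<beta>)
  have \<alpha>W: "(x, a, y) \<in> W1" and \<beta>W: "(y, b, z) \<in> W2"
    using \<alpha>\<beta> \<alpha> \<beta> eqs by auto
  have "(x, a, y) \<in> \<Gamma>" "(y, b, z) \<in> \<Gamma>"
    using \<alpha>W \<beta>W openin_subset[OF W1] openin_subset[OF W2] by auto
  then obtain m n m' n' where mn: "m \<in> P" "n \<in> P" "a = m \<otimes> inv n" "\<theta> m x = \<theta> n y"
    "x \<in> topspace X" "y \<in> topspace X"
    and m'n': "m' \<in> P" "n' \<in> P" "b = m' \<otimes> inv n'" "\<theta> m' y = \<theta> n' z" "z \<in> topspace X"
    by (auto elim!: in_\<Gamma>E)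
  obtain A1 B1 where 1: "openin X A1" "openin X B1" "x \<in> A1" "y \<in> B1"
    "\<And>x' y'. x' \<in> A1 \<Longrightarrow> y' \<in> B1 \<Longrightarrow> \<theta> m x' = \<theta> n y' \<Longrightarrow> (x', m \<otimes> inv n, y') \<in> W1"
    using openin_gpdD[OF W1 mn(1,2,5,6,4)] \<alpha>W mn(3) by blast
  obtain A2 B2 where 2: "openin X A2" "openin X B2" "y \<in> A2" "z \<in> B2"
    "\<And>x' y'. x' \<in> A2 \<Longrightarrow> y' \<in> B2 \<Longrightarrow> \<theta> m' x' = \<theta> n' y' \<Longrightarrow> (x', m' \<otimes> inv n', y') \<in> W2"
    using openin_gpdD[OF W2 m'n'(1,2) mn(6) m'n'(5,4)] \<beta>W m'n'(3) by blast
  obtain p q where pq: "p \<in> P" "q \<in> P" "n \<otimes> p = m' \<otimes> q"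
    using common_multiple mn(2) m'n'(1) by metis
  obtain N where N: "openin X N" "\<theta> m' y \<in> N" "inj_on (\<theta> q) N"
    using local_homeomorphism_imp_locally_injective[OF local_homeo[OF pq(2)], of "\<theta> m' y"]
      act_closed[OF m'n'(1) mn(6)] by blast
  have nbhd: "openin X (B1 \<inter> A2 \<inter> {y' \<in> topspace X. \<theta> m' y' \<in> N})"
    "y \<in> B1 \<inter> A2 \<inter> {y' \<in> topspace X. \<theta> m' y' \<in> N}"
    using 1 2 N mn m'n' open_act_preimage[OF m'n'(1) N(1)] by auto
  obtain A3 where 3: "openin X A3" "x \<in> A3"
    "\<And>x'. x' \<in> A3 \<Longrightarrow> \<exists>y'\<in>B1 \<inter> A2 \<inter> {y' \<in> topspace X. \<theta> m' y' \<in> N}. \<theta> m x' = \<theta> n y'"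
    using act_lift[OF mn(1,2,5,4) nbhd] by blast
  define A where "A = A1 \<inter> A3"
  define B where "B = B2 \<inter> {z' \<in> topspace X. \<theta> n' z' \<in> N}"
  have AB: "openin X A" "openin X B" "x \<in> A" "z \<in> B"
    unfolding A_def B_def using 1 2 3 N m'n' open_act_preimage[OF m'n'(2) N(1)] by auto
  have split: "\<theta> (m \<otimes> p) x' = \<theta> q (\<theta> m' y')"
    if "x' \<in> topspace X" "y' \<in> topspace X" "\<theta> m x' = \<theta> n y'" for x' y'
  proof -
    have "\<theta> (m \<otimes> p) x' = \<theta> p (\<theta> m x')"
      using that(1) mn(1) pq(1) by (simp add: action_mult)
    also have "\<dots> = \<theta> p (\<theta> n y')"
      by (simp add: that(3))
    also have "\<dots> = \<theta> q (\<theta> m' y')"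
      using that(2) mn(2) m'n'(1) pq by (simp add: action_mult)
    finally show ?thesis .
  qed
  have n'q: "\<theta> (n' \<otimes> q) z' = \<theta> q (\<theta> n' z')" if "z' \<in> topspace X" for z'
    using that m'n'(2) pq(2) by (simp add: action_mult)
  have "(x', g, z') \<in> ?W" if x': "x' \<in> A" and z': "z' \<in> B" and eq: "\<theta> (m \<otimes> p) x' = \<theta> (n' \<otimes> q) z'" for x' z'
  proof -
    obtain y' where y': "y' \<in> B1" "y' \<in> A2" "y' \<in> topspace X" "\<theta> m' y' \<in> N" "\<theta> m x' = \<theta> n y'"
      using 3(3)[of x'] x' unfolding A_def by blast
    have xX: "x' \<in> topspace X" "x' \<in> A1" using x' 1(1) openin_subset unfolding A_def by blast+
    have zX: "z' \<in> topspace X" "\<theta> n' z' \<in> N" "z' \<in> B2" using z' by (auto simp: B_def)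
    have "\<theta> q (\<theta> m' y') = \<theta> q (\<theta> n' z')"
      using split[OF xX(1) y'(3,5)] n'q[OF zX(1)] eq by simp
    then have "\<theta> m' y' = \<theta> n' z'"
      using N(3) y'(4) zX(2) by (simp add: inj_on_eq_iff)
    then have "(y', b, z') \<in> W2" using 2(5) y' zX m'n'(3) by blast
    moreover have "(x', a, y') \<in> W1" using 1(5) xX y' mn(3) by blast
    moreover have "(x', g, z') = sg_mult gpd (x', a, y') (y', b, z')" using eqs by simp
    ultimately show ?thesis by (intro CollectI bexI[of _ "(x', a, y')"] bexI[of _ "(y', b, z')"]) auto
  qed
  moreover have "g = (m \<otimes> p) \<otimes> inv (n' \<otimes> q)"
    using product_quotient[of m n m' n' p q] mn m'n' pq eqs(4) by simp
  moreover have "\<theta> (m \<otimes> p) x = \<theta> (n' \<otimes> q) z"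
    using split[OF mn(5,6,4)] n'q[OF m'n'(5)] m'n'(4) by simp
  moreover have "m \<otimes> p \<in> P" "n' \<otimes> q \<in> P" using mn m'n' pq by auto
  ultimately show "\<exists>m\<in>P. \<exists>n\<in>P. \<exists>A B. g = m \<otimes> inv n \<and> \<theta> m x = \<theta> n z \<and>
      openin X A \<and> openin X B \<and> x \<in> A \<and> z \<in> B \<and>
      (\<forall>x'\<in>A. \<forall>y'\<in>B. \<theta> m x' = \<theta> n y' \<longrightarrow> (x', g, y') \<in> ?W)"
    using AB by blast
qed

lemma openin_range_image:
  assumes W: "openin (sg_top gpd) W"
  shows "openin X (rng ` W)"
proof (subst openin_subopen, intro ballI)
  fix x assume "x \<in> rng ` W"
  then obtain g y where \<gamma>: "(x, g, y) \<in> W" by force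
  then obtain m n where mn: "m \<in> P" "n \<in> P" "g = m \<otimes> inv n" "\<theta> m x = \<theta> n y"
    "x \<in> topspace X" "y \<in> topspace X"
    using openin_subset[OF W] by (meson in_\<Gamma>E subsetD)
  obtain A B where AB: "openin X A" "openin X B" "x \<in> A" "y \<in> B"
    "\<And>x' y'. x' \<in> A \<Longrightarrow> y' \<in> B \<Longrightarrow> \<theta> m x' = \<theta> n y' \<Longrightarrow> (x', m \<otimes> inv n, y') \<in> W"
    using openin_gpdD[OF W mn(1,2,5,6,4)] \<gamma> mn(3) by blast
  obtain A' where A': "openin X A'" "x \<in> A'" "\<And>x'. x' \<in> A' \<Longrightarrow> \<exists>y'\<in>B. \<theta> m x' = \<theta> n y'"
    using act_lift[OF mn(1,2,5,4) AB(2,4)] by blast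
  have "A \<inter> A' \<subseteq> rng ` W"
    using AB(5) A'(3) by force
  then show "\<exists>T. openin X T \<and> x \<in> T \<and> T \<subseteq> rng ` W"
    using AB A' by (intro exI[of _ "A \<inter> A'"]) auto
qed

lemma Cc_mult_range:
  assumes F: "continuous_map X euclidean F" and f: "f \<in> Cc gpd"
  shows "(\<lambda>\<gamma>. F (rng \<gamma>) * f \<gamma>) \<in> Cc gpd"
proof -
  obtain K where K: "compactin (sg_top gpd) K" "closedin (sg_top gpd) K" "\<And>\<gamma>. \<gamma> \<in> \<Gamma> \<Longrightarrow> f \<gamma> \<noteq> 0 \<Longrightarrow> \<gamma> \<in> K"
    using CcE[OF f] by blast
  have "continuous_map (sg_top gpd) (prod_topology euclidean euclidean) (\<lambda>\<gamma>. ((F \<circ> rng) \<gamma>, f \<gamma>))"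
    by (intro continuous_map_pairedI continuous_map_compose[OF continuous_range F] Cc_continuous[OF f])
  moreover have "continuous_map (prod_topology euclidean euclidean) euclidean (\<lambda>z :: complex \<times> complex. fst z * snd z)"
    by (simp add: continuous_on_fst continuous_on_mult continuous_on_snd)
  ultimately have "continuous_map (sg_top gpd) euclidean ((\<lambda>z. fst z * snd z) \<circ> (\<lambda>\<gamma>. ((F \<circ> rng) \<gamma>, f \<gamma>)))"
    by (rule continuous_map_compose)
  then have "continuous_map (sg_top gpd) euclidean (\<lambda>\<gamma>. F (rng \<gamma>) * f \<gamma>)"
    by (simp add: comp_def)
  then show ?thesis
    by (rule CcI[OF _ _ K(1,2)]) (use Cc_zero[OF f] K(3) in auto)
qed

lemma Cc_add:
  assumes f: "f \<in> Cc gpd" and f': "f' \<in> Cc gpd"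
  shows "(\<lambda>\<gamma>. f \<gamma> + f' \<gamma>) \<in> Cc gpd"
proof -
  obtain K where K: "compactin (sg_top gpd) K" "closedin (sg_top gpd) K" "\<And>\<gamma>. \<gamma> \<in> \<Gamma> \<Longrightarrow> f \<gamma> \<noteq> 0 \<Longrightarrow> \<gamma> \<in> K"
    using CcE[OF f] by blast
  obtain K' where K': "compactin (sg_top gpd) K'" "closedin (sg_top gpd) K'" "\<And>\<gamma>. \<gamma> \<in> \<Gamma> \<Longrightarrow> f' \<gamma> \<noteq> 0 \<Longrightarrow> \<gamma> \<in> K'"
    using CcE[OF f'] by blast
  have "continuous_map (sg_top gpd) euclidean (\<lambda>\<gamma>. f \<gamma> + f' \<gamma>)"
    using continuous_map_add[OF Cc_continuous[OF f] Cc_continuous[OF f']] .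
  then show ?thesis
  proof (rule CcI[OF _ _ compactin_Un[OF K(1) K'(1)] closedin_Un[OF K(2) K'(2)]])
    show "f \<gamma> + f' \<gamma> = 0" if "\<gamma> \<notin> \<Gamma>" for \<gamma>
      using that by (simp add: Cc_zero[OF f] Cc_zero[OF f'])
    show "\<gamma> \<in> K \<union> K'" if "\<gamma> \<in> \<Gamma>" "f \<gamma> + f' \<gamma> \<noteq> 0" for \<gamma>
      using that K(3)[of \<gamma>] K'(3)[of \<gamma>] by (cases "f \<gamma> = 0") auto
  qed
qed

lemma Cc_restrict:
  assumes f: "f \<in> Cc gpd" and B: "openin (sg_top gpd) B" "closedin (sg_top gpd) B"
  shows "(\<lambda>\<gamma>. if \<gamma> \<in> B then f \<gamma> else 0) \<in> Cc gpd"
proof -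
  obtain K where K: "compactin (sg_top gpd) K" "closedin (sg_top gpd) K" "\<And>\<gamma>. \<gamma> \<in> \<Gamma> \<Longrightarrow> f \<gamma> \<noteq> 0 \<Longrightarrow> \<gamma> \<in> K"
    using CcE[OF f] by blast
  have "openin (sg_top gpd) {\<gamma> \<in> \<Gamma>. (if \<gamma> \<in> B then f \<gamma> else 0) \<in> O'}" if "openin euclidean O'" for O'
  proof -
    have "openin (sg_top gpd) {\<gamma> \<in> \<Gamma>. f \<gamma> \<in> O'}"
      using Cc_continuous[OF f] that by (rule openin_continuous_map_preimage)
    then have "openin (sg_top gpd) ({\<gamma> \<in> \<Gamma>. f \<gamma> \<in> O'} \<inter> B \<union> (if 0 \<in> O' then \<Gamma> - B else {}))"
      using B by auto
    moreover have "{\<gamma> \<in> \<Gamma>. (if \<gamma> \<in> B then f \<gamma> else 0) \<in> O'} = {\<gamma> \<in> \<Gamma>. f \<gamma> \<in> O'} \<inter> B \<union> (if 0 \<in> O' then \<Gamma> - B else {})"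
      by (auto split: if_splits)
    ultimately show ?thesis by simp
  qed
  then have "continuous_map (sg_top gpd) euclidean (\<lambda>\<gamma>. if \<gamma> \<in> B then f \<gamma> else 0)"
    by (auto simp: continuous_map_def)
  then show ?thesis
    by (rule CcI[OF _ _ K(1,2)]) (use Cc_zero[OF f] K(3) in \<open>auto split: if_splits\<close>)
qed

lemma regular_rep_add:
  assumes f: "f \<in> Cc gpd" and f': "f' \<in> Cc gpd"
  shows "regular_rep gpd (\<lambda>\<gamma>. f \<gamma> + f' \<gamma>) = op_add \<Gamma> (regular_rep gpd f) (regular_rep gpd f')"
proof (rule extensionalityI[of _ "ell2 \<Gamma>"])
  fix \<xi> assume \<xi>: "\<xi> \<in> ell2 \<Gamma>"
  show "regular_rep gpd (\<lambda>\<gamma>. f \<gamma> + f' \<gamma>) \<xi> = op_add \<Gamma> (regular_rep gpd f) (regular_rep gpd f') \<xi>"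
  proof
    fix \<gamma> :: "'x \<times> 'g \<times> 'x"
    have summ: "(\<lambda>\<alpha>. h \<alpha> * \<xi> (ldiv \<alpha> \<gamma>)) summable_on {\<alpha> \<in> \<Gamma>. rng \<alpha> = rng \<gamma>}" if h: "h \<in> Cc gpd" for h
    proof (rule finite_nonzero_values_imp_summable_on)
      obtain N where "\<And>x. finite {\<alpha> \<in> \<Gamma>. rng \<alpha> = x \<and> h \<alpha> \<noteq> 0}"
        using Cc_fibre_bound[OF h] by blast
      then show "finite {\<alpha> \<in> {\<alpha> \<in> \<Gamma>. rng \<alpha> = rng \<gamma>}. h \<alpha> * \<xi> (ldiv \<alpha> \<gamma>) \<noteq> 0}"
        by (rule rev_finite_subset) auto
    qed
    show "regular_rep gpd (\<lambda>\<gamma>. f \<gamma> + f' \<gamma>) \<xi> \<gamma> = op_add \<Gamma> (regular_rep gpd f) (regular_rep gpd f') \<xi> \<gamma>"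
    proof (cases "\<gamma> \<in> \<Gamma>")
      case True
      then show ?thesis
        using \<xi> infsum_add[OF summ[OF f] summ[OF f']]
        by (simp add: op_add_def regular_rep_apply distrib_right)
    qed (use \<xi> in \<open>simp add: op_add_def regular_rep_outside\<close>)
  qed
qed (simp_all add: regular_rep_extensional op_add_def)

end

section \<open>Clopen bisections, their partial homeomorphisms and translations\<close>

locale clopen_bisection = semigroup_action G X P \<theta>
  for G :: "'g monoid" (structure) and X :: "'x topology" and P :: "'g set" and \<theta> :: "'g \<Rightarrow> 'x \<Rightarrow> 'x" +
  fixes m n :: 'g and U V :: "'x set"
  assumes m: "m \<in> P" and n: "n \<in> P" and openU: "openin X U" and closedU: "closedin X U"
    and openV: "openin X V" and closedV: "closedin X V"
    and inj_m: "inj_on (\<theta> m) U" and inj_n: "inj_on (\<theta> n) V" and image_eq: "\<theta> m ` U = \<theta> n ` V"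
begin

lemma bisection_swap: "clopen_bisection G X P \<theta> n m V U"
  by unfold_locales (use m n openU closedU openV closedV inj_m inj_n image_eq in auto)

text \<open>The partial homeomorphism of \<open>U\<close> onto \<open>V\<close> that the bisection
  implements; the swapped bisection implements its inverse.\<close>

definition \<tau> :: "'x \<Rightarrow> 'x" where "\<tau> x = inv_into V (\<theta> n) (\<theta> m x)"

definition section_at :: "'x \<Rightarrow> 'x \<times> 'g \<times> 'x" where "section_at x = (x, m \<otimes> inv n, \<tau> x)"

abbreviation B :: "('x \<times> 'g \<times> 'x) set" where "B \<equiv> basic_bisection G \<theta> U m n V"

lemma \<tau>: assumes "x \<in> U" shows "\<tau> x \<in> V" "\<theta> n (\<tau> x) = \<theta> m x"
proof -
  have "\<theta> m x \<in> \<theta> n ` V" using assms image_eq by blast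
  then show "\<tau> x \<in> V" "\<theta> n (\<tau> x) = \<theta> m x"
    unfolding \<tau>_def by (auto intro: inv_into_into f_inv_into_f)
qed

lemma \<tau>_unique: "x \<in> U \<Longrightarrow> y \<in> V \<Longrightarrow> \<theta> m x = \<theta> n y \<Longrightarrow> y = \<tau> x"
  using \<tau> inj_n by (metis inj_onD)

lemma U_subset: "U \<subseteq> topspace X" and V_subset: "V \<subseteq> topspace X"
  using openU openV openin_subset by auto

lemma B_iff: "\<alpha> \<in> B \<longleftrightarrow> rng \<alpha> \<in> U \<and> \<alpha> = section_at (rng \<alpha>)"
  using \<tau> \<tau>_unique by (cases \<alpha>) (fastforce simp: basic_bisection_def section_at_def)

lemma B_subset: "B \<subseteq> \<Gamma>"
  by (rule basic_bisection_subset_\<Gamma>[OF m n U_subset V_subset])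

lemma section_at_in_\<Gamma>: "x \<in> U \<Longrightarrow> section_at x \<in> \<Gamma>"
  using B_iff[of "section_at x"] B_subset by (auto simp: section_at_def)

lemma rng_section_at [simp]: "rng (section_at x) = x" and src_section_at [simp]: "src (section_at x) = \<tau> x"
  by (simp_all add: section_at_def)

text \<open>Left translation by the inverse of the bisection element with range
  \<open>rng \<gamma>\<close>. It carries elements with range in \<open>U\<close> to elements with
  range in \<open>V\<close>, and the shift of the swapped bisection undoes it.\<close>

definition shift :: "'x \<times> 'g \<times> 'x \<Rightarrow> 'x \<times> 'g \<times> 'x" where
  "shift \<gamma> = ldiv (section_at (rng \<gamma>)) \<gamma>"

lemma rng_shift: "rng (shift \<gamma>) = \<tau> (rng \<gamma>)"
  by (simp add: shift_def ldiv_def)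

lemma shift_in_\<Gamma>: "\<gamma> \<in> \<Gamma> \<Longrightarrow> rng \<gamma> \<in> U \<Longrightarrow> shift \<gamma> \<in> \<Gamma>"
  unfolding shift_def by (intro ldiv_in_\<Gamma> section_at_in_\<Gamma>) auto

lemma swap_shift:
  assumes "\<gamma> \<in> \<Gamma>" "rng \<gamma> \<in> U"
  shows "clopen_bisection.shift G \<theta> n m U (shift \<gamma>) = \<gamma>"
proof -
  interpret s: clopen_bisection G X P \<theta> n m V U by (rule bisection_swap)
  obtain x g z where \<gamma>: "\<gamma> = (x, g, z)" by (metis prod.exhaust)
  have car: "g \<in> carrier G" using assms \<gamma> in_\<Gamma>_carrier by auto
  have "s.\<tau> (\<tau> x) = x"
    using s.\<tau>_unique[of "\<tau> x" x] \<tau>[of x] assms \<gamma> by simp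
  moreover have "inv (n \<otimes> inv m) \<otimes> (inv (m \<otimes> inv n) \<otimes> g) = g"
    using m n car by (simp add: inv_mult_group m_assoc) (simp flip: m_assoc)
  ultimately show ?thesis
    by (simp add: \<gamma> shift_def s.shift_def section_at_def s.section_at_def ldiv_def)
qed

text \<open>The preimage of \<open>W\<close> is the product set of \<open>B\<close> and
  \<open>W\<close>, because \<gamma> factors as the bisection element at its range times
  \<open>shift \<gamma>\<close>. Openness of products finishes.\<close>

lemma openin_shift_preimage:
  assumes "openin (sg_top gpd) W"
  shows "openin (sg_top gpd) {\<gamma> \<in> \<Gamma>. rng \<gamma> \<in> U \<and> shift \<gamma> \<in> W}"
proof -
  have "{\<gamma> \<in> \<Gamma>. rng \<gamma> \<in> U \<and> shift \<gamma> \<in> W} =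
      {\<gamma>. \<exists>\<alpha>\<in>B. \<exists>\<beta>\<in>W. src \<alpha> = rng \<beta> \<and> \<gamma> = sg_mult gpd \<alpha> \<beta>}" (is "?L = ?R")
  proof
    show "?L \<subseteq> ?R"
    proof
      fix \<gamma> assume \<gamma>: "\<gamma> \<in> ?L"
      then have "section_at (rng \<gamma>) \<in> B" by (simp add: B_iff)
      moreover have "src (section_at (rng \<gamma>)) = rng (shift \<gamma>)" by (simp add: rng_shift)
      moreover have "\<gamma> = sg_mult gpd (section_at (rng \<gamma>)) (shift \<gamma>)"
        unfolding shift_def using \<gamma> by (intro mult_ldiv(2)[symmetric] section_at_in_\<Gamma>) auto
      ultimately show "\<gamma> \<in> ?R" using \<gamma> by blast
    qed
    show "?R \<subseteq> ?L"
    proof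
      fix \<gamma> assume "\<gamma> \<in> ?R"
      then obtain \<alpha> \<beta> where *: "\<alpha> \<in> B" "\<beta> \<in> W" "src \<alpha> = rng \<beta>" "\<gamma> = sg_mult gpd \<alpha> \<beta>" by blast
      have in\<Gamma>: "\<alpha> \<in> \<Gamma>" "\<beta> \<in> \<Gamma>"
        using * B_subset openin_subset[OF assms] by auto
      have rng: "rng \<gamma> = rng \<alpha>" using *(4) by (cases \<alpha>; cases \<beta>) simp
      have "shift \<gamma> = \<beta>"
        unfolding shift_def rng using ldiv_mult[OF in\<Gamma> *(3)] *(1,4) B_iff by metis
      moreover have "sg_comp gpd \<alpha> \<beta>" using *(3) by (cases \<alpha>; cases \<beta>) simp
      then have "\<gamma> \<in> \<Gamma>" using sg_mult_closed in\<Gamma> *(4) by blast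
      ultimately show "\<gamma> \<in> ?L" using * rng B_iff by auto
    qed
  qed
  then show ?thesis
    using openin_product[OF openin_basic_bisection[OF m n openU openV] assms] by simp
qed

lemma openin_range_preimage: "openin X D \<Longrightarrow> openin (sg_top gpd) {\<gamma> \<in> \<Gamma>. rng \<gamma> \<in> D}"
  by (rule openin_continuous_map_preimage[OF continuous_range])

text \<open>The support stays compact since it lies in the image, under the continuous swapped
  shift, of the part of \<open>K\<close> with range in \<open>V\<close>. Extension by zero is
  continuous because \<open>U\<close> is clopen.\<close>

lemma Cc_shift:
  assumes f: "f \<in> Cc gpd"
  shows "(\<lambda>\<gamma>. if \<gamma> \<in> \<Gamma> \<and> rng \<gamma> \<in> U then f (shift \<gamma>) else 0) \<in> Cc gpd" (is "?f \<in> _")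
proof -
  interpret s: clopen_bisection G X P \<theta> n m V U by (rule bisection_swap)
  obtain K where K: "compactin (sg_top gpd) K" "closedin (sg_top gpd) K" "\<And>\<gamma>. \<gamma> \<in> \<Gamma> \<Longrightarrow> f \<gamma> \<noteq> 0 \<Longrightarrow> \<gamma> \<in> K"
    using CcE[OF f] by blast
  define L where "L = {\<gamma> \<in> \<Gamma>. rng \<gamma> \<in> U \<and> shift \<gamma> \<in> K}"
  have rngV: "closedin (sg_top gpd) {\<gamma> \<in> \<Gamma>. rng \<gamma> \<in> V}"
    using closedin_continuous_map_preimage[OF continuous_range closedV] .
  have L_eq: "L = s.shift ` (K \<inter> {\<gamma> \<in> \<Gamma>. rng \<gamma> \<in> V})"
  proof
    show "L \<subseteq> s.shift ` (K \<inter> {\<gamma> \<in> \<Gamma>. rng \<gamma> \<in> V})"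
    proof
      fix \<gamma> assume \<gamma>: "\<gamma> \<in> L"
      then have "shift \<gamma> \<in> K \<inter> {\<gamma> \<in> \<Gamma>. rng \<gamma> \<in> V}"
        unfolding L_def using shift_in_\<Gamma> rng_shift \<tau>(1) by auto
      moreover have "\<gamma> = s.shift (shift \<gamma>)" using swap_shift \<gamma> unfolding L_def by auto
      ultimately show "\<gamma> \<in> s.shift ` (K \<inter> {\<gamma> \<in> \<Gamma>. rng \<gamma> \<in> V})" by blast
    qed
    show "s.shift ` (K \<inter> {\<gamma> \<in> \<Gamma>. rng \<gamma> \<in> V}) \<subseteq> L"
      unfolding L_def using s.shift_in_\<Gamma> s.rng_shift s.\<tau>(1) s.swap_shift by auto
  qed
  have comp: "compactin (subtopology (sg_top gpd) {\<gamma> \<in> \<Gamma>. rng \<gamma> \<in> V}) (K \<inter> {\<gamma> \<in> \<Gamma>. rng \<gamma> \<in> V})"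
    using compact_Int_closedin[OF K(1) rngV] by (simp add: compactin_subtopology)
  have cont: "continuous_map (subtopology (sg_top gpd) {\<gamma> \<in> \<Gamma>. rng \<gamma> \<in> V}) (sg_top gpd) s.shift"
    unfolding continuous_map_def
  proof (intro conjI allI impI)
    fix W assume W: "openin (sg_top gpd) W"
    have eq: "{\<gamma> \<in> topspace (subtopology (sg_top gpd) {\<gamma> \<in> \<Gamma>. rng \<gamma> \<in> V}). s.shift \<gamma> \<in> W} =
        {\<gamma> \<in> \<Gamma>. rng \<gamma> \<in> V} \<inter> {\<gamma> \<in> \<Gamma>. rng \<gamma> \<in> V \<and> s.shift \<gamma> \<in> W}"
      by auto
    show "openin (subtopology (sg_top gpd) {\<gamma> \<in> \<Gamma>. rng \<gamma> \<in> V})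
        {\<gamma> \<in> topspace (subtopology (sg_top gpd) {\<gamma> \<in> \<Gamma>. rng \<gamma> \<in> V}). s.shift \<gamma> \<in> W}"
      unfolding eq by (rule openin_subtopology_Int2[OF s.openin_shift_preimage[OF W]])
  qed (use s.shift_in_\<Gamma> in auto)
  have compL: "compactin (sg_top gpd) L"
    unfolding L_eq by (rule image_compactin[OF comp cont])
  have "openin (sg_top gpd) ({\<gamma> \<in> \<Gamma>. rng \<gamma> \<in> topspace X - U} \<union> {\<gamma> \<in> \<Gamma>. rng \<gamma> \<in> U \<and> shift \<gamma> \<in> \<Gamma> - K})"
    using K(2) closedU by (intro openin_Un openin_range_preimage openin_shift_preimage) auto
  moreover have "\<Gamma> - L = {\<gamma> \<in> \<Gamma>. rng \<gamma> \<in> topspace X - U} \<union> {\<gamma> \<in> \<Gamma>. rng \<gamma> \<in> U \<and> shift \<gamma> \<in> \<Gamma> - K}"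
    unfolding L_def using rng_in_X shift_in_\<Gamma> by auto
  ultimately have closedL: "closedin (sg_top gpd) L"
    unfolding closedin_def L_def by auto
  have "openin (sg_top gpd) {\<gamma> \<in> \<Gamma>. ?f \<gamma> \<in> O'}" if "openin euclidean O'" for O'
  proof -
    have "openin (sg_top gpd) {\<gamma> \<in> \<Gamma>. f \<gamma> \<in> O'}"
      using Cc_continuous[OF f] that by (rule openin_continuous_map_preimage)
    then have "openin (sg_top gpd) ({\<gamma> \<in> \<Gamma>. rng \<gamma> \<in> U \<and> shift \<gamma> \<in> {\<gamma> \<in> \<Gamma>. f \<gamma> \<in> O'}} \<union>
        (if 0 \<in> O' then {\<gamma> \<in> \<Gamma>. rng \<gamma> \<in> topspace X - U} else {}))"
      using openin_range_preimage[OF openin_diff[OF openin_topspace closedU]]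
      by (intro openin_Un openin_shift_preimage) simp_all
    moreover have "{\<gamma> \<in> \<Gamma>. ?f \<gamma> \<in> O'} = {\<gamma> \<in> \<Gamma>. rng \<gamma> \<in> U \<and> shift \<gamma> \<in> {\<gamma> \<in> \<Gamma>. f \<gamma> \<in> O'}} \<union>
        (if 0 \<in> O' then {\<gamma> \<in> \<Gamma>. rng \<gamma> \<in> topspace X - U} else {})"
      using rng_in_X shift_in_\<Gamma> by (auto split: if_splits)
    ultimately show ?thesis by simp
  qed
  then have "continuous_map (sg_top gpd) euclidean ?f"
    by (auto simp: continuous_map_def)
  then show ?thesis
  proof (rule CcI[OF _ _ compL closedL])
    show "\<gamma> \<in> L" if "\<gamma> \<in> \<Gamma>" "?f \<gamma> \<noteq> 0" for \<gamma>
      using that K(3) shift_in_\<Gamma> unfolding L_def by (auto split: if_splits)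
  qed simp
qed

lemma regular_rep_supported:
  assumes supp: "\<And>\<alpha>. \<alpha> \<notin> B \<Longrightarrow> f \<alpha> = 0" and \<xi>: "\<xi> \<in> ell2 \<Gamma>" and \<gamma>: "\<gamma> \<in> \<Gamma>"
  shows "regular_rep gpd f \<xi> \<gamma> = (if rng \<gamma> \<in> U then f (section_at (rng \<gamma>)) * \<xi> (shift \<gamma>) else 0)"
proof (cases "rng \<gamma> \<in> U")
  case True
  have zero: "f \<alpha> = 0" if "rng \<alpha> = rng \<gamma>" "\<alpha> \<noteq> section_at (rng \<gamma>)" for \<alpha>
    using that B_iff supp by metis
  show ?thesis
    using True regular_rep_single[OF \<xi> \<gamma> section_at_in_\<Gamma>[OF True], of f] zero by (simp add: shift_def)
next
  case False
  have zero: "f \<alpha> = 0" if "rng \<alpha> = rng \<gamma>" for \<alpha>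
    using that B_iff supp False by metis
  show ?thesis
    using False regular_rep_null[OF \<xi> \<gamma>, of f] zero by simp
qed

text \<open>A function on a bisection has at most one nonzero term in each convolution sum, so the
  product is explicit: its value at \<gamma> is \<open>F (rng \<gamma>)\<close> times
  \<open>f' (shift \<gamma>)\<close>, where \<open>F\<close> reads \<open>f\<close> along the
  bisection.\<close>

lemma Cc_product_supported:
  assumes f: "f \<in> Cc gpd" and supp: "\<And>\<alpha>. \<alpha> \<notin> B \<Longrightarrow> f \<alpha> = 0" and f': "f' \<in> Cc gpd"
  obtains f'' where "f'' \<in> Cc gpd" "op_mult \<Gamma> (regular_rep gpd f) (regular_rep gpd f') = regular_rep gpd f''"
proof -
  define F where "F = (\<lambda>x. if x \<in> U then f (section_at x) else 0)"
  define f\<^sub>1 where "f\<^sub>1 = (\<lambda>\<gamma>. if \<gamma> \<in> \<Gamma> \<and> rng \<gamma> \<in> U then f' (shift \<gamma>) else 0)"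
  have "openin X {x \<in> topspace X. F x \<in> O'}" if "openin euclidean O'" for O'
  proof -
    have "openin (sg_top gpd) ({\<gamma> \<in> \<Gamma>. f \<gamma> \<in> O'} \<inter> B)"
      using openin_continuous_map_preimage[OF Cc_continuous[OF f] that]
        openin_basic_bisection[OF m n openU openV] by (rule openin_Int)
    then have "openin X (rng ` ({\<gamma> \<in> \<Gamma>. f \<gamma> \<in> O'} \<inter> B) \<union> (if 0 \<in> O' then topspace X - U else {}))"
      using closedU openin_range_image by auto
    moreover have "{x \<in> topspace X. F x \<in> O'} = rng ` ({\<gamma> \<in> \<Gamma>. f \<gamma> \<in> O'} \<inter> B) \<union> (if 0 \<in> O' then topspace X - U else {})"
    proof -
      have "x \<in> rng ` ({\<gamma> \<in> \<Gamma>. f \<gamma> \<in> O'} \<inter> B) \<longleftrightarrow> x \<in> U \<and> f (section_at x) \<in> O'" for x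
      proof
        assume "x \<in> rng ` ({\<gamma> \<in> \<Gamma>. f \<gamma> \<in> O'} \<inter> B)"
        then obtain \<gamma> where \<gamma>: "f \<gamma> \<in> O'" "\<gamma> \<in> B" "x = rng \<gamma>" by blast
        then have "rng \<gamma> \<in> U" "\<gamma> = section_at (rng \<gamma>)" using B_iff by auto
        with \<gamma> show "x \<in> U \<and> f (section_at x) \<in> O'" by metis
      next
        assume "x \<in> U \<and> f (section_at x) \<in> O'"
        then show "x \<in> rng ` ({\<gamma> \<in> \<Gamma>. f \<gamma> \<in> O'} \<inter> B)"
          using B_iff section_at_in_\<Gamma> by (intro image_eqI[of _ _ "section_at x"]) auto
      qed
      then show ?thesis
        using U_subset unfolding F_def by (auto split: if_splits)
    qed
    ultimately show ?thesis by simp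
  qed
  then have F: "continuous_map X euclidean F"
    by (auto simp: continuous_map_def)
  have f\<^sub>1: "f\<^sub>1 \<in> Cc gpd"
    unfolding f\<^sub>1_def by (rule Cc_shift[OF f'])
  define f'' where "f'' = (\<lambda>\<gamma>. F (rng \<gamma>) * f\<^sub>1 \<gamma>)"
  have f'': "f'' \<in> Cc gpd"
    unfolding f''_def by (rule Cc_mult_range[OF F f\<^sub>1])
  interpret s: clopen_bisection G X P \<theta> n m V U by (rule bisection_swap)
  have "op_mult \<Gamma> (regular_rep gpd f) (regular_rep gpd f') = regular_rep gpd f''"
  proof (rule extensionalityI[of _ "ell2 \<Gamma>"])
    fix \<xi> assume \<xi>: "\<xi> \<in> ell2 \<Gamma>"
    have \<xi>': "regular_rep gpd f' \<xi> \<in> ell2 \<Gamma>"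
      using bounded_operators_closed[OF regular_rep_bounded[OF f'] \<xi>] .
    show "op_mult \<Gamma> (regular_rep gpd f) (regular_rep gpd f') \<xi> = regular_rep gpd f'' \<xi>"
    proof
      fix \<gamma> :: "'x \<times> 'g \<times> 'x"
      consider "\<gamma> \<notin> \<Gamma>" | "\<gamma> \<in> \<Gamma>" "rng \<gamma> \<notin> U" | "\<gamma> \<in> \<Gamma>" "rng \<gamma> \<in> U" by blast
      then show "op_mult \<Gamma> (regular_rep gpd f) (regular_rep gpd f') \<xi> \<gamma> = regular_rep gpd f'' \<xi> \<gamma>"
      proof cases
        case 1
        then show ?thesis using \<xi> \<xi>' by (simp add: op_mult_def regular_rep_outside)
      next
        case 2
        have "regular_rep gpd f'' \<xi> \<gamma> = 0"
          by (rule regular_rep_null[OF \<xi> 2(1)]) (simp add: f''_def F_def 2)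
        then show ?thesis
          using 2 \<xi> \<xi>' by (simp add: op_mult_def regular_rep_supported[OF supp])
      next
        case 3
        let ?t = "shift \<gamma>"
        have t: "?t \<in> \<Gamma>" "rng ?t \<in> V"
          using 3 shift_in_\<Gamma> rng_shift \<tau>(1) by auto
        \<comment> \<open>Elements of one range fibre are translated by the same bisection element,
          which cancels in the left quotient.\<close>
        have ldiv_shift: "ldiv (shift \<alpha>) ?t = ldiv \<alpha> \<gamma>" if \<alpha>': "\<alpha> \<in> \<Gamma>" "rng \<alpha> = rng \<gamma>" for \<alpha>
        proof -
          obtain x k y where \<alpha>: "\<alpha> = (x, k, y)" by (metis prod.exhaust)
          obtain g z where \<gamma>: "\<gamma> = (x, g, z)" using \<alpha>'(2) \<alpha> by (metis fst_conv prod.exhaust)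
          have car: "k \<in> carrier G" "g \<in> carrier G"
            using \<alpha>' 3 \<alpha> \<gamma> in_\<Gamma>_carrier by auto
          define l where "l = m \<otimes> inv n"
          have l: "l \<in> carrier G" using m n by (simp add: l_def)
          have "inv (inv l \<otimes> k) \<otimes> (inv l \<otimes> g) = inv k \<otimes> g"
            using car l by (simp add: inv_mult_group m_assoc) (simp flip: m_assoc)
          then show ?thesis
            by (simp add: \<alpha> \<gamma> shift_def section_at_def ldiv_def flip: l_def)
        qed
        have "regular_rep gpd f' \<xi> ?t = (\<Sum>\<^sub>\<infinity>\<beta>\<in>{\<beta> \<in> \<Gamma>. rng \<beta> = rng ?t}. f' \<beta> * \<xi> (ldiv \<beta> ?t))"
          by (rule regular_rep_apply[OF \<xi> t(1)])
        also have "\<dots> = (\<Sum>\<^sub>\<infinity>\<alpha>\<in>{\<alpha> \<in> \<Gamma>. rng \<alpha> = rng \<gamma>}. f' (shift \<alpha>) * \<xi> (ldiv \<alpha> \<gamma>))"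
        proof (rule infsum_reindex_bij_witness[of _ shift s.shift])
          fix \<beta> assume "\<beta> \<in> {\<beta> \<in> \<Gamma>. rng \<beta> = rng ?t}"
          then have \<beta>: "\<beta> \<in> \<Gamma>" "rng \<beta> = \<tau> (rng \<gamma>)" "rng \<beta> \<in> V" using t by (auto simp: rng_shift)
          show "shift (s.shift \<beta>) = \<beta>" using s.swap_shift[OF \<beta>(1,3)] .
          have "s.\<tau> (\<tau> (rng \<gamma>)) = rng \<gamma>"
            using s.\<tau>_unique[of "\<tau> (rng \<gamma>)" "rng \<gamma>"] \<tau>[OF 3(2)] 3(2) by simp
          then show in_fib: "s.shift \<beta> \<in> {\<alpha> \<in> \<Gamma>. rng \<alpha> = rng \<gamma>}"
            using s.shift_in_\<Gamma>[OF \<beta>(1,3)] \<beta>(2) by (simp add: s.rng_shift)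
          show "f' (shift (s.shift \<beta>)) * \<xi> (ldiv (s.shift \<beta>) \<gamma>) = f' \<beta> * \<xi> (ldiv \<beta> ?t)"
            using ldiv_shift[of "s.shift \<beta>"] in_fib s.swap_shift[OF \<beta>(1,3)] by simp
        next
          fix \<alpha> assume "\<alpha> \<in> {\<alpha> \<in> \<Gamma>. rng \<alpha> = rng \<gamma>}"
          then have \<alpha>: "\<alpha> \<in> \<Gamma>" "rng \<alpha> = rng \<gamma>" "rng \<alpha> \<in> U" using 3 by auto
          show "s.shift (shift \<alpha>) = \<alpha>" using swap_shift[OF \<alpha>(1,3)] .
          show "shift \<alpha> \<in> {\<beta> \<in> \<Gamma>. rng \<beta> = rng ?t}"
            using shift_in_\<Gamma>[OF \<alpha>(1,3)] \<alpha>(2) by (simp add: rng_shift)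
        qed
        finally have *: "regular_rep gpd f' \<xi> ?t = (\<Sum>\<^sub>\<infinity>\<alpha>\<in>{\<alpha> \<in> \<Gamma>. rng \<alpha> = rng \<gamma>}. f' (shift \<alpha>) * \<xi> (ldiv \<alpha> \<gamma>))" .
        have "op_mult \<Gamma> (regular_rep gpd f) (regular_rep gpd f') \<xi> \<gamma> = F (rng \<gamma>) * regular_rep gpd f' \<xi> ?t"
          using 3 \<xi> \<xi>' by (simp add: op_mult_def regular_rep_supported[OF supp] F_def)
        also have "\<dots> = (\<Sum>\<^sub>\<infinity>\<alpha>\<in>{\<alpha> \<in> \<Gamma>. rng \<alpha> = rng \<gamma>}. F (rng \<gamma>) * (f' (shift \<alpha>) * \<xi> (ldiv \<alpha> \<gamma>)))"
          unfolding * by (rule infsum_cmult_right'[symmetric])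
        also have "\<dots> = (\<Sum>\<^sub>\<infinity>\<alpha>\<in>{\<alpha> \<in> \<Gamma>. rng \<alpha> = rng \<gamma>}. f'' \<alpha> * \<xi> (ldiv \<alpha> \<gamma>))"
          by (rule infsum_cong) (use 3 in \<open>simp add: f''_def f\<^sub>1_def\<close>)
        also have "\<dots> = regular_rep gpd f'' \<xi> \<gamma>"
          by (rule regular_rep_apply[OF \<xi> 3(1), symmetric])
        finally show ?thesis .
      qed
    qed
  qed (simp_all add: regular_rep_extensional op_mult_def)
  with f'' show thesis by (rule that)
qed

end

section \<open>Norm estimates for products of bounded operators\<close>

lemma ell2_norm_scale: "ell2_norm A (\<lambda>\<gamma>. c * \<xi> \<gamma>) = cmod c * ell2_norm A \<xi>"
  by (simp add: ell2_norm_def norm_mult power_mult_distrib infsum_cmult_right' real_sqrt_mult)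

lemma op_norm_scaled_bound:
  assumes T: "T \<in> bounded_operators A" and \<xi>: "\<xi> \<in> ell2 A"
  shows "ell2_norm A (T \<xi>) \<le> op_norm A T * ell2_norm A \<xi>"
proof (cases "ell2_norm A \<xi> = 0")
  case True
  \<comment> \<open>A vector of norm 0 cannot be rescaled to the unit sphere; any bound for
    \<open>T\<close> shows that its image has norm 0 as well.\<close>
  obtain K where "\<And>\<xi>. \<xi> \<in> ell2 A \<Longrightarrow> ell2_norm A (T \<xi>) \<le> K * ell2_norm A \<xi>"
    using bounded_operators_bound[OF T] by blast
  from this[OF \<xi>] True show ?thesis by simp
next
  case False
  define r where "r = ell2_norm A \<xi>"
  have r: "0 < r" using False by (simp add: r_def less_le)
  define \<xi>' where "\<xi>' = (\<lambda>\<gamma>. complex_of_real (1 / r) * \<xi> \<gamma>)"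
  have \<xi>': "\<xi>' \<in> ell2 A"
    using ell2_lincomb(1)[OF \<xi> \<xi>, of "complex_of_real (1 / r)" 0] by (simp add: \<xi>'_def)
  have "ell2_norm A \<xi>' \<le> 1"
    unfolding \<xi>'_def ell2_norm_scale using r by (simp add: r_def norm_divide)
  then have "ell2_norm A (T \<xi>') \<le> op_norm A T"
    by (rule op_norm_bound[OF T \<xi>'])
  moreover have "T \<xi>' = (\<lambda>\<gamma>. complex_of_real (1 / r) * T \<xi> \<gamma>)"
    using bounded_operators_linear[OF T \<xi> \<xi>, of "complex_of_real (1 / r)" 0] by (simp add: \<xi>'_def)
  then have "ell2_norm A (T \<xi>') = ell2_norm A (T \<xi>) / r"
    using r by (simp only: ell2_norm_scale norm_of_real) simp
  ultimately have "ell2_norm A (T \<xi>) / r \<le> op_norm A T"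
    by simp
  then show ?thesis
    using r by (simp add: divide_le_eq flip: r_def)
qed

lemma op_norm_le:
  assumes "\<And>\<xi>. \<xi> \<in> ell2 A \<Longrightarrow> ell2_norm A \<xi> \<le> 1 \<Longrightarrow> ell2_norm A (T \<xi>) \<le> C"
  shows "op_norm A T \<le> C"
proof -
  have "ell2_norm A (\<lambda>\<gamma>. 0) \<le> 1" by (simp add: ell2_norm_def)
  then have "{\<xi> \<in> ell2 A. ell2_norm A \<xi> \<le> 1} \<noteq> {}" using ell2_0 by blast
  then show ?thesis
    unfolding op_norm_def by (rule cSUP_least) (use assms in auto)
qed

lemma op_mult_bounded:
  assumes S: "S \<in> bounded_operators A" and T: "T \<in> bounded_operators A"
  shows "op_mult A S T \<in> bounded_operators A"
proof -
  obtain K where K: "0 \<le> K" "\<And>\<xi>. \<xi> \<in> ell2 A \<Longrightarrow> ell2_norm A (S \<xi>) \<le> K * ell2_norm A \<xi>"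
    using bounded_operators_bound[OF S] by blast
  obtain L where L: "0 \<le> L" "\<And>\<xi>. \<xi> \<in> ell2 A \<Longrightarrow> ell2_norm A (T \<xi>) \<le> L * ell2_norm A \<xi>"
    using bounded_operators_bound[OF T] by blast
  note closed = bounded_operators_closed[OF S] bounded_operators_closed[OF T]
  have "op_mult A S T \<in> ell2 A \<rightarrow>\<^sub>E ell2 A"
    using closed by (auto simp: op_mult_def)
  moreover have "op_mult A S T (\<lambda>\<gamma>. c * \<xi> \<gamma> + d * \<eta> \<gamma>) = (\<lambda>\<gamma>. c * op_mult A S T \<xi> \<gamma> + d * op_mult A S T \<eta> \<gamma>)"
    if "\<xi> \<in> ell2 A" "\<eta> \<in> ell2 A" for \<xi> \<eta> c d
    using that closed by (simp add: op_mult_def ell2_lincomb bounded_operators_linear[OF S] bounded_operators_linear[OF T])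
  moreover have "ell2_norm A (op_mult A S T \<xi>) \<le> (K * L) * ell2_norm A \<xi>" if "\<xi> \<in> ell2 A" for \<xi>
  proof -
    have "ell2_norm A (S (T \<xi>)) \<le> K * ell2_norm A (T \<xi>)"
      using K(2) closed that by blast
    also have "\<dots> \<le> K * (L * ell2_norm A \<xi>)"
      using L(2)[OF that] K(1) by (rule mult_left_mono)
    finally show ?thesis using that by (simp add: op_mult_def algebra_simps)
  qed
  ultimately show ?thesis
    unfolding bounded_operators_def by blast
qed

text \<open>From \<open>S T - S' T' = (S - S') T + S' (T - T')\<close>. The outer factor 2 is the
  constant of \<open>ell2_lincomb\<close>.\<close>

lemma op_dist_mult_le:
  assumes S: "S \<in> bounded_operators A" and T: "T \<in> bounded_operators A"
    and S': "S' \<in> bounded_operators A" and T': "T' \<in> bounded_operators A"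
    and K: "\<And>\<xi>. \<xi> \<in> ell2 A \<Longrightarrow> ell2_norm A \<xi> \<le> 1 \<Longrightarrow> ell2_norm A (T \<xi>) \<le> K"
    and L: "0 \<le> L" "\<And>\<xi>. \<xi> \<in> ell2 A \<Longrightarrow> ell2_norm A (S' \<xi>) \<le> L * ell2_norm A \<xi>"
    and \<epsilon>: "op_dist A S S' \<le> \<epsilon>" and \<delta>: "op_dist A T T' \<le> \<delta>" and "0 \<le> \<epsilon>"
  shows "op_dist A (op_mult A S T) (op_mult A S' T') \<le> 2 * (\<epsilon> * K + L * \<delta>)"
  unfolding op_dist_def
proof (rule op_norm_le)
  fix \<xi> assume \<xi>: "\<xi> \<in> ell2 A" "ell2_norm A \<xi> \<le> 1"
  let ?D = "op_add A S (op_scale A (- 1) S')" and ?E = "op_add A T (op_scale A (- 1) T')"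
  have D: "?D \<in> bounded_operators A" and E: "?E \<in> bounded_operators A"
    using op_diff_bounded S S' T T' by blast+
  have T\<xi>: "T \<xi> \<in> ell2 A" "T' \<xi> \<in> ell2 A"
    using bounded_operators_closed[OF T] bounded_operators_closed[OF T'] \<xi>(1) by auto
  have E\<xi>: "?E \<xi> = (\<lambda>\<gamma>. 1 * T \<xi> \<gamma> + (- 1) * T' \<xi> \<gamma>)"
    using \<xi>(1) by (simp add: op_add_def op_scale_def)
  have "S' (?E \<xi>) = (\<lambda>\<gamma>. 1 * S' (T \<xi>) \<gamma> + (- 1) * S' (T' \<xi>) \<gamma>)"
    unfolding E\<xi> by (rule bounded_operators_linear[OF S' T\<xi>])
  then have split: "op_add A (op_mult A S T) (op_scale A (- 1) (op_mult A S' T')) \<xi> =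
      (\<lambda>\<gamma>. 1 * ?D (T \<xi>) \<gamma> + 1 * S' (?E \<xi>) \<gamma>)"
    using \<xi>(1) T\<xi> by (simp add: op_add_def op_scale_def op_mult_def)
  have "ell2_norm A (?D (T \<xi>)) \<le> op_norm A ?D * ell2_norm A (T \<xi>)"
    by (rule op_norm_scaled_bound[OF D T\<xi>(1)])
  also have "\<dots> \<le> \<epsilon> * K"
    using \<epsilon> K[OF \<xi>] \<open>0 \<le> \<epsilon>\<close> by (intro mult_mono) (auto simp: op_dist_def)
  finally have 1: "ell2_norm A (?D (T \<xi>)) \<le> \<epsilon> * K" .
  have "ell2_norm A (S' (?E \<xi>)) \<le> L * ell2_norm A (?E \<xi>)"
    using L(2) bounded_operators_closed[OF E \<xi>(1)] .
  also have "\<dots> \<le> L * \<delta>"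
    using op_norm_bound[OF E \<xi>] \<delta> L(1) by (intro mult_left_mono) (auto simp: op_dist_def)
  finally have 2: "ell2_norm A (S' (?E \<xi>)) \<le> L * \<delta>" .
  show "ell2_norm A (op_add A (op_mult A S T) (op_scale A (- 1) (op_mult A S' T')) \<xi>) \<le> 2 * (\<epsilon> * K + L * \<delta>)"
    using ell2_lincomb(2)[OF bounded_operators_closed[OF D T\<xi>(1)]
        bounded_operators_closed[OF S' bounded_operators_closed[OF E \<xi>(1)]], of 1 1] 1 2
    unfolding split by simp
qed

section \<open>Closure of the reduced algebra under products\<close>

context semigroup_action
begin

text \<open>This is where total disconnectedness gives the groupoid a cover by compact open
  bisections.\<close>

lemma clopen_bisection_exists:
  assumes td: "totally_disconnected_space X" and mn: "m \<in> P" "n \<in> P"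
    and xy: "x \<in> topspace X" "y \<in> topspace X" "\<theta> m x = \<theta> n y"
  obtains U V where "clopen_bisection G X P \<theta> m n U V" "x \<in> U" "y \<in> V"
proof -
  obtain U0 where U0: "openin X U0" "x \<in> U0" "inj_on (\<theta> m) U0"
    using local_homeomorphism_imp_locally_injective[OF local_homeo[OF mn(1)] xy(1)] .
  obtain V0 where V0: "openin X V0" "y \<in> V0" "inj_on (\<theta> n) V0"
    using local_homeomorphism_imp_locally_injective[OF local_homeo[OF mn(2)] xy(2)] .
  obtain U1 where U1: "openin X U1" "closedin X U1" "x \<in> U1" "U1 \<subseteq> U0"
    using clopen_neighbourhood[OF compact_X Hausdorff_X td U0(1,2)] .
  obtain V1 where V1: "openin X V1" "closedin X V1" "y \<in> V1" "V1 \<subseteq> V0"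
    using clopen_neighbourhood[OF compact_X Hausdorff_X td V0(1,2)] .
  have img: "openin X (\<theta> m ` U1 \<inter> \<theta> n ` V1)" "\<theta> m x \<in> \<theta> m ` U1 \<inter> \<theta> n ` V1"
  proof -
    show "openin X (\<theta> m ` U1 \<inter> \<theta> n ` V1)"
      by (intro openin_Int open_act mn U1 V1)
    have "\<theta> m x \<in> \<theta> m ` U1" "\<theta> n y \<in> \<theta> n ` V1"
      by (intro imageI U1 V1)+
    then show "\<theta> m x \<in> \<theta> m ` U1 \<inter> \<theta> n ` V1"
      by (simp only: xy(3) Int_iff)
  qed
  \<comment> \<open>A clopen set inside both images; the preimages of \<open>C\<close> cut
    \<open>U1\<close> and \<open>V1\<close> down to clopen sets that have \<open>C\<close> as common
    image.\<close>
  obtain C where C: "openin X C" "closedin X C" "\<theta> m x \<in> C" "C \<subseteq> \<theta> m ` U1 \<inter> \<theta> n ` V1"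
    using clopen_neighbourhood[OF compact_X Hausdorff_X td img] .
  define U where "U = U1 \<inter> {u \<in> topspace X. \<theta> m u \<in> C}"
  define V where "V = V1 \<inter> {v \<in> topspace X. \<theta> n v \<in> C}"
  have clo: "closedin X {u \<in> topspace X. \<theta> k u \<in> C}" if "k \<in> P" for k
    using closedin_continuous_map_preimage[OF continuous_act[OF that] C(2)] .
  have sub: "U1 \<subseteq> topspace X" "V1 \<subseteq> topspace X"
    by (fact openin_subset[OF U1(1)], fact openin_subset[OF V1(1)])
  have image: "\<theta> m ` U = C" "\<theta> n ` V = C"
  proof -
    have "U = {u \<in> U1. \<theta> m u \<in> C}" "V = {v \<in> V1. \<theta> n v \<in> C}"
      unfolding U_def V_def using sub by blast+
    moreover have "f ` {u \<in> D. f u \<in> C} = C" if "C \<subseteq> f ` D" for f :: "'x \<Rightarrow> 'x" and D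
      using that by blast
    moreover have "C \<subseteq> \<theta> m ` U1" "C \<subseteq> \<theta> n ` V1"
      using C(4) by simp_all
    ultimately show "\<theta> m ` U = C" "\<theta> n ` V = C"
      by metis+
  qed
  have "clopen_bisection G X P \<theta> m n U V"
  proof (unfold_locales)
    show "openin X U" "openin X V"
      unfolding U_def V_def using U1 V1 C mn by (auto intro!: openin_Int open_act_preimage)
    show "closedin X U" "closedin X V"
      unfolding U_def V_def using U1 V1 clo mn by (auto intro!: closedin_Int)
    show "inj_on (\<theta> m) U" "inj_on (\<theta> n) V"
      using U0(3) V0(3) U1(4) V1(4) unfolding U_def V_def by (auto intro: inj_on_subset)
  qed (use mn image in auto)
  moreover have "x \<in> U" "y \<in> V"
    unfolding U_def V_def using U1 V1 C xy by auto
  ultimately show thesis by (rule that)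
qed

text \<open>The support of \<open>f\<close> is covered by finitely many clopen bisections. Since
  these are clopen, the part of \<open>f\<close> on one of them can be split off continuously, its
  product with \<open>f'\<close> is known, and the remainder has a smaller cover.\<close>

lemma Cc_product:
  assumes td: "totally_disconnected_space X" and f: "f \<in> Cc gpd" and f': "f' \<in> Cc gpd"
  obtains f'' where "f'' \<in> Cc gpd" "op_mult \<Gamma> (regular_rep gpd f) (regular_rep gpd f') = regular_rep gpd f''"
proof -
  define \<B> where "\<B> = {basic_bisection G \<theta> U m n V |U m n V. clopen_bisection G X P \<theta> m n U V}"
  have step: "\<exists>f''\<in>Cc gpd. op_mult \<Gamma> (regular_rep gpd h) (regular_rep gpd f') = regular_rep gpd f''"
    if "finite \<F>" "\<F> \<subseteq> \<B>" "h \<in> Cc gpd" "\<And>\<gamma>. h \<gamma> \<noteq> 0 \<Longrightarrow> \<gamma> \<in> \<Union>\<F>" for \<F> h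
    using that
  proof (induction \<F> arbitrary: h rule: finite_induct)
    case empty
    have h0: "h = (\<lambda>\<gamma>. 0)" using empty.prems(3) by fastforce
    have "regular_rep gpd h \<xi> = (\<lambda>\<gamma>. 0)" if \<xi>: "\<xi> \<in> ell2 \<Gamma>" for \<xi>
    proof
      show "regular_rep gpd h \<xi> \<gamma> = 0" for \<gamma>
        using regular_rep_null[OF \<xi>, of \<gamma> h] regular_rep_outside[OF \<xi>, of \<gamma> h]
        by (cases "\<gamma> \<in> \<Gamma>") (simp_all add: h0)
    qed
    then have "op_mult \<Gamma> (regular_rep gpd h) (regular_rep gpd f') = regular_rep gpd h"
      using bounded_operators_closed[OF regular_rep_bounded[OF f']]
      by (intro extensionalityI[of _ "ell2 \<Gamma>"]) (simp_all add: op_mult_def regular_rep_extensional)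
    then show ?case using empty.prems(2) by blast
  next
    case (insert B \<F>)
    obtain U m n V where B: "B = basic_bisection G \<theta> U m n V" "clopen_bisection G X P \<theta> m n U V"
      using insert.prems(1) unfolding \<B>_def by auto
    interpret c: clopen_bisection G X P \<theta> m n U V by (rule B(2))
    have clopen: "openin (sg_top gpd) B" "closedin (sg_top gpd) B"
      unfolding B(1) using openin_basic_bisection[OF c.m c.n c.openU c.openV]
        closedin_basic_bisection[OF c.m c.n c.closedU c.closedV] by auto
    define h1 where "h1 = (\<lambda>\<gamma>. if \<gamma> \<in> B then h \<gamma> else 0)"
    define h2 where "h2 = (\<lambda>\<gamma>. if \<gamma> \<in> \<Gamma> - B then h \<gamma> else 0)"
    have h1: "h1 \<in> Cc gpd" unfolding h1_def by (rule Cc_restrict[OF insert.prems(2) clopen])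
    have h2: "h2 \<in> Cc gpd"
      unfolding h2_def by (rule Cc_restrict[OF insert.prems(2)]) (use clopen in auto)
    have h: "h = (\<lambda>\<gamma>. h1 \<gamma> + h2 \<gamma>)"
      using Cc_zero[OF insert.prems(2)] by (auto simp: h1_def h2_def fun_eq_iff)
    obtain k1 where k1: "k1 \<in> Cc gpd" "op_mult \<Gamma> (regular_rep gpd h1) (regular_rep gpd f') = regular_rep gpd k1"
      by (rule c.Cc_product_supported[OF h1 _ f']) (auto simp: h1_def B(1))
    have "\<gamma> \<in> \<Union>\<F>" if "h2 \<gamma> \<noteq> 0" for \<gamma>
      using insert.prems(3)[of \<gamma>] that by (auto simp: h2_def split: if_splits)
    then obtain k2 where k2: "k2 \<in> Cc gpd" "op_mult \<Gamma> (regular_rep gpd h2) (regular_rep gpd f') = regular_rep gpd k2"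
      using insert.IH[OF _ h2] insert.prems(1) by auto
    have "op_mult \<Gamma> (regular_rep gpd h) (regular_rep gpd f') =
        op_add \<Gamma> (op_mult \<Gamma> (regular_rep gpd h1) (regular_rep gpd f')) (op_mult \<Gamma> (regular_rep gpd h2) (regular_rep gpd f'))"
      unfolding h regular_rep_add[OF h1 h2]
      using bounded_operators_closed[OF regular_rep_bounded[OF f']]
      by (intro extensionalityI[of _ "ell2 \<Gamma>"]) (simp_all add: op_mult_def op_add_def)
    also have "\<dots> = regular_rep gpd (\<lambda>\<gamma>. k1 \<gamma> + k2 \<gamma>)"
      unfolding k1(2) k2(2) regular_rep_add[OF k1(1) k2(1)] ..
    finally show ?case using Cc_add[OF k1(1) k2(1)] by blast
  qed
  obtain K where K: "compactin (sg_top gpd) K" "\<And>\<gamma>. \<gamma> \<in> \<Gamma> \<Longrightarrow> f \<gamma> \<noteq> 0 \<Longrightarrow> \<gamma> \<in> K"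
    using CcE[OF f] by metis
  have open\<B>: "openin (sg_top gpd) B" if B: "B \<in> \<B>" for B
  proof -
    obtain U m n V where B': "B = basic_bisection G \<theta> U m n V" "clopen_bisection G X P \<theta> m n U V"
      using B unfolding \<B>_def by auto
    interpret c: clopen_bisection G X P \<theta> m n U V by (rule B'(2))
    show ?thesis unfolding B'(1) by (rule openin_basic_bisection[OF c.m c.n c.openU c.openV])
  qed
  have "\<Gamma> \<subseteq> \<Union>\<B>"
  proof
    fix \<gamma> assume \<gamma>: "\<gamma> \<in> \<Gamma>"
    obtain x g y where xgy: "\<gamma> = (x, g, y)" by (metis prod.exhaust)
    then obtain m n where *: "m \<in> P" "n \<in> P" "g = m \<otimes> inv n" "\<theta> m x = \<theta> n y" "x \<in> topspace X" "y \<in> topspace X"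
      using \<gamma> by (auto elim: in_\<Gamma>E)
    obtain U V where UV: "clopen_bisection G X P \<theta> m n U V" "x \<in> U" "y \<in> V"
      using clopen_bisection_exists[OF td *(1,2,5,6,4)] .
    have "\<gamma> \<in> basic_bisection G \<theta> U m n V"
      using * UV xgy unfolding basic_bisection_def by blast
    then show "\<gamma> \<in> \<Union>\<B>" using UV(1) unfolding \<B>_def by blast
  qed
  then have "K \<subseteq> \<Union>\<B>"
    using compactin_subset_topspace[OF K(1)] by simp
  then obtain \<F> where \<F>: "finite \<F>" "\<F> \<subseteq> \<B>" "K \<subseteq> \<Union>\<F>"
    using K(1)[unfolded compactin_def, THEN conjunct2, rule_format, of \<B>] open\<B> by blast
  have "\<gamma> \<in> \<Union>\<F>" if "f \<gamma> \<noteq> 0" for \<gamma>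
    using that K(2) \<F>(3) Cc_zero[OF f] by blast
  then show thesis
    using step[OF \<F>(1,2) f] that by blast
qed

text \<open>The inverse of a \<open>*\<close>-isomorphism of reduced algebras is multiplicative because of this closure.\<close>

lemma reduced_algebra_mult:
  assumes td: "totally_disconnected_space X" and S: "S \<in> reduced_algebra gpd" and T: "T \<in> reduced_algebra gpd"
  shows "op_mult \<Gamma> S T \<in> reduced_algebra gpd"
proof -
  note Sb = reduced_algebra_bounded[OF S] and Tb = reduced_algebra_bounded[OF T]
  have "\<exists>f\<in>Cc gpd. op_dist \<Gamma> (op_mult \<Gamma> S T) (regular_rep gpd f) < \<epsilon>" if \<epsilon>: "0 < \<epsilon>" for \<epsilon>
  proof -
    obtain K where K: "0 \<le> K" "\<And>\<xi>. \<xi> \<in> ell2 \<Gamma> \<Longrightarrow> ell2_norm \<Gamma> (T \<xi>) \<le> K * ell2_norm \<Gamma> \<xi>"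
      using bounded_operators_bound[OF Tb] by blast
    have K': "ell2_norm \<Gamma> (T \<xi>) \<le> K" if "\<xi> \<in> ell2 \<Gamma>" "ell2_norm \<Gamma> \<xi> \<le> 1" for \<xi>
      using K(2)[OF that(1)] mult_left_mono[OF that(2) K(1)] by simp
    \<comment> \<open>The order of choice matters: \<open>K\<close> bounds \<open>T\<close>, then
      \<open>f\<close> approximates \<open>S\<close>, and only then does \<open>L\<close> bound the
      approximant and fix the tolerance for \<open>f'\<close>. Each term is at most
      \<open>\<epsilon> / 8\<close>, and the factor 2 of the product estimate leaves room.\<close>
    have "0 < \<epsilon> / (8 * (K + 1))" using \<epsilon> K(1) by simp
    then obtain f where f: "f \<in> Cc gpd" "op_dist \<Gamma> S (regular_rep gpd f) < \<epsilon> / (8 * (K + 1))"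
      using S unfolding reduced_algebra_def by blast
    note fb = regular_rep_bounded[OF f(1)]
    obtain L where L: "0 \<le> L" "\<And>\<xi>. \<xi> \<in> ell2 \<Gamma> \<Longrightarrow> ell2_norm \<Gamma> (regular_rep gpd f \<xi>) \<le> L * ell2_norm \<Gamma> \<xi>"
      using bounded_operators_bound[OF fb] by blast
    have "0 < \<epsilon> / (8 * (L + 1))" using \<epsilon> L(1) by simp
    then obtain f' where f': "f' \<in> Cc gpd" "op_dist \<Gamma> T (regular_rep gpd f') < \<epsilon> / (8 * (L + 1))"
      using T unfolding reduced_algebra_def by blast
    obtain f'' where f'': "f'' \<in> Cc gpd" "op_mult \<Gamma> (regular_rep gpd f) (regular_rep gpd f') = regular_rep gpd f''"
      using Cc_product[OF td f(1) f'(1)] .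
    have "op_dist \<Gamma> (op_mult \<Gamma> S T) (regular_rep gpd f'') \<le> 2 * (\<epsilon> / (8 * (K + 1)) * K + L * (\<epsilon> / (8 * (L + 1))))"
      unfolding f''(2)[symmetric]
      by (rule op_dist_mult_le[OF Sb Tb fb regular_rep_bounded[OF f'(1)] K' L]) (use f f' \<epsilon> K(1) in auto)
    also have "\<dots> < \<epsilon>"
    proof -
      have small: "2 * (a + b) < \<epsilon>" if "a \<le> \<epsilon> / 8" "b \<le> \<epsilon> / 8" for a b :: real
      proof -
        have "2 * (a + b) \<le> 2 * (\<epsilon> / 8 + \<epsilon> / 8)"
          by (intro mult_left_mono add_mono that) simp
        also have "\<dots> < \<epsilon>" using \<epsilon> by simp
        finally show ?thesis .
      qed
      show ?thesis
        by (rule small) (use \<epsilon> K(1) L(1) in \<open>simp_all add: field_simps\<close>)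
    qed
    finally show ?thesis using f''(1) by blast
  qed
  then show ?thesis
    unfolding reduced_algebra_def using op_mult_bounded[OF Sb Tb] by blast
qed

end

section \<open>Diagonal-preserving isomorphisms\<close>

context semigroup_action
begin

definition diag_op :: "('x \<Rightarrow> complex) \<Rightarrow> ('x \<times> 'g \<times> 'x) ell2_operator" where
  "diag_op F = regular_rep gpd (diagonal_function G X F)"

definition proj :: "'x set \<Rightarrow> ('x \<times> 'g \<times> 'x) ell2_operator" where
  "proj K = diag_op (\<lambda>x. if x \<in> K then 1 else 0)"

lemma diag_op_apply: "\<xi> \<in> ell2 \<Gamma> \<Longrightarrow> diag_op F \<xi> = (\<lambda>\<gamma>. F (rng \<gamma>) * \<xi> \<gamma>)"
  by (simp add: diag_op_def regular_rep_diagonal)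

lemma diag_op_extensional: "diag_op F \<in> extensional (ell2 \<Gamma>)"
  by (simp add: diag_op_def regular_rep_extensional)

lemma diag_op_in_reduced_algebra: "continuous_map X euclidean F \<Longrightarrow> diag_op F \<in> reduced_algebra gpd"
  unfolding diag_op_def by (intro regular_rep_in_reduced_algebra Cc_diagonal)

lemma diag_op_eq_iff: "diag_op F = diag_op F' \<longleftrightarrow> (\<forall>x\<in>topspace X. F x = F' x)"
proof
  assume eq: "diag_op F = diag_op F'"
  show "\<forall>x\<in>topspace X. F x = F' x"
  proof
    fix x assume x: "x \<in> topspace X"
    then have e: "basic \<in> ell2 \<Gamma>" if "basic = basis_vector (x, \<one>, x)" for basic
      using that by (simp add: basis_vector_ell2)
    have "diag_op F (basis_vector (x, \<one>, x)) (x, \<one>, x) = diag_op F' (basis_vector (x, \<one>, x)) (x, \<one>, x)"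
      by (simp add: eq)
    then show "F x = F' x"
      using e by (simp add: diag_op_apply basis_vector_def)
  qed
next
  assume eq: "\<forall>x\<in>topspace X. F x = F' x"
  show "diag_op F = diag_op F'"
  proof (rule extensionalityI[OF diag_op_extensional diag_op_extensional])
    fix \<xi> assume \<xi>: "\<xi> \<in> ell2 \<Gamma>"
    have "F (rng \<gamma>) * \<xi> \<gamma> = F' (rng \<gamma>) * \<xi> \<gamma>" for \<gamma>
      using eq rng_in_X ell2_zero[OF \<xi>] by (cases "\<gamma> \<in> \<Gamma>") auto
    then show "diag_op F \<xi> = diag_op F' \<xi>"
      unfolding diag_op_apply[OF \<xi>] by (rule ext)
  qed
qed

lemma diag_op_mult:
  assumes "continuous_map X euclidean F'"
  shows "op_mult \<Gamma> (diag_op F) (diag_op F') = diag_op (\<lambda>x. F x * F' x)"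
proof (rule extensionalityI[OF _ diag_op_extensional])
  fix \<xi> assume \<xi>: "\<xi> \<in> ell2 \<Gamma>"
  then have "diag_op F' \<xi> \<in> ell2 \<Gamma>"
    using assms bounded_operators_closed reduced_algebra_bounded diag_op_in_reduced_algebra by blast
  then show "op_mult \<Gamma> (diag_op F) (diag_op F') \<xi> = diag_op (\<lambda>x. F x * F' x) \<xi>"
    using \<xi> by (simp add: op_mult_def diag_op_apply algebra_simps)
qed (simp add: op_mult_def)

lemma continuous_map_indicator:
  assumes "openin X K" "closedin X K"
  shows "continuous_map X euclidean (\<lambda>x. if x \<in> K then 1 else 0 :: complex)"
proof -
  have "{x \<in> topspace X. (if x \<in> K then 1 else 0 :: complex) \<in> O'} =
      (if 1 \<in> O' then K else {}) \<union> (if 0 \<in> O' then topspace X - K else {})" for O'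
    using openin_subset[OF assms(1)] by (auto split: if_splits)
  then show ?thesis
    using assms by (auto simp: continuous_map_def)
qed

lemma proj_eq_iff: "K \<subseteq> topspace X \<Longrightarrow> L \<subseteq> topspace X \<Longrightarrow> proj K = proj L \<longleftrightarrow> K = L"
  unfolding proj_def diag_op_eq_iff by (auto split: if_splits)

lemma proj_mult: "openin X L \<Longrightarrow> closedin X L \<Longrightarrow> op_mult \<Gamma> (proj K) (proj L) = proj (K \<inter> L)"
  unfolding proj_def diag_op_mult[OF continuous_map_indicator] diag_op_eq_iff by auto

lemma proj_in_reduced_algebra: "openin X K \<Longrightarrow> closedin X K \<Longrightarrow> proj K \<in> reduced_algebra gpd"
  unfolding proj_def by (intro diag_op_in_reduced_algebra continuous_map_indicator)

lemma diagonal_subalgebra_eq: "diagonal_subalgebra G X P \<theta> = {diag_op F |F. continuous_map X euclidean F}"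
  by (simp add: diagonal_subalgebra_def diag_op_def)

text \<open>An idempotent continuous function takes only the values 0 and 1, and the set where it is
  1 is both closed and open. Clopen sets thus become visible through multiplication alone.\<close>

lemma diag_op_idempotent:
  assumes F: "continuous_map X euclidean F" and idem: "op_mult \<Gamma> (diag_op F) (diag_op F) = diag_op F"
  obtains K where "openin X K" "closedin X K" "diag_op F = proj K"
proof -
  define K where "K = {x \<in> topspace X. F x = 1}"
  have F01: "F x = 0 \<or> F x = 1" if "x \<in> topspace X" for x
    using idem that unfolding diag_op_mult[OF F] diag_op_eq_iff by auto
  have "closedin X {x \<in> topspace X. F x \<in> {1}}"
    using F by (rule closedin_continuous_map_preimage) simp
  then have "closedin X K" by (simp add: K_def)
  have "openin X {x \<in> topspace X. F x \<in> - {0}}"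
    using F by (rule openin_continuous_map_preimage) auto
  moreover have "{x \<in> topspace X. F x \<in> - {0}} = K"
    using F01 by (auto simp: K_def)
  ultimately have "openin X K" by simp
  moreover have "diag_op F = proj K"
    unfolding proj_def diag_op_eq_iff using F01 by (auto simp: K_def)
  ultimately show thesis using \<open>closedin X K\<close> that by blast
qed

end

section \<open>The partial isometry attached to a clopen bisection\<close>

context clopen_bisection
begin

definition bis_op :: "('x \<times> 'g \<times> 'x) ell2_operator" where
  "bis_op = regular_rep gpd (\<lambda>\<gamma>. if \<gamma> \<in> B then 1 else 0)"

lemma bis_op_in_reduced_algebra: "bis_op \<in> reduced_algebra gpd"
  unfolding bis_op_def
  by (intro regular_rep_in_reduced_algebra Cc_basic_bisection[OF m n openU closedU openV closedV, of "\<lambda>_. 1"])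
    simp

lemma bis_op_apply:
  assumes "\<xi> \<in> ell2 \<Gamma>" "\<gamma> \<in> \<Gamma>"
  shows "bis_op \<xi> \<gamma> = (if rng \<gamma> \<in> U then \<xi> (shift \<gamma>) else 0)"
  using regular_rep_supported[of "\<lambda>\<gamma>. if \<gamma> \<in> B then 1 else 0", OF _ assms] B_iff[of "section_at (rng \<gamma>)"]
  by (simp add: bis_op_def)

lemma bis_op_closed: "\<xi> \<in> ell2 \<Gamma> \<Longrightarrow> bis_op \<xi> \<in> ell2 \<Gamma>"
  using bis_op_in_reduced_algebra reduced_algebra_bounded bounded_operators_closed by blast

lemma bis_op_outside: "\<xi> \<in> ell2 \<Gamma> \<Longrightarrow> \<gamma> \<notin> \<Gamma> \<Longrightarrow> bis_op \<xi> \<gamma> = 0"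
  by (simp add: bis_op_def regular_rep_outside)

text \<open>The range projection of the partial isometry, with the operator of the swapped bisection
  in the place of the adjoint. The relation is purely multiplicative and so is carried over by
  \<Phi>.\<close>

lemma bis_op_swap:
  "op_mult \<Gamma> bis_op (clopen_bisection.bis_op G X P \<theta> n m V U) = proj U"
proof -
  interpret s: clopen_bisection G X P \<theta> n m V U by (rule bisection_swap)
  show ?thesis
    unfolding proj_def
  proof (rule extensionalityI[OF _ diag_op_extensional])
    fix \<xi> assume \<xi>: "\<xi> \<in> ell2 \<Gamma>"
    show "op_mult \<Gamma> bis_op s.bis_op \<xi> = diag_op (\<lambda>x. if x \<in> U then 1 else 0) \<xi>"
    proof
      fix \<gamma> :: "'x \<times> 'g \<times> 'x"
      show "op_mult \<Gamma> bis_op s.bis_op \<xi> \<gamma> = diag_op (\<lambda>x. if x \<in> U then 1 else 0) \<xi> \<gamma>"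
      proof (cases "\<gamma> \<in> \<Gamma>")
        case True
        then show ?thesis
          using \<xi> s.bis_op_closed[OF \<xi>] \<tau>(1)[of "rng \<gamma>"]
          by (simp add: op_mult_def diag_op_apply bis_op_apply s.bis_op_apply shift_in_\<Gamma> rng_shift swap_shift)
      next
        case False
        then show ?thesis
          using \<xi> s.bis_op_closed[OF \<xi>]
          by (simp add: op_mult_def diag_op_apply bis_op_outside ell2_zero[OF \<xi>])
      qed
    qed
  qed (simp add: op_mult_def)
qed

text \<open>Both sides evaluate \<xi> at \<open>shift \<gamma>\<close>, whose range is
  \<open>\<tau> (rng \<gamma>)\<close>; testing that range against \<open>K\<close> is the same as
  testing \<open>rng \<gamma>\<close> against the preimage of \<open>K\<close>.\<close>

lemma bis_op_proj:
  assumes K: "openin X K" "closedin X K"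
  shows "op_mult \<Gamma> bis_op (proj K) = op_mult \<Gamma> (proj {x \<in> U. \<tau> x \<in> K}) bis_op"
proof (rule extensionalityI[of _ "ell2 \<Gamma>"])
  fix \<xi> assume \<xi>: "\<xi> \<in> ell2 \<Gamma>"
  have \<xi>': "proj K \<xi> \<in> ell2 \<Gamma>"
    using \<xi> bounded_operators_closed[OF reduced_algebra_bounded[OF proj_in_reduced_algebra[OF K]]] by blast
  show "op_mult \<Gamma> bis_op (proj K) \<xi> = op_mult \<Gamma> (proj {x \<in> U. \<tau> x \<in> K}) bis_op \<xi>"
  proof
    fix \<gamma> :: "'x \<times> 'g \<times> 'x"
    show "op_mult \<Gamma> bis_op (proj K) \<xi> \<gamma> = op_mult \<Gamma> (proj {x \<in> U. \<tau> x \<in> K}) bis_op \<xi> \<gamma>"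
    proof (cases "\<gamma> \<in> \<Gamma>")
      case True
      have "op_mult \<Gamma> bis_op (proj K) \<xi> \<gamma> = (if rng \<gamma> \<in> U then proj K \<xi> (shift \<gamma>) else 0)"
        using \<xi> bis_op_apply[OF \<xi>' True] by (simp add: op_mult_def)
      also have "\<dots> = op_mult \<Gamma> (proj {x \<in> U. \<tau> x \<in> K}) bis_op \<xi> \<gamma>"
        using \<xi> bis_op_closed[OF \<xi>] bis_op_apply[OF \<xi> True]
        by (simp add: op_mult_def proj_def diag_op_apply rng_shift)
      finally show ?thesis .
    next
      case False
      then show ?thesis
        using \<xi> bis_op_outside[OF \<xi>' False] bis_op_outside[OF \<xi> False] bis_op_closed[OF \<xi>]
        by (simp add: op_mult_def proj_def diag_op_apply)
    qed
  qed
qed (simp_all add: op_mult_def)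

lemma clopen_\<tau>_preimage:
  assumes K: "openin X K" "closedin X K"
  shows "openin X {x \<in> U. \<tau> x \<in> K}" "closedin X {x \<in> U. \<tau> x \<in> K}"
proof -
  have eq: "{x \<in> U. \<tau> x \<in> K} = U \<inter> {x \<in> topspace X. \<theta> m x \<in> \<theta> n ` (V \<inter> K)}" (is "_ = _ \<inter> ?R")
  proof
    show "{x \<in> U. \<tau> x \<in> K} \<subseteq> U \<inter> ?R"
    proof
      fix x assume x: "x \<in> {x \<in> U. \<tau> x \<in> K}"
      then have "\<theta> m x = \<theta> n (\<tau> x)" "\<tau> x \<in> V \<inter> K" using \<tau>[of x] by auto
      then show "x \<in> U \<inter> ?R" using x U_subset by blast
    qed
    show "U \<inter> ?R \<subseteq> {x \<in> U. \<tau> x \<in> K}"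
    proof
      fix x assume x: "x \<in> U \<inter> ?R"
      then obtain y where "y \<in> V" "y \<in> K" "\<theta> m x = \<theta> n y" by blast
      then show "x \<in> {x \<in> U. \<tau> x \<in> K}" using x \<tau>_unique by blast
    qed
  qed
  show "openin X {x \<in> U. \<tau> x \<in> K}"
    unfolding eq by (intro openin_Int openU open_act_preimage[OF m] open_act[OF n] openV K)
  have "compactin X (V \<inter> K)"
    by (intro closedin_compact_space compact_X closedin_Int closedV K)
  then have "compactin X (\<theta> n ` (V \<inter> K))"
    using image_compactin continuous_act[OF n] by blast
  then have "closedin X (\<theta> n ` (V \<inter> K))"
    using compactin_imp_closedin Hausdorff_X by blast
  then show "closedin X {x \<in> U. \<tau> x \<in> K}"
    unfolding eq by (intro closedin_Int closedU closedin_continuous_map_preimage[OF continuous_act[OF m]])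
qed

end

section \<open>Germs recovered from the action of an isomorphism on bisections and
  projections\<close>

context semigroup_action_pair
begin

text \<open>Stated for a multiplicative map with prescribed values on projections, so that it
  applies both to \<Phi> and to its inverse. The target labels are those of a point in the support
  of \<open>coeff T\<close>.\<close>

lemma multiplicative_map_preserves_orbit_germs:
  assumes td: "totally_disconnected_space X" and hm: "homeomorphic_maps X Y \<phi> \<psi>"
    and \<Phi>_in: "\<And>T. T \<in> reduced_algebra X.gpd \<Longrightarrow> \<Phi> T \<in> reduced_algebra Y.gpd"
    and \<Phi>_mult: "\<And>T T'. T \<in> reduced_algebra X.gpd \<Longrightarrow> T' \<in> reduced_algebra X.gpd \<Longrightarrow>
      \<Phi> (op_mult X.\<Gamma> T T') = op_mult Y.\<Gamma> (\<Phi> T) (\<Phi> T')"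
    and \<Phi>_proj: "\<And>K. openin X K \<Longrightarrow> closedin X K \<Longrightarrow> \<Phi> (X.proj K) = Y.proj {u \<in> topspace Y. \<psi> u \<in> K}"
  shows "preserves_orbit_germs X P \<theta> S \<rho> \<phi>"
  unfolding preserves_orbit_germs_def
proof (intro ballI impI)
  have \<phi>: "continuous_map X Y \<phi>" and \<psi>: "continuous_map Y X \<psi>"
    and \<psi>_\<phi>: "\<And>x. x \<in> topspace X \<Longrightarrow> \<psi> (\<phi> x) = x" and \<phi>_\<psi>: "\<And>y. y \<in> topspace Y \<Longrightarrow> \<phi> (\<psi> y) = y"
    using hm unfolding homeomorphic_maps_def by auto
  have \<phi>_in: "\<phi> x \<in> topspace Y" if "x \<in> topspace X" for x
    using \<phi> that by (auto simp: continuous_map_def)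
  have \<psi>_in: "\<psi> y \<in> topspace X" if "y \<in> topspace Y" for y
    using \<psi> that by (auto simp: continuous_map_def)
  fix m n x y assume mn: "m \<in> P" "n \<in> P" and xy: "x \<in> topspace X" "y \<in> topspace X" "\<theta> m x = \<theta> n y"
  obtain U V where c: "clopen_bisection G X P \<theta> m n U V" and xU: "x \<in> U" and yV: "y \<in> V"
    using X.clopen_bisection_exists[OF td mn xy] .
  interpret c: clopen_bisection G X P \<theta> m n U V by (rule c)
  interpret s: clopen_bisection G X P \<theta> n m V U by (rule c.bisection_swap)
  define T where "T = \<Phi> c.bis_op"
  define T' where "T' = \<Phi> s.bis_op"
  have T: "T \<in> reduced_algebra Y.gpd" and T': "T' \<in> reduced_algebra Y.gpd"
    unfolding T_def T'_def using \<Phi>_in c.bis_op_in_reduced_algebra s.bis_op_in_reduced_algebra by auto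
  note Tb = Y.reduced_algebra_bounded[OF T] and T'b = Y.reduced_algebra_bounded[OF T']
  have TT': "op_mult Y.\<Gamma> T T' = Y.proj {u \<in> topspace Y. \<psi> u \<in> U}"
    unfolding T_def T'_def
    using \<Phi>_mult[OF c.bis_op_in_reduced_algebra s.bis_op_in_reduced_algebra] \<Phi>_proj[OF c.openU c.closedU] c.bis_op_swap
    by simp
  have T_proj: "op_mult Y.\<Gamma> T (Y.proj {u \<in> topspace Y. \<psi> u \<in> K}) =
      op_mult Y.\<Gamma> (Y.proj {u \<in> topspace Y. \<psi> u \<in> {x \<in> U. c.\<tau> x \<in> K}}) T"
    if K: "openin X K" "closedin X K" for K
    using \<Phi>_mult[OF c.bis_op_in_reduced_algebra X.proj_in_reduced_algebra[OF K]]
      \<Phi>_mult[OF X.proj_in_reduced_algebra[OF c.clopen_\<tau>_preimage[OF K]] c.bis_op_in_reduced_algebra]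
      \<Phi>_proj[OF K] \<Phi>_proj[OF c.clopen_\<tau>_preimage[OF K]] c.bis_op_proj[OF K]
    unfolding T_def by simp
  \<comment> \<open>Evaluate the transported commutation relation at \<gamma> on the basis vector of
    the unit at \<open>src \<gamma>\<close>. One side multiplies the coefficient by the indicator of
    \<open>K\<close> at the source, the other by the indicator of its \<tau>-preimage at the range.
    As the coefficient is nonzero the indicators agree for every clopen \<open>K\<close>, and clopen
    sets separate points.\<close>
  have claim: "\<psi> (Y.rng \<gamma>) \<in> U \<and> c.\<tau> (\<psi> (Y.rng \<gamma>)) = \<psi> (Y.src \<gamma>)"
    if \<gamma>: "\<gamma> \<in> Y.\<Gamma>" and nz: "Y.coeff T \<gamma> \<noteq> 0" for \<gamma>
  proof -
    define e where "e = basis_vector (Y.src \<gamma>, \<one>\<^bsub>H\<^esub>, Y.src \<gamma>)"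
    note \<gamma>Y = Y.rng_in_X[OF \<gamma>] Y.src_in_X[OF \<gamma>]
    have e: "e \<in> ell2 Y.\<Gamma>"
      unfolding e_def using \<gamma>Y by (intro basis_vector_ell2) simp
    have Te: "T e \<in> ell2 Y.\<Gamma>" using bounded_operators_closed[OF Tb e] .
    have iff: "\<psi> (Y.src \<gamma>) \<in> K \<longleftrightarrow> \<psi> (Y.rng \<gamma>) \<in> {x \<in> U. c.\<tau> x \<in> K}"
      if K: "openin X K" "closedin X K" for K
    proof -
      define k where "k = (if \<psi> (Y.src \<gamma>) \<in> K then 1 else 0 :: complex)"
      have "Y.proj {u \<in> topspace Y. \<psi> u \<in> K} e = (\<lambda>\<gamma>'. k * e \<gamma>' + 0 * e \<gamma>')"
        unfolding Y.proj_def Y.diag_op_apply[OF e] using \<gamma>Y by (auto simp: k_def e_def basis_vector_def fun_eq_iff)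
      then have "op_mult Y.\<Gamma> T (Y.proj {u \<in> topspace Y. \<psi> u \<in> K}) e \<gamma> = k * T e \<gamma>"
        using e bounded_operators_linear[OF Tb e e, of k 0] by (simp add: op_mult_def)
      moreover have "op_mult Y.\<Gamma> (Y.proj {u \<in> topspace Y. \<psi> u \<in> {x \<in> U. c.\<tau> x \<in> K}}) T e \<gamma> =
          (if \<psi> (Y.rng \<gamma>) \<in> {x \<in> U. c.\<tau> x \<in> K} then 1 else 0) * T e \<gamma>"
        using e \<gamma>Y by (simp add: op_mult_def Y.proj_def Y.diag_op_apply[OF Te])
      moreover have "T e \<gamma> \<noteq> 0"
        using nz by (simp add: Y.coeff_def e_def)
      ultimately have "k = (if \<psi> (Y.rng \<gamma>) \<in> {x \<in> U. c.\<tau> x \<in> K} then 1 else 0)"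
        using T_proj[OF K] by simp
      then show ?thesis
        by (simp add: k_def split: if_splits)
    qed
    have U: "\<psi> (Y.rng \<gamma>) \<in> U"
      using iff[of "topspace X"] \<psi>_in \<gamma>Y by simp
    have "c.\<tau> (\<psi> (Y.rng \<gamma>)) \<in> topspace X"
      using c.\<tau>(1)[OF U] c.V_subset by blast
    moreover have "\<not> (openin X K \<and> closedin X K \<and> c.\<tau> (\<psi> (Y.rng \<gamma>)) \<in> K \<and> \<psi> (Y.src \<gamma>) \<notin> K)" for K
      using iff[of K] U by auto
    ultimately have "c.\<tau> (\<psi> (Y.rng \<gamma>)) = \<psi> (Y.src \<gamma>)"
      using clopen_separation[OF X.compact_X X.Hausdorff_X td] \<psi>_in[OF \<gamma>Y(2)] by metis
    with U show ?thesis ..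
  qed
  \<comment> \<open>Otherwise the row of \<open>T\<close> at the unit over \<open>\<phi> x\<close>
    vanishes. But \<open>T T'\<close> is the projection of the image of \<open>U\<close>, whose
    diagonal entry at that unit is 1.\<close>
  have "\<exists>\<gamma>\<in>Y.\<Gamma>. Y.rng \<gamma> = \<phi> x \<and> Y.coeff T \<gamma> \<noteq> 0"
  proof (rule ccontr)
    assume none: "\<not> (\<exists>\<gamma>\<in>Y.\<Gamma>. Y.rng \<gamma> = \<phi> x \<and> Y.coeff T \<gamma> \<noteq> 0)"
    define u where "u = (\<phi> x, \<one>\<^bsub>H\<^esub>, \<phi> x)"
    have u: "u \<in> Y.\<Gamma>" using \<phi>_in[OF xy(1)] by (simp add: u_def)
    note e = basis_vector_ell2(1)[OF u]
    have zero: "T (basis_vector \<eta>) u = 0" if \<eta>: "\<eta> \<in> Y.\<Gamma>" for \<eta>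
    proof (cases "Y.src u = Y.src \<eta>")
      case True
      have "Y.rng (Y.rdiv u \<eta>) = \<phi> x" by (simp add: Y.rdiv_def u_def)
      then show ?thesis
        using Y.reduced_algebra_matrix[OF T u \<eta>] Y.rdiv_in_\<Gamma>[OF u \<eta> True] none True by auto
    next
      case False
      then show ?thesis using Y.reduced_algebra_matrix[OF T u \<eta>] by simp
    qed
    have "T (T' (basis_vector u)) u = 0"
      by (rule bounded_operators_coord_zero[OF Tb bounded_operators_closed[OF T'b e]]) (rule zero)
    moreover have "T (T' (basis_vector u)) u = Y.proj {u \<in> topspace Y. \<psi> u \<in> U} (basis_vector u) u"
      using e by (simp add: op_mult_def flip: TT')
    moreover have "Y.proj {u \<in> topspace Y. \<psi> u \<in> U} (basis_vector u) u = 1"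
      unfolding Y.proj_def Y.diag_op_apply[OF e] using \<phi>_in[OF xy(1)] \<psi>_\<phi>[OF xy(1)] xU
      by (simp add: basis_vector_def u_def)
    ultimately show False by simp
  qed
  then obtain h v where \<gamma>: "(\<phi> x, h, v) \<in> Y.\<Gamma>" "Y.coeff T (\<phi> x, h, v) \<noteq> 0"
    by force
  have vY: "v \<in> topspace Y" using Y.src_in_X[OF \<gamma>(1)] by simp
  have "\<psi> v = c.\<tau> x"
    using claim[OF \<gamma>] \<psi>_\<phi>[OF xy(1)] by simp
  also have "\<dots> = y"
    using c.\<tau>_unique[OF xU yV xy(3)] by simp
  finally have v: "v = \<phi> y"
    using \<phi>_\<psi>[OF vY] by simp
  obtain s t where st: "s \<in> S" "t \<in> S" "h = s \<otimes>\<^bsub>H\<^esub> inv\<^bsub>H\<^esub> t" "\<rho> s (\<phi> x) = \<rho> t v"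
    using \<gamma>(1) by (rule Y.in_\<Gamma>E)
  define W where "W = {\<gamma> \<in> Y.\<Gamma>. Y.coeff T \<gamma> \<noteq> 0}"
  have W: "openin (sg_top Y.gpd) W" "(\<phi> x, s \<otimes>\<^bsub>H\<^esub> inv\<^bsub>H\<^esub> t, v) \<in> W"
    unfolding W_def using Y.openin_coeff_support[OF T] \<gamma> st(3) by auto
  obtain A B where AB: "openin Y A" "openin Y B" "\<phi> x \<in> A" "v \<in> B"
    "\<And>u w. u \<in> A \<Longrightarrow> w \<in> B \<Longrightarrow> \<rho> s u = \<rho> t w \<Longrightarrow> (u, s \<otimes>\<^bsub>H\<^esub> inv\<^bsub>H\<^esub> t, w) \<in> W"
    using Y.openin_gpdD[OF W(1) st(1,2) \<phi>_in[OF xy(1)] vY st(4) W(2)] by blast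
  \<comment> \<open>Openness of the support alone says nothing yet about the pair
    \<open>(\<phi> x', \<phi> y')\<close>. The lift provides some partner \<open>w\<close> of
    \<open>\<phi> x'\<close> inside the support, and the claim then forces
    \<open>w = \<phi> y'\<close>.\<close>
  obtain A' where A': "openin Y A'" "\<phi> x \<in> A'" "\<And>u. u \<in> A' \<Longrightarrow> \<exists>w\<in>B. \<rho> s u = \<rho> t w"
    using Y.act_lift[OF st(1,2) \<phi>_in[OF xy(1)] st(4) AB(2,4)] by blast
  define A'' where "A'' = U \<inter> {x' \<in> topspace X. \<phi> x' \<in> A \<inter> A'}"
  have "openin X A''" "x \<in> A''"
    unfolding A''_def using c.openU xU xy(1) AB A' openin_continuous_map_preimage[OF \<phi>, of "A \<inter> A'"]
    by auto
  moreover have "\<rho> s (\<phi> x') = \<rho> t (\<phi> y')" if x': "x' \<in> A''" and y': "y' \<in> V" and eq: "\<theta> m x' = \<theta> n y'" for x' y'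
  proof -
    have x'': "x' \<in> U" "x' \<in> topspace X" "\<phi> x' \<in> A" "\<phi> x' \<in> A'" using x' unfolding A''_def by auto
    obtain w where w: "w \<in> B" "\<rho> s (\<phi> x') = \<rho> t w" using A'(3) x'' by blast
    have "(\<phi> x', s \<otimes>\<^bsub>H\<^esub> inv\<^bsub>H\<^esub> t, w) \<in> W" using AB(5) x'' w by blast
    then have "c.\<tau> (\<psi> (\<phi> x')) = \<psi> w"
      using claim[of "(\<phi> x', s \<otimes>\<^bsub>H\<^esub> inv\<^bsub>H\<^esub> t, w)"] unfolding W_def by simp
    then have "\<psi> w = y'"
      using \<psi>_\<phi> x'' c.\<tau>_unique[OF x''(1) y' eq] by simp
    then have "w = \<phi> y'"
      using \<phi>_\<psi>[OF subsetD[OF openin_subset[OF AB(2)] w(1)]] by simp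
    with w(2) show ?thesis by simp
  qed
  ultimately show "\<exists>s\<in>S. \<exists>t\<in>S. \<exists>A B. openin X A \<and> openin X B \<and> x \<in> A \<and> y \<in> B \<and>
      (\<forall>x'\<in>A. \<forall>y'\<in>B. \<theta> m x' = \<theta> n y' \<longrightarrow> \<rho> s (\<phi> x') = \<rho> t (\<phi> y'))"
    using st(1,2) c.openV yV by blast
qed

text \<open>Idempotents of the diagonal are the projections of clopen sets, so \<Phi> induces a
  bijection \<kappa> between the clopen sets of the two spaces, compatible with intersections.
  Duality applied to \<kappa> and to its inverse gives the two maps, which are mutually inverse
  because clopen sets separate points.\<close>

lemma diagonal_iso_homeomorphism:
  assumes tdX: "totally_disconnected_space X" and tdY: "totally_disconnected_space Y"
    and iso: "reduced_algebra_iso X.gpd Y.gpd \<Phi>"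
    and diag: "\<Phi> ` diagonal_subalgebra G X P \<theta> = diagonal_subalgebra H Y S \<rho>"
  obtains \<phi> \<psi> where "homeomorphic_maps X Y \<phi> \<psi>"
    "\<And>K. openin X K \<Longrightarrow> closedin X K \<Longrightarrow> \<Phi> (X.proj K) = Y.proj {u \<in> topspace Y. \<psi> u \<in> K}"
proof -
  have inj: "inj_on \<Phi> (reduced_algebra X.gpd)"
    and mult: "\<And>T T'. T \<in> reduced_algebra X.gpd \<Longrightarrow> T' \<in> reduced_algebra X.gpd \<Longrightarrow>
      \<Phi> (op_mult X.\<Gamma> T T') = op_mult Y.\<Gamma> (\<Phi> T) (\<Phi> T')"
    using iso unfolding reduced_algebra_iso_def star_isomorphism_def bij_betw_def by blast+
  note projX = X.proj_in_reduced_algebra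
  define clX where "clX = (\<lambda>K. openin X K \<and> closedin X K)"
  define clY where "clY = (\<lambda>L. openin Y L \<and> closedin Y L)"
  have "\<exists>L. clY L \<and> \<Phi> (X.proj K) = Y.proj L" if K: "clX K" for K
  proof -
    have K': "openin X K" "closedin X K" using K by (auto simp: clX_def)
    have "X.proj K \<in> diagonal_subalgebra G X P \<theta>"
      unfolding X.diagonal_subalgebra_eq X.proj_def using X.continuous_map_indicator[OF K'] by blast
    then have "\<Phi> (X.proj K) \<in> diagonal_subalgebra H Y S \<rho>" using diag by blast
    then obtain F where F: "continuous_map Y euclidean F" "\<Phi> (X.proj K) = Y.diag_op F"
      unfolding Y.diagonal_subalgebra_eq by blast
    have "op_mult Y.\<Gamma> (Y.diag_op F) (Y.diag_op F) = Y.diag_op F"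
      using mult[OF projX[OF K'] projX[OF K']] X.proj_mult[OF K', of K] F(2) by simp
    then obtain L where "openin Y L" "closedin Y L" "Y.diag_op F = Y.proj L"
      using Y.diag_op_idempotent[OF F(1)] by blast
    then show ?thesis using F(2) unfolding clY_def by auto
  qed
  then obtain \<kappa> where \<kappa>: "\<And>K. clX K \<Longrightarrow> clY (\<kappa> K)" "\<And>K. clX K \<Longrightarrow> \<Phi> (X.proj K) = Y.proj (\<kappa> K)"
    by metis
  have proj_eqY: "L = L'" if "clY L" "clY L'" "Y.proj L = Y.proj L'" for L L'
    using that Y.proj_eq_iff[of L L'] openin_subset unfolding clY_def by blast
  have inj\<kappa>: "K = K'" if "clX K" "clX K'" "\<kappa> K = \<kappa> K'" for K K'
  proof -
    have "X.proj K = X.proj K'"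
      using that \<kappa>(2) inj_onD[OF inj] projX unfolding clX_def by metis
    then show ?thesis
      using that X.proj_eq_iff[of K K'] openin_subset unfolding clX_def by blast
  qed
  have clX_Int: "clX (K \<inter> L)" if "clX K" "clX L" for K L
    using that unfolding clX_def by auto
  have clY_Int: "clY (K \<inter> L)" if "clY K" "clY L" for K L
    using that unfolding clY_def by auto
  have clX_compl: "clX (topspace X - K)" if "clX K" for K
    using that unfolding clX_def by (auto simp: openin_diff closedin_diff)
  have clY_compl: "clY (topspace Y - K)" if "clY K" for K
    using that unfolding clY_def by (auto simp: openin_diff closedin_diff)
  have \<kappa>_Int: "\<kappa> (K \<inter> L) = \<kappa> K \<inter> \<kappa> L" if K: "clX K" and L: "clX L" for K L
  proof (rule proj_eqY)
    show "clY (\<kappa> (K \<inter> L))" "clY (\<kappa> K \<inter> \<kappa> L)" using K L \<kappa>(1) clX_Int clY_Int by auto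
    have "Y.proj (\<kappa> (K \<inter> L)) = \<Phi> (op_mult X.\<Gamma> (X.proj K) (X.proj L))"
      using \<kappa>(2)[OF clX_Int[OF K L]] X.proj_mult[of L K] L by (simp add: clX_def)
    also have "\<dots> = op_mult Y.\<Gamma> (Y.proj (\<kappa> K)) (Y.proj (\<kappa> L))"
      using mult[of "X.proj K" "X.proj L"] projX \<kappa>(2) K L by (simp add: clX_def)
    also have "\<dots> = Y.proj (\<kappa> K \<inter> \<kappa> L)"
      using Y.proj_mult[of "\<kappa> L" "\<kappa> K"] \<kappa>(1)[OF L] by (simp add: clY_def)
    finally show "Y.proj (\<kappa> (K \<inter> L)) = Y.proj (\<kappa> K \<inter> \<kappa> L)" .
  qed
  have "\<exists>K. clX K \<and> \<kappa> K = L" if L: "clY L" for L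
  proof -
    have L': "openin Y L" "closedin Y L" using L by (auto simp: clY_def)
    have "Y.proj L \<in> \<Phi> ` diagonal_subalgebra G X P \<theta>"
      unfolding diag Y.diagonal_subalgebra_eq Y.proj_def using Y.continuous_map_indicator[OF L'] by blast
    then obtain F where F: "continuous_map X euclidean F" "Y.proj L = \<Phi> (X.diag_op F)"
      unfolding X.diagonal_subalgebra_eq by blast
    note FA = X.diag_op_in_reduced_algebra[OF F(1)]
    \<comment> \<open>\<Phi> is injective only on the algebra, so the square must be known to lie
      there before idempotence can be pulled back.\<close>
    have F2: "op_mult X.\<Gamma> (X.diag_op F) (X.diag_op F) \<in> reduced_algebra X.gpd"
      by (rule X.reduced_algebra_mult[OF tdX FA FA])
    have "\<Phi> (op_mult X.\<Gamma> (X.diag_op F) (X.diag_op F)) = \<Phi> (X.diag_op F)"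
      using mult[OF FA FA] Y.proj_mult[OF L', of L] F(2) by simp
    then have "op_mult X.\<Gamma> (X.diag_op F) (X.diag_op F) = X.diag_op F"
      using inj_onD[OF inj _ F2 FA] by blast
    then obtain K where K: "openin X K" "closedin X K" "X.diag_op F = X.proj K"
      using X.diag_op_idempotent[OF F(1)] by blast
    then have "clX K" by (simp add: clX_def)
    moreover have "\<kappa> K = L"
      by (rule proj_eqY[OF \<kappa>(1)[OF \<open>clX K\<close>] L]) (use F(2) K(3) \<kappa>(2)[OF \<open>clX K\<close>] in simp)
    ultimately show ?thesis by blast
  qed
  then obtain \<kappa>' where \<kappa>': "\<And>L. clY L \<Longrightarrow> clX (\<kappa>' L)" "\<And>L. clY L \<Longrightarrow> \<kappa> (\<kappa>' L) = L"
    by metis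
  have clX_empty: "clX {}" and clY_empty: "clY {}" by (simp_all add: clX_def clY_def)
  have \<kappa>_empty: "\<kappa> {} = {}"
    using \<kappa>_Int[OF \<kappa>'(1)[OF clY_empty] clX_empty] \<kappa>'(2)[OF clY_empty] by simp
  \<comment> \<open>Complements follow from intersections and surjectivity: the clopen set
    \<open>E\<close> mapped onto the complement of \<open>\<kappa> K\<close> is disjoint from
    \<open>K\<close>, hence contained in its complement, and \<kappa> is monotone.\<close>
  have \<kappa>_compl: "\<kappa> (topspace X - K) = topspace Y - \<kappa> K" if K: "clX K" for K
  proof
    have "\<kappa> (topspace X - K) \<inter> \<kappa> K = {}"
      using \<kappa>_Int[OF clX_compl[OF K] K] \<kappa>_empty by (simp add: Diff_Int_distrib2 Int_commute)
    moreover have "\<kappa> (topspace X - K) \<subseteq> topspace Y"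
      using \<kappa>(1)[OF clX_compl[OF K]] openin_subset unfolding clY_def by blast
    ultimately show "\<kappa> (topspace X - K) \<subseteq> topspace Y - \<kappa> K" by blast
    define E where "E = \<kappa>' (topspace Y - \<kappa> K)"
    have E: "clX E" "\<kappa> E = topspace Y - \<kappa> K"
      unfolding E_def using \<kappa>' clY_compl \<kappa>(1)[OF K] by auto
    have "\<kappa> (K \<inter> E) = \<kappa> {}"
      using \<kappa>_Int[OF K E(1)] E(2) \<kappa>_empty by blast
    then have "K \<inter> E = {}"
      using inj\<kappa> clX_Int[OF K E(1)] clX_empty by blast
    moreover have "E \<subseteq> topspace X" using E(1) openin_subset unfolding clX_def by blast
    ultimately have "E \<inter> (topspace X - K) = E" by blast
    then have "\<kappa> E \<subseteq> \<kappa> (topspace X - K)"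
      using \<kappa>_Int[OF E(1) clX_compl[OF K]] by (metis Int_lower2)
    then show "topspace Y - \<kappa> K \<subseteq> \<kappa> (topspace X - K)" using E(2) by simp
  qed
  have \<kappa>'_\<kappa>: "\<kappa>' (\<kappa> K) = K" if "clX K" for K
    using that \<kappa>(1) \<kappa>' inj\<kappa> by metis
  have \<kappa>'_Int: "\<kappa>' (K \<inter> L) = \<kappa>' K \<inter> \<kappa>' L" if K: "clY K" and L: "clY L" for K L
    using \<kappa>_Int[OF \<kappa>'(1)[OF K] \<kappa>'(1)[OF L]] \<kappa>'(2)[OF K] \<kappa>'(2)[OF L]
      \<kappa>'_\<kappa>[OF clX_Int[OF \<kappa>'(1)[OF K] \<kappa>'(1)[OF L]]] by simp
  have \<kappa>'_compl: "\<kappa>' (topspace Y - K) = topspace X - \<kappa>' K" if K: "clY K" for K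
    using \<kappa>_compl[OF \<kappa>'(1)[OF K]] \<kappa>'(2)[OF K] \<kappa>'_\<kappa>[OF clX_compl[OF \<kappa>'(1)[OF K]]] by simp
  obtain \<psi> where \<psi>: "continuous_map Y X \<psi>" "\<And>K y. clX K \<Longrightarrow> y \<in> topspace Y \<Longrightarrow> \<psi> y \<in> K \<longleftrightarrow> y \<in> \<kappa> K"
    by (rule clopen_homomorphism_dual[OF X.compact_X X.Hausdorff_X tdX, of Y \<kappa>])
      (use \<kappa>(1) \<kappa>_Int \<kappa>_compl in \<open>auto simp: clX_def clY_def\<close>)
  obtain \<phi> where \<phi>: "continuous_map X Y \<phi>" "\<And>L x. clY L \<Longrightarrow> x \<in> topspace X \<Longrightarrow> \<phi> x \<in> L \<longleftrightarrow> x \<in> \<kappa>' L"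
    by (rule clopen_homomorphism_dual[OF Y.compact_X Y.Hausdorff_X tdY, of X \<kappa>'])
      (use \<kappa>'(1) \<kappa>'_Int \<kappa>'_compl in \<open>auto simp: clX_def clY_def\<close>)
  have \<phi>_in: "\<phi> x \<in> topspace Y" if "x \<in> topspace X" for x
    using \<phi>(1) that by (auto simp: continuous_map_def)
  have \<psi>_in: "\<psi> y \<in> topspace X" if "y \<in> topspace Y" for y
    using \<psi>(1) that by (auto simp: continuous_map_def)
  have "\<psi> (\<phi> x) = x" if x: "x \<in> topspace X" for x
  proof (rule ccontr)
    assume "\<psi> (\<phi> x) \<noteq> x"
    then obtain K where K: "openin X K" "closedin X K" "\<psi> (\<phi> x) \<in> K" "x \<notin> K"
      using clopen_separation[OF X.compact_X X.Hausdorff_X tdX] \<psi>_in \<phi>_in x by metis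
    then have "clX K" by (simp add: clX_def)
    then show False
      using K(3,4) \<psi>(2) \<phi>(2)[OF \<kappa>(1) x] \<kappa>'_\<kappa> \<phi>_in[OF x] by metis
  qed
  moreover have "\<phi> (\<psi> y) = y" if y: "y \<in> topspace Y" for y
  proof (rule ccontr)
    assume "\<phi> (\<psi> y) \<noteq> y"
    then obtain L where L: "openin Y L" "closedin Y L" "\<phi> (\<psi> y) \<in> L" "y \<notin> L"
      using clopen_separation[OF Y.compact_X Y.Hausdorff_X tdY] \<psi>_in \<phi>_in y by metis
    then have "clY L" by (simp add: clY_def)
    then show False
      using L(3,4) \<phi>(2) \<psi>(2)[OF \<kappa>'(1) y] \<kappa>'(2) \<psi>_in[OF y] by metis
  qed
  ultimately have hm: "homeomorphic_maps X Y \<phi> \<psi>"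
    using \<phi>(1) \<psi>(1) by (simp add: homeomorphic_maps_def)
  have "\<Phi> (X.proj K) = Y.proj {u \<in> topspace Y. \<psi> u \<in> K}" if "openin X K" "closedin X K" for K
  proof -
    have K: "clX K" using that by (simp add: clX_def)
    have "\<kappa> K \<subseteq> topspace Y" using \<kappa>(1)[OF K] openin_subset unfolding clY_def by blast
    then have "{u \<in> topspace Y. \<psi> u \<in> K} = \<kappa> K" using \<psi>(2)[OF K] by blast
    then show ?thesis using \<kappa>(2)[OF K] by simp
  qed
  with hm show thesis by (rule that)
qed

end

text \<open>The germ argument runs twice, for \<Phi> and for its inverse on the algebra. The inverse
  takes the projection of \<open>L\<close> to that of its preimage under \<phi>, since \<psi> pulls
  that preimage back to \<open>L\<close>.\<close>

lemma reduced_algebra_iso_imp_preserves_orbit_germs: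
  assumes X: "semigroup_action G X P \<theta>" and Y: "semigroup_action H Y S \<rho>"
    and tdX: "totally_disconnected_space X" and tdY: "totally_disconnected_space Y"
    and iso: "reduced_algebra_iso (transformation_groupoid G X P \<theta>) (transformation_groupoid H Y S \<rho>) \<Phi>"
    and diag: "\<Phi> ` diagonal_subalgebra G X P \<theta> = diagonal_subalgebra H Y S \<rho>"
  obtains \<phi> \<psi> where "homeomorphic_maps X Y \<phi> \<psi>"
    "preserves_orbit_germs X P \<theta> S \<rho> \<phi>" "preserves_orbit_germs Y S \<rho> P \<theta> \<psi>"
proof -
  interpret XY: semigroup_action_pair G X P \<theta> H Y S \<rho>
    using X Y by (simp add: semigroup_action_pair_def)
  interpret YX: semigroup_action_pair H Y S \<rho> G X P \<theta>
    using X Y by (simp add: semigroup_action_pair_def)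
  let ?M = "reduced_algebra XY.X.gpd" and ?N = "reduced_algebra XY.Y.gpd"
  obtain \<phi> \<psi> where hm: "homeomorphic_maps X Y \<phi> \<psi>"
    and proj: "\<And>K. openin X K \<Longrightarrow> closedin X K \<Longrightarrow> \<Phi> (XY.X.proj K) = XY.Y.proj {u \<in> topspace Y. \<psi> u \<in> K}"
    using XY.diagonal_iso_homeomorphism[OF tdX tdY iso diag] by blast
  have bij: "bij_betw \<Phi> ?M ?N"
    and mult: "\<And>T T'. T \<in> ?M \<Longrightarrow> T' \<in> ?M \<Longrightarrow> \<Phi> (op_mult XY.X.\<Gamma> T T') = op_mult XY.Y.\<Gamma> (\<Phi> T) (\<Phi> T')"
    using iso unfolding reduced_algebra_iso_def star_isomorphism_def by blast+
  have \<Phi>_in: "\<Phi> T \<in> ?N" if "T \<in> ?M" for T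
    using bij that by (auto simp: bij_betw_def)
  have 1: "preserves_orbit_germs X P \<theta> S \<rho> \<phi>"
    by (rule XY.multiplicative_map_preserves_orbit_germs[OF tdX hm \<Phi>_in mult proj])
  define \<Psi> where "\<Psi> = inv_into ?M \<Phi>"
  have \<Psi>_in: "\<Psi> T \<in> ?M" and \<Phi>_\<Psi>: "\<Phi> (\<Psi> T) = T" if "T \<in> ?N" for T
    unfolding \<Psi>_def using bij that by (auto simp: bij_betw_def inv_into_into f_inv_into_f)
  have \<Psi>_\<Phi>: "\<Psi> (\<Phi> T) = T" if "T \<in> ?M" for T
    unfolding \<Psi>_def using bij that by (simp add: bij_betw_def)
  have 2: "preserves_orbit_germs Y S \<rho> P \<theta> \<psi>"
  proof (rule YX.multiplicative_map_preserves_orbit_germs[OF tdY _ \<Psi>_in])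
    show "homeomorphic_maps Y X \<psi> \<phi>" using hm homeomorphic_maps_sym by blast
    show "\<Psi> (op_mult XY.Y.\<Gamma> T T') = op_mult XY.X.\<Gamma> (\<Psi> T) (\<Psi> T')" if "T \<in> ?N" "T' \<in> ?N" for T T'
    proof -
      have "op_mult XY.Y.\<Gamma> T T' = \<Phi> (op_mult XY.X.\<Gamma> (\<Psi> T) (\<Psi> T'))"
        using that by (simp add: mult \<Psi>_in \<Phi>_\<Psi>)
      then show ?thesis
        using XY.X.reduced_algebra_mult[OF tdX \<Psi>_in[OF that(1)] \<Psi>_in[OF that(2)]] \<Psi>_\<Phi> by simp
    qed
    fix L assume L: "openin Y L" "closedin Y L"
    define K where "K = {x \<in> topspace X. \<phi> x \<in> L}"
    have K: "openin X K" "closedin X K"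
      unfolding K_def using hm L openin_continuous_map_preimage closedin_continuous_map_preimage
      by (auto simp: homeomorphic_maps_def)
    have "{u \<in> topspace Y. \<psi> u \<in> K} = L"
      using hm openin_subset[OF L(1)] unfolding K_def
      by (auto simp: homeomorphic_maps_def continuous_map_def)
    then have "\<Phi> (XY.X.proj K) = XY.Y.proj L"
      using proj[OF K] by simp
    then show "\<Psi> (XY.Y.proj L) = XY.X.proj {x \<in> topspace X. \<phi> x \<in> L}"
      using \<Psi>_\<Phi>[OF XY.X.proj_in_reduced_algebra[OF K]] by (simp add: K_def)
  qed
  from hm 1 2 show thesis by (rule that)
qed

theorem theorem1p1:
  fixes X :: "'x topology" and G :: "'g monoid" and P :: "'g set" and \<theta> :: "'g \<Rightarrow> 'x \<Rightarrow> 'x"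
    and Y :: "'y topology" and H :: "'h monoid" and S :: "'h set" and \<rho> :: "'h \<Rightarrow> 'y \<Rightarrow> 'y"
  assumes "semigroup_action G X P \<theta>" and "essentially_free X P \<theta>"
    and "semigroup_action H Y S \<rho>" and "essentially_free Y S \<rho>"
  shows
    "(one_sided_coe X P \<theta> Y S \<rho> \<longleftrightarrow>
        semigroupoids_isomorphic (action_semigroupoid G X P \<theta>) (action_semigroupoid H Y S \<rho>))
     \<and>
     (cont_orbit_equiv X P \<theta> Y S \<rho> \<longrightarrow>
        groupoids_isomorphic (transformation_groupoid G X P \<theta>) (transformation_groupoid H Y S \<rho>))
     \<and>
     (totally_disconnected_space X \<and> totally_disconnected_space Y \<longrightarrow>
        (cont_orbit_equiv X P \<theta> Y S \<rho> \<longleftrightarrow>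
           groupoids_isomorphic (transformation_groupoid G X P \<theta>) (transformation_groupoid H Y S \<rho>))
        \<and>
        (groupoids_isomorphic (transformation_groupoid G X P \<theta>) (transformation_groupoid H Y S \<rho>) \<longleftrightarrow>
           (\<exists>\<Phi>. reduced_algebra_iso (transformation_groupoid G X P \<theta>) (transformation_groupoid H Y S \<rho>) \<Phi> \<and>
                \<Phi> ` diagonal_subalgebra G X P \<theta> = diagonal_subalgebra H Y S \<rho>)))
     \<and>
     (action_by_homeomorphisms X P \<theta> \<and> action_by_homeomorphisms Y S \<rho> \<longrightarrow>
        (cont_orbit_equiv X P \<theta> Y S \<rho> \<longrightarrow>
           Li_coe X G (associated_action G X P \<theta>) Y H (associated_action H Y S \<rho>))
        \<and>
        ((totally_disconnected_space X \<and> totally_disconnected_space Y) \<or>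
         (lattice_ordered_group G P \<and> lattice_ordered_group H S) \<longrightarrow>
           (Li_coe X G (associated_action G X P \<theta>) Y H (associated_action H Y S \<rho>) \<longrightarrow>
            cont_orbit_equiv X P \<theta> Y S \<rho>)))"
proof -
  let ?\<G> = "transformation_groupoid G X P \<theta>" and ?\<H> = "transformation_groupoid H Y S \<rho>"
  interpret XY: semigroup_action_pair G X P \<theta> H Y S \<rho>
    using assms by (simp add: semigroup_action_pair_def)
  have germs_imp_iso: "groupoids_isomorphic ?\<G> ?\<H>"
    if "homeomorphic_maps X Y \<phi> \<psi>" "preserves_orbit_germs X P \<theta> S \<rho> \<phi>"
      "preserves_orbit_germs Y S \<rho> P \<theta> \<psi>" for \<phi> \<psi>
    using preserves_orbit_germs_imp_groupoids_isomorphic[OF assms that] .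
  have coe_imp_iso: "groupoids_isomorphic ?\<G> ?\<H>" if "cont_orbit_equiv X P \<theta> Y S \<rho>"
    using that germs_imp_iso XY.X.orbit_cocycles_imp_preserves_orbit_germs
      XY.Y.orbit_cocycles_imp_preserves_orbit_germs
    unfolding cont_orbit_equiv_iff by blast
  have iso_imp_coe: "cont_orbit_equiv X P \<theta> Y S \<rho>"
    if td: "totally_disconnected_space X" "totally_disconnected_space Y" and iso: "groupoids_isomorphic ?\<G> ?\<H>"
  proof -
    obtain \<phi> \<psi> where "homeomorphic_maps X Y \<phi> \<psi>" "preserves_orbit_germs X P \<theta> S \<rho> \<phi>"
      "preserves_orbit_germs Y S \<rho> P \<theta> \<psi>"
      using groupoids_isomorphic_obtain[OF assms(1,3) iso] by metis
    then show ?thesis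
      using XY.X.preserves_orbit_germs_imp_orbit_cocycles[OF td(1)]
        XY.Y.preserves_orbit_germs_imp_orbit_cocycles[OF td(2)]
      unfolding cont_orbit_equiv_iff by blast
  qed
  \<comment> \<open>From algebras to groupoids there is no direct transport: the isomorphism yields
    \<phi> and \<psi> preserving germs, and the germs rebuild a groupoid isomorphism.\<close>
  have iso_iff_algebra: "groupoids_isomorphic ?\<G> ?\<H> \<longleftrightarrow>
      (\<exists>\<Phi>. reduced_algebra_iso ?\<G> ?\<H> \<Phi> \<and> \<Phi> ` diagonal_subalgebra G X P \<theta> = diagonal_subalgebra H Y S \<rho>)"
    if td: "totally_disconnected_space X" "totally_disconnected_space Y"
    using groupoids_isomorphic_imp_reduced_algebra_iso[OF assms(1,3)]
      reduced_algebra_iso_imp_preserves_orbit_germs[OF assms(1,3) td] germs_imp_iso by metis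
  have one_sided: "one_sided_coe X P \<theta> Y S \<rho> \<longleftrightarrow>
      semigroupoids_isomorphic (action_semigroupoid G X P \<theta>) (action_semigroupoid H Y S \<rho>)"
    using XY.one_sided_coe_imp_semigroupoids_isomorphic[OF assms(2,4)]
      XY.semigroupoids_isomorphic_imp_one_sided_coe by blast
  show ?thesis
    using one_sided coe_imp_iso iso_imp_coe iso_iff_algebra cont_orbit_equiv_iff_Li_coe[OF assms(1,3)] by blast
qed

end
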